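(* Let $\mathbf{k}$ be a commutative ring, $\delta\in\mathbf{k}$, $B=B^{\mathbf{k},\delta}$ the Brauer category, and let $r\ge0$ be an integer. Then the truncated Brauer category $B_{\preceq r}$ is a perfect quasi-cellular category (over $\mathbb{S}_{\preceq r}$) if and only if $\delta$ is non-singular at ranks $\preceq r$.
   Context: **Brauer diagrams and category.** For $p,q\ge0$, a $(p,q)$-Brauer diagram is a partition of $[p]^+\sqcup[q]^-=\{1^+,\dots,p^+\}\sqcup\{1^-,\dots,q^-\}$ into unordered pairs ($i^+$ top points, $i^-$ bottom points); $\mathbb{B}(p,q)$ is their set. Upward: no pair of two top points; downward: no pair of two bottom points; level: both; monotone: $(i-k)(j-l)>0$ for any two distinct pairs $\{i^+,j^-\},\{k^+,l^-\}$. $\mathbb{B}^+,\mathbb{B}^-,\mathbb{B}^0$: upward, downward, level; $\mathbb{B}^{\pm,m}$: monotone ones in $\mathbb{B}^\pm$. $\overline f$: exchange $i^\pm\leftrightarrow i^\mp$. $p\preceq q$ iff $p\le q$ and $q-p$ even. $B$ has objects the non-negative integers, $B(p,q)$ free on $\mathbb{B}(p,q)$, and $f\circ g=\delta^{l(f,g)}f\hat\circ g$ where $g$ is placed above $f$, $l(f,g)$ is the number of closed loops and $f\hat\circ g$ the diagram after deleting loops. $B^\pm$: wide subcategories spanned by $\mathbb{B}^\pm$; $\mathbb{S}$: wide subcategory spanned by level diagrams, $\mathbb{S}_p=\mathbb{S}(p,p)=\mathbf{k}[\mathfrak{S}_p]$. Subscript $\preceq r$: restriction to objects $q\preceq r$.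 For $\mathbb{S}$-bimodules (families of $(\mathbb{S}_q,\mathbb{S}_p)$-bimodules $M(p,q)$), $(M\otimes_{\mathbb{S}}N)(p,q)=\bigoplus_sM(s,q)\otimes_{\mathbb{S}_s}N(p,s)$; composition gives $B^+\otimes_{\mathbb{S}}B^-\cong B$ (and likewise truncated), which makes $B_{\preceq r}$ a stratified linear category over $\mathbb{S}_{\preceq r}$: $B^+(p,q)=0$ unless $p\preceq q$, $B^-(p,q)=0$ unless $q\preceq p$, $B^\pm(p,p)=\mathbb{S}_p$, and composition $B^+\otimes_{\mathbb{S}}B^-\to B$ is an isomorphism. **Quasi-cellular structure.** $B_{\preceq r}$ carries the $\mathbb{S}_{\preceq r}$-bimodule pairing $b':B^-\otimes_{\mathbb{S}}B^+\to\mathbb{S}$ given on diagrams $u\in\mathbb{B}^-(q,s)$, $w\in\mathbb{B}^+(p,q)$ by $b'(u\otimes w)=\sigma$ if $s=p$ and $u=\sigma\overline w$ for some $\sigma\in\mathfrak{S}_p$, and $0$ otherwise, with copairing $d'(1_p)=\sum_{s\preceq p}\sum_{f\in\mathbb{B}^{+,m}(s,p)}f\otimes\overline f$. "Quasi-cellular" means stratified together with such a perfect pairing $b'$ with copairing $d'$ satisfying $b'(1_p\otimes f)=\varepsilon^+(f)$, $b'(g\otimes1_p)=\varepsilon^-(g)$, where $\varepsilon^\pm:B^\pm\to\mathbb{S}$ is the identity on $B^\pm(p,p)$ and zero elsewhere. **Perfect.** Let $b:B^-_{\preceq r}\otimes_{\mathbb{S}_{\preceq r}}B^+_{\preceq r}\to\mathbb{S}_{\preceq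 r}$ be the pairing sending $g\otimes f$ (diagrams, $f\in\mathbb{B}^+(p,q)$, $g\in\mathbb{B}^-(q,s)$) to $g\circ f$ if $g\hat\circ f$ is level (so $s=p$) and to $0$ otherwise. $B_{\preceq r}$ is perfect if there is an $\mathbb{S}_{\preceq r}$-bimodule map $d:\mathbb{S}_{\preceq r}\to B^+_{\preceq r}\otimes_{\mathbb{S}_{\preceq r}}B^-_{\preceq r}$ with $(\mathrm{id}\otimes b)(d\otimes\mathrm{id})=\mathrm{id}_{B^+_{\preceq r}}$ and $(b\otimes\mathrm{id})(\mathrm{id}\otimes d)=\mathrm{id}_{B^-_{\preceq r}}$. **Non-singularity.** For $p\preceq q$, over $\mathbb{Z}[x]$ with parameter $x$ let $A_{p,q}=(b(\overline f\otimes g))_{f,g\in\mathbb{B}^{+,m}(p,q)}\in M_n(\mathbb{Z}[x][\mathfrak{S}_p])$, $n=|\mathbb{B}^{+,m}(p,q)|$, let $\iota:M_n(\mathbb{Z}[x][\mathfrak{S}_p])\hookrightarrow M_{n\,p!}(\mathbb{Z}[x])$ be induced by the left regular representation, and $f_{p,q}(x)=\det\iota(A_{p,q})$. $\delta$ is non-singular at ranks $\preceq r$ if $f_{p,q}(\delta)$ is invertible in $\mathbf{k}$ for all $p\preceq q\preceq r$. *)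

theory Defs
  imports
    "HOL-Library.Disjoint_Sets"
    "HOL-Algebra.Free_Abelian_Groups"
    "HOL-Algebra.Generated_Groups"
    "Jordan_Normal_Form.Determinant"
begin

section \<open>Bimodules over a family of algebras and their tensor products\<close>

text \<open>
  Throughout, \<open>Ob\<close> is a set of objects and \<open>A s\<close> (for \<open>s \<in> Ob\<close>) is the carrier of an algebra.
  A bimodule over \<open>A\<close> is a family of abelian groups indexed by (source, target) with a left action
  of \<open>A\<close> at the target and a right action of \<open>A\<close> at the source.
\<close>

record ('o, 'a, 'm) bimodule =
  grp  :: "'o \<Rightarrow> 'o \<Rightarrow> 'm monoid"
  lact :: "'o \<Rightarrow> 'o \<Rightarrow> 'a \<Rightarrow> 'm \<Rightarrow> 'm"
  ract :: "'o \<Rightarrow> 'o \<Rightarrow> 'm \<Rightarrow> 'a \<Rightarrow> 'm"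

definition bimodule_map ::
  "'o set \<Rightarrow> ('o \<Rightarrow> 'a set) \<Rightarrow> ('o, 'a, 'm) bimodule \<Rightarrow> ('o, 'a, 'n) bimodule
    \<Rightarrow> ('o \<Rightarrow> 'o \<Rightarrow> 'm \<Rightarrow> 'n) \<Rightarrow> bool" where
  "bimodule_map Ob A M N \<phi> \<longleftrightarrow>
    (\<forall>p\<in>Ob. \<forall>q\<in>Ob. \<phi> p q \<in> hom (grp M p q) (grp N p q) \<and>
      (\<forall>x\<in>carrier (grp M p q).
        (\<forall>a\<in>A q. \<phi> p q (lact M p q a x) = lact N p q a (\<phi> p q x)) \<and>
        (\<forall>a\<in>A p. \<phi> p q (ract M p q x a) = ract N p q (\<phi> p q x) a)))"

definition bimodule_iso ::
  "'o set \<Rightarrow> ('o \<Rightarrow> 'a set) \<Rightarrow> ('o, 'a, 'm) bimodule \<Rightarrow> ('o, 'a, 'n) bimodule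
    \<Rightarrow> ('o \<Rightarrow> 'o \<Rightarrow> 'm \<Rightarrow> 'n) \<Rightarrow> bool" where
  "bimodule_iso Ob A M N \<phi> \<longleftrightarrow> bimodule_map Ob A M N \<phi> \<and>
    (\<forall>p\<in>Ob. \<forall>q\<in>Ob. bij_betw (\<phi> p q) (carrier (grp M p q)) (carrier (grp N p q)))"

text \<open>
  \<open>(M \<otimes> N)(p,q)\<close> is the direct sum over \<open>s\<close> of the \<open>M(s,q) \<otimes> N(p,s)\<close> (tensor product over \<open>A s\<close>),
  presented as the free abelian group on the triples \<open>(s,m,n)\<close> modulo the biadditivity and balancing
  relations. Its elements are cosets of formal sums.
\<close>

definition tensor_gens ::
  "'o set \<Rightarrow> ('o, 'a, 'm) bimodule \<Rightarrow> ('o, 'a, 'n) bimodule \<Rightarrow> 'o \<Rightarrow> 'o \<Rightarrow> ('o \<times> 'm \<times> 'n) set" where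
  "tensor_gens Ob M N p q =
    {(s, m, n). s \<in> Ob \<and> m \<in> carrier (grp M s q) \<and> n \<in> carrier (grp N p s)}"

definition tensor_rels ::
  "'o set \<Rightarrow> ('o \<Rightarrow> 'a set) \<Rightarrow> ('o, 'a, 'm) bimodule \<Rightarrow> ('o, 'a, 'n) bimodule
    \<Rightarrow> 'o \<Rightarrow> 'o \<Rightarrow> (('o \<times> 'm \<times> 'n) \<Rightarrow>\<^sub>0 int) set" where
  "tensor_rels Ob A M N p q =
    {frag_of (s, m \<otimes>\<^bsub>grp M s q\<^esub> m', n) - frag_of (s, m, n) - frag_of (s, m', n) | s m m' n.
       s \<in> Ob \<and> m \<in> carrier (grp M s q) \<and> m' \<in> carrier (grp M s q) \<and> n \<in> carrier (grp N p s)} \<union>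
    {frag_of (s, m, n \<otimes>\<^bsub>grp N p s\<^esub> n') - frag_of (s, m, n) - frag_of (s, m, n') | s m n n'.
       s \<in> Ob \<and> m \<in> carrier (grp M s q) \<and> n \<in> carrier (grp N p s) \<and> n' \<in> carrier (grp N p s)} \<union>
    {frag_of (s, ract M s q m a, n) - frag_of (s, m, lact N p s a n) | s m a n.
       s \<in> Ob \<and> m \<in> carrier (grp M s q) \<and> a \<in> A s \<and> n \<in> carrier (grp N p s)}"

definition tensor_ker ::
  "'o set \<Rightarrow> ('o \<Rightarrow> 'a set) \<Rightarrow> ('o, 'a, 'm) bimodule \<Rightarrow> ('o, 'a, 'n) bimodule
    \<Rightarrow> 'o \<Rightarrow> 'o \<Rightarrow> (('o \<times> 'm \<times> 'n) \<Rightarrow>\<^sub>0 int) set" where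
  "tensor_ker Ob A M N p q =
    generate (free_Abelian_group (tensor_gens Ob M N p q)) (tensor_rels Ob A M N p q)"

definition tensor_grp ::
  "'o set \<Rightarrow> ('o \<Rightarrow> 'a set) \<Rightarrow> ('o, 'a, 'm) bimodule \<Rightarrow> ('o, 'a, 'n) bimodule
    \<Rightarrow> 'o \<Rightarrow> 'o \<Rightarrow> (('o \<times> 'm \<times> 'n) \<Rightarrow>\<^sub>0 int) set monoid" where
  "tensor_grp Ob A M N p q =
    free_Abelian_group (tensor_gens Ob M N p q) Mod tensor_ker Ob A M N p q"

definition tensor_class ::
  "'o set \<Rightarrow> ('o \<Rightarrow> 'a set) \<Rightarrow> ('o, 'a, 'm) bimodule \<Rightarrow> ('o, 'a, 'n) bimodule
    \<Rightarrow> 'o \<Rightarrow> 'o \<Rightarrow> (('o \<times> 'm \<times> 'n) \<Rightarrow>\<^sub>0 int) \<Rightarrow> (('o \<times> 'm \<times> 'n) \<Rightarrow>\<^sub>0 int) set" where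
  "tensor_class Ob A M N p q c =
    tensor_ker Ob A M N p q #>\<^bsub>free_Abelian_group (tensor_gens Ob M N p q)\<^esub> c"

definition pure_tensor ::
  "'o set \<Rightarrow> ('o \<Rightarrow> 'a set) \<Rightarrow> ('o, 'a, 'm) bimodule \<Rightarrow> ('o, 'a, 'n) bimodule
    \<Rightarrow> 'o \<Rightarrow> 'o \<Rightarrow> 'o \<Rightarrow> 'm \<Rightarrow> 'n \<Rightarrow> (('o \<times> 'm \<times> 'n) \<Rightarrow>\<^sub>0 int) set" where
  "pure_tensor Ob A M N p q s m n = tensor_class Ob A M N p q (frag_of (s, m, n))"

text \<open>
  The homomorphism out of a tensor product into the abelian group \<open>G\<close> with prescribed values \<open>\<phi>\<close>
  on the generators; meaningful whenever \<open>\<phi>\<close> is biadditive and balanced, since then the value does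
  not depend on the representative of the coset \<open>C\<close>.
\<close>

definition tensor_lift ::
  "('g, 'b) monoid_scheme \<Rightarrow> ('o \<times> 'm \<times> 'n \<Rightarrow> 'g) \<Rightarrow> (('o \<times> 'm \<times> 'n) \<Rightarrow>\<^sub>0 int) set \<Rightarrow> 'g" where
  "tensor_lift G \<phi> C =
    the_elem ((\<lambda>c. finprod G (\<lambda>x. \<phi> x [^]\<^bsub>G\<^esub> Poly_Mapping.lookup c x) (Poly_Mapping.keys c)) ` C)"

definition tensor ::
  "'o set \<Rightarrow> ('o \<Rightarrow> 'a set) \<Rightarrow> ('o, 'a, 'm) bimodule \<Rightarrow> ('o, 'a, 'n) bimodule
    \<Rightarrow> ('o, 'a, (('o \<times> 'm \<times> 'n) \<Rightarrow>\<^sub>0 int) set) bimodule" where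
  "tensor Ob A M N = \<lparr>
    grp = tensor_grp Ob A M N,
    lact = (\<lambda>p q a. tensor_lift (tensor_grp Ob A M N p q)
      (\<lambda>(s, m, n). pure_tensor Ob A M N p q s (lact M s q a m) n)),
    ract = (\<lambda>p q x a. tensor_lift (tensor_grp Ob A M N p q)
      (\<lambda>(s, m, n). pure_tensor Ob A M N p q s m (ract N p s n a)) x) \<rparr>"

text \<open>\<open>tensor_map Ob A M' N' \<phi> \<psi>\<close> is \<open>\<phi> \<otimes> \<psi>\<close>, with codomain \<open>M' \<otimes> N'\<close>.\<close>

definition tensor_map ::
  "'o set \<Rightarrow> ('o \<Rightarrow> 'a set) \<Rightarrow> ('o, 'a, 'm2) bimodule \<Rightarrow> ('o, 'a, 'n2) bimodule
    \<Rightarrow> ('o \<Rightarrow> 'o \<Rightarrow> 'm \<Rightarrow> 'm2) \<Rightarrow> ('o \<Rightarrow> 'o \<Rightarrow> 'n \<Rightarrow> 'n2)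
    \<Rightarrow> 'o \<Rightarrow> 'o \<Rightarrow> (('o \<times> 'm \<times> 'n) \<Rightarrow>\<^sub>0 int) set \<Rightarrow> (('o \<times> 'm2 \<times> 'n2) \<Rightarrow>\<^sub>0 int) set" where
  "tensor_map Ob A M' N' \<phi> \<psi> p q = tensor_lift (tensor_grp Ob A M' N' p q)
    (\<lambda>(s, m, n). pure_tensor Ob A M' N' p q s (\<phi> s q m) (\<psi> p s n))"

definition tensor_assoc ::
  "'o set \<Rightarrow> ('o \<Rightarrow> 'a set) \<Rightarrow> ('o, 'a, 'l) bimodule \<Rightarrow> ('o, 'a, 'm) bimodule \<Rightarrow> ('o, 'a, 'n) bimodule
    \<Rightarrow> 'o \<Rightarrow> 'o \<Rightarrow> (('o \<times> (('o \<times> 'l \<times> 'm) \<Rightarrow>\<^sub>0 int) set \<times> 'n) \<Rightarrow>\<^sub>0 int) set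
    \<Rightarrow> (('o \<times> 'l \<times> (('o \<times> 'm \<times> 'n) \<Rightarrow>\<^sub>0 int) set) \<Rightarrow>\<^sub>0 int) set" where
  "tensor_assoc Ob A L M N p q =
    tensor_lift (tensor_grp Ob A L (tensor Ob A M N) p q)
      (\<lambda>(s, x, n). tensor_lift (tensor_grp Ob A L (tensor Ob A M N) p q)
        (\<lambda>(t, l, m). pure_tensor Ob A L (tensor Ob A M N) p q t l (pure_tensor Ob A M N p t s m n)) x)"

definition tensor_assoc_inv ::
  "'o set \<Rightarrow> ('o \<Rightarrow> 'a set) \<Rightarrow> ('o, 'a, 'l) bimodule \<Rightarrow> ('o, 'a, 'm) bimodule \<Rightarrow> ('o, 'a, 'n) bimodule
    \<Rightarrow> 'o \<Rightarrow> 'o \<Rightarrow> (('o \<times> 'l \<times> (('o \<times> 'm \<times> 'n) \<Rightarrow>\<^sub>0 int) set) \<Rightarrow>\<^sub>0 int) set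
    \<Rightarrow> (('o \<times> (('o \<times> 'l \<times> 'm) \<Rightarrow>\<^sub>0 int) set \<times> 'n) \<Rightarrow>\<^sub>0 int) set" where
  "tensor_assoc_inv Ob A L M N p q =
    tensor_lift (tensor_grp Ob A (tensor Ob A L M) N p q)
      (\<lambda>(t, l, x). tensor_lift (tensor_grp Ob A (tensor Ob A L M) N p q)
        (\<lambda>(s, m, n). pure_tensor Ob A (tensor Ob A L M) N p q s (pure_tensor Ob A L M s q t l m) n) x)"

text \<open>
  The unit for the tensor product is the bimodule that is \<open>A s\<close> at \<open>(s,s)\<close> and zero elsewhere;
  the following are the unit isomorphisms.
\<close>

definition left_unitor ::
  "('o, 'a, 'n) bimodule \<Rightarrow> 'o \<Rightarrow> 'o \<Rightarrow> (('o \<times> 'a \<times> 'n) \<Rightarrow>\<^sub>0 int) set \<Rightarrow> 'n" where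
  "left_unitor N p q = tensor_lift (grp N p q)
    (\<lambda>(s, a, n). if s = q then lact N p q a n else \<one>\<^bsub>grp N p q\<^esub>)"

definition right_unitor ::
  "('o, 'a, 'm) bimodule \<Rightarrow> 'o \<Rightarrow> 'o \<Rightarrow> (('o \<times> 'm \<times> 'a) \<Rightarrow>\<^sub>0 int) set \<Rightarrow> 'm" where
  "right_unitor M p q = tensor_lift (grp M p q)
    (\<lambda>(s, m, a). if s = p then ract M p q m a else \<one>\<^bsub>grp M p q\<^esub>)"

text \<open>
  \<open>d : S \<rightarrow> P \<otimes> M\<close> is a copairing for \<open>b : M \<otimes> P \<rightarrow> S\<close>, where \<open>S\<close> is the unit bimodule. The two
  conditions are \<open>(id \<otimes> b)(d \<otimes> id) = id\<close> on \<open>P\<close> and \<open>(b \<otimes> id)(id \<otimes> d) = id\<close> on \<open>M\<close>, with the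
  identifications \<open>S \<otimes> P = P = P \<otimes> S\<close>, \<open>M \<otimes> S = M = S \<otimes> M\<close> and the associativity written out.
\<close>

definition is_copairing ::
  "'o set \<Rightarrow> ('o \<Rightarrow> 'a set) \<Rightarrow> ('o, 'a, 'a) bimodule \<Rightarrow> ('o, 'a, 'p) bimodule \<Rightarrow> ('o, 'a, 'm) bimodule
    \<Rightarrow> ('o \<Rightarrow> 'o \<Rightarrow> (('o \<times> 'm \<times> 'p) \<Rightarrow>\<^sub>0 int) set \<Rightarrow> 'a)
    \<Rightarrow> ('o \<Rightarrow> 'o \<Rightarrow> 'a \<Rightarrow> (('o \<times> 'p \<times> 'm) \<Rightarrow>\<^sub>0 int) set) \<Rightarrow> bool" where
  "is_copairing Ob A S P M b d \<longleftrightarrow>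
    bimodule_map Ob A S (tensor Ob A P M) d \<and>
    (\<forall>p\<in>Ob. \<forall>q\<in>Ob. \<forall>x\<in>carrier (tensor_grp Ob A S P p q).
       right_unitor P p q
         (tensor_map Ob A P S (\<lambda>_ _. id) b p q
           (tensor_assoc Ob A P M P p q
             (tensor_map Ob A (tensor Ob A P M) P d (\<lambda>_ _. id) p q x)))
       = left_unitor P p q x) \<and>
    (\<forall>p\<in>Ob. \<forall>q\<in>Ob. \<forall>x\<in>carrier (tensor_grp Ob A M S p q).
       left_unitor M p q
         (tensor_map Ob A S M b (\<lambda>_ _. id) p q
           (tensor_assoc_inv Ob A M P M p q
             (tensor_map Ob A M (tensor Ob A P M) (\<lambda>_ _. id) d p q x)))
       = right_unitor M p q x)"

definition perfect_pairing ::
  "'o set \<Rightarrow> ('o \<Rightarrow> 'a set) \<Rightarrow> ('o, 'a, 'a) bimodule \<Rightarrow> ('o, 'a, 'p) bimodule \<Rightarrow> ('o, 'a, 'm) bimodule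
    \<Rightarrow> ('o \<Rightarrow> 'o \<Rightarrow> (('o \<times> 'm \<times> 'p) \<Rightarrow>\<^sub>0 int) set \<Rightarrow> 'a) \<Rightarrow> bool" where
  "perfect_pairing Ob A S P M b \<longleftrightarrow>
    bimodule_map Ob A (tensor Ob A M P) S b \<and> (\<exists>d. is_copairing Ob A S P M b d)"


section \<open>Linear, stratified and quasi-cellular categories\<close>

text \<open>\<open>cmp f g\<close> is \<open>f \<circ> g\<close>, and \<open>Mor p q\<close> consists of the morphisms from \<open>p\<close> to \<open>q\<close>; all morphism
  modules are submodules of one ambient module.\<close>

locale linear_category = Modules.module scale
  for scale :: "'k::comm_ring_1 \<Rightarrow> 'a::ab_group_add \<Rightarrow> 'a" +
  fixes Ob :: "'o set"
    and Mor :: "'o \<Rightarrow> 'o \<Rightarrow> 'a set"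
    and cmp :: "'a \<Rightarrow> 'a \<Rightarrow> 'a"
    and ident :: "'o \<Rightarrow> 'a"
  assumes subspace_Mor: "p \<in> Ob \<Longrightarrow> q \<in> Ob \<Longrightarrow> subspace (Mor p q)"
    and cmp_closed: "p \<in> Ob \<Longrightarrow> q \<in> Ob \<Longrightarrow> s \<in> Ob \<Longrightarrow> f \<in> Mor q s \<Longrightarrow> g \<in> Mor p q
      \<Longrightarrow> cmp f g \<in> Mor p s"
    and cmp_add_left: "p \<in> Ob \<Longrightarrow> q \<in> Ob \<Longrightarrow> s \<in> Ob \<Longrightarrow> f \<in> Mor q s \<Longrightarrow> f' \<in> Mor q s \<Longrightarrow> g \<in> Mor p q
      \<Longrightarrow> cmp (f + f') g = cmp f g + cmp f' g"
    and cmp_add_right: "p \<in> Ob \<Longrightarrow> q \<in> Ob \<Longrightarrow> s \<in> Ob \<Longrightarrow> f \<in> Mor q s \<Longrightarrow> g \<in> Mor p q \<Longrightarrow> g' \<in> Mor p q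
      \<Longrightarrow> cmp f (g + g') = cmp f g + cmp f g'"
    and cmp_scale_left: "p \<in> Ob \<Longrightarrow> q \<in> Ob \<Longrightarrow> s \<in> Ob \<Longrightarrow> f \<in> Mor q s \<Longrightarrow> g \<in> Mor p q
      \<Longrightarrow> cmp (scale c f) g = scale c (cmp f g)"
    and cmp_scale_right: "p \<in> Ob \<Longrightarrow> q \<in> Ob \<Longrightarrow> s \<in> Ob \<Longrightarrow> f \<in> Mor q s \<Longrightarrow> g \<in> Mor p q
      \<Longrightarrow> cmp f (scale c g) = scale c (cmp f g)"
    and cmp_assoc: "p \<in> Ob \<Longrightarrow> q \<in> Ob \<Longrightarrow> s \<in> Ob \<Longrightarrow> t \<in> Ob
      \<Longrightarrow> f \<in> Mor s t \<Longrightarrow> g \<in> Mor q s \<Longrightarrow> h \<in> Mor p q \<Longrightarrow> cmp (cmp f g) h = cmp f (cmp g h)"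
    and ident_closed: "p \<in> Ob \<Longrightarrow> ident p \<in> Mor p p"
    and ident_left: "p \<in> Ob \<Longrightarrow> q \<in> Ob \<Longrightarrow> f \<in> Mor p q \<Longrightarrow> cmp (ident q) f = f"
    and ident_right: "p \<in> Ob \<Longrightarrow> q \<in> Ob \<Longrightarrow> f \<in> Mor p q \<Longrightarrow> cmp f (ident p) = f"
begin

definition wide_subcategory :: "('o \<Rightarrow> 'o \<Rightarrow> 'a set) \<Rightarrow> bool" where
  "wide_subcategory N \<longleftrightarrow>
    (\<forall>p\<in>Ob. \<forall>q\<in>Ob. subspace (N p q) \<and> N p q \<subseteq> Mor p q) \<and>
    (\<forall>p\<in>Ob. ident p \<in> N p p) \<and>
    (\<forall>p\<in>Ob. \<forall>q\<in>Ob. \<forall>s\<in>Ob. \<forall>f\<in>N q s. \<forall>g\<in>N p q. cmp f g \<in> N p s)"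

end

definition hom_bimodule ::
  "('a \<Rightarrow> 'a \<Rightarrow> 'a::ab_group_add) \<Rightarrow> ('o \<Rightarrow> 'o \<Rightarrow> 'a set) \<Rightarrow> ('o, 'a, 'a) bimodule" where
  "hom_bimodule cmp N = \<lparr>
    grp = (\<lambda>p q. \<lparr>carrier = N p q, monoid.mult = (+), one = 0\<rparr>),
    lact = (\<lambda>p q. cmp),
    ract = (\<lambda>p q. cmp) \<rparr>"

locale stratified_category = linear_category scale Ob Mor cmp ident
  for scale :: "'k::comm_ring_1 \<Rightarrow> 'a::ab_group_add \<Rightarrow> 'a"
    and Ob :: "'o set" and Mor cmp ident +
  fixes le :: "'o \<Rightarrow> 'o \<Rightarrow> bool"
    and S P M :: "'o \<Rightarrow> 'o \<Rightarrow> 'a set"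
  assumes le_order: "partial_order_on Ob {(p, q). p \<in> Ob \<and> q \<in> Ob \<and> le p q}"
    and wide_S: "wide_subcategory S"
    and wide_P: "wide_subcategory P"
    and wide_M: "wide_subcategory M"
    and S_offdiag: "p \<in> Ob \<Longrightarrow> q \<in> Ob \<Longrightarrow> p \<noteq> q \<Longrightarrow> S p q = {0}"
    and P_zero: "p \<in> Ob \<Longrightarrow> q \<in> Ob \<Longrightarrow> \<not> le p q \<Longrightarrow> P p q = {0}"
    and M_zero: "p \<in> Ob \<Longrightarrow> q \<in> Ob \<Longrightarrow> \<not> le q p \<Longrightarrow> M p q = {0}"
    and P_diag: "p \<in> Ob \<Longrightarrow> P p p = S p p"
    and M_diag: "p \<in> Ob \<Longrightarrow> M p p = S p p"
    and cmp_iso: "bimodule_iso Ob (\<lambda>s. S s s)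
      (tensor Ob (\<lambda>s. S s s) (hom_bimodule cmp P) (hom_bimodule cmp M)) (hom_bimodule cmp Mor)
      (\<lambda>p q. tensor_lift (grp (hom_bimodule cmp Mor) p q) (\<lambda>(s, f, g). cmp f g))"

text \<open>The last two assumptions say that \<open>b\<close> restricts along the identities to the projections
  \<open>\<epsilon>\<close> from \<open>P\<close> and \<open>M\<close> onto \<open>S\<close>.\<close>

locale quasi_cellular_category = stratified_category scale Ob Mor cmp ident le S P M
  for scale :: "'k::comm_ring_1 \<Rightarrow> 'a::ab_group_add \<Rightarrow> 'a"
    and Ob :: "'o set" and Mor cmp ident le S P M +
  fixes b :: "'o \<Rightarrow> 'o \<Rightarrow> (('o \<times> 'a \<times> 'a) \<Rightarrow>\<^sub>0 int) set \<Rightarrow> 'a"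
    and d :: "'o \<Rightarrow> 'o \<Rightarrow> 'a \<Rightarrow> (('o \<times> 'a \<times> 'a) \<Rightarrow>\<^sub>0 int) set"
  assumes b_map: "bimodule_map Ob (\<lambda>s. S s s)
      (tensor Ob (\<lambda>s. S s s) (hom_bimodule cmp M) (hom_bimodule cmp P)) (hom_bimodule cmp S) b"
    and d_copairing: "is_copairing Ob (\<lambda>s. S s s)
      (hom_bimodule cmp S) (hom_bimodule cmp P) (hom_bimodule cmp M) b d"
    and b_ident_left: "p \<in> Ob \<Longrightarrow> q \<in> Ob \<Longrightarrow> f \<in> P q p \<Longrightarrow>
      b q p (pure_tensor Ob (\<lambda>s. S s s) (hom_bimodule cmp M) (hom_bimodule cmp P) q p p (ident p) f)
      = (if q = p then f else 0)"
    and b_ident_right: "p \<in> Ob \<Longrightarrow> q \<in> Ob \<Longrightarrow> g \<in> M p q \<Longrightarrow>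
      b p q (pure_tensor Ob (\<lambda>s. S s s) (hom_bimodule cmp M) (hom_bimodule cmp P) p q p g (ident p))
      = (if p = q then g else 0)"


section \<open>Brauer diagrams\<close>

datatype point = Top nat | Bot nat

type_synonym diagram = "point set set"

definition points :: "nat \<Rightarrow> nat \<Rightarrow> point set" where
  "points p q = Top ` {1..p} \<union> Bot ` {1..q}"

definition brauer_diagrams :: "nat \<Rightarrow> nat \<Rightarrow> diagram set" where
  "brauer_diagrams p q = {D. partition_on (points p q) D \<and> (\<forall>e\<in>D. card e = 2)}"

definition is_upward :: "diagram \<Rightarrow> bool" where
  "is_upward D \<longleftrightarrow> (\<nexists>i k. i \<noteq> k \<and> {Top i, Top k} \<in> D)"

definition is_downward :: "diagram \<Rightarrow> bool" where
  "is_downward D \<longleftrightarrow> (\<nexists>i k. i \<noteq> k \<and> {Bot i, Bot k} \<in> D)"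

definition is_level :: "diagram \<Rightarrow> bool" where
  "is_level D \<longleftrightarrow> is_upward D \<and> is_downward D"

definition is_monotone :: "diagram \<Rightarrow> bool" where
  "is_monotone D \<longleftrightarrow>
    (\<forall>i j k l. {Top i, Bot j} \<in> D \<and> {Top k, Bot l} \<in> D \<and> {Top i, Bot j} \<noteq> {Top k, Bot l} \<longrightarrow>
      (int i - int k) * (int j - int l) > 0)"

definition up_diagrams :: "nat \<Rightarrow> nat \<Rightarrow> diagram set" where
  "up_diagrams p q = {D \<in> brauer_diagrams p q. is_upward D}"

definition down_diagrams :: "nat \<Rightarrow> nat \<Rightarrow> diagram set" where
  "down_diagrams p q = {D \<in> brauer_diagrams p q. is_downward D}"

definition level_diagrams :: "nat \<Rightarrow> nat \<Rightarrow> diagram set" where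
  "level_diagrams p q = {D \<in> brauer_diagrams p q. is_level D}"

definition mono_up_diagrams :: "nat \<Rightarrow> nat \<Rightarrow> diagram set" where
  "mono_up_diagrams p q = {D \<in> up_diagrams p q. is_monotone D}"

fun flip_point :: "point \<Rightarrow> point" where
  "flip_point (Top i) = Bot i"
| "flip_point (Bot i) = Top i"

definition flip_diagram :: "diagram \<Rightarrow> diagram" where
  "flip_diagram D = (\<lambda>e. flip_point ` e) ` D"

definition id_diagram :: "nat \<Rightarrow> diagram" where
  "id_diagram p = (\<lambda>i. {Top i, Bot i}) ` {1..p}"

definition prec :: "nat \<Rightarrow> nat \<Rightarrow> bool" where
  "prec p q \<longleftrightarrow> p \<le> q \<and> even (q - p)"

text \<open>
  Stacking \<open>g\<close> above \<open>f\<close>: the bottom points of \<open>g\<close> are glued to the top points of \<open>f\<close>, giving the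
  middle layer. Closed loops are the connected components that lie entirely in the middle layer.
\<close>

datatype vertex = Upper nat | Middle nat | Lower nat

fun upper_vertex :: "point \<Rightarrow> vertex" where
  "upper_vertex (Top i) = Upper i"
| "upper_vertex (Bot i) = Middle i"

fun lower_vertex :: "point \<Rightarrow> vertex" where
  "lower_vertex (Top i) = Middle i"
| "lower_vertex (Bot i) = Lower i"

fun outer_vertex :: "point \<Rightarrow> vertex" where
  "outer_vertex (Top i) = Upper i"
| "outer_vertex (Bot i) = Lower i"

definition stack_edges :: "diagram \<Rightarrow> diagram \<Rightarrow> vertex set set" where
  "stack_edges f g = (\<lambda>e. upper_vertex ` e) ` g \<union> (\<lambda>e. lower_vertex ` e) ` f"

definition stack_conn :: "diagram \<Rightarrow> diagram \<Rightarrow> (vertex \<times> vertex) set" where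
  "stack_conn f g = {(u, v). \<exists>e\<in>stack_edges f g. u \<in> e \<and> v \<in> e}\<^sup>*"

definition loops :: "diagram \<Rightarrow> diagram \<Rightarrow> nat" where
  "loops f g = card {C. \<exists>v\<in>\<Union>(stack_edges f g). C = stack_conn f g `` {v} \<and> C \<subseteq> range Middle}"

definition diagram_comp :: "diagram \<Rightarrow> diagram \<Rightarrow> diagram" where
  "diagram_comp f g = {{x, y} | x y. x \<noteq> y \<and> (outer_vertex x, outer_vertex y) \<in> stack_conn f g}"


section \<open>The Brauer category\<close>

text \<open>A morphism is a linear combination of diagrams; the objects \<open>p\<close> and \<open>q\<close> are determined by the
  point set of a diagram, so all morphism modules live inside one free module.\<close>

type_synonym 'k brauer = "diagram \<Rightarrow>\<^sub>0 'k"

definition scale_brauer :: "'k::comm_ring_1 \<Rightarrow> 'k brauer \<Rightarrow> 'k brauer" where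
  "scale_brauer c = Poly_Mapping.map ((*) c)"

definition diagram_span :: "diagram set \<Rightarrow> 'k::comm_ring_1 brauer set" where
  "diagram_span X = {F. Poly_Mapping.keys F \<subseteq> X}"

abbreviation diag_mor :: "diagram \<Rightarrow> 'k::comm_ring_1 brauer" where
  "diag_mor f \<equiv> Poly_Mapping.single f 1"

definition bilinear_ext ::
  "(diagram \<Rightarrow> diagram \<Rightarrow> 'k::comm_ring_1 brauer) \<Rightarrow> 'k brauer \<Rightarrow> 'k brauer \<Rightarrow> 'k brauer" where
  "bilinear_ext \<phi> F G = (\<Sum>f\<in>Poly_Mapping.keys F. \<Sum>g\<in>Poly_Mapping.keys G.
    scale_brauer (Poly_Mapping.lookup F f * Poly_Mapping.lookup G g) (\<phi> f g))"

definition brauer_comp :: "'k::comm_ring_1 \<Rightarrow> 'k brauer \<Rightarrow> 'k brauer \<Rightarrow> 'k brauer" where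
  "brauer_comp \<delta> =
    bilinear_ext (\<lambda>f g. Poly_Mapping.single (diagram_comp f g) (\<delta> ^ loops f g))"

definition brauer_id :: "nat \<Rightarrow> 'k::comm_ring_1 brauer" where
  "brauer_id p = diag_mor (id_diagram p)"

definition BMor :: "nat \<Rightarrow> nat \<Rightarrow> 'k::comm_ring_1 brauer set" where
  "BMor p q = diagram_span (brauer_diagrams p q)"

definition BUp :: "nat \<Rightarrow> nat \<Rightarrow> 'k::comm_ring_1 brauer set" where
  "BUp p q = diagram_span (up_diagrams p q)"

definition BDown :: "nat \<Rightarrow> nat \<Rightarrow> 'k::comm_ring_1 brauer set" where
  "BDown p q = diagram_span (down_diagrams p q)"

definition BSym :: "nat \<Rightarrow> nat \<Rightarrow> 'k::comm_ring_1 brauer set" where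
  "BSym p q = diagram_span (level_diagrams p q)"

definition trunc_objects :: "nat \<Rightarrow> nat set" where
  "trunc_objects r = {q. prec q r}"

abbreviation BSymBim :: "'k::comm_ring_1 \<Rightarrow> (nat, 'k brauer, 'k brauer) bimodule" where
  "BSymBim \<delta> \<equiv> hom_bimodule (brauer_comp \<delta>) BSym"

abbreviation BUpBim :: "'k::comm_ring_1 \<Rightarrow> (nat, 'k brauer, 'k brauer) bimodule" where
  "BUpBim \<delta> \<equiv> hom_bimodule (brauer_comp \<delta>) BUp"

abbreviation BDownBim :: "'k::comm_ring_1 \<Rightarrow> (nat, 'k brauer, 'k brauer) bimodule" where
  "BDownBim \<delta> \<equiv> hom_bimodule (brauer_comp \<delta>) BDown"

type_synonym 'k brauer_tensor = "((nat \<times> 'k brauer \<times> 'k brauer) \<Rightarrow>\<^sub>0 int) set"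

text \<open>The pairing \<open>b'\<close> and copairing \<open>d'\<close> of the quasi-cellular structure; \<open>d'\<close> is extended from
  \<open>d'(1\<^sub>p)\<close> by the left action.\<close>

definition cell_pairing_diag ::
  "nat \<Rightarrow> nat \<Rightarrow> diagram \<Rightarrow> diagram \<Rightarrow> 'k::comm_ring_1 brauer" where
  "cell_pairing_diag p s u w =
    (if s = p \<and> (\<exists>\<sigma>\<in>level_diagrams p p. u = diagram_comp \<sigma> (flip_diagram w))
     then diag_mor (THE \<sigma>. \<sigma> \<in> level_diagrams p p \<and> u = diagram_comp \<sigma> (flip_diagram w))
     else 0)"

definition cell_pairing :: "'k::comm_ring_1 \<Rightarrow> nat \<Rightarrow> nat \<Rightarrow> 'k brauer_tensor \<Rightarrow> 'k brauer" where
  "cell_pairing \<delta> p s = tensor_lift (grp (BSymBim \<delta>) p s)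
    (\<lambda>(q, g, f). bilinear_ext (cell_pairing_diag p s) g f)"

definition cell_copairing_id :: "'k::comm_ring_1 \<Rightarrow> nat \<Rightarrow> nat \<Rightarrow> 'k brauer_tensor" where
  "cell_copairing_id \<delta> r p =
    tensor_class (trunc_objects r) (\<lambda>s. BSym s s) (BUpBim \<delta>) (BDownBim \<delta>) p p
      (\<Sum>s\<in>{s. prec s p}. \<Sum>f\<in>mono_up_diagrams s p.
        frag_of (s, diag_mor f, diag_mor (flip_diagram f)))"

definition cell_copairing ::
  "'k::comm_ring_1 \<Rightarrow> nat \<Rightarrow> nat \<Rightarrow> nat \<Rightarrow> 'k brauer \<Rightarrow> 'k brauer_tensor" where
  "cell_copairing \<delta> r p q x =
    (let T = tensor (trunc_objects r) (\<lambda>s. BSym s s) (BUpBim \<delta>) (BDownBim \<delta>) in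
     if p = q then lact T p p x (cell_copairing_id \<delta> r p) else \<one>\<^bsub>grp T p q\<^esub>)"

definition brauer_quasi_cellular :: "'k::comm_ring_1 \<Rightarrow> nat \<Rightarrow> bool" where
  "brauer_quasi_cellular \<delta> r \<longleftrightarrow>
    quasi_cellular_category scale_brauer (trunc_objects r) BMor (brauer_comp \<delta>) brauer_id
      prec BSym BUp BDown (cell_pairing \<delta>) (cell_copairing \<delta> r)"

text \<open>The pairing \<open>b\<close>, given by composition followed by projection to level diagrams.\<close>

definition level_pairing_diag :: "'k::comm_ring_1 \<Rightarrow> diagram \<Rightarrow> diagram \<Rightarrow> 'k brauer" where
  "level_pairing_diag \<delta> g f =
    (if is_level (diagram_comp g f) then brauer_comp \<delta> (diag_mor g) (diag_mor f) else 0)"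

definition level_pairing :: "'k::comm_ring_1 \<Rightarrow> nat \<Rightarrow> nat \<Rightarrow> 'k brauer_tensor \<Rightarrow> 'k brauer" where
  "level_pairing \<delta> p s = tensor_lift (grp (BSymBim \<delta>) p s)
    (\<lambda>(q, g, f). bilinear_ext (level_pairing_diag \<delta>) g f)"

definition brauer_perfect :: "'k::comm_ring_1 \<Rightarrow> nat \<Rightarrow> bool" where
  "brauer_perfect \<delta> r \<longleftrightarrow>
    perfect_pairing (trunc_objects r) (\<lambda>s. BSym s s) (BSymBim \<delta>) (BUpBim \<delta>) (BDownBim \<delta>)
      (level_pairing \<delta>)"


section \<open>Non-singularity\<close>

text \<open>
  The ground ring is \<open>\<int>[x]\<close> with parameter \<open>x\<close>. The rows and columns of \<open>\<iota>(A)\<close> are indexed by pairs of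
  a monotone upward diagram and a permutation; the determinant does not depend on the chosen
  enumeration of the index set.
\<close>

definition gram_entry :: "diagram \<Rightarrow> diagram \<Rightarrow> int poly brauer" where
  "gram_entry f g = level_pairing_diag [:0, 1:] (flip_diagram f) g"

definition left_regular :: "int poly brauer \<Rightarrow> diagram \<Rightarrow> diagram \<Rightarrow> int poly" where
  "left_regular a \<sigma> \<tau> = Poly_Mapping.lookup (brauer_comp [:0, 1:] a (diag_mor \<tau>)) \<sigma>"

definition enumeration :: "'b set \<Rightarrow> 'b list" where
  "enumeration X = (SOME xs. distinct xs \<and> set xs = X)"

definition gram_matrix :: "nat \<Rightarrow> nat \<Rightarrow> int poly mat" where
  "gram_matrix p q =
    (let I = enumeration (mono_up_diagrams p q \<times> level_diagrams p p) in
     mat (length I) (length I) (\<lambda>(i, j).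
       case (I ! i, I ! j) of ((f, \<sigma>), (g, \<tau>)) \<Rightarrow> left_regular (gram_entry f g) \<sigma> \<tau>))"

definition gram_det :: "nat \<Rightarrow> nat \<Rightarrow> int poly" where
  "gram_det p q = det (gram_matrix p q)"

definition nonsingular :: "'k::comm_ring_1 \<Rightarrow> nat \<Rightarrow> bool" where
  "nonsingular \<delta> r \<longleftrightarrow>
    (\<forall>p q. prec p q \<and> prec q r \<longrightarrow> poly (map_poly of_int (gram_det p q)) \<delta> dvd 1)"

end

theory Submission
  imports Defs
begin

text \<open>
  Both pairings come from scalar-valued forms \<open>\<beta>\<close> on diagrams that are invariant under
  permutations: for \<open>b'\<close> it is \<open>\<beta> g f = [g = flip f]\<close>, for \<open>b\<close> it is
  \<open>\<beta> g f = \<delta>\<close> to the number of loops if \<open>g\<close> after \<open>f\<close> is an identity diagram, and \<open>0\<close> otherwise.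
  The pairing is recovered as the sum over all permutations \<open>\<sigma>\<close> of \<open>\<beta> g (f \<sigma>\<^sup>-\<^sup>1) \<sigma>\<close>.

  If the upward diagrams have a dual basis \<open>u*\<close> of downward morphisms with respect to \<open>\<beta>\<close>, then
  the sum of \<open>f \<otimes> f*\<close> over the monotone upward diagrams \<open>f\<close> into \<open>q\<close> is central and is the
  value at \<open>1\<^sub>q\<close> of a copairing. Conversely, the coefficients of the zigzag identity on
  upward diagrams give a left inverse of the Gram matrix of \<open>\<beta>\<close>. For \<open>b'\<close> the dual basis consists
  of the flipped diagrams. For \<open>b\<close> the Gram matrix is \<open>\<iota>(A\<^sub>p\<^sub>,\<^sub>q)\<close>, because every upward diagram is
  uniquely a monotone diagram after a permutation; so a copairing exists if and only if the determinants
  \<open>f\<^sub>p\<^sub>,\<^sub>q(\<delta>)\<close> are units.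
\<close>

section \<open>Tensor products of bimodules\<close>

text \<open>Quasi-cellularity holds for every \<delta>, so the equivalence is one about the pairing
  \<open>b\<close>. Its values lie in group algebras, which are not commutative, so determinants do
  not apply directly; \<beta> is its coefficient at the identity permutation, and invariance
  recovers all other coefficients from this one. The price is a larger matrix, indexed by all upward
  diagrams rather than the monotone ones, which is what the left regular representation does to a
  matrix over the group algebra. The zigzag identity for \<open>P\<close> yields only a left
  inverse, but over a commutative ring this already makes the determinant a unit, and the adjugate
  then inverts on both sides. A copairing uses both sides: the left inverse has the dual basis as
  its rows, the right inverse gives non-degeneracy. Two further obstacles shape the development.
  Elements of a tensor product are cosets, so every map out of one must be shown balanced before it
  can be evaluated. And loops have to be counted correctly in triple stacks, since associativity of
  composition depends on it.\<close>

definition bimod :: "'o set \<Rightarrow> ('o \<Rightarrow> 'a set) \<Rightarrow> ('o, 'a, 'm) bimodule \<Rightarrow> bool" where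
  "bimod Ob A M \<longleftrightarrow> (\<forall>p\<in>Ob. \<forall>q\<in>Ob. comm_group (grp M p q) \<and>
     (\<forall>a\<in>A q. lact M p q a \<in> hom (grp M p q) (grp M p q)) \<and>
     (\<forall>a\<in>A p. (\<lambda>x. ract M p q x a) \<in> hom (grp M p q) (grp M p q)) \<and>
     (\<forall>a\<in>A q. \<forall>c\<in>A p. \<forall>x\<in>carrier (grp M p q).
        lact M p q a (ract M p q x c) = ract M p q (lact M p q a x) c))"

lemma bimodD:
  assumes "bimod Ob A M" "p \<in> Ob" "q \<in> Ob"
  shows "comm_group (grp M p q)"
    and "a \<in> A q \<Longrightarrow> lact M p q a \<in> hom (grp M p q) (grp M p q)"
    and "c \<in> A p \<Longrightarrow> (\<lambda>x. ract M p q x c) \<in> hom (grp M p q) (grp M p q)"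
    and "a \<in> A q \<Longrightarrow> c \<in> A p \<Longrightarrow> x \<in> carrier (grp M p q) \<Longrightarrow>
      lact M p q a (ract M p q x c) = ract M p q (lact M p q a x) c"
  using assms unfolding bimod_def by blast+

lemma bimod_closed:
  assumes "bimod Ob A M" "p \<in> Ob" "q \<in> Ob" "x \<in> carrier (grp M p q)"
  shows "a \<in> A q \<Longrightarrow> lact M p q a x \<in> carrier (grp M p q)"
    and "c \<in> A p \<Longrightarrow> ract M p q x c \<in> carrier (grp M p q)"
  using bimodD(2)[OF assms(1-3), of a] hom_in_carrier[OF bimodD(3)[OF assms(1-3), of c] assms(4)] assms(4)
  by (auto simp: hom_def)

lemma comm_group_group: "comm_group G \<Longrightarrow> group G"
  by (rule comm_group.axioms(2))

lemma bimod_mult_closed: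
  assumes "bimod Ob A M" "p \<in> Ob" "q \<in> Ob" "x \<in> carrier (grp M p q)" "y \<in> carrier (grp M p q)"
  shows "x \<otimes>\<^bsub>grp M p q\<^esub> y \<in> carrier (grp M p q)"
  using bimodD(1)[OF assms(1-3), THEN comm_group_group, THEN group.is_monoid] assms(4,5)
  by (rule monoid.m_closed)

text \<open>The maps represented by the tensor product at (p,q): biadditive and balanced over
  \<open>A s\<close> in every summand s. This is the condition under which
  \<open>tensor_lift\<close> is independent of the representative.\<close>

definition balanced ::
  "'o set \<Rightarrow> ('o \<Rightarrow> 'a set) \<Rightarrow> ('o, 'a, 'm) bimodule \<Rightarrow> ('o, 'a, 'n) bimodule \<Rightarrow> 'o \<Rightarrow> 'o
    \<Rightarrow> ('g, 'b) monoid_scheme \<Rightarrow> ('o \<times> 'm \<times> 'n \<Rightarrow> 'g) \<Rightarrow> bool" where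
  "balanced Ob A M N p q G \<phi> \<longleftrightarrow> (\<forall>s\<in>Ob.
     (\<forall>m\<in>carrier (grp M s q). (\<lambda>n. \<phi> (s, m, n)) \<in> hom (grp N p s) G) \<and>
     (\<forall>n\<in>carrier (grp N p s). (\<lambda>m. \<phi> (s, m, n)) \<in> hom (grp M s q) G) \<and>
     (\<forall>m\<in>carrier (grp M s q). \<forall>a\<in>A s. \<forall>n\<in>carrier (grp N p s).
        \<phi> (s, ract M s q m a, n) = \<phi> (s, m, lact N p s a n)))"

lemma balancedD:
  assumes "balanced Ob A M N p q G \<phi>" "s \<in> Ob"
  shows "m \<in> carrier (grp M s q) \<Longrightarrow> (\<lambda>n. \<phi> (s, m, n)) \<in> hom (grp N p s) G"
    and "n \<in> carrier (grp N p s) \<Longrightarrow> (\<lambda>m. \<phi> (s, m, n)) \<in> hom (grp M s q) G"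
    and "m \<in> carrier (grp M s q) \<Longrightarrow> a \<in> A s \<Longrightarrow> n \<in> carrier (grp N p s) \<Longrightarrow>
       \<phi> (s, ract M s q m a, n) = \<phi> (s, m, lact N p s a n)"
  using assms unfolding balanced_def by blast+

text \<open>The universal property of the free abelian group. The supports of c, d and c + d differ,
  so all three products are extended to the union of the first two supports; the added factors have
  exponent 0.\<close>

lemma (in comm_group) frag_eval_hom:
  fixes \<phi> :: "'x \<Rightarrow> 'a"
  assumes "\<phi> \<in> X \<rightarrow> carrier G"
  shows "(\<lambda>c. finprod G (\<lambda>x. \<phi> x [^] Poly_Mapping.lookup c x) (Poly_Mapping.keys c))
    \<in> hom (free_Abelian_group X) G"
proof -
  let ?h = "\<lambda>c. finprod G (\<lambda>x. \<phi> x [^] Poly_Mapping.lookup c x) (Poly_Mapping.keys c)"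
  have cl: "\<phi> x [^] (k::int) \<in> carrier G" if "x \<in> X" for x k
    using assms that by auto
  have ext: "?h c = finprod G (\<lambda>x. \<phi> x [^] Poly_Mapping.lookup c x) Y"
    if "finite Y" "Poly_Mapping.keys c \<subseteq> Y" "Y \<subseteq> X" for c :: "'x \<Rightarrow>\<^sub>0 int" and Y
    by (rule finprod_mono_neutral_cong_left) (use that assms in \<open>auto simp: in_keys_iff\<close>)
  show ?thesis
  proof (rule homI)
    fix c assume "c \<in> carrier (free_Abelian_group X)"
    then show "?h c \<in> carrier G" using cl by (auto intro!: finprod_closed)
  next
    fix c d assume "c \<in> carrier (free_Abelian_group X)" "d \<in> carrier (free_Abelian_group X)"
    then have cd: "Poly_Mapping.keys c \<subseteq> X" "Poly_Mapping.keys d \<subseteq> X" by auto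
    let ?Y = "Poly_Mapping.keys c \<union> Poly_Mapping.keys d"
    have Y: "finite ?Y" "?Y \<subseteq> X" using cd by auto
    have "?h (c + d) = finprod G (\<lambda>x. \<phi> x [^] Poly_Mapping.lookup (c + d) x) ?Y"
      using Y Poly_Mapping.keys_add[of c d] by (intro ext) auto
    also have "\<dots> = finprod G (\<lambda>x. \<phi> x [^] Poly_Mapping.lookup c x \<otimes> \<phi> x [^] Poly_Mapping.lookup d x) ?Y"
    proof (rule finprod_cong')
      fix x assume "x \<in> ?Y"
      then have "\<phi> x \<in> carrier G" using Y assms by auto
      then show "\<phi> x [^] Poly_Mapping.lookup (c + d) x
          = \<phi> x [^] Poly_Mapping.lookup c x \<otimes> \<phi> x [^] Poly_Mapping.lookup d x"
        by (simp add: lookup_add int_pow_mult)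
    qed (use Y cl in auto)
    also have "\<dots> = finprod G (\<lambda>x. \<phi> x [^] Poly_Mapping.lookup c x) ?Y
        \<otimes> finprod G (\<lambda>x. \<phi> x [^] Poly_Mapping.lookup d x) ?Y"
      by (rule finprod_multf) (use Y cl in auto)
    also have "\<dots> = ?h c \<otimes> ?h d"
      using ext[of ?Y c] ext[of ?Y d] Y by simp
    finally show "?h (c \<otimes>\<^bsub>free_Abelian_group X\<^esub> d) = ?h c \<otimes> ?h d" by simp
  qed
qed

lemma (in comm_group) frag_eval_of:
  assumes "\<phi> x \<in> carrier G"
  shows "finprod G (\<lambda>y. \<phi> y [^] Poly_Mapping.lookup (frag_of x) y) (Poly_Mapping.keys (frag_of x)) = \<phi> x"
  using assms by simp

section \<open>The universal property of the tensor product\<close>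

locale tensor_pair =
  fixes Ob :: "'o set" and A :: "'o \<Rightarrow> 'a set" and M :: "('o, 'a, 'm) bimodule"
    and N :: "('o, 'a, 'n) bimodule" and p q :: 'o
  assumes M: "bimod Ob A M" and N: "bimod Ob A N" and p: "p \<in> Ob" and q: "q \<in> Ob"
begin

abbreviation "F \<equiv> free_Abelian_group (tensor_gens Ob M N p q)"
abbreviation "K \<equiv> tensor_ker Ob A M N p q"
abbreviation "T \<equiv> tensor_grp Ob A M N p q"
abbreviation "cls \<equiv> tensor_class Ob A M N p q"
abbreviation "pure \<equiv> pure_tensor Ob A M N p q"

lemma gen_iff: "(s, m, n) \<in> tensor_gens Ob M N p q \<longleftrightarrow>
    s \<in> Ob \<and> m \<in> carrier (grp M s q) \<and> n \<in> carrier (grp N p s)"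
  by (simp add: tensor_gens_def)

lemma rels_closed: "tensor_rels Ob A M N p q \<subseteq> carrier F"
proof -
  note mM = bimod_mult_closed[OF M _ q] and mN = bimod_mult_closed[OF N p]
  have d2: "Poly_Mapping.keys (frag_of x - frag_of y) \<subseteq> {x, y}" for x y :: "'o \<times> 'm \<times> 'n"
    using keys_diff[of "frag_of x" "frag_of y"] by auto
  have d3: "Poly_Mapping.keys (frag_of x - frag_of y - frag_of z) \<subseteq> {x, y, z}" for x y z :: "'o \<times> 'm \<times> 'n"
    using keys_diff[of "frag_of x - frag_of y" "frag_of z"] d2[of x y] by auto
  show ?thesis
    unfolding tensor_rels_def
    apply (intro Un_least subsetI)
      apply (clarsimp, erule subsetD[OF d3, THEN rev_mp], use mM in \<open>auto simp: gen_iff\<close>)[1]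
     apply (clarsimp, erule subsetD[OF d3, THEN rev_mp], use mN in \<open>auto simp: gen_iff\<close>)[1]
    apply (clarsimp, erule subsetD[OF d2, THEN rev_mp], use bimod_closed(2)[OF M _ q] bimod_closed(1)[OF N p] in \<open>auto simp: gen_iff\<close>)[1]
    done
qed

lemma normal_ker: "K \<lhd> F"
  unfolding tensor_ker_def
  using rels_closed group.generate_is_subgroup[OF group_free_Abelian_group]
    comm_group.subgroup_imp_normal[OF abelian_free_Abelian_group] by blast

lemma comm_group_tensor: "comm_group T"
  unfolding tensor_grp_def
  using comm_group.abelian_FactGroup[OF abelian_free_Abelian_group] normal_ker normal_imp_subgroup by blast

lemma group_tensor: "group T"
  using comm_group_tensor comm_group_group by blast

lemma class_hom: "cls \<in> hom F T"
  using normal.r_coset_hom_Mod[OF normal_ker] by (simp add: tensor_class_def[abs_def] tensor_grp_def)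

lemma class_surj: "x \<in> carrier T \<Longrightarrow> \<exists>c\<in>carrier F. x = cls c"
  by (auto simp: tensor_grp_def carrier_FactGroup tensor_class_def)

lemma class_closed: "Poly_Mapping.keys c \<subseteq> tensor_gens Ob M N p q \<Longrightarrow> cls c \<in> carrier T"
  using class_hom by (auto simp: hom_def)

lemma class_add: "Poly_Mapping.keys c \<subseteq> tensor_gens Ob M N p q \<Longrightarrow> Poly_Mapping.keys d \<subseteq> tensor_gens Ob M N p q
   \<Longrightarrow> cls (c + d) = cls c \<otimes>\<^bsub>T\<^esub> cls d"
  using class_hom by (auto simp: hom_def)

lemma class_zero: "cls 0 = \<one>\<^bsub>T\<^esub>"
  using hom_one[OF class_hom group_free_Abelian_group group_tensor] by simp

lemma class_rel: "r \<in> tensor_rels Ob A M N p q \<Longrightarrow> cls r = \<one>\<^bsub>T\<^esub>"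
  unfolding tensor_class_def tensor_grp_def one_FactGroup
  using subgroup.rcos_const[OF normal_imp_subgroup[OF normal_ker] group_free_Abelian_group]
  by (simp add: tensor_ker_def generate.incl)

lemma class_diff_rel:
  assumes "Poly_Mapping.keys c \<subseteq> tensor_gens Ob M N p q" "Poly_Mapping.keys d \<subseteq> tensor_gens Ob M N p q"
    "c - d \<in> tensor_rels Ob A M N p q"
  shows "cls c = cls d"
proof -
  interpret T: group T by (rule group_tensor)
  have "cls c = cls ((c - d) + d)" by simp
  also have "\<dots> = cls (c - d) \<otimes>\<^bsub>T\<^esub> cls d"
    using assms(2) subsetD[OF rels_closed assms(3)] by (intro class_add) simp_all
  finally show ?thesis using class_rel[OF assms(3)] class_closed[OF assms(2)] by simp
qed

lemma pure_closed: "s \<in> Ob \<Longrightarrow> m \<in> carrier (grp M s q) \<Longrightarrow> n \<in> carrier (grp N p s) \<Longrightarrow> pure s m n \<in> carrier T"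
  unfolding pure_tensor_def by (intro class_closed) (simp add: gen_iff)

text \<open>Each clause is one of the three families in \<open>tensor_rels\<close>;
  \<open>class_diff_rel\<close> turns a relation into an equality of classes.\<close>

lemma pure_balanced: "balanced Ob A M N p q T (\<lambda>(s, m, n). pure s m n)"
proof -
  note mM = bimod_mult_closed[OF M _ q] and mN = bimod_mult_closed[OF N p]
  have k2: "Poly_Mapping.keys (frag_of x + frag_of y) \<subseteq> X" if "x \<in> X" "y \<in> X" for x y :: "'o \<times> 'm \<times> 'n" and X
    using Poly_Mapping.keys_add[of "frag_of x" "frag_of y"] that by auto
  show ?thesis
    unfolding balanced_def
  proof (intro ballI conjI)
    fix s m assume s: "s \<in> Ob" "m \<in> carrier (grp M s q)"
    show "(\<lambda>n. case (s, m, n) of (s, m, n) \<Rightarrow> pure s m n) \<in> hom (grp N p s) T"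
    proof (rule homI)
      fix n n' assume n: "n \<in> carrier (grp N p s)" "n' \<in> carrier (grp N p s)"
      let ?c = "frag_of (s, m, n \<otimes>\<^bsub>grp N p s\<^esub> n')" and ?d = "frag_of (s, m, n) + frag_of (s, m, n')"
      have "?c - ?d \<in> tensor_rels Ob A M N p q"
        unfolding tensor_rels_def diff_diff_eq[symmetric] using s n by blast
      then have "cls ?c = cls ?d"
        using s n mN by (intro class_diff_rel k2) (auto simp: gen_iff)
      also have "\<dots> = cls (frag_of (s, m, n)) \<otimes>\<^bsub>T\<^esub> cls (frag_of (s, m, n'))"
        using s n by (intro class_add) (auto simp: gen_iff)
      finally show "(case (s, m, n \<otimes>\<^bsub>grp N p s\<^esub> n') of (s, m, n) \<Rightarrow> pure s m n) =
        (case (s, m, n) of (s, m, n) \<Rightarrow> pure s m n) \<otimes>\<^bsub>T\<^esub> (case (s, m, n') of (s, m, n) \<Rightarrow> pure s m n)"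
        by (simp add: pure_tensor_def)
    qed (use s pure_closed in auto)
  next
    fix s n assume s: "s \<in> Ob" "n \<in> carrier (grp N p s)"
    show "(\<lambda>m. case (s, m, n) of (s, m, n) \<Rightarrow> pure s m n) \<in> hom (grp M s q) T"
    proof (rule homI)
      fix m m' assume m: "m \<in> carrier (grp M s q)" "m' \<in> carrier (grp M s q)"
      let ?c = "frag_of (s, m \<otimes>\<^bsub>grp M s q\<^esub> m', n)" and ?d = "frag_of (s, m, n) + frag_of (s, m', n)"
      have "?c - ?d \<in> tensor_rels Ob A M N p q"
        unfolding tensor_rels_def diff_diff_eq[symmetric] using s m by blast
      then have "cls ?c = cls ?d"
        using s m mM by (intro class_diff_rel k2) (auto simp: gen_iff)
      also have "\<dots> = cls (frag_of (s, m, n)) \<otimes>\<^bsub>T\<^esub> cls (frag_of (s, m', n))"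
        using s m by (intro class_add) (auto simp: gen_iff)
      finally show "(case (s, m \<otimes>\<^bsub>grp M s q\<^esub> m', n) of (s, m, n) \<Rightarrow> pure s m n) =
        (case (s, m, n) of (s, m, n) \<Rightarrow> pure s m n) \<otimes>\<^bsub>T\<^esub> (case (s, m', n) of (s, m, n) \<Rightarrow> pure s m n)"
        by (simp add: pure_tensor_def)
    qed (use s pure_closed in auto)
  next
    fix s m a n assume s: "s \<in> Ob" "m \<in> carrier (grp M s q)" "a \<in> A s" "n \<in> carrier (grp N p s)"
    have "frag_of (s, ract M s q m a, n) - frag_of (s, m, lact N p s a n) \<in> tensor_rels Ob A M N p q"
      unfolding tensor_rels_def using s by blast
    then have "cls (frag_of (s, ract M s q m a, n)) = cls (frag_of (s, m, lact N p s a n))"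
      using s bimod_closed(2)[OF M _ q] bimod_closed(1)[OF N p] by (intro class_diff_rel) (auto simp: gen_iff)
    then show "(case (s, ract M s q m a, n) of (s, m, n) \<Rightarrow> pure s m n) =
        (case (s, m, lact N p s a n) of (s, m, n) \<Rightarrow> pure s m n)"
      by (simp add: pure_tensor_def)
  qed
qed

context
  fixes G :: "('g, 'b) monoid_scheme" and \<phi>
  assumes G: "comm_group G" and \<phi>: "balanced Ob A M N p q G \<phi>"
begin

lemma balanced_closed: "\<phi> \<in> tensor_gens Ob M N p q \<rightarrow> carrier G"
  using balancedD(1)[OF \<phi>] by (auto simp: tensor_gens_def hom_def)

text \<open>The evaluation \<open>?h\<close> kills each generating relation because \<phi> is
  balanced, hence kills the subgroup they generate. It is therefore constant on the coset, and
  \<open>the_elem\<close> in \<open>tensor_lift\<close> returns its value at c.\<close>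

lemma lift_class:
  assumes c: "c \<in> carrier F"
  shows "tensor_lift G \<phi> (cls c) =
    finprod G (\<lambda>x. \<phi> x [^]\<^bsub>G\<^esub> Poly_Mapping.lookup c x) (Poly_Mapping.keys c)"
proof -
  interpret G: comm_group G by (rule G)
  let ?h = "\<lambda>c. finprod G (\<lambda>x. \<phi> x [^]\<^bsub>G\<^esub> Poly_Mapping.lookup c x) (Poly_Mapping.keys c)"
  have h: "?h \<in> hom F G" by (rule G.frag_eval_hom[OF balanced_closed])
  interpret h: group_hom F G ?h
    by (simp add: group_hom_def group_hom_axioms_def h)
  have of: "?h (frag_of x) = \<phi> x" if "x \<in> tensor_gens Ob M N p q" for x
    using that balanced_closed by (intro G.frag_eval_of) auto
  have fin: "frag_of x \<in> carrier F" if "x \<in> tensor_gens Ob M N p q" for x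
    using that by simp
  have dif: "?h (c - d) = ?h c \<otimes>\<^bsub>G\<^esub> inv\<^bsub>G\<^esub> ?h d" if "c \<in> carrier F" "d \<in> carrier F" for c d
  proof -
    have i: "inv\<^bsub>F\<^esub> d \<in> carrier F" by (rule group.inv_closed[OF group_free_Abelian_group that(2)])
    have e: "c \<otimes>\<^bsub>F\<^esub> inv\<^bsub>F\<^esub> d = c - d" using that by simp
    have "?h (c \<otimes>\<^bsub>F\<^esub> inv\<^bsub>F\<^esub> d) = ?h c \<otimes>\<^bsub>G\<^esub> inv\<^bsub>G\<^esub> ?h d"
      unfolding h.hom_mult[OF that(1) i] h.hom_inv[OF that(2)] by (rule refl)
    then show ?thesis unfolding e .
  qed
  have difc: "c - d \<in> carrier F" if "c \<in> carrier F" "d \<in> carrier F" for c d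
    using that keys_diff[of c d] by auto
  note mM = bimod_mult_closed[OF M _ q] and mN = bimod_mult_closed[OF N p]
  have can: "(a \<otimes>\<^bsub>G\<^esub> b) \<otimes>\<^bsub>G\<^esub> inv\<^bsub>G\<^esub> a \<otimes>\<^bsub>G\<^esub> inv\<^bsub>G\<^esub> b = \<one>\<^bsub>G\<^esub>" if "a \<in> carrier G" "b \<in> carrier G" for a b
    using that G.m_comm[of a b] by (simp add: G.m_assoc)
  have of3: "?h (frag_of x - frag_of y - frag_of z) = \<phi> x \<otimes>\<^bsub>G\<^esub> inv\<^bsub>G\<^esub> \<phi> y \<otimes>\<^bsub>G\<^esub> inv\<^bsub>G\<^esub> \<phi> z"
    if "x \<in> tensor_gens Ob M N p q" "y \<in> tensor_gens Ob M N p q" "z \<in> tensor_gens Ob M N p q" for x y z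
    using dif[OF difc[OF fin[OF that(1)] fin[OF that(2)]] fin[OF that(3)]]
      dif[OF fin[OF that(1)] fin[OF that(2)]] of that by presburger
  have of2: "?h (frag_of x - frag_of y) = \<phi> x \<otimes>\<^bsub>G\<^esub> inv\<^bsub>G\<^esub> \<phi> y"
    if "x \<in> tensor_gens Ob M N p q" "y \<in> tensor_gens Ob M N p q" for x y
    using dif[OF fin[OF that(1)] fin[OF that(2)]] of that by presburger
  have cG: "\<phi> x \<in> carrier G" if "x \<in> tensor_gens Ob M N p q" for x
    using balanced_closed that by auto
  have rel: "?h r = \<one>\<^bsub>G\<^esub>" if "r \<in> tensor_rels Ob A M N p q" for r
    using that unfolding tensor_rels_def
  proof (elim UnE CollectE exE conjE)
    fix s m m' n assume r: "r = frag_of (s, m \<otimes>\<^bsub>grp M s q\<^esub> m', n) - frag_of (s, m, n) - frag_of (s, m', n)"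
      and *: "s \<in> Ob" "m \<in> carrier (grp M s q)" "m' \<in> carrier (grp M s q)" "n \<in> carrier (grp N p s)"
    have g: "(s, m \<otimes>\<^bsub>grp M s q\<^esub> m', n) \<in> tensor_gens Ob M N p q" "(s, m, n) \<in> tensor_gens Ob M N p q"
       "(s, m', n) \<in> tensor_gens Ob M N p q"
      using * mM by (auto simp: gen_iff)
    have "\<phi> (s, m \<otimes>\<^bsub>grp M s q\<^esub> m', n) = \<phi> (s, m, n) \<otimes>\<^bsub>G\<^esub> \<phi> (s, m', n)"
      using hom_mult[OF balancedD(2)[OF \<phi> *(1,4)] *(2,3)] .
    then show ?thesis unfolding r using of3[OF g] can[OF cG[OF g(2)] cG[OF g(3)]] by simp
  next
    fix s m n n' assume r: "r = frag_of (s, m, n \<otimes>\<^bsub>grp N p s\<^esub> n') - frag_of (s, m, n) - frag_of (s, m, n')"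
      and *: "s \<in> Ob" "m \<in> carrier (grp M s q)" "n \<in> carrier (grp N p s)" "n' \<in> carrier (grp N p s)"
    have g: "(s, m, n \<otimes>\<^bsub>grp N p s\<^esub> n') \<in> tensor_gens Ob M N p q" "(s, m, n) \<in> tensor_gens Ob M N p q"
       "(s, m, n') \<in> tensor_gens Ob M N p q"
      using * mN by (auto simp: gen_iff)
    have "\<phi> (s, m, n \<otimes>\<^bsub>grp N p s\<^esub> n') = \<phi> (s, m, n) \<otimes>\<^bsub>G\<^esub> \<phi> (s, m, n')"
      using hom_mult[OF balancedD(1)[OF \<phi> *(1,2)] *(3,4)] .
    then show ?thesis unfolding r using of3[OF g] can[OF cG[OF g(2)] cG[OF g(3)]] by simp
  next
    fix s m a n assume r: "r = frag_of (s, ract M s q m a, n) - frag_of (s, m, lact N p s a n)"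
      and *: "s \<in> Ob" "m \<in> carrier (grp M s q)" "a \<in> A s" "n \<in> carrier (grp N p s)"
    have g: "(s, ract M s q m a, n) \<in> tensor_gens Ob M N p q" "(s, m, lact N p s a n) \<in> tensor_gens Ob M N p q"
      using * bimod_closed(2)[OF M _ q] bimod_closed(1)[OF N p] by (auto simp: gen_iff)
    have "\<phi> (s, ract M s q m a, n) = \<phi> (s, m, lact N p s a n)"
      using balancedD(3)[OF \<phi> *] .
    then show ?thesis unfolding r using of2[OF g] G.r_inv[OF cG[OF g(2)]] by simp
  qed
  have "K \<subseteq> kernel F G ?h"
    unfolding tensor_ker_def
    by (rule group.generate_subgroup_incl[OF group_free_Abelian_group _ h.subgroup_kernel])
      (use rel rels_closed in \<open>unfold kernel_def, blast\<close>)
  then have ker: "k \<in> carrier F \<and> ?h k = \<one>\<^bsub>G\<^esub>" if "k \<in> K" for k using that by (auto simp: kernel_def)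
  have "?h ` (cls c) = {?h c}"
  proof -
    have "?h x = ?h c" if x: "x \<in> cls c" for x
    proof -
      obtain k where "k \<in> K" "x = k \<otimes>\<^bsub>F\<^esub> c" using x by (auto simp: tensor_class_def r_coset_def)
      then show ?thesis using ker[of k] c h.hom_mult[of k c] h.hom_closed[OF c] G.l_one by metis
    qed
    moreover have "c \<in> cls c"
      unfolding tensor_class_def
      by (rule group.rcos_self[OF group_free_Abelian_group c normal_imp_subgroup[OF normal_ker]])
    ultimately show ?thesis by blast
  qed
  then show ?thesis by (simp add: tensor_lift_def)
qed

lemma lift_hom: "tensor_lift G \<phi> \<in> hom T G"
proof -
  interpret G: comm_group G by (rule G)
  let ?h = "\<lambda>c. finprod G (\<lambda>x. \<phi> x [^]\<^bsub>G\<^esub> Poly_Mapping.lookup c x) (Poly_Mapping.keys c)"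
  have h: "?h \<in> hom F G" by (rule G.frag_eval_hom[OF balanced_closed])
  show ?thesis
  proof (rule homI)
    fix x assume "x \<in> carrier T"
    then obtain c where "c \<in> carrier F" "x = cls c" using class_surj by blast
    then show "tensor_lift G \<phi> x \<in> carrier G" using lift_class hom_in_carrier[OF h] by simp
  next
    fix x y assume "x \<in> carrier T" "y \<in> carrier T"
    then obtain c d where c: "c \<in> carrier F" "x = cls c" and d: "d \<in> carrier F" "y = cls d"
      using class_surj by metis
    have cd: "c \<otimes>\<^bsub>F\<^esub> d \<in> carrier F"
      using c d by (meson group.is_monoid group_free_Abelian_group monoid.m_closed)
    have "x \<otimes>\<^bsub>T\<^esub> y = cls (c \<otimes>\<^bsub>F\<^esub> d)" using c d hom_mult[OF class_hom] by simp
    then have "tensor_lift G \<phi> (x \<otimes>\<^bsub>T\<^esub> y) = ?h (c \<otimes>\<^bsub>F\<^esub> d)" using lift_class[OF cd] by simp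
    also have "\<dots> = ?h c \<otimes>\<^bsub>G\<^esub> ?h d" using hom_mult[OF h c(1) d(1)] .
    finally show "tensor_lift G \<phi> (x \<otimes>\<^bsub>T\<^esub> y) = tensor_lift G \<phi> x \<otimes>\<^bsub>G\<^esub> tensor_lift G \<phi> y"
      using c d by (simp add: lift_class)
  qed
qed

lemma lift_pure:
  assumes "s \<in> Ob" "m \<in> carrier (grp M s q)" "n \<in> carrier (grp N p s)"
  shows "tensor_lift G \<phi> (pure s m n) = \<phi> (s, m, n)"
proof -
  interpret G: comm_group G by (rule G)
  have "(s, m, n) \<in> tensor_gens Ob M N p q" using assms by (simp add: gen_iff)
  then show ?thesis
    unfolding pure_tensor_def using balanced_closed by (subst lift_class) (auto simp: Pi_iff)
qed

end

text \<open>Pure tensors generate. \<open>frag_induction\<close> builds formal sums by differences,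
  so it is enough that h and h' respect products and inverses. Almost every identity between maps
  out of a tensor product is verified through this rule.\<close>

lemma hom_class_eq:
  assumes "group G" "h \<in> hom T G" "h' \<in> hom T G"
    and eq: "\<And>s m n. s \<in> Ob \<Longrightarrow> m \<in> carrier (grp M s q) \<Longrightarrow> n \<in> carrier (grp N p s) \<Longrightarrow>
      h (pure s m n) = h' (pure s m n)"
    and x: "x \<in> carrier T"
  shows "h x = h' x"
proof -
  interpret G: group G by fact
  obtain c where c: "Poly_Mapping.keys c \<subseteq> tensor_gens Ob M N p q" "x = cls c" using class_surj[OF x] by auto
  have dif: "g (cls (a - b)) = g (cls a) \<otimes>\<^bsub>G\<^esub> inv\<^bsub>G\<^esub> g (cls b)"
    if g: "g \<in> hom T G" and a: "Poly_Mapping.keys a \<subseteq> tensor_gens Ob M N p q"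
      and b: "Poly_Mapping.keys b \<subseteq> tensor_gens Ob M N p q" for g a b
  proof -
    have k: "(\<lambda>c. g (cls c)) \<in> hom F G" using hom_compose[OF class_hom g] by (simp add: o_def)
    interpret k: group_hom F G "\<lambda>c. g (cls c)" by (simp add: group_hom_def group_hom_axioms_def k assms(1))
    have "a - b = a \<otimes>\<^bsub>F\<^esub> inv\<^bsub>F\<^esub> b" using b by simp
    then show ?thesis using a b k.hom_mult[of a "inv\<^bsub>F\<^esub> b"] k.hom_inv[of b] by simp
  qed
  define Pr where "Pr = (\<lambda>c. Poly_Mapping.keys c \<subseteq> tensor_gens Ob M N p q \<and> h (cls c) = h' (cls c))"
  have "Pr c"
    using c(1)
  proof (induction c rule: frag_induction)
    case zero
    then show ?case using assms(1-3) group_tensor by (simp add: Pr_def class_zero hom_one)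
  next
    case (one y)
    then show ?case using eq by (auto simp: Pr_def tensor_gens_def pure_tensor_def)
  next
    case (diff a b)
    then show ?case
      using dif[OF assms(2), of a b] dif[OF assms(3), of a b] keys_diff[of a b] by (auto simp: Pr_def)
  qed
  then show ?thesis using c(2) by (simp add: Pr_def)
qed

text \<open>Negative multiples are absorbed into the first factor.\<close>

lemma tensor_sum_pures:
  assumes x: "x \<in> carrier T"
  shows "\<exists>xs. (\<forall>(s, m, n)\<in>set xs. s \<in> Ob \<and> m \<in> carrier (grp M s q) \<and> n \<in> carrier (grp N p s)) \<and>
    x = foldr (\<lambda>(s, m, n) y. pure s m n \<otimes>\<^bsub>T\<^esub> y) xs \<one>\<^bsub>T\<^esub>"
proof -
  interpret T: comm_group T by (rule comm_group_tensor)
  define ok where "ok = (\<lambda>xs. \<forall>(s, m, n)\<in>set xs. s \<in> Ob \<and> m \<in> carrier (grp M s q) \<and> n \<in> carrier (grp N p s))"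
  define val where "val = (\<lambda>xs. foldr (\<lambda>(s, m, n) y. pure s m n \<otimes>\<^bsub>T\<^esub> y) xs \<one>\<^bsub>T\<^esub>)"
  have val: "val xs \<in> carrier T" if "ok xs" for xs
    using that by (induction xs) (auto simp: val_def ok_def intro!: T.m_closed pure_closed)
  have app: "ok xs \<Longrightarrow> ok ys \<Longrightarrow> val (xs @ ys) = val xs \<otimes>\<^bsub>T\<^esub> val ys" for xs ys
  proof (induction xs)
    case Nil
    then show ?case using val[of ys] by (simp add: val_def)
  next
    case (Cons z xs)
    obtain s m n where z: "z = (s, m, n)" by (cases z)
    have o: "ok xs" using Cons.prems(1) by (auto simp: ok_def)
    have pz: "pure s m n \<in> carrier T" using Cons.prems(1) by (auto simp: ok_def z intro: pure_closed)
    have "val (z # xs @ ys) = pure s m n \<otimes>\<^bsub>T\<^esub> val (xs @ ys)" by (simp add: val_def z)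
    also have "\<dots> = pure s m n \<otimes>\<^bsub>T\<^esub> (val xs \<otimes>\<^bsub>T\<^esub> val ys)" using Cons.IH[OF o Cons.prems(2)] by simp
    also have "\<dots> = val (z # xs) \<otimes>\<^bsub>T\<^esub> val ys"
      using T.m_assoc[OF pz val[OF o] val[OF Cons.prems(2)]] by (simp add: val_def z)
    finally show ?case by simp
  qed
  define neg where "neg = map (\<lambda>(s, m, n :: 'n). (s, inv\<^bsub>grp M s q\<^esub> m, n))"
  have neg: "ok xs \<Longrightarrow> ok (neg xs) \<and> val (neg xs) = inv\<^bsub>T\<^esub> (val xs)" for xs
  proof (induction xs)
    case (Cons z xs)
    obtain s m n where z: "z = (s, m, n)" by (cases z)
    have *: "s \<in> Ob" "m \<in> carrier (grp M s q)" "n \<in> carrier (grp N p s)" and o: "ok xs"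
      using Cons.prems by (auto simp: ok_def z)
    note g = bimodD(1)[OF M *(1) q, THEN comm_group_group]
    have i: "inv\<^bsub>grp M s q\<^esub> m \<in> carrier (grp M s q)" using g *(2) by (simp add: group.inv_closed)
    interpret gh: group_hom "grp M s q" T "\<lambda>m. pure s m n"
      using balancedD(2)[OF pure_balanced *(1,3)] g group_tensor by (simp add: group_hom_def group_hom_axioms_def)
    have "val (neg (z # xs)) = inv\<^bsub>T\<^esub> (pure s m n) \<otimes>\<^bsub>T\<^esub> inv\<^bsub>T\<^esub> (val xs)"
      using gh.hom_inv[OF *(2)] Cons.IH[OF o] by (simp add: val_def neg_def z)
    also have "\<dots> = inv\<^bsub>T\<^esub> (val (z # xs))"
      using T.inv_mult[OF pure_closed[OF *] val[OF o]] by (simp add: val_def z)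
    finally show ?case using Cons.IH[OF o] * i by (auto simp: ok_def neg_def z)
  qed (simp add: val_def neg_def ok_def)
  obtain c where c: "Poly_Mapping.keys c \<subseteq> tensor_gens Ob M N p q" "x = cls c" using class_surj[OF x] by auto
  define Pr where "Pr = (\<lambda>c. Poly_Mapping.keys c \<subseteq> tensor_gens Ob M N p q \<and> (\<exists>xs. ok xs \<and> cls c = val xs))"
  have "Pr c"
    using c(1)
  proof (induction c rule: frag_induction)
    case zero
    have "ok []" "cls 0 = val []" by (simp_all add: ok_def val_def class_zero)
    then show ?case unfolding Pr_def by auto
  next
    case (one y)
    have "ok [y]" "cls (frag_of y) = val [y]"
      using one pure_closed by (auto simp: ok_def val_def tensor_gens_def pure_tensor_def)
    then show ?case unfolding Pr_def using one by auto
  next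
    case (diff a b)
    then obtain xs ys where xy: "ok xs" "cls a = val xs" "ok ys" "cls b = val ys"
      and ab: "a \<in> carrier F" "b \<in> carrier F" by (auto simp: Pr_def)
    interpret k: group_hom F T cls by (simp add: group_hom_def group_hom_axioms_def class_hom group_tensor)
    have "cls (a - b) = cls a \<otimes>\<^bsub>T\<^esub> inv\<^bsub>T\<^esub> (cls b)"
      using ab k.hom_mult[of a "inv\<^bsub>F\<^esub> b"] k.hom_inv[of b] by simp
    also have "\<dots> = val (xs @ neg ys)" using app neg xy by metis
    finally have "cls (a - b) = val (xs @ neg ys)" .
    moreover have "ok (xs @ neg ys)" using neg[OF xy(3)] xy(1) by (auto simp: ok_def)
    ultimately show ?case unfolding Pr_def using keys_diff[of a b] ab by (auto intro!: exI[of _ "xs @ neg ys"])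
  qed
  then show ?thesis using c(2) unfolding Pr_def ok_def val_def by auto
qed

end

lemma grp_tensor: "grp (tensor Ob A M N) = tensor_grp Ob A M N"
  by (simp add: tensor_def)

lemma tensor_pairI: "bimod Ob A M \<Longrightarrow> bimod Ob A N \<Longrightarrow> p \<in> Ob \<Longrightarrow> q \<in> Ob \<Longrightarrow> tensor_pair Ob A M N p q"
  by (simp add: tensor_pair_def)

lemma balancedI:
  assumes "\<And>s m n. s \<in> Ob \<Longrightarrow> m \<in> carrier (grp M s q) \<Longrightarrow> n \<in> carrier (grp N p s) \<Longrightarrow> f s m n \<in> carrier G"
    and "\<And>s m n n'. s \<in> Ob \<Longrightarrow> m \<in> carrier (grp M s q) \<Longrightarrow> n \<in> carrier (grp N p s) \<Longrightarrow>
      n' \<in> carrier (grp N p s) \<Longrightarrow> f s m (n \<otimes>\<^bsub>grp N p s\<^esub> n') = f s m n \<otimes>\<^bsub>G\<^esub> f s m n'"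
    and "\<And>s m m' n. s \<in> Ob \<Longrightarrow> m \<in> carrier (grp M s q) \<Longrightarrow> m' \<in> carrier (grp M s q) \<Longrightarrow>
      n \<in> carrier (grp N p s) \<Longrightarrow> f s (m \<otimes>\<^bsub>grp M s q\<^esub> m') n = f s m n \<otimes>\<^bsub>G\<^esub> f s m' n"
    and "\<And>s m a n. s \<in> Ob \<Longrightarrow> m \<in> carrier (grp M s q) \<Longrightarrow> a \<in> A s \<Longrightarrow> n \<in> carrier (grp N p s) \<Longrightarrow>
      f s (ract M s q m a) n = f s m (lact N p s a n)"
  shows "balanced Ob A M N p q G (\<lambda>(s, m, n). f s m n)"
  using assms unfolding balanced_def by (auto intro!: homI)

lemma hom_id: "id \<in> hom G G"
  by (auto intro: homI)

lemma hom_comp: "f \<in> hom G H \<Longrightarrow> g \<in> hom H I \<Longrightarrow> (\<lambda>x. g (f x)) \<in> hom G I"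
  using hom_compose[of f G H g I] by (simp add: o_def)

section \<open>Induced maps and the bimodule structure of a tensor product\<close>

context tensor_pair
begin

lemma pure_hom_right: "s \<in> Ob \<Longrightarrow> m \<in> carrier (grp M s q) \<Longrightarrow> pure s m \<in> hom (grp N p s) T"
  using balancedD(1)[OF pure_balanced, of s m] by simp

lemma pure_hom_left: "s \<in> Ob \<Longrightarrow> n \<in> carrier (grp N p s) \<Longrightarrow> (\<lambda>m. pure s m n) \<in> hom (grp M s q) T"
  using balancedD(2)[OF pure_balanced, of s n] by simp

lemma pure_ract_lact: "s \<in> Ob \<Longrightarrow> m \<in> carrier (grp M s q) \<Longrightarrow> a \<in> A s \<Longrightarrow> n \<in> carrier (grp N p s) \<Longrightarrow>
    pure s (ract M s q m a) n = pure s m (lact N p s a n)"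
  using balancedD(3)[OF pure_balanced, of s m a n] by simp

text \<open>Covers \<open>tensor_map\<close> and, with one factor the identity, the two actions on a
  tensor product. Balancing involves the actions at the contracted object s, so source and target
  may change.\<close>

lemma balanced_mapI:
  assumes f: "\<And>s. s \<in> Ob \<Longrightarrow> f s \<in> hom (grp M s q) (grp M' s q')"
    and g: "\<And>s. s \<in> Ob \<Longrightarrow> g s \<in> hom (grp N p s) (grp N' p' s)"
    and fr: "\<And>s m a. s \<in> Ob \<Longrightarrow> m \<in> carrier (grp M s q) \<Longrightarrow> a \<in> A s \<Longrightarrow> f s (ract M s q m a) = ract M' s q' (f s m) a"
    and gl: "\<And>s n a. s \<in> Ob \<Longrightarrow> n \<in> carrier (grp N p s) \<Longrightarrow> a \<in> A s \<Longrightarrow> g s (lact N p s a n) = lact N' p' s a (g s n)"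
    and tp: "tensor_pair Ob A M' N' p' q'"
  shows "balanced Ob A M N p q (tensor_grp Ob A M' N' p' q')
    (\<lambda>(s, m, n). pure_tensor Ob A M' N' p' q' s (f s m) (g s n))"
proof -
  interpret T': tensor_pair Ob A M' N' p' q' by (rule tp)
  note fc = hom_in_carrier[OF f] and gc = hom_in_carrier[OF g]
  show ?thesis
  proof (rule balancedI, goal_cases)
    case (1 s m n)
    then show ?case using fc gc by (intro T'.pure_closed) auto
  next
    case (2 s m n n')
    then show ?case using hom_mult[OF T'.pure_hom_right[OF 2(1) fc[OF 2(1,2)]] gc[OF 2(1,3)] gc[OF 2(1,4)]]
      hom_mult[OF g[OF 2(1)] 2(3,4)] by simp
  next
    case (3 s m m' n)
    then show ?case using hom_mult[OF T'.pure_hom_left[OF 3(1) gc[OF 3(1,4)]] fc[OF 3(1,2)] fc[OF 3(1,3)]]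
      hom_mult[OF f[OF 3(1)] 3(2,3)] by simp
  next
    case (4 s m a n)
    then show ?case using T'.pure_ract_lact[OF 4(1) fc[OF 4(1,2)] 4(3) gc[OF 4(1,4)]] fr gl by simp
  qed
qed

end

context
  fixes Ob :: "'o set" and A :: "'o \<Rightarrow> 'a set" and M :: "('o, 'a, 'm) bimodule"
    and N :: "('o, 'a, 'n) bimodule"
  assumes M: "bimod Ob A M" and N: "bimod Ob A N"
begin

text \<open>Acting on the outer side of one factor respects balancing because the two actions on
  that factor commute (\<open>bimodD(4)\<close>).\<close>

lemma lact_tensor:
  assumes pq: "p \<in> Ob" "q \<in> Ob" and a: "a \<in> A q"
  shows "lact (tensor Ob A M N) p q a \<in> hom (tensor_grp Ob A M N p q) (tensor_grp Ob A M N p q)"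
    and "s \<in> Ob \<Longrightarrow> m \<in> carrier (grp M s q) \<Longrightarrow> n \<in> carrier (grp N p s) \<Longrightarrow>
      lact (tensor Ob A M N) p q a (pure_tensor Ob A M N p q s m n) = pure_tensor Ob A M N p q s (lact M s q a m) n"
proof -
  interpret tensor_pair Ob A M N p q by (rule tensor_pairI[OF M N pq])
  have b: "balanced Ob A M N p q T (\<lambda>(s, m, n). pure s (lact M s q a m) (id n))"
    by (rule balanced_mapI[OF _ hom_id _ _ tensor_pairI[OF M N pq]])
      (use bimodD(2,4)[OF M _ pq(2)] a in simp_all)
  show "lact (tensor Ob A M N) p q a \<in> hom T T"
    using lift_hom[OF comm_group_tensor b] by (simp add: tensor_def)
  show "lact (tensor Ob A M N) p q a (pure s m n) = pure s (lact M s q a m) n"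
    if "s \<in> Ob" "m \<in> carrier (grp M s q)" "n \<in> carrier (grp N p s)"
    using lift_pure[OF comm_group_tensor b that] by (simp add: tensor_def)
qed

lemma ract_tensor:
  assumes pq: "p \<in> Ob" "q \<in> Ob" and a: "a \<in> A p"
  shows "(\<lambda>x. ract (tensor Ob A M N) p q x a) \<in> hom (tensor_grp Ob A M N p q) (tensor_grp Ob A M N p q)"
    and "s \<in> Ob \<Longrightarrow> m \<in> carrier (grp M s q) \<Longrightarrow> n \<in> carrier (grp N p s) \<Longrightarrow>
      ract (tensor Ob A M N) p q (pure_tensor Ob A M N p q s m n) a = pure_tensor Ob A M N p q s m (ract N p s n a)"
proof -
  interpret tensor_pair Ob A M N p q by (rule tensor_pairI[OF M N pq])
  have b: "balanced Ob A M N p q T (\<lambda>(s, m, n). pure s (id m) (ract N p s n a))"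
    by (rule balanced_mapI[OF hom_id _ _ _ tensor_pairI[OF M N pq]])
      (use bimodD(3)[OF N pq(1)] bimodD(4)[OF N pq(1), symmetric] a in simp_all)
  show "(\<lambda>x. ract (tensor Ob A M N) p q x a) \<in> hom T T"
    using lift_hom[OF comm_group_tensor b] by (simp add: tensor_def)
  show "ract (tensor Ob A M N) p q (pure s m n) a = pure s m (ract N p s n a)"
    if "s \<in> Ob" "m \<in> carrier (grp M s q)" "n \<in> carrier (grp N p s)"
    using lift_pure[OF comm_group_tensor b that] by (simp add: tensor_def)
qed

lemma bimod_tensor: "bimod Ob A (tensor Ob A M N)"
  unfolding bimod_def grp_tensor
proof (intro ballI conjI)
  fix p q assume pq: "p \<in> Ob" "q \<in> Ob"
  interpret tensor_pair Ob A M N p q by (rule tensor_pairI[OF M N pq])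
  show "comm_group T" by (rule comm_group_tensor)
  show "lact (tensor Ob A M N) p q a \<in> hom T T" if "a \<in> A q" for a using lact_tensor(1)[OF pq that] .
  show "(\<lambda>x. ract (tensor Ob A M N) p q x a) \<in> hom T T" if "a \<in> A p" for a using ract_tensor(1)[OF pq that] .
  show "lact (tensor Ob A M N) p q a (ract (tensor Ob A M N) p q x c) =
      ract (tensor Ob A M N) p q (lact (tensor Ob A M N) p q a x) c"
    if a: "a \<in> A q" and c: "c \<in> A p" and x: "x \<in> carrier T" for a c x
  proof (rule hom_class_eq[OF group_tensor hom_comp[OF ract_tensor(1)[OF pq c] lact_tensor(1)[OF pq a]]
        hom_comp[OF lact_tensor(1)[OF pq a] ract_tensor(1)[OF pq c]] _ x])
    fix s m n assume *: "s \<in> Ob" "m \<in> carrier (grp M s q)" "n \<in> carrier (grp N p s)"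
    show "lact (tensor Ob A M N) p q a (ract (tensor Ob A M N) p q (pure s m n) c) =
      ract (tensor Ob A M N) p q (lact (tensor Ob A M N) p q a (pure s m n)) c"
      using * a c pq bimod_closed(1)[OF M *(1) pq(2) *(2) a] bimod_closed(2)[OF N pq(1) *(1,3) c]
      by (simp add: lact_tensor(2) ract_tensor(2))
  qed
qed

end

lemma bimodule_mapD:
  assumes "bimodule_map Ob A M M' f" "p \<in> Ob" "q \<in> Ob"
  shows "f p q \<in> hom (grp M p q) (grp M' p q)"
    and "x \<in> carrier (grp M p q) \<Longrightarrow> a \<in> A q \<Longrightarrow> f p q (lact M p q a x) = lact M' p q a (f p q x)"
    and "x \<in> carrier (grp M p q) \<Longrightarrow> a \<in> A p \<Longrightarrow> f p q (ract M p q x a) = ract M' p q (f p q x) a"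
  using assms unfolding bimodule_map_def by blast+

lemma tensor_map_props:
  assumes bm: "bimod Ob A M" "bimod Ob A N" "bimod Ob A M'" "bimod Ob A N'" and pq: "p \<in> Ob" "q \<in> Ob"
    and f: "bimodule_map Ob A M M' f" and g: "bimodule_map Ob A N N' g"
  shows "tensor_map Ob A M' N' f g p q \<in> hom (tensor_grp Ob A M N p q) (tensor_grp Ob A M' N' p q)"
    and "s \<in> Ob \<Longrightarrow> m \<in> carrier (grp M s q) \<Longrightarrow> n \<in> carrier (grp N p s) \<Longrightarrow>
      tensor_map Ob A M' N' f g p q (pure_tensor Ob A M N p q s m n)
      = pure_tensor Ob A M' N' p q s (f s q m) (g p s n)"
proof -
  interpret tensor_pair Ob A M N p q by (rule tensor_pairI[OF bm(1,2) pq])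
  interpret T': tensor_pair Ob A M' N' p q by (rule tensor_pairI[OF bm(3,4) pq])
  have b: "balanced Ob A M N p q (tensor_grp Ob A M' N' p q)
     (\<lambda>(s, m, n). pure_tensor Ob A M' N' p q s (f s q m) (g p s n))"
    by (rule balanced_mapI[OF _ _ _ _ tensor_pairI[OF bm(3,4) pq]])
      (use bimodule_mapD[OF f _ pq(2)] bimodule_mapD[OF g pq(1)] in simp_all)
  show "tensor_map Ob A M' N' f g p q \<in> hom (tensor_grp Ob A M N p q) (tensor_grp Ob A M' N' p q)"
    unfolding tensor_map_def by (rule lift_hom[OF T'.comm_group_tensor b])
  show "tensor_map Ob A M' N' f g p q (pure_tensor Ob A M N p q s m n)
      = pure_tensor Ob A M' N' p q s (f s q m) (g p s n)"
    if "s \<in> Ob" "m \<in> carrier (grp M s q)" "n \<in> carrier (grp N p s)"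
    unfolding tensor_map_def lift_pure[OF T'.comm_group_tensor b that] by simp
qed

text \<open>With it, additivity in a parameter becomes an equality of two homomorphisms into an
  abelian group, which \<open>hom_class_eq\<close> reduces to pure tensors.\<close>

lemma hom_mult_fun:
  assumes G: "comm_group H" and f: "f \<in> hom G H" and g: "g \<in> hom G H"
  shows "(\<lambda>x. f x \<otimes>\<^bsub>H\<^esub> g x) \<in> hom G H"
proof -
  interpret comm_group H by (rule G)
  show ?thesis
    using hom_in_carrier[OF f] hom_in_carrier[OF g]
    by (auto intro!: homI simp: hom_mult[OF f] hom_mult[OF g] m_ac)
qed

section \<open>Associativity of the tensor product\<close>

context
  fixes Ob :: "'o set" and A :: "'o \<Rightarrow> 'a set" and L :: "('o, 'a, 'l) bimodule"
    and M :: "('o, 'a, 'm) bimodule" and N :: "('o, 'a, 'n) bimodule" and p q :: 'o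
  assumes L: "bimod Ob A L" and M: "bimod Ob A M" and N: "bimod Ob A N" and pq: "p \<in> Ob" "q \<in> Ob"
begin

interpretation R: tensor_pair Ob A L "tensor Ob A M N" p q
  by (rule tensor_pairI[OF L bimod_tensor[OF M N] pq])

lemma assoc_inner:
  assumes s: "s \<in> Ob" and n: "n \<in> carrier (grp N p s)"
  shows "balanced Ob A L M s q R.T (\<lambda>(t, l, m). R.pure t l (pure_tensor Ob A M N p t s m n))" (is "balanced _ _ _ _ _ _ _ ?f")
proof -
  have tp: "tensor_pair Ob A M N p t" if "t \<in> Ob" for t using tensor_pairI[OF M N pq(1) that] .
  show ?thesis
  proof (rule balancedI, goal_cases)
    case (1 t l m)
    then show ?case using tensor_pair.pure_closed[OF tp, of t s m n] s n
      by (intro R.pure_closed) (auto simp: grp_tensor)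
  next
    case (2 t l m m')
    interpret tensor_pair Ob A M N p t using tp[OF 2(1)] .
    have "pure s (m \<otimes>\<^bsub>grp M s t\<^esub> m') n = pure s m n \<otimes>\<^bsub>T\<^esub> pure s m' n"
      using hom_mult[OF pure_hom_left[OF s n] 2(3,4)] .
    then show ?case
      using hom_mult[OF R.pure_hom_right[OF 2(1,2)], of "pure s m n" "pure s m' n"] pure_closed s n 2
      by (simp add: grp_tensor)
  next
    case (3 t l l' m)
    interpret tensor_pair Ob A M N p t using tp[OF 3(1)] .
    show ?case
      using hom_mult[OF R.pure_hom_left[OF 3(1)], of "pure s m n" l l'] pure_closed s n 3
      by (simp add: grp_tensor)
  next
    case (4 t l a m)
    interpret tensor_pair Ob A M N p t using tp[OF 4(1)] .
    show ?case
      using R.pure_ract_lact[OF 4(1,2,3), of "pure s m n"] pure_closed s n 4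
      by (simp add: grp_tensor lact_tensor[OF M N pq(1)])
  qed
qed

text \<open>The associator is a lift whose values are themselves lifts. Balancing compares
  homomorphisms on L \<otimes> M that depend on the parameter n, and these are known on pure tensors
  by \<open>hp\<close>.\<close>

lemma tensor_assoc_outer:
  "balanced Ob A (tensor Ob A L M) N p q R.T
    (\<lambda>(s, x, n). tensor_lift R.T (\<lambda>(t, l, m). R.pure t l (pure_tensor Ob A M N p t s m n)) x)"
proof -
  have tpL: "tensor_pair Ob A L M s q" if "s \<in> Ob" for s using tensor_pairI[OF L M that pq(2)] .
  have tp: "tensor_pair Ob A M N p t" if "t \<in> Ob" for t using tensor_pairI[OF M N pq(1) that] .
  let ?h = "\<lambda>s n. tensor_lift R.T (\<lambda>(t, l, m). R.pure t l (pure_tensor Ob A M N p t s m n))"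
  have h: "?h s n \<in> hom (tensor_grp Ob A L M s q) R.T" if "s \<in> Ob" "n \<in> carrier (grp N p s)" for s n
    using tensor_pair.lift_hom[OF tpL[OF that(1)] R.comm_group_tensor assoc_inner[OF that]] .
  have hp: "?h s n (pure_tensor Ob A L M s q t l m) = R.pure t l (pure_tensor Ob A M N p t s m n)"
    if "s \<in> Ob" "n \<in> carrier (grp N p s)" "t \<in> Ob" "l \<in> carrier (grp L t q)" "m \<in> carrier (grp M s t)" for s n t l m
    using tensor_pair.lift_pure[OF tpL[OF that(1)] R.comm_group_tensor assoc_inner[OF that(1,2)] that(3-5)] by simp
  show ?thesis
  proof (rule balancedI, unfold grp_tensor, goal_cases)
    case (1 s x n)
    then show ?case using hom_in_carrier[OF h] by blast
  next
    case (2 s x n n')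
    have nn: "n \<otimes>\<^bsub>grp N p s\<^esub> n' \<in> carrier (grp N p s)" using bimod_mult_closed[OF N pq(1) 2(1,3,4)] .
    show ?case
    proof (rule tensor_pair.hom_class_eq[OF tpL[OF 2(1)] R.group_tensor h[OF 2(1) nn]
           hom_mult_fun[OF R.comm_group_tensor h[OF 2(1,3)] h[OF 2(1,4)]] _ 2(2)])
      fix t l m assume *: "t \<in> Ob" "l \<in> carrier (grp L t q)" "m \<in> carrier (grp M s t)"
      interpret tensor_pair Ob A M N p t using tp[OF *(1)] .
      have c: "pure s m n \<in> carrier T" "pure s m n' \<in> carrier T" using pure_closed 2 * by auto
      have "R.pure t l (pure s m (n \<otimes>\<^bsub>grp N p s\<^esub> n')) = R.pure t l (pure s m n \<otimes>\<^bsub>T\<^esub> pure s m n')"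
        using hom_mult[OF pure_hom_right[OF 2(1) *(3)] 2(3,4)] by simp
      also have "\<dots> = R.pure t l (pure s m n) \<otimes>\<^bsub>R.T\<^esub> R.pure t l (pure s m n')"
        using hom_mult[OF R.pure_hom_right[OF *(1,2)], unfolded grp_tensor, OF c] .
      finally show "?h s (n \<otimes>\<^bsub>grp N p s\<^esub> n') (pure_tensor Ob A L M s q t l m) =
        ?h s n (pure_tensor Ob A L M s q t l m) \<otimes>\<^bsub>R.T\<^esub> ?h s n' (pure_tensor Ob A L M s q t l m)"
        using hp[OF 2(1) nn *] hp[OF 2(1,3) *] hp[OF 2(1,4) *] by simp
    qed
  next
    case (3 s x x' n)
    show ?case using hom_mult[OF h[OF 3(1,4)] 3(2,3)] .
  next
    case (4 s x a n)
    have an: "lact N p s a n \<in> carrier (grp N p s)" using bimod_closed(1)[OF N pq(1) 4(1,4,3)] .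
    show ?case
    proof (rule tensor_pair.hom_class_eq[OF tpL[OF 4(1)] R.group_tensor
          hom_comp[OF ract_tensor(1)[OF L M 4(1) pq(2) 4(3)] h[OF 4(1,4)]] h[OF 4(1) an] _ 4(2)])
      fix t l m assume *: "t \<in> Ob" "l \<in> carrier (grp L t q)" "m \<in> carrier (grp M s t)"
      interpret tensor_pair Ob A M N p t using tp[OF *(1)] .
      have ma: "ract M s t m a \<in> carrier (grp M s t)" using bimod_closed(2)[OF M 4(1) *(1,3) 4(3)] .
      show "?h s n (ract (tensor Ob A L M) s q (pure_tensor Ob A L M s q t l m) a) =
        ?h s (lact N p s a n) (pure_tensor Ob A L M s q t l m)"
        unfolding ract_tensor(2)[OF L M 4(1) pq(2) 4(3) *] hp[OF 4(1,4) *(1,2) ma] hp[OF 4(1) an *]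
          pure_ract_lact[OF 4(1) *(3) 4(3,4)] by simp
    qed
  qed
qed

lemma tensor_assoc_props:
  shows "tensor_assoc Ob A L M N p q \<in> hom (tensor_grp Ob A (tensor Ob A L M) N p q) (tensor_grp Ob A L (tensor Ob A M N) p q)"
    and "s \<in> Ob \<Longrightarrow> n \<in> carrier (grp N p s) \<Longrightarrow> t \<in> Ob \<Longrightarrow> l \<in> carrier (grp L t q) \<Longrightarrow> m \<in> carrier (grp M s t) \<Longrightarrow>
      tensor_assoc Ob A L M N p q (pure_tensor Ob A (tensor Ob A L M) N p q s (pure_tensor Ob A L M s q t l m) n)
      = pure_tensor Ob A L (tensor Ob A M N) p q t l (pure_tensor Ob A M N p t s m n)"
proof -
  interpret S: tensor_pair Ob A "tensor Ob A L M" N p q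
    by (rule tensor_pairI[OF bimod_tensor[OF L M] N pq])
  show "tensor_assoc Ob A L M N p q \<in> hom S.T R.T"
    unfolding tensor_assoc_def by (rule S.lift_hom[OF R.comm_group_tensor tensor_assoc_outer])
  show "tensor_assoc Ob A L M N p q (S.pure s (pure_tensor Ob A L M s q t l m) n)
      = R.pure t l (pure_tensor Ob A M N p t s m n)"
    if "s \<in> Ob" "n \<in> carrier (grp N p s)" "t \<in> Ob" "l \<in> carrier (grp L t q)" "m \<in> carrier (grp M s t)"
  proof -
    note tp = tensor_pairI[OF L M that(1) pq(2)]
    have c: "pure_tensor Ob A L M s q t l m \<in> carrier (grp (tensor Ob A L M) s q)"
      unfolding grp_tensor using tensor_pair.pure_closed[OF tp that(3-5)] .
    show ?thesis
      unfolding tensor_assoc_def S.lift_pure[OF R.comm_group_tensor tensor_assoc_outer that(1) c that(2)]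
      using tensor_pair.lift_pure[OF tp R.comm_group_tensor assoc_inner[OF that(1,2)] that(3-5)] by simp
  qed
qed

end

context
  fixes Ob :: "'o set" and A :: "'o \<Rightarrow> 'a set" and L :: "('o, 'a, 'l) bimodule"
    and M :: "('o, 'a, 'm) bimodule" and N :: "('o, 'a, 'n) bimodule" and p q :: 'o
  assumes L: "bimod Ob A L" and M: "bimod Ob A M" and N: "bimod Ob A N" and pq: "p \<in> Ob" "q \<in> Ob"
begin

interpretation R: tensor_pair Ob A "tensor Ob A L M" N p q
  by (rule tensor_pairI[OF bimod_tensor[OF L M] N pq])

text \<open>Mirror image of \<open>assoc_inner\<close>: the left factor l is the fixed parameter,
  and the inner lift runs over M \<otimes> N.\<close>

lemma assoc_inv_inner:
  assumes t: "t \<in> Ob" and l: "l \<in> carrier (grp L t q)"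
  shows "balanced Ob A M N p t R.T (\<lambda>(s, m, n). R.pure s (pure_tensor Ob A L M s q t l m) n)"
proof -
  have tp: "tensor_pair Ob A L M s q" if "s \<in> Ob" for s using tensor_pairI[OF L M that pq(2)] .
  show ?thesis
  proof (rule balancedI, goal_cases)
    case (1 s m n)
    then show ?case using tensor_pair.pure_closed[OF tp, of s t l m] t l
      by (intro R.pure_closed) (auto simp: grp_tensor)
  next
    case (2 s m n n')
    interpret tensor_pair Ob A L M s q using tp[OF 2(1)] .
    show ?case
      using hom_mult[OF R.pure_hom_right[OF 2(1)], of "pure t l m" n n'] pure_closed t l 2
      by (simp add: grp_tensor)
  next
    case (3 s m m' n)
    interpret tensor_pair Ob A L M s q using tp[OF 3(1)] .
    have "pure t l (m \<otimes>\<^bsub>grp M s t\<^esub> m') = pure t l m \<otimes>\<^bsub>T\<^esub> pure t l m'"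
      using hom_mult[OF pure_hom_right[OF t l] 3(2,3)] .
    then show ?case
      using hom_mult[OF R.pure_hom_left[OF 3(1,4)], of "pure t l m" "pure t l m'"] pure_closed t l 3
      by (simp add: grp_tensor)
  next
    case (4 s m a n)
    note ra = ract_tensor(2)[OF L M 4(1) pq(2) 4(3) t l 4(2)]
    interpret tensor_pair Ob A L M s q using tp[OF 4(1)] .
    show ?case
      using R.pure_ract_lact[OF 4(1) _ 4(3,4), of "pure t l m"] pure_closed t l 4
      by (simp add: grp_tensor ra)
  qed
qed

lemma tensor_assoc_inv_outer:
  "balanced Ob A L (tensor Ob A M N) p q R.T
    (\<lambda>(t, l, x). tensor_lift R.T (\<lambda>(s, m, n). R.pure s (pure_tensor Ob A L M s q t l m) n) x)"
proof -
  have tpL: "tensor_pair Ob A L M s q" if "s \<in> Ob" for s using tensor_pairI[OF L M that pq(2)] .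
  have tp: "tensor_pair Ob A M N p t" if "t \<in> Ob" for t using tensor_pairI[OF M N pq(1) that] .
  let ?h = "\<lambda>t l. tensor_lift R.T (\<lambda>(s, m, n). R.pure s (pure_tensor Ob A L M s q t l m) n)"
  have h: "?h t l \<in> hom (tensor_grp Ob A M N p t) R.T" if "t \<in> Ob" "l \<in> carrier (grp L t q)" for t l
    using tensor_pair.lift_hom[OF tp[OF that(1)] R.comm_group_tensor assoc_inv_inner[OF that]] .
  have hp: "?h t l (pure_tensor Ob A M N p t s m n) = R.pure s (pure_tensor Ob A L M s q t l m) n"
    if "t \<in> Ob" "l \<in> carrier (grp L t q)" "s \<in> Ob" "m \<in> carrier (grp M s t)" "n \<in> carrier (grp N p s)" for s n t l m
    using tensor_pair.lift_pure[OF tp[OF that(1)] R.comm_group_tensor assoc_inv_inner[OF that(1,2)] that(3-5)] by simp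
  show ?thesis
  proof (rule balancedI, unfold grp_tensor, goal_cases)
    case (1 t l x)
    then show ?case using hom_in_carrier[OF h] by blast
  next
    case (2 t l x x')
    show ?case using hom_mult[OF h[OF 2(1,2)] 2(3,4)] .
  next
    case (3 t l l' x)
    have ll: "l \<otimes>\<^bsub>grp L t q\<^esub> l' \<in> carrier (grp L t q)" using bimod_mult_closed[OF L 3(1) pq(2) 3(2,3)] .
    show ?case
    proof (rule tensor_pair.hom_class_eq[OF tp[OF 3(1)] R.group_tensor h[OF 3(1) ll]
           hom_mult_fun[OF R.comm_group_tensor h[OF 3(1,2)] h[OF 3(1,3)]] _ 3(4)])
      fix s m n assume *: "s \<in> Ob" "m \<in> carrier (grp M s t)" "n \<in> carrier (grp N p s)"
      interpret tensor_pair Ob A L M s q using tpL[OF *(1)] .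
      have c: "pure t l m \<in> carrier T" "pure t l' m \<in> carrier T" using pure_closed 3 * by auto
      have "R.pure s (pure t (l \<otimes>\<^bsub>grp L t q\<^esub> l') m) n = R.pure s (pure t l m \<otimes>\<^bsub>T\<^esub> pure t l' m) n"
        using hom_mult[OF pure_hom_left[OF 3(1) *(2)] 3(2,3)] by simp
      also have "\<dots> = R.pure s (pure t l m) n \<otimes>\<^bsub>R.T\<^esub> R.pure s (pure t l' m) n"
        using hom_mult[OF R.pure_hom_left[OF *(1,3)], unfolded grp_tensor, OF c] .
      finally show "?h t (l \<otimes>\<^bsub>grp L t q\<^esub> l') (pure_tensor Ob A M N p t s m n) =
        ?h t l (pure_tensor Ob A M N p t s m n) \<otimes>\<^bsub>R.T\<^esub> ?h t l' (pure_tensor Ob A M N p t s m n)"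
        using hp[OF 3(1) ll *] hp[OF 3(1,2) *] hp[OF 3(1,3) *] by simp
    qed
  next
    case (4 t l a x)
    have la: "ract L t q l a \<in> carrier (grp L t q)" using bimod_closed(2)[OF L 4(1) pq(2) 4(2,3)] .
    show ?case
    proof (rule tensor_pair.hom_class_eq[OF tp[OF 4(1)] R.group_tensor h[OF 4(1) la]
          hom_comp[OF lact_tensor(1)[OF M N pq(1) 4(1,3)] h[OF 4(1,2)]] _ 4(4)])
      fix s m n assume *: "s \<in> Ob" "m \<in> carrier (grp M s t)" "n \<in> carrier (grp N p s)"
      have am: "lact M s t a m \<in> carrier (grp M s t)" using bimod_closed(1)[OF M *(1) 4(1) *(2) 4(3)] .
      note lx = lact_tensor(2)[OF M N pq(1) 4(1,3) *]
      interpret tensor_pair Ob A L M s q using tpL[OF *(1)] .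
      show "?h t (ract L t q l a) (pure_tensor Ob A M N p t s m n) =
        ?h t l (lact (tensor Ob A M N) p t a (pure_tensor Ob A M N p t s m n))"
        unfolding lx hp[OF 4(1,2) *(1) am *(3)] hp[OF 4(1) la *]
          pure_ract_lact[OF 4(1,2,3) *(2)] by simp
    qed
  qed
qed

lemma tensor_assoc_inv_props:
  shows "tensor_assoc_inv Ob A L M N p q \<in> hom (tensor_grp Ob A L (tensor Ob A M N) p q) (tensor_grp Ob A (tensor Ob A L M) N p q)"
    and "s \<in> Ob \<Longrightarrow> n \<in> carrier (grp N p s) \<Longrightarrow> t \<in> Ob \<Longrightarrow> l \<in> carrier (grp L t q) \<Longrightarrow> m \<in> carrier (grp M s t) \<Longrightarrow>
      tensor_assoc_inv Ob A L M N p q (pure_tensor Ob A L (tensor Ob A M N) p q t l (pure_tensor Ob A M N p t s m n))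
      = pure_tensor Ob A (tensor Ob A L M) N p q s (pure_tensor Ob A L M s q t l m) n"
proof -
  interpret S: tensor_pair Ob A L "tensor Ob A M N" p q
    by (rule tensor_pairI[OF L bimod_tensor[OF M N] pq])
  show "tensor_assoc_inv Ob A L M N p q \<in> hom S.T R.T"
    unfolding tensor_assoc_inv_def by (rule S.lift_hom[OF R.comm_group_tensor tensor_assoc_inv_outer])
  show "tensor_assoc_inv Ob A L M N p q (S.pure t l (pure_tensor Ob A M N p t s m n))
      = R.pure s (pure_tensor Ob A L M s q t l m) n"
    if "s \<in> Ob" "n \<in> carrier (grp N p s)" "t \<in> Ob" "l \<in> carrier (grp L t q)" "m \<in> carrier (grp M s t)"
  proof -
    note tp = tensor_pairI[OF M N pq(1) that(3)]
    have c: "pure_tensor Ob A M N p t s m n \<in> carrier (grp (tensor Ob A M N) p t)"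
      unfolding grp_tensor using tensor_pair.pure_closed[OF tp that(1,5,2)] .
    show ?thesis
      unfolding tensor_assoc_inv_def S.lift_pure[OF R.comm_group_tensor tensor_assoc_inv_outer that(3,4) c]
      using tensor_pair.lift_pure[OF tp R.comm_group_tensor assoc_inv_inner[OF that(3,4)] that(1,5,2)] by simp
  qed
qed

end


lemma bimodule_map_id: "bimodule_map Ob A M M (\<lambda>_ _. id)"
  by (simp add: bimodule_map_def hom_id)

section \<open>Zigzag identities\<close>

text \<open>Well-definedness of the unit maps: the functions lifted by \<open>left_unitor\<close>
  and \<open>right_unitor\<close> are balanced, including their neutral values off the
  diagonal.\<close>

definition unital :: "'o set \<Rightarrow> ('o \<Rightarrow> 'a set) \<Rightarrow> ('o, 'a, 'a) bimodule \<Rightarrow> ('o, 'a, 'm) bimodule \<Rightarrow> bool" where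
  "unital Ob A S M \<longleftrightarrow> (\<forall>p\<in>Ob. \<forall>q\<in>Ob.
    balanced Ob A S M p q (grp M p q) (\<lambda>(s, a, n). if s = q then lact M p q a n else \<one>\<^bsub>grp M p q\<^esub>) \<and>
    balanced Ob A M S p q (grp M p q) (\<lambda>(s, m, a). if s = p then ract M p q m a else \<one>\<^bsub>grp M p q\<^esub>))"

text \<open>The part of the first zigzag composite that follows d, evaluated on X \<otimes> n. With
  n fixed it is a homomorphism in X, so the identity becomes a statement about the values of d;
  \<open>zag\<close> does the same for the second identity.\<close>

definition zig where
  "zig Ob A S P M b p q s n X = right_unitor P p q (tensor_map Ob A P S (\<lambda>_ _. id) b p q
     (tensor_assoc Ob A P M P p q (pure_tensor Ob A (tensor Ob A P M) P p q s X n)))"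

definition zag where
  "zag Ob A S P M b p q s m X = left_unitor M p q (tensor_map Ob A S M b (\<lambda>_ _. id) p q
     (tensor_assoc_inv Ob A M P M p q (pure_tensor Ob A M (tensor Ob A P M) p q s m X)))"

context
  fixes Ob :: "'o set" and A :: "'o \<Rightarrow> 'a set" and S :: "('o, 'a, 'a) bimodule"
    and P :: "('o, 'a, 'm) bimodule" and M :: "('o, 'a, 'n) bimodule"
    and b :: "'o \<Rightarrow> 'o \<Rightarrow> (('o \<times> 'n \<times> 'm) \<Rightarrow>\<^sub>0 int) set \<Rightarrow> 'a"
  assumes S: "bimod Ob A S" and P: "bimod Ob A P" and M: "bimod Ob A M"
    and uP: "unital Ob A S P" and uM: "unital Ob A S M"
    and b: "bimodule_map Ob A (tensor Ob A M P) S b"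
begin

lemma left_unitor_props:
  assumes uN: "unital Ob A S N" and N: "bimod Ob A N" and pq: "p \<in> Ob" "q \<in> Ob"
  shows "left_unitor N p q \<in> hom (tensor_grp Ob A S N p q) (grp N p q)"
    and "s \<in> Ob \<Longrightarrow> a \<in> carrier (grp S s q) \<Longrightarrow> n \<in> carrier (grp N p s) \<Longrightarrow>
      left_unitor N p q (pure_tensor Ob A S N p q s a n) = (if s = q then lact N p q a n else \<one>\<^bsub>grp N p q\<^esub>)"
proof -
  interpret tensor_pair Ob A S N p q by (rule tensor_pairI[OF S N pq])
  have bal: "balanced Ob A S N p q (grp N p q) (\<lambda>(s, a, n). if s = q then lact N p q a n else \<one>\<^bsub>grp N p q\<^esub>)"
    using uN pq unfolding unital_def by blast
  note cg = bimodD(1)[OF N pq]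
  show "left_unitor N p q \<in> hom T (grp N p q)"
    unfolding left_unitor_def by (rule lift_hom[OF cg bal])
  show "left_unitor N p q (pure s a n) = (if s = q then lact N p q a n else \<one>\<^bsub>grp N p q\<^esub>)"
    if "s \<in> Ob" "a \<in> carrier (grp S s q)" "n \<in> carrier (grp N p s)"
    unfolding left_unitor_def lift_pure[OF cg bal that] by simp
qed

lemma right_unitor_props:
  assumes uN: "unital Ob A S N" and N: "bimod Ob A N" and pq: "p \<in> Ob" "q \<in> Ob"
  shows "right_unitor N p q \<in> hom (tensor_grp Ob A N S p q) (grp N p q)"
    and "s \<in> Ob \<Longrightarrow> n \<in> carrier (grp N s q) \<Longrightarrow> a \<in> carrier (grp S p s) \<Longrightarrow>
      right_unitor N p q (pure_tensor Ob A N S p q s n a) = (if s = p then ract N p q n a else \<one>\<^bsub>grp N p q\<^esub>)"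
proof -
  note cg = bimodD(1)[OF N pq]
  interpret tensor_pair Ob A N S p q by (rule tensor_pairI[OF N S pq])
  have bal: "balanced Ob A N S p q (grp N p q) (\<lambda>(s, n, a). if s = p then ract N p q n a else \<one>\<^bsub>grp N p q\<^esub>)"
    using uN pq unfolding unital_def by blast
  show "right_unitor N p q \<in> hom T (grp N p q)"
    unfolding right_unitor_def by (rule lift_hom[OF cg bal])
  show "right_unitor N p q (pure s n a) = (if s = p then ract N p q n a else \<one>\<^bsub>grp N p q\<^esub>)"
    if "s \<in> Ob" "n \<in> carrier (grp N s q)" "a \<in> carrier (grp S p s)"
    unfolding right_unitor_def lift_pure[OF cg bal that] by simp
qed

lemma pairing_closed:
  assumes "p \<in> Ob" "q \<in> Ob" "s \<in> Ob" "g \<in> carrier (grp M s q)" "f \<in> carrier (grp P p s)"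
  shows "b p q (pure_tensor Ob A M P p q s g f) \<in> carrier (grp S p q)"
  using hom_in_carrier[OF bimodule_mapD(1)[OF b assms(1,2)]]
    tensor_pair.pure_closed[OF tensor_pairI[OF M P assms(1,2)] assms(3-5)]
  by (simp add: grp_tensor)

text \<open>On X = f \<otimes> g the associator and b produce f \<otimes> b(g \<otimes> n); the
  right unitor multiplies this out at t = p and discards all other t.\<close>

lemma zig_props:
  assumes o: "p \<in> Ob" "q \<in> Ob" "s \<in> Ob" and n: "n \<in> carrier (grp P p s)"
  shows "zig Ob A S P M b p q s n \<in> hom (tensor_grp Ob A P M s q) (grp P p q)"
    and "t \<in> Ob \<Longrightarrow> f \<in> carrier (grp P t q) \<Longrightarrow> g \<in> carrier (grp M s t) \<Longrightarrow>
      zig Ob A S P M b p q s n (pure_tensor Ob A P M s q t f g)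
      = (if t = p then ract P p q f (b p p (pure_tensor Ob A M P p p s g n)) else \<one>\<^bsub>grp P p q\<^esub>)"
proof -
  note MP = bimod_tensor[OF M P] and PM = bimod_tensor[OF P M]
  interpret X: tensor_pair Ob A "tensor Ob A P M" P p q by (rule tensor_pairI[OF PM P o(1,2)])
  note as = tensor_assoc_props[OF P M P o(1,2)]
  note tm = tensor_map_props[OF P MP P S o(1,2) bimodule_map_id b]
  note ru = right_unitor_props[OF uP P o(1,2)]
  have "(\<lambda>X. X.pure s X n) \<in> hom (tensor_grp Ob A P M s q) X.T"
    using X.pure_hom_left[OF o(3) n] by (simp add: grp_tensor)
  from hom_comp[OF hom_comp[OF hom_comp[OF this as(1)] tm(1)] ru(1)]
  show "zig Ob A S P M b p q s n \<in> hom (tensor_grp Ob A P M s q) (grp P p q)"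
    by (simp add: zig_def[abs_def])
  show "zig Ob A S P M b p q s n (pure_tensor Ob A P M s q t f g)
      = (if t = p then ract P p q f (b p p (pure_tensor Ob A M P p p s g n)) else \<one>\<^bsub>grp P p q\<^esub>)"
    if *: "t \<in> Ob" "f \<in> carrier (grp P t q)" "g \<in> carrier (grp M s t)"
  proof -
    have c: "pure_tensor Ob A M P p t s g n \<in> carrier (grp (tensor Ob A M P) p t)"
      unfolding grp_tensor using tensor_pair.pure_closed[OF tensor_pairI[OF M P o(1) *(1)] o(3) *(3) n] .
    show ?thesis
      unfolding zig_def as(2)[OF o(3) n *] tm(2)[OF *(1,2) c] id_apply
        ru(2)[OF *(1,2) pairing_closed[OF o(1) *(1) o(3) *(3) n]] by simp
  qed
qed

lemma zag_props:
  assumes o: "p \<in> Ob" "q \<in> Ob" "s \<in> Ob" and m: "m \<in> carrier (grp M s q)"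
  shows "zag Ob A S P M b p q s m \<in> hom (tensor_grp Ob A P M p s) (grp M p q)"
    and "t \<in> Ob \<Longrightarrow> f \<in> carrier (grp P t s) \<Longrightarrow> g \<in> carrier (grp M p t) \<Longrightarrow>
      zag Ob A S P M b p q s m (pure_tensor Ob A P M p s t f g)
      = (if t = q then lact M p q (b q q (pure_tensor Ob A M P q q s m f)) g else \<one>\<^bsub>grp M p q\<^esub>)"
proof -
  note MP = bimod_tensor[OF M P] and PM = bimod_tensor[OF P M]
  interpret X: tensor_pair Ob A M "tensor Ob A P M" p q by (rule tensor_pairI[OF M PM o(1,2)])
  note as = tensor_assoc_inv_props[OF M P M o(1,2)]
  note tm = tensor_map_props[OF MP M S M o(1,2) b bimodule_map_id]
  note lu = left_unitor_props[OF uM M o(1,2)]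
  have "X.pure s m \<in> hom (tensor_grp Ob A P M p s) X.T"
    using X.pure_hom_right[OF o(3) m] by (simp add: grp_tensor)
  from hom_comp[OF hom_comp[OF hom_comp[OF this as(1)] tm(1)] lu(1)]
  show "zag Ob A S P M b p q s m \<in> hom (tensor_grp Ob A P M p s) (grp M p q)"
    by (simp add: zag_def[abs_def])
  show "zag Ob A S P M b p q s m (pure_tensor Ob A P M p s t f g)
      = (if t = q then lact M p q (b q q (pure_tensor Ob A M P q q s m f)) g else \<one>\<^bsub>grp M p q\<^esub>)"
    if *: "t \<in> Ob" "f \<in> carrier (grp P t s)" "g \<in> carrier (grp M p t)"
  proof -
    have c: "pure_tensor Ob A M P t q s m f \<in> carrier (grp (tensor Ob A M P) t q)"
      unfolding grp_tensor using tensor_pair.pure_closed[OF tensor_pairI[OF M P *(1) o(2)] o(3) m *(2)] .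
    show ?thesis
      unfolding zag_def as(2)[OF *(1,3) o(3) m *(2)] tm(2)[OF *(1) c *(3)] id_apply
        lu(2)[OF *(1) pairing_closed[OF *(1) o(2,3) m *(2)] *(3)] by simp
  qed
qed

text \<open>Both sides of a zigzag identity are homomorphisms out of a tensor product with the unit
  bimodule, so they need only be compared on pure tensors a \<otimes> n and m \<otimes> a.\<close>

lemma is_copairing_iff:
  "is_copairing Ob A S P M b d \<longleftrightarrow> bimodule_map Ob A S (tensor Ob A P M) d \<and>
    (\<forall>p\<in>Ob. \<forall>q\<in>Ob. \<forall>s\<in>Ob. \<forall>a\<in>carrier (grp S s q). \<forall>n\<in>carrier (grp P p s).
       zig Ob A S P M b p q s n (d s q a) = (if s = q then lact P p q a n else \<one>\<^bsub>grp P p q\<^esub>)) \<and>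
    (\<forall>p\<in>Ob. \<forall>q\<in>Ob. \<forall>s\<in>Ob. \<forall>m\<in>carrier (grp M s q). \<forall>a\<in>carrier (grp S p s).
       zag Ob A S P M b p q s m (d p s a) = (if s = p then ract M p q m a else \<one>\<^bsub>grp M p q\<^esub>))"
proof (cases "bimodule_map Ob A S (tensor Ob A P M) d")
  case False
  then show ?thesis by (simp add: is_copairing_def)
next
  case d: True
  note MP = bimod_tensor[OF M P] and PM = bimod_tensor[OF P M]
  let ?L1 = "\<lambda>p q x. right_unitor P p q (tensor_map Ob A P S (\<lambda>_ _. id) b p q
    (tensor_assoc Ob A P M P p q (tensor_map Ob A (tensor Ob A P M) P d (\<lambda>_ _. id) p q x)))"
  let ?L2 = "\<lambda>p q x. left_unitor M p q (tensor_map Ob A S M b (\<lambda>_ _. id) p q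
    (tensor_assoc_inv Ob A M P M p q (tensor_map Ob A M (tensor Ob A P M) (\<lambda>_ _. id) d p q x)))"
  have 1: "(\<forall>x\<in>carrier (tensor_grp Ob A S P p q). ?L1 p q x = left_unitor P p q x) \<longleftrightarrow>
     (\<forall>s\<in>Ob. \<forall>a\<in>carrier (grp S s q). \<forall>n\<in>carrier (grp P p s).
       zig Ob A S P M b p q s n (d s q a) = (if s = q then lact P p q a n else \<one>\<^bsub>grp P p q\<^esub>))"
    (is "?l \<longleftrightarrow> ?r") if o: "p \<in> Ob" "q \<in> Ob" for p q
  proof -
    interpret X: tensor_pair Ob A S P p q by (rule tensor_pairI[OF S P o])
    note lu = left_unitor_props[OF uP P o]
    note td = tensor_map_props[OF S P PM P o d bimodule_map_id]
    have ev: "?L1 p q (X.pure s a n) = zig Ob A S P M b p q s n (d s q a)"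
      if "s \<in> Ob" "a \<in> carrier (grp S s q)" "n \<in> carrier (grp P p s)" for s a n
      unfolding td(2)[OF that] zig_def id_apply ..
    have h: "(\<lambda>x. ?L1 p q x) \<in> hom X.T (grp P p q)"
      using hom_comp[OF hom_comp[OF hom_comp[OF td(1) tensor_assoc_props(1)[OF P M P o]]
        tensor_map_props(1)[OF P MP P S o bimodule_map_id b]] right_unitor_props(1)[OF uP P o]] .
    show ?thesis
    proof
      assume ?l
      then show ?r using ev lu(2) X.pure_closed by metis
    next
      assume r: ?r
      show ?l
        using X.hom_class_eq[OF comm_group_group[OF bimodD(1)[OF P o]] h lu(1)] ev lu(2) r by simp
    qed
  qed
  have 2: "(\<forall>x\<in>carrier (tensor_grp Ob A M S p q). ?L2 p q x = right_unitor M p q x) \<longleftrightarrow>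
     (\<forall>s\<in>Ob. \<forall>m\<in>carrier (grp M s q). \<forall>a\<in>carrier (grp S p s).
       zag Ob A S P M b p q s m (d p s a) = (if s = p then ract M p q m a else \<one>\<^bsub>grp M p q\<^esub>))"
    (is "?l \<longleftrightarrow> ?r") if o: "p \<in> Ob" "q \<in> Ob" for p q
  proof -
    interpret X: tensor_pair Ob A M S p q by (rule tensor_pairI[OF M S o])
    note ru = right_unitor_props[OF uM M o]
    note td = tensor_map_props[OF M S M PM o bimodule_map_id d]
    have ev: "?L2 p q (X.pure s m a) = zag Ob A S P M b p q s m (d p s a)"
      if "s \<in> Ob" "m \<in> carrier (grp M s q)" "a \<in> carrier (grp S p s)" for s a m
      unfolding td(2)[OF that] zag_def id_apply ..
    have h: "(\<lambda>x. ?L2 p q x) \<in> hom X.T (grp M p q)"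
      using hom_comp[OF hom_comp[OF hom_comp[OF td(1) tensor_assoc_inv_props(1)[OF M P M o]]
        tensor_map_props(1)[OF MP M S M o b bimodule_map_id]] left_unitor_props(1)[OF uM M o]] .
    show ?thesis
    proof
      assume ?l
      then show ?r using ev ru(2) X.pure_closed by metis
    next
      assume r: ?r
      show ?l
        using X.hom_class_eq[OF comm_group_group[OF bimodD(1)[OF M o]] h ru(1)] ev ru(2) r by simp
    qed
  qed
  show ?thesis
    unfolding is_copairing_def using d 1 2 by simp
qed

end

section \<open>Unions of two matchings\<close>

text \<open>A fixed-point-free involution of X, written as a relation. Diagrams are matchings of
  their points (\<open>matching_rel\<close>, \<open>brauerI\<close>), and stacking two diagrams
  gives the union of two matchings.\<close>

definition matching :: "('v \<times> 'v) set \<Rightarrow> 'v set \<Rightarrow> bool" where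
  "matching R X \<longleftrightarrow> sym R \<and> irrefl R \<and> single_valued R \<and> Domain R = X"

lemma matchingD:
  assumes "matching R X"
  shows "(x, y) \<in> R \<Longrightarrow> (y, x) \<in> R" "(x, x) \<notin> R" "(x, y) \<in> R \<Longrightarrow> (x, z) \<in> R \<Longrightarrow> y = z"
    "(x, y) \<in> R \<Longrightarrow> x \<in> X" "(x, y) \<in> R \<Longrightarrow> y \<in> X" "x \<in> X \<Longrightarrow> \<exists>y. (x, y) \<in> R"
  using assms unfolding matching_def
  by (auto simp: sym_def irrefl_def single_valued_def Domain_iff)

lemma sym_rtrancl_Un: "sym a \<Longrightarrow> sym b \<Longrightarrow> sym ((a \<union> b)\<^sup>*)"
  by (simp add: sym_rtrancl sym_Un)

text \<open>Walking from an end point, one deletes the first edge and exchanges the roles of the two matchings.\<close>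

lemma matching_path:
  assumes "matching a A" "matching b B" "finite A" "finite B" "x \<in> A - B"
  shows "\<exists>y C. y \<noteq> x \<and> a `` C \<subseteq> C \<and> b `` C \<subseteq> C \<and> C \<inter> ((A - B) \<union> (B - A)) = {x, y} \<and> C \<subseteq> (a \<union> b)\<^sup>* `` {x}"
  using assms
proof (induction "card A + card B" arbitrary: a A b B x rule: less_induct)
  case less
  note a = matchingD[OF less.prems(1)] and b = matchingD[OF less.prems(2)]
  obtain x' where x': "(x, x') \<in> a" using a(6) less.prems(5) by blast
  then have xx: "x' \<in> A" "x \<noteq> x'" "(x', x) \<in> a" using a by blast+
  show ?case
  proof (cases "x' \<in> B")
    case False
    have "a `` {x, x'} \<subseteq> {x, x'}" using x' xx a(3) by blast
    moreover have "b `` {x, x'} \<subseteq> {x, x'}" using b(4) False less.prems(5) by blast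
    moreover have "{x, x'} \<inter> ((A - B) \<union> (B - A)) = {x, x'}" using False less.prems(5) xx by blast
    moreover have "{x, x'} \<subseteq> (a \<union> b)\<^sup>* `` {x}" using x' by blast
    ultimately show ?thesis using xx(2) by (intro exI[of _ x'] exI[of _ "{x, x'}"]) simp
  next
    case True
    define A' where "A' = A - {x, x'}"
    define a' where "a' = a \<inter> (A' \<times> A')"
    have closed: "w \<in> A'" if "(z, w) \<in> a" "z \<in> A'" for z w
      using that a(1,3,5) x' xx unfolding A'_def by blast
    have m': "matching a' A'"
      unfolding matching_def
    proof (intro conjI)
      show "sym a'" using a(1) by (auto simp: sym_def a'_def)
      show "irrefl a'" using a(2) by (auto simp: irrefl_def a'_def)
      show "single_valued a'" using a(3) by (auto simp: single_valued_def a'_def)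
      show "Domain a' = A'"
      proof
        show "A' \<subseteq> Domain a'"
        proof
          fix z assume z: "z \<in> A'"
          then obtain w where "(z, w) \<in> a" using a(6) by (auto simp: A'_def)
          then show "z \<in> Domain a'" using z closed by (auto simp: a'_def)
        qed
      qed (auto simp: a'_def)
    qed
    have "card A' < card A" using less.prems(3,5) unfolding A'_def by (intro psubset_card_mono) auto
    then have "card B + card A' < card A + card B" by simp
    moreover have "x' \<in> B - A'" using True by (simp add: A'_def)
    ultimately obtain y C where C: "y \<noteq> x'" "b `` C \<subseteq> C" "a' `` C \<subseteq> C"
      "C \<inter> ((B - A') \<union> (A' - B)) = {x', y}" "C \<subseteq> (b \<union> a')\<^sup>* `` {x'}"
      using less.hyps[OF _ less.prems(2) m' less.prems(4) _, of x'] less.prems(3)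
      by (auto simp: A'_def)
    have x'C: "x' \<in> C" using C(4) by blast
    have yx: "y \<noteq> x" using C(4) less.prems(5) by (auto simp: A'_def)
    have "a `` insert x C \<subseteq> insert x C"
    proof
      fix w assume "w \<in> a `` insert x C"
      then obtain z where z: "(z, w) \<in> a" "z = x \<or> z \<in> C" by blast
      show "w \<in> insert x C"
      proof (cases "z \<in> A'")
        case True
        then have "(z, w) \<in> a'" using z(1) closed by (simp add: a'_def)
        moreover have "z \<in> C" using True z(2) by (auto simp: A'_def)
        ultimately show ?thesis using C(3) by blast
      next
        case False
        then have "z = x \<or> z = x'" using a(4) z(1) by (auto simp: A'_def)
        then show ?thesis using z(1) x' xx(3) a(3) x'C by blast
      qed
    qed
    moreover have "b `` insert x C \<subseteq> insert x C" using C(2) b(4) less.prems(5) by blast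
    \<comment> \<open>The free points of the shortened pair are those of the original one, except
      that x has been replaced by x'.\<close>
    moreover have "insert x C \<inter> ((A - B) \<union> (B - A)) = {x, y}"
    proof -
      have iff: "z \<in> (B - A') \<union> (A' - B) \<longleftrightarrow> z \<in> (A - B) \<union> (B - A)" if "z \<noteq> x" "z \<noteq> x'" for z
        using that by (auto simp: A'_def)
      have yC: "y \<in> C" "y \<in> (B - A') \<union> (A' - B)" using C(4) by auto
      have un: "z = y" if "z \<in> C" "z \<in> (A - B) \<union> (B - A)" "z \<noteq> x" for z
      proof -
        have "z \<noteq> x'" using that(2) True xx(1) by auto
        then have "z \<in> C \<inter> ((B - A') \<union> (A' - B))" using iff that by blast
        then show ?thesis using C(4) \<open>z \<noteq> x'\<close> by auto
      qed
      have "y \<in> (A - B) \<union> (B - A)" using yC(2) iff[OF yx C(1)] by simp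
      moreover have "x \<in> (A - B) \<union> (B - A)" using less.prems(5) by simp
      ultimately show ?thesis using yC(1) un by (intro equalityI subsetI) (erule IntE insertE, blast+)
    qed
    moreover have "insert x C \<subseteq> (a \<union> b)\<^sup>* `` {x}"
    proof -
      have "(b \<union> a')\<^sup>* \<subseteq> (a \<union> b)\<^sup>*" by (rule rtrancl_mono) (auto simp: a'_def)
      moreover have "(x, x') \<in> (a \<union> b)\<^sup>*" using x' by blast
      ultimately have "(x, z) \<in> (a \<union> b)\<^sup>*" if "z \<in> C" for z
        using C(5) that rtrancl_trans[of x x' "(a \<union> b)" z] by blast
      then show ?thesis by auto
    qed
    ultimately show ?thesis using yx by (intro exI[of _ y] exI[of _ "insert x C"]) simp
  qed
qed

lemma rtrancl_class_eq:
  assumes "sym (R\<^sup>*)" "(u, v) \<in> R\<^sup>*"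
  shows "R\<^sup>* `` {u} = R\<^sup>* `` {v}"
  using rtrancl_trans[OF assms(2)] rtrancl_trans[OF symD[OF assms]] by blast

lemma rtrancl_closed: "(x, y) \<in> R\<^sup>* \<Longrightarrow> x \<in> C \<Longrightarrow> R `` C \<subseteq> C \<Longrightarrow> y \<in> C"
  by (induction rule: rtrancl_induct) auto

text \<open>A free point, matched by only one of a and b, is an end of an alternating path, and
  \<open>matching_path\<close> finds a closed set in which the other end is the only further free
  point. In a stack the free points are the outer ones.\<close>

lemma matching_comp:
  assumes "matching a A" "matching b B" "finite A" "finite B"
  defines "X \<equiv> (A - B) \<union> (B - A)"
  shows "matching {(x, y). x \<in> X \<and> y \<in> X \<and> x \<noteq> y \<and> (x, y) \<in> (a \<union> b)\<^sup>*} X" (is "matching ?R X")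
proof -
  have s: "sym ((a \<union> b)\<^sup>*)" using assms(1,2) by (intro sym_rtrancl_Un) (auto simp: matching_def)
  have key: "\<exists>y. \<forall>z. (x, z) \<in> ?R \<longleftrightarrow> z = y" if x: "x \<in> X" for x
  proof -
    have "\<exists>y C. y \<noteq> x \<and> a `` C \<subseteq> C \<and> b `` C \<subseteq> C \<and> C \<inter> X = {x, y} \<and> C \<subseteq> (a \<union> b)\<^sup>* `` {x}"
    proof (cases "x \<in> A")
      case True
      then show ?thesis using matching_path[OF assms(1-4)] x unfolding X_def by blast
    next
      case False
      then have "x \<in> B - A" using x by (auto simp: X_def)
      from matching_path[OF assms(2,1,4,3) this] obtain y C where
        C: "y \<noteq> x" "b `` C \<subseteq> C" "a `` C \<subseteq> C" "C \<inter> (B - A \<union> (A - B)) = {x, y}" "C \<subseteq> (b \<union> a)\<^sup>* `` {x}"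
        by blast
      have "C \<inter> X = {x, y}" unfolding X_def using C(4) by (simp add: Un_commute)
      moreover have "C \<subseteq> (a \<union> b)\<^sup>* `` {x}" using C(5) by (simp add: Un_commute)
      ultimately show ?thesis using C by blast
    qed
    then obtain y C where C: "y \<noteq> x" "a `` C \<subseteq> C" "b `` C \<subseteq> C" "C \<inter> X = {x, y}" "C \<subseteq> (a \<union> b)\<^sup>* `` {x}"
      by blast
    have cl: "(a \<union> b) `` C \<subseteq> C" using C by blast
    show ?thesis
    proof (intro exI[of _ y] allI iffI)
      fix z assume z: "(x, z) \<in> ?R"
      then have "z \<in> C" using rtrancl_closed[OF _ _ cl, of x z] C(4) by blast
      then have "z \<in> C \<inter> X" using z by simp
      then show "z = y" using z C(4) by auto
    next
      fix z assume "z = y"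
      then show "(x, z) \<in> ?R" using C x by blast
    qed
  qed
  show ?thesis
    unfolding matching_def
  proof (intro conjI)
    show "sym ?R" using s by (auto simp: sym_def)
    show "irrefl ?R" by (auto simp: irrefl_def)
    show "single_valued ?R"
    proof (rule single_valuedI)
      fix x y z assume yz: "(x, y) \<in> ?R" "(x, z) \<in> ?R"
      then have "x \<in> X" by simp
      from key[OF this] obtain w where w: "\<forall>z. (x, z) \<in> ?R \<longleftrightarrow> z = w" ..
      show "y = z" by (rule trans[OF iffD1[OF spec[OF w] yz(1)] iffD1[OF spec[OF w] yz(2), symmetric]])
    qed
    show "Domain ?R = X"
    proof (intro equalityI subsetI)
      fix x assume "x \<in> X"
      from key[OF this] obtain w where w: "\<forall>z. (x, z) \<in> ?R \<longleftrightarrow> z = w" ..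
      show "x \<in> Domain ?R" by (rule DomainI[OF iffD2[OF spec[OF w] refl]])
    qed auto
  qed
qed

lemma matching_image:
  assumes "matching R X" "inj h"
  shows "matching (map_prod h h ` R) (h ` X)"
proof -
  note R = matchingD[OF assms(1)]
  show ?thesis
    unfolding matching_def
  proof (intro conjI)
    show "sym (map_prod h h ` R)" using R(1) by (auto simp: sym_def)
    show "irrefl (map_prod h h ` R)" using R(2) by (auto simp: irrefl_def inj_eq[OF assms(2)])
    show "single_valued (map_prod h h ` R)" using R(3) by (auto simp: single_valued_def inj_eq[OF assms(2)])
    show "Domain (map_prod h h ` R) = h ` X" using assms(1) by (force simp: matching_def)
  qed
qed

lemma rtrancl_map_prod:
  assumes "inj h"
  shows "(h x, h y) \<in> (map_prod h h ` R)\<^sup>* \<longleftrightarrow> (x, y) \<in> R\<^sup>*"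
proof
  have "\<And>z. (h x, z) \<in> (map_prod h h ` R)\<^sup>* \<Longrightarrow> \<exists>y. z = h y \<and> (x, y) \<in> R\<^sup>*"
  proof -
    fix z assume "(h x, z) \<in> (map_prod h h ` R)\<^sup>*"
    then show "\<exists>y. z = h y \<and> (x, y) \<in> R\<^sup>*"
      by (induction rule: rtrancl_induct) (use assms in \<open>auto simp: inj_eq intro: rtrancl_into_rtrancl\<close>)
  qed
  then show "(h x, h y) \<in> (map_prod h h ` R)\<^sup>* \<Longrightarrow> (x, y) \<in> R\<^sup>*" using injD[OF assms] by blast
  show "(x, y) \<in> R\<^sup>* \<Longrightarrow> (h x, h y) \<in> (map_prod h h ` R)\<^sup>*"
    by (induction rule: rtrancl_induct) (auto intro: rtrancl_into_rtrancl)
qed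

section \<open>Contracting part of a graph and counting components\<close>

lemma rtrancl_Field: "(x, y) \<in> R\<^sup>* \<Longrightarrow> x = y \<or> (x \<in> Field R \<and> y \<in> Field R)"
  by (induction rule: rtrancl_induct) (auto simp: Field_def)

text \<open>The relation seen from X alone: distinct points are joined when some path of R connects
  them. On a stack, with X the outer layers, this is the composite diagram
  (\<open>contract_comp\<close>).\<close>

definition contract :: "('v \<times> 'v) set \<Rightarrow> 'v set \<Rightarrow> ('v \<times> 'v) set" where
  "contract R X = {(x, y). x \<in> X \<and> y \<in> X \<and> x \<noteq> y \<and> (x, y) \<in> R\<^sup>*}"

text \<open>R1 lives on X \<union> Y and R2 avoids Y, so a path can enter and leave Y only through
  X, and each excursion can be replaced by an edge of \<open>contract R1 X\<close>.\<close>

lemma rtrancl_contract: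
  assumes F1: "Field R1 \<subseteq> X \<union> Y" and XY: "X \<inter> Y = {}" and F2: "Field R2 \<inter> Y = {}" and u: "u \<notin> Y"
  shows "v \<notin> Y \<Longrightarrow> (u, v) \<in> (R1 \<union> R2)\<^sup>* \<longleftrightarrow> (u, v) \<in> (contract R1 X \<union> R2)\<^sup>*"
    and "(u, v) \<in> (contract R1 X \<union> R2)\<^sup>* \<Longrightarrow> v \<notin> Y"
proof -
  show nY: "(u, v) \<in> (contract R1 X \<union> R2)\<^sup>* \<Longrightarrow> v \<notin> Y" for v
    using rtrancl_Field[of u v "contract R1 X \<union> R2"] u XY F2 by (auto simp: contract_def Field_def)
  \<comment> \<open>Invariant along a path to w: z is outside Y and reached in the contracted
    relation, and the rest of the way from z to w stays in R1.\<close>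
  have fwd: "\<exists>z. (u, z) \<in> (contract R1 X \<union> R2)\<^sup>* \<and> z \<notin> Y \<and> (z = w \<or> z \<in> X \<and> (z, w) \<in> R1\<^sup>*)"
    if "(u, w) \<in> (R1 \<union> R2)\<^sup>*" for w
    using that
  proof (induction rule: rtrancl_induct)
    case base
    then show ?case using u by blast
  next
    case (step w w')
    then obtain z where z: "(u, z) \<in> (contract R1 X \<union> R2)\<^sup>*" "z \<notin> Y" "z = w \<or> z \<in> X \<and> (z, w) \<in> R1\<^sup>*" by blast
    show ?case
    proof (cases "(w, w') \<in> R1")
      case True
      then have "w \<in> X \<union> Y" using F1 by (auto simp: Field_def)
      then have "z \<in> X" "(z, w) \<in> R1\<^sup>*" using z by auto
      then show ?thesis using z True by (meson rtrancl_into_rtrancl)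
    next
      case False
      then have 2: "(w, w') \<in> R2" using step by blast
      then have w: "w \<notin> Y" "w' \<notin> Y" using F2 by (auto simp: Field_def)
      have "(z, w) \<in> (contract R1 X \<union> R2)\<^sup>*"
      proof (cases "z = w")
        case False
        then have "z \<in> X" "(z, w) \<in> R1\<^sup>*" using z by auto
        moreover have "w \<in> X" using rtrancl_Field[OF calculation(2)] False F1 w by auto
        ultimately have "(z, w) \<in> contract R1 X" using False by (simp add: contract_def)
        then show ?thesis by blast
      qed simp
      with z(1) have "(u, w) \<in> (contract R1 X \<union> R2)\<^sup>*" by (rule rtrancl_trans)
      then have "(u, w') \<in> (contract R1 X \<union> R2)\<^sup>*" using 2 by (rule rtrancl_into_rtrancl[OF _ UnI2])
      then show ?thesis using w by blast
    qed
  qed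
  have "(contract R1 X \<union> R2)\<^sup>* \<subseteq> (R1 \<union> R2)\<^sup>*"
  proof (rule rtrancl_subset_rtrancl, rule Un_least)
    have "R1\<^sup>* \<subseteq> (R1 \<union> R2)\<^sup>*" by (rule rtrancl_mono) simp
    then show "contract R1 X \<subseteq> (R1 \<union> R2)\<^sup>*" by (auto simp: contract_def)
  qed auto
  moreover have "(u, v) \<in> (contract R1 X \<union> R2)\<^sup>*" if uv: "(u, v) \<in> (R1 \<union> R2)\<^sup>*" "v \<notin> Y" for v
  proof -
    obtain z where z: "(u, z) \<in> (contract R1 X \<union> R2)\<^sup>*" "z \<notin> Y" "z = v \<or> z \<in> X \<and> (z, v) \<in> R1\<^sup>*"
      using fwd[OF uv(1)] by blast
    show ?thesis
    proof (cases "z = v")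
      case False
      then have zv: "z \<in> X" "(z, v) \<in> R1\<^sup>*" using z by auto
      moreover have "v \<in> X" using rtrancl_Field[OF zv(2)] False F1 uv(2) by auto
      ultimately have "(z, v) \<in> contract R1 X" using False by (simp add: contract_def)
      then show ?thesis using z(1) by (meson UnI1 rtrancl_into_rtrancl)
    qed (use z in simp)
  qed
  ultimately show "v \<notin> Y \<Longrightarrow> (u, v) \<in> (R1 \<union> R2)\<^sup>* \<longleftrightarrow> (u, v) \<in> (contract R1 X \<union> R2)\<^sup>*" by blast
qed

text \<open>The components contained in Z; with Z the middle layer of a stack these are its closed
  loops.\<close>

definition comps :: "('v \<times> 'v) set \<Rightarrow> 'v set \<Rightarrow> 'v set set" where
  "comps R Z = {C. \<exists>v\<in>Z. C = R\<^sup>* `` {v} \<and> C \<subseteq> Z}"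

text \<open>A component inside Z \<union> Y either lies in Y, and then it never uses R2, or it meets
  Z, and then deleting Y turns it into a component of the contraction. The deletion is injective
  because a component is determined by any of its points in Z.\<close>

lemma card_comps_contract:
  assumes F1: "Field R1 \<subseteq> X \<union> Y" and XY: "X \<inter> Y = {}" and F2: "Field R2 \<inter> Y = {}"
    and s: "sym R1" "sym R2" and Z: "Z \<inter> Y = {}" and fin: "finite Z" "finite Y"
  shows "card (comps (R1 \<union> R2) (Z \<union> Y)) = card (comps R1 Y) + card (comps (contract R1 X \<union> R2) Z)"
proof -
  let ?R = "R1 \<union> R2" and ?R' = "contract R1 X \<union> R2"
  define B where "B = {C \<in> comps ?R (Z \<union> Y). C \<inter> Z \<noteq> {}}"
  have stay: "?R\<^sup>* `` {v} = R1\<^sup>* `` {v}" if v: "v \<in> Y" and sub: "?R\<^sup>* `` {v} \<subseteq> Y \<or> R1\<^sup>* `` {v} \<subseteq> Y" for v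
  proof
    show "R1\<^sup>* `` {v} \<subseteq> ?R\<^sup>* `` {v}" using rtrancl_mono[of R1 ?R] by blast
    have "(v, w) \<in> R1\<^sup>* \<and> w \<in> Y" if "(v, w) \<in> ?R\<^sup>*" for w
      using that
    proof (induction rule: rtrancl_induct)
      case base
      then show ?case using v by simp
    next
      case (step w w')
      then have "(w, w') \<in> R1" using F2 by (auto simp: Field_def)
      then have 1: "(v, w') \<in> R1\<^sup>*" using step by (meson rtrancl_into_rtrancl)
      have "(v, w') \<in> ?R\<^sup>*" using step by (meson rtrancl_into_rtrancl)
      then show ?case using 1 sub by blast
    qed
    then show "?R\<^sup>* `` {v} \<subseteq> R1\<^sup>* `` {v}" by blast
  qed
  have split: "comps ?R (Z \<union> Y) = comps R1 Y \<union> B"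
  proof (intro equalityI subsetI)
    fix C assume C: "C \<in> comps ?R (Z \<union> Y)"
    then obtain v where v: "v \<in> Z \<union> Y" "C = ?R\<^sup>* `` {v}" "C \<subseteq> Z \<union> Y" by (auto simp: comps_def)
    show "C \<in> comps R1 Y \<union> B"
    proof (cases "C \<inter> Z = {}")
      case True
      have "v \<in> C" using v by simp
      then have vY: "v \<in> Y" and CY: "C \<subseteq> Y" using True v by blast+
      have "C = R1\<^sup>* `` {v}" using stay[OF vY] CY v(2) by simp
      then show ?thesis using vY CY by (auto simp: comps_def)
    qed (use C in \<open>simp add: B_def\<close>)
  next
    fix C assume "C \<in> comps R1 Y \<union> B"
    then show "C \<in> comps ?R (Z \<union> Y)"
    proof
      assume "C \<in> comps R1 Y"
      then obtain v where v: "v \<in> Y" "C = R1\<^sup>* `` {v}" "C \<subseteq> Y" by (auto simp: comps_def)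
      then have "C = ?R\<^sup>* `` {v}" using stay[OF v(1)] by simp
      then show ?thesis using v unfolding comps_def by blast
    qed (simp add: B_def)
  qed
  have disj: "comps R1 Y \<inter> B = {}" using Z by (auto simp: comps_def B_def)
  have cl: "?R\<^sup>* `` {v} - Y = ?R'\<^sup>* `` {v}" if "v \<in> Z" for v
  proof -
    have "v \<notin> Y" using that Z by blast
    then show ?thesis using rtrancl_contract[OF F1 XY F2] by blast
  qed
  have Bchar: "\<exists>v\<in>Z. C = ?R\<^sup>* `` {v} \<and> C \<subseteq> Z \<union> Y" if CB: "C \<in> B" for C
  proof -
    obtain u v where u: "C = ?R\<^sup>* `` {u}" "C \<subseteq> Z \<union> Y" and v: "v \<in> C" "v \<in> Z"
      using CB unfolding B_def comps_def by blast
    have "?R\<^sup>* `` {u} = ?R\<^sup>* `` {v}" using u v by (intro rtrancl_class_eq sym_rtrancl_Un s) simp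
    then show ?thesis using u v by blast
  qed
  have "bij_betw (\<lambda>C. C - Y) B (comps ?R' Z)"
    unfolding bij_betw_def
  proof
    show "inj_on (\<lambda>C. C - Y) B"
    proof (rule inj_onI)
      fix C D assume C: "C \<in> B" and D: "D \<in> B" and eq: "C - Y = D - Y"
      obtain v where v: "v \<in> Z" "C = ?R\<^sup>* `` {v}" using Bchar[OF C] by blast
      obtain w where w: "w \<in> Z" "D = ?R\<^sup>* `` {w}" using Bchar[OF D] by blast
      have "v \<in> C" using v by simp
      then have "v \<in> D" using eq v(1) Z by blast
      then have "(w, v) \<in> ?R\<^sup>*" using w by blast
      then have "?R\<^sup>* `` {w} = ?R\<^sup>* `` {v}" by (intro rtrancl_class_eq sym_rtrancl_Un s)
      then show "C = D" unfolding v(2) w(2) by simp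
    qed
    show "(\<lambda>C. C - Y) ` B = comps ?R' Z"
    proof (intro equalityI subsetI)
      fix E assume "E \<in> (\<lambda>C. C - Y) ` B"
      then obtain v where v: "v \<in> Z" "E = ?R\<^sup>* `` {v} - Y" "?R\<^sup>* `` {v} \<subseteq> Z \<union> Y" using Bchar by blast
      have "E = ?R'\<^sup>* `` {v}" using cl[OF v(1)] v(2) by (rule trans[rotated])
      moreover have "E \<subseteq> Z" using v(2,3) by blast
      ultimately show "E \<in> comps ?R' Z" unfolding comps_def by (intro CollectI bexI[OF _ v(1)] conjI)
    next
      fix E assume "E \<in> comps ?R' Z"
      then obtain v where v: "v \<in> Z" "E = ?R'\<^sup>* `` {v}" "E \<subseteq> Z" unfolding comps_def by blast
      have e: "E = ?R\<^sup>* `` {v} - Y" using cl[OF v(1)] v(2) by simp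
      have "?R\<^sup>* `` {v} \<subseteq> Z \<union> Y" using e v(3) by auto
      then have "?R\<^sup>* `` {v} \<in> comps ?R (Z \<union> Y)"
        unfolding comps_def by (intro CollectI bexI[OF _ UnI1[OF v(1)]] conjI refl)
      moreover have "v \<in> ?R\<^sup>* `` {v}" by simp
      ultimately have "?R\<^sup>* `` {v} \<in> B" using v(1) unfolding B_def by auto
      then show "E \<in> (\<lambda>C. C - Y) ` B" using e by (rule rev_image_eqI)
    qed
  qed
  then have cB: "card B = card (comps ?R' Z)" by (rule bij_betw_same_card)
  have "finite (comps ?R (Z \<union> Y))"
  proof (rule finite_subset)
    show "comps ?R (Z \<union> Y) \<subseteq> Pow (Z \<union> Y)"
      unfolding comps_def by (rule subsetI, rule PowI) (elim CollectE bexE conjE)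
    show "finite (Pow (Z \<union> Y))" using fin by simp
  qed
  then have f: "finite (comps R1 Y)" "finite B" unfolding split by simp_all
  show ?thesis unfolding split card_Un_disjoint[OF f disj] cB ..
qed

section \<open>Composition of Brauer diagrams\<close>

definition rel :: "'v set set \<Rightarrow> ('v \<times> 'v) set" where
  "rel D = {(x, y). {x, y} \<in> D \<and> x \<noteq> y}"

lemma rel_iff: "(x, y) \<in> rel D \<longleftrightarrow> {x, y} \<in> D \<and> x \<noteq> y"
  by (simp add: rel_def)

lemma finite_points [simp]: "finite (points p q)"
  by (simp add: points_def)

lemma points_iff [simp]:
  "Top i \<in> points p q \<longleftrightarrow> i \<in> {1..p}" "Bot i \<in> points p q \<longleftrightarrow> i \<in> {1..q}"
  by (auto simp: points_def)

lemma brauerD: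
  assumes "D \<in> brauer_diagrams p q"
  shows "e \<in> D \<Longrightarrow> \<exists>x y. e = {x, y} \<and> x \<noteq> y"
    and "{x, y} \<in> D \<Longrightarrow> x \<in> points p q" "{x, y} \<in> D \<Longrightarrow> y \<in> points p q" "{x, y} \<in> D \<Longrightarrow> x \<noteq> y"
    and "{x, y} \<in> D \<Longrightarrow> {x, z} \<in> D \<Longrightarrow> y = z"
    and "x \<in> points p q \<Longrightarrow> \<exists>y. {x, y} \<in> D"
proof -
  have P: "partition_on (points p q) D" and c: "\<And>e. e \<in> D \<Longrightarrow> card e = 2"
    using assms by (auto simp: brauer_diagrams_def)
  have U: "\<Union>D = points p q" and dis: "\<And>e e'. e \<in> D \<Longrightarrow> e' \<in> D \<Longrightarrow> e \<inter> e' \<noteq> {} \<Longrightarrow> e = e'"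
    using P unfolding partition_on_def disjoint_def by blast+
  show two: "e \<in> D \<Longrightarrow> \<exists>x y. e = {x, y} \<and> x \<noteq> y" for e using c card_2_iff by metis
  show "{x, y} \<in> D \<Longrightarrow> x \<in> points p q" "{x, y} \<in> D \<Longrightarrow> y \<in> points p q" using U by blast+
  show ne: "{x, y} \<in> D \<Longrightarrow> x \<noteq> y" for y using c[of "{x, y}"] by auto
  show "{x, y} \<in> D \<Longrightarrow> {x, z} \<in> D \<Longrightarrow> y = z"
    using dis[of "{x, y}" "{x, z}"] by (auto simp: doubleton_eq_iff)
  show "\<exists>y. {x, y} \<in> D" if x: "x \<in> points p q"
  proof -
    obtain e where e: "e \<in> D" "x \<in> e" using U x by blast
    then obtain a b where "e = {a, b}" using two by blast
    then have "e = {x, a} \<or> e = {x, b}" using e(2) by auto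
    then show ?thesis using e(1) by auto
  qed
qed

lemma matching_rel: "D \<in> brauer_diagrams p q \<Longrightarrow> matching (rel D) (points p q)"
  unfolding matching_def
proof (intro conjI)
  assume D: "D \<in> brauer_diagrams p q"
  show "sym (rel D)" by (auto simp: sym_def rel_iff insert_commute)
  show "irrefl (rel D)" by (auto simp: irrefl_def rel_iff)
  show "single_valued (rel D)" using brauerD(5)[OF D] by (auto simp: single_valued_def rel_iff)
  show "Domain (rel D) = points p q"
  proof (intro equalityI subsetI)
    fix x assume "x \<in> Domain (rel D)"
    then obtain y where "(x, y) \<in> rel D" by (rule DomainE)
    then show "x \<in> points p q" using brauerD(2)[OF D, of x y] by (simp add: rel_iff)
  next
    fix x assume "x \<in> points p q"
    then obtain y where y: "{x, y} \<in> D" using brauerD(6)[OF D] by blast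
    then show "x \<in> Domain (rel D)" using brauerD(4)[OF D y] by (intro DomainI[of _ y]) (simp add: rel_iff)
  qed
qed

lemma brauerI:
  assumes R: "matching R (points p q)"
  shows "{{x, y} | x y. (x, y) \<in> R} \<in> brauer_diagrams p q" (is "?D \<in> _")
proof -
  note r = matchingD[OF R]
  have "partition_on (points p q) ?D"
  proof (rule partition_onI)
    show "\<Union>?D = points p q"
    proof (intro equalityI subsetI)
      fix x assume "x \<in> \<Union>?D"
      then obtain a b where "(a, b) \<in> R" "x = a \<or> x = b" by auto
      then show "x \<in> points p q" using r(4)[of a b] r(5)[of a b] by auto
    next
      fix x assume "x \<in> points p q"
      then obtain y where "(x, y) \<in> R" using r(6) by auto
      then show "x \<in> \<Union>?D" by auto
    qed
    show "disjnt e e'" if "e \<in> ?D" "e' \<in> ?D" "e \<noteq> e'" for e e'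
    proof (rule ccontr)
      assume "\<not> disjnt e e'"
      then obtain z where z: "z \<in> e" "z \<in> e'" by (auto simp: disjnt_def)
      have el: "\<exists>w. u = {z, w} \<and> (z, w) \<in> R" if "u \<in> ?D" "z \<in> u" for u
        using that r(1) by (auto simp: insert_commute)
      obtain v w where "e = {z, v}" "(z, v) \<in> R" "e' = {z, w}" "(z, w) \<in> R"
        using el[OF \<open>e \<in> ?D\<close> z(1)] el[OF \<open>e' \<in> ?D\<close> z(2)] by auto
      then show False using r(3)[of z v w] \<open>e \<noteq> e'\<close> by simp
    qed
    show "{} \<notin> ?D" by auto
  qed
  moreover have "card e = 2" if e: "e \<in> ?D" for e
  proof -
    obtain x y where "e = {x, y}" "(x, y) \<in> R" using e by auto
    then show ?thesis using r(2)[of x] by (cases "x = y") auto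
  qed
  ultimately show ?thesis by (simp add: brauer_diagrams_def)
qed

lemma rel_Collect: "sym R \<Longrightarrow> irrefl R \<Longrightarrow> rel {{x, y} | x y. (x, y) \<in> R} = R"
  by (auto simp: rel_def sym_def irrefl_def doubleton_eq_iff)

text \<open>Each point already has a partner in E, which leaves no room for a further pair of D.
  Many equalities of diagrams thus need one inclusion only.\<close>

lemma brauer_eqI:
  assumes E: "E \<in> brauer_diagrams p q" and D: "D \<in> brauer_diagrams p q" and sub: "E \<subseteq> D"
  shows "E = D"
proof
  show "D \<subseteq> E"
  proof
    fix e assume e: "e \<in> D"
    then obtain x y where xy: "e = {x, y}" using brauerD(1)[OF D] by blast
    then have "x \<in> points p q" using brauerD(2)[OF D] e by blast
    then obtain z where z: "{x, z} \<in> E" using brauerD(6)[OF E] by blast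
    then have "z = y" using brauerD(5)[OF D, of x z y] sub e xy by blast
    then show "e \<in> E" using z xy by simp
  qed
qed (rule sub)

lemma finite_brauer [simp]: "finite (brauer_diagrams p q)"
  by (rule finite_subset[of _ "Pow (Pow (points p q))"])
    (auto simp: brauer_diagrams_def partition_on_def)

section \<open>Stacks of diagrams as graphs on labelled layers\<close>

fun layers :: "'l \<Rightarrow> 'l \<Rightarrow> point \<Rightarrow> 'l \<times> nat" where
  "layers a b (Top i) = (a, i)"
| "layers a b (Bot i) = (b, i)"

text \<open>A diagram as a matching on the layers a and b. The datatype \<open>vertex\<close> has
  three layers, enough for two diagrams; arbitrary labels allow the stack of three diagrams that
  associativity requires.\<close>

definition lrel :: "'l \<Rightarrow> 'l \<Rightarrow> diagram \<Rightarrow> (('l \<times> nat) \<times> ('l \<times> nat)) set" where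
  "lrel a b D = map_prod (layers a b) (layers a b) ` rel D"

lemma inj_layers: "a \<noteq> b \<Longrightarrow> inj (layers a b)"
proof (rule injI)
  fix x y assume "a \<noteq> b" "layers a b x = layers a b y"
  then show "x = y" by (cases x; cases y) auto
qed

lemma sym_rel: "sym (rel D)"
  by (auto simp: sym_def rel_iff insert_commute)

lemma sym_map_prod:
  assumes "sym R"
  shows "sym (map_prod h h ` R)"
proof (rule symI)
  fix u v assume "(u, v) \<in> map_prod h h ` R"
  then obtain x y where "(x, y) \<in> R" "u = h x" "v = h y" by auto
  then show "(v, u) \<in> map_prod h h ` R" using symD[OF assms] by (intro image_eqI[of _ _ "(y, x)"]) simp_all
qed

lemma sym_lrel: "sym (lrel a b D)"
  unfolding lrel_def by (rule sym_map_prod[OF sym_rel])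

lemma layers_points: "layers a b ` points p q = {a} \<times> {1..p} \<union> {b} \<times> {1..q}"
  unfolding points_def image_Un image_image layers.simps by auto

lemma matching_lrel:
  assumes "a \<noteq> b" "D \<in> brauer_diagrams p q"
  shows "matching (lrel a b D) ({a} \<times> {1..p} \<union> {b} \<times> {1..q})"
  using matching_image[OF matching_rel[OF assms(2)] inj_layers[OF assms(1)]]
  by (simp add: lrel_def layers_points)

lemma matching_Field: "matching R X \<Longrightarrow> Field R = X"
  using matchingD(5)[of R X] by (auto simp: matching_def Field_def)

text \<open>Embeds the stack on \<open>vertex\<close> into labelled layers, so that statements about
  \<open>stack_conn\<close> become statements about unions of \<open>lrel\<close>.\<close>

fun stack_layers :: "'l \<Rightarrow> 'l \<Rightarrow> 'l \<Rightarrow> vertex \<Rightarrow> 'l \<times> nat" where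
  "stack_layers a b c (Upper i) = (a, i)"
| "stack_layers a b c (Middle i) = (b, i)"
| "stack_layers a b c (Lower i) = (c, i)"

lemma inj_stack_layers: "distinct [a, b, c] \<Longrightarrow> inj (stack_layers a b c)"
proof (rule injI)
  fix x y assume "distinct [a, b, c]" "stack_layers a b c x = stack_layers a b c y"
  then show "x = y" by (cases x; cases y) auto
qed

lemma stack_layers_simps:
  "stack_layers a b c (upper_vertex x) = layers a b x"
  "stack_layers a b c (lower_vertex x) = layers b c x"
  "stack_layers a b c (outer_vertex x) = layers a c x"
  by (cases x; simp)+

lemma range_layers: "range (layers a b) = {a, b} \<times> UNIV"
proof (intro equalityI subsetI)
  fix w assume "w \<in> range (layers a b)"
  then obtain y where "w = layers a b y" by blast
  then show "w \<in> {a, b} \<times> UNIV" by (cases y) auto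
next
  fix w assume "w \<in> {a, b} \<times> (UNIV :: nat set)"
  then obtain l i where "w = (l, i)" "l = a \<or> l = b" by auto
  then have "w = layers a b (if l = a then Top i else Bot i)" by auto
  then show "w \<in> range (layers a b)" by (rule range_eqI)
qed

lemma stack_layers_surj:
  assumes "w \<in> {a} \<times> I \<union> {b} \<times> J \<union> {c} \<times> K"
  shows "\<exists>u. w = stack_layers a b c u"
proof -
  obtain l i where "w = (l, i)" "l = a \<or> l = b \<or> l = c" using assms by auto
  then have "w = stack_layers a b c (if l = a then Upper i else if l = b then Middle i else Lower i)" by auto
  then show ?thesis ..
qed

text \<open>The union of the two matchings underlying \<open>stack_conn\<close>, without its
  reflexive pairs; the closures agree by \<open>stack_conn_eq\<close>.\<close>

definition srel :: "diagram \<Rightarrow> diagram \<Rightarrow> (vertex \<times> vertex) set" where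
  "srel f g = map_prod upper_vertex upper_vertex ` rel g \<union> map_prod lower_vertex lower_vertex ` rel f"

lemma map_prod_image_iff: "(u, v) \<in> map_prod h h ` R \<longleftrightarrow> (\<exists>x y. (x, y) \<in> R \<and> u = h x \<and> v = h y)"
  by auto

lemma srel_iff: "(u, v) \<in> srel f g \<longleftrightarrow>
    (\<exists>x y. {x, y} \<in> g \<and> x \<noteq> y \<and> u = upper_vertex x \<and> v = upper_vertex y) \<or>
    (\<exists>x y. {x, y} \<in> f \<and> x \<noteq> y \<and> u = lower_vertex x \<and> v = lower_vertex y)"
  unfolding srel_def Un_iff map_prod_image_iff rel_iff conj_assoc ..

lemma stack_conn_eq:
  assumes f: "f \<in> brauer_diagrams q s" and g: "g \<in> brauer_diagrams p q"
  shows "stack_conn f g = (srel f g)\<^sup>*"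
  unfolding stack_conn_def
proof (rule rtrancl_subset)
  show "srel f g \<subseteq> {(u, v). \<exists>e\<in>stack_edges f g. u \<in> e \<and> v \<in> e}"
  proof (rule subrelI)
    fix u v assume "(u, v) \<in> srel f g"
    then have "\<exists>e\<in>stack_edges f g. u \<in> e \<and> v \<in> e"
      unfolding srel_iff
    proof (elim disjE exE conjE)
      fix x y assume "{x, y} \<in> g" "u = upper_vertex x" "v = upper_vertex y"
      then show ?thesis
        by (intro bexI[of _ "upper_vertex ` {x, y}"]) (simp_all add: stack_edges_def del: image_insert)
    next
      fix x y assume "{x, y} \<in> f" "u = lower_vertex x" "v = lower_vertex y"
      then show ?thesis
        by (intro bexI[of _ "lower_vertex ` {x, y}"]) (simp_all add: stack_edges_def del: image_insert)
    qed
    then show "(u, v) \<in> {(u, v). \<exists>e\<in>stack_edges f g. u \<in> e \<and> v \<in> e}" by simp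
  qed
  have "(u, v) \<in> (srel f g)\<^sup>*" if "e \<in> D" "u \<in> h ` e" "v \<in> h ` e" "D = g \<and> h = upper_vertex \<or> D = f \<and> h = lower_vertex" for D h u v e
  proof -
    have "\<exists>x y. e = {x, y} \<and> x \<noteq> y" using that(1,4) brauerD(1)[OF f] brauerD(1)[OF g] by blast
    then obtain x y where xy: "e = {x, y}" "x \<noteq> y" by blast
    then have "(h x, h y) \<in> srel f g" "(h y, h x) \<in> srel f g"
      unfolding srel_iff using that(1,4) by (metis insert_commute)+
    then show ?thesis using that(2,3) xy(1) by (elim imageE) auto
  qed
  note edge = this
  show "{(u, v). \<exists>e\<in>stack_edges f g. u \<in> e \<and> v \<in> e} \<subseteq> (srel f g)\<^sup>*"
  proof (rule subrelI)
    fix u v assume "(u, v) \<in> {(u, v). \<exists>e\<in>stack_edges f g. u \<in> e \<and> v \<in> e}"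
    then obtain e where e: "e \<in> stack_edges f g" "u \<in> e" "v \<in> e" by auto
    from e(1) show "(u, v) \<in> (srel f g)\<^sup>*"
      unfolding stack_edges_def
    proof (elim UnE imageE)
      fix e' assume "e = upper_vertex ` e'" "e' \<in> g"
      then show ?thesis using e edge[of e' g u upper_vertex v] by simp
    next
      fix e' assume "e = lower_vertex ` e'" "e' \<in> f"
      then show ?thesis using e edge[of e' f u lower_vertex v] by simp
    qed
  qed
qed

lemma srel_layers: "map_prod (stack_layers a b c) (stack_layers a b c) ` srel f g = lrel a b g \<union> lrel b c f"
  unfolding srel_def lrel_def image_Un image_image
  by (intro arg_cong2[of _ _ _ _ "(\<union>)"] image_cong) (auto simp: stack_layers_simps)

lemma stack_conn_layers:
  assumes "f \<in> brauer_diagrams q s" "g \<in> brauer_diagrams p q" "distinct [a, b, c]"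
  shows "(u, v) \<in> stack_conn f g \<longleftrightarrow>
    (stack_layers a b c u, stack_layers a b c v) \<in> (lrel a b g \<union> lrel b c f)\<^sup>*"
  using rtrancl_map_prod[OF inj_stack_layers[OF assms(3)], of u v "srel f g"]
  by (simp add: stack_conn_eq[OF assms(1,2)] srel_layers)

text \<open>Middle points belong to both matchings, so the symmetric difference in
  \<open>matching_comp\<close> consists of the two outer layers; pulling the resulting matching back
  along \<open>layers a c\<close> gives the composite.\<close>

lemma diagram_comp_props:
  assumes f: "f \<in> brauer_diagrams q s" and g: "g \<in> brauer_diagrams p q" and d: "distinct [a, b, c]"
  shows "rel (diagram_comp f g) = {(x, y). x \<noteq> y \<and> (layers a c x, layers a c y) \<in> (lrel a b g \<union> lrel b c f)\<^sup>*}" (is "_ = ?R")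
    and "diagram_comp f g \<in> brauer_diagrams p s"
proof -
  have ac: "a \<noteq> c" "a \<noteq> b" "b \<noteq> c" using d by auto
  have D: "diagram_comp f g = {{x, y} | x y. (x, y) \<in> ?R}"
    unfolding diagram_comp_def stack_conn_layers[OF f g d] stack_layers_simps by simp
  have s: "sym ((lrel a b g \<union> lrel b c f)\<^sup>*)" by (intro sym_rtrancl_Un sym_lrel)
  have sR: "sym ?R"
  proof (rule symI)
    fix x y assume "(x, y) \<in> ?R"
    then have "y \<noteq> x" "(layers a c x, layers a c y) \<in> (lrel a b g \<union> lrel b c f)\<^sup>*" by auto
    then show "(y, x) \<in> ?R" using symD[OF s] by simp
  qed
  have iR: "irrefl ?R" by (simp add: irrefl_def)
  from sR iR show r: "rel (diagram_comp f g) = ?R" unfolding D by (rule rel_Collect)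
  note ml = matching_lrel[OF ac(2) g] matching_lrel[OF ac(3) f]
  define X where "X = {a} \<times> {1..p} \<union> {c} \<times> {1..s}"
  have X: "({a} \<times> {1..p} \<union> {b} \<times> {1..q}) - ({b} \<times> {1..q} \<union> {c} \<times> {1..s}) \<union>
      (({b} \<times> {1..q} \<union> {c} \<times> {1..s}) - ({a} \<times> {1..p} \<union> {b} \<times> {1..q})) = X"
    using ac by (auto simp: X_def)
  have m: "matching {(x, y). x \<in> X \<and> y \<in> X \<and> x \<noteq> y \<and> (x, y) \<in> (lrel a b g \<union> lrel b c f)\<^sup>*} X"
    using matching_comp[OF ml, unfolded X] by simp
  have F: "Field (lrel a b g \<union> lrel b c f) = X \<union> {b} \<times> {1..q}"
    using ml[THEN matching_Field] by (auto simp: X_def)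
  have lX: "layers a c x \<in> X \<longleftrightarrow> x \<in> points p s" for x
    using ac by (cases x) (auto simp: X_def)
  have nb: "layers a c x \<notin> {b} \<times> {1..q}" for x using ac by (cases x) auto
  have inX: "x \<in> points p s \<and> y \<in> points p s" if "(x, y) \<in> ?R" for x y
  proof -
    have "layers a c x \<noteq> layers a c y" using that inj_layers[OF ac(1)] by (auto simp: inj_eq)
    then have "layers a c x \<in> X \<union> {b} \<times> {1..q}" "layers a c y \<in> X \<union> {b} \<times> {1..q}"
      using rtrancl_Field[of "layers a c x" "layers a c y" "lrel a b g \<union> lrel b c f"] that F by auto
    then show ?thesis using nb[of x] nb[of y] lX[of x] lX[of y] by simp
  qed
  have "matching ?R (points p s)"
    unfolding matching_def
  proof (intro conjI)
    show "sym ?R" by (rule sR)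
    show "irrefl ?R" by (rule iR)
    have mm: "(layers a c x, layers a c y) \<in> {(x, y). x \<in> X \<and> y \<in> X \<and> x \<noteq> y \<and> (x, y) \<in> (lrel a b g \<union> lrel b c f)\<^sup>*}"
      if "(x, y) \<in> ?R" for x y
      using inX[OF that] that lX inj_layers[OF ac(1)] by (auto simp: inj_eq)
    show "single_valued ?R"
    proof (rule single_valuedI)
      fix x y z assume "(x, y) \<in> ?R" "(x, z) \<in> ?R"
      from matchingD(3)[OF m mm[OF this(1)] mm[OF this(2)]] show "y = z"
        using inj_layers[OF ac(1)] by (simp add: inj_eq)
    qed
    show "Domain ?R = points p s"
    proof (intro equalityI subsetI)
      fix x assume "x \<in> Domain ?R"
      then obtain y where "(x, y) \<in> ?R" by (rule DomainE)
      from inX[OF this] show "x \<in> points p s" ..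
    next
      fix x assume "x \<in> points p s"
      then have "layers a c x \<in> X" using lX by simp
      from matchingD(6)[OF m this] obtain v where v: "v \<in> X" "layers a c x \<noteq> v"
        "(layers a c x, v) \<in> (lrel a b g \<union> lrel b c f)\<^sup>*" by auto
      have "\<exists>y. v = layers a c y" using v(1) unfolding X_def layers_points[symmetric] by auto
      then obtain y where "v = layers a c y" ..
      then have "(x, y) \<in> ?R" using v by auto
      then show "x \<in> Domain ?R" by (rule DomainI)
    qed
  qed
  then show "diagram_comp f g \<in> brauer_diagrams p s" unfolding D by (rule brauerI)
qed

lemma diagram_comp_closed:
  assumes "f \<in> brauer_diagrams q s" "g \<in> brauer_diagrams p q"
  shows "diagram_comp f g \<in> brauer_diagrams p s"
  using diagram_comp_props(2)[OF assms, of "0::nat" 1 2] by simp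

text \<open>\<open>loops\<close> counts classes contained in the infinite set
  \<open>range Middle\<close>; since edges meet only the middle points 1 to q, these are the
  components inside a finite layer.\<close>

lemma loops_comps:
  assumes f: "f \<in> brauer_diagrams q s" and g: "g \<in> brauer_diagrams p q" and d: "distinct [a, b, c]"
  shows "loops f g = card (comps (lrel a b g \<union> lrel b c f) ({b} \<times> {1..q}))"
proof -
  let ?m = "stack_layers a b c" and ?R = "(lrel a b g \<union> lrel b c f)\<^sup>*"
  let ?L = "{C. \<exists>v\<in>\<Union>(stack_edges f g). C = stack_conn f g `` {v} \<and> C \<subseteq> range Middle}"
  have ac: "a \<noteq> c" "a \<noteq> b" "b \<noteq> c" using d by auto
  note ml = matching_lrel[OF ac(2) g] matching_lrel[OF ac(3) f]
  have F: "Field (lrel a b g \<union> lrel b c f) = {a} \<times> {1..p} \<union> {b} \<times> {1..q} \<union> {c} \<times> {1..s}"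
    using ml[THEN matching_Field] by auto
  have inj: "inj ?m" using inj_stack_layers[OF d] .
  have V1: "\<Union>((\<lambda>e. h ` e) ` D) = h ` points p' q'" if "D \<in> brauer_diagrams p' q'" for h :: "point \<Rightarrow> vertex" and D p' q'
    using that unfolding brauer_diagrams_def partition_on_def by blast
  have V: "\<Union>(stack_edges f g) = upper_vertex ` points p q \<union> lower_vertex ` points q s"
    unfolding stack_edges_def Union_Un_distrib V1[OF f] V1[OF g] ..
  have img: "?m ` (stack_conn f g `` {v}) = ?R `` {?m v}" if "v \<in> \<Union>(stack_edges f g)" for v
  proof (intro equalityI subsetI)
    fix w assume "w \<in> ?m ` (stack_conn f g `` {v})"
    then show "w \<in> ?R `` {?m v}" using stack_conn_layers[OF f g d] by auto
  next
    fix w assume w: "w \<in> ?R `` {?m v}"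
    have "\<exists>u. w = ?m u"
    proof (cases "w = ?m v")
      case False
      then have "w \<in> {a} \<times> {1..p} \<union> {b} \<times> {1..q} \<union> {c} \<times> {1..s}"
        using w rtrancl_Field[of "?m v" w "lrel a b g \<union> lrel b c f"] F by auto
      then show ?thesis by (rule stack_layers_surj)
    qed blast
    then show "w \<in> ?m ` (stack_conn f g `` {v})" using w stack_conn_layers[OF f g d] by auto
  qed
  have "bij_betw ((`) ?m) ?L (comps (lrel a b g \<union> lrel b c f) ({b} \<times> {1..q}))"
    unfolding bij_betw_def
  proof
    show "inj_on ((`) ?m) ?L" using inj by (auto intro!: inj_onI simp: inj_image_eq_iff)
    show "(`) ?m ` ?L = comps (lrel a b g \<union> lrel b c f) ({b} \<times> {1..q})"
    proof (intro equalityI subsetI)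
      fix E assume "E \<in> (`) ?m ` ?L"
      then obtain v where v: "v \<in> \<Union>(stack_edges f g)" "E = ?R `` {?m v}" "stack_conn f g `` {v} \<subseteq> range Middle"
        using img by auto
      have "v \<in> stack_conn f g `` {v}" by (simp add: stack_conn_def)
      then obtain i where i: "v = Middle i" using v(3) by blast
      have iq: "i \<in> {1..q}" using v(1) unfolding V i by (auto simp: points_def)
      have "E \<subseteq> {b} \<times> UNIV"
      proof
        fix w assume "w \<in> E"
        then obtain u where u: "u \<in> stack_conn f g `` {v}" "w = ?m u" unfolding v(2) img[OF v(1), symmetric] by blast
        then obtain j where "u = Middle j" using v(3) by blast
        then show "w \<in> {b} \<times> UNIV" using u(2) by simp
      qed
      moreover have "E \<subseteq> insert (?m v) ({a} \<times> {1..p} \<union> {b} \<times> {1..q} \<union> {c} \<times> {1..s})"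
      proof
        fix w assume "w \<in> E"
        then have "(?m v, w) \<in> ?R" unfolding v(2) by simp
        from rtrancl_Field[OF this]
        show "w \<in> insert (?m v) ({a} \<times> {1..p} \<union> {b} \<times> {1..q} \<union> {c} \<times> {1..s})"
          unfolding F[symmetric] by (elim disjE conjE) simp_all
      qed
      ultimately have "E \<subseteq> {b} \<times> {1..q}" using i iq ac by auto
      then show "E \<in> comps (lrel a b g \<union> lrel b c f) ({b} \<times> {1..q})"
        using v(2) i iq unfolding comps_def by auto
    next
      fix E assume "E \<in> comps (lrel a b g \<union> lrel b c f) ({b} \<times> {1..q})"
      then obtain i where i: "i \<in> {1..q}" "E = ?R `` {(b, i)}" "E \<subseteq> {b} \<times> {1..q}" by (auto simp: comps_def)
      let ?v = "Middle i"
      have v: "?v \<in> \<Union>(stack_edges f g)" unfolding V using i(1) by (force simp: points_def)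
      have E: "E = ?m ` (stack_conn f g `` {?v})" using img[OF v] i(2) by simp
      have "stack_conn f g `` {?v} \<subseteq> range Middle"
      proof
        fix u assume "u \<in> stack_conn f g `` {?v}"
        then have "?m u \<in> {b} \<times> {1..q}" using E i(3) by blast
        then show "u \<in> range Middle" using ac by (cases u) auto
      qed
      then show "E \<in> (`) ?m ` ?L" using v E by blast
    qed
  qed
  then show ?thesis unfolding loops_def by (rule bij_betw_same_card)
qed

text \<open>Composition is contraction to the outer layers. This lets a stack of three diagrams be
  contracted one inner layer at a time.\<close>

lemma contract_comp:
  assumes f: "f \<in> brauer_diagrams q s" and g: "g \<in> brauer_diagrams p q" and d: "distinct [a, b, c]"
  shows "contract (lrel a b g \<union> lrel b c f) ({a, c} \<times> UNIV) = lrel a c (diagram_comp f g)"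
proof -
  have inj: "inj (layers a c)" using d by (intro inj_layers) auto
  note X = range_layers[of a c, symmetric]
  show ?thesis
  proof (intro equalityI subrelI)
    fix u v assume "(u, v) \<in> contract (lrel a b g \<union> lrel b c f) ({a, c} \<times> UNIV)"
    then have uv: "u \<in> range (layers a c)" "v \<in> range (layers a c)" "u \<noteq> v" "(u, v) \<in> (lrel a b g \<union> lrel b c f)\<^sup>*"
      unfolding contract_def X by simp_all
    then obtain x y where xy: "u = layers a c x" "v = layers a c y" by blast
    then have "(x, y) \<in> rel (diagram_comp f g)"
      unfolding diagram_comp_props(1)[OF f g d] using uv by auto
    then show "(u, v) \<in> lrel a c (diagram_comp f g)"
      unfolding lrel_def xy by (intro image_eqI[of _ _ "(x, y)"]) simp_all
  next
    fix u v assume "(u, v) \<in> lrel a c (diagram_comp f g)"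
    then obtain x y where xy: "(x, y) \<in> rel (diagram_comp f g)" "u = layers a c x" "v = layers a c y"
      unfolding lrel_def by auto
    then have "x \<noteq> y" "(u, v) \<in> (lrel a b g \<union> lrel b c f)\<^sup>*"
      unfolding diagram_comp_props(1)[OF f g d] by simp_all
    then show "(u, v) \<in> contract (lrel a b g \<union> lrel b c f) ({a, c} \<times> UNIV)"
      unfolding contract_def X using xy injD[OF inj, of x y] by auto
  qed
qed

text \<open>Both bracketings arise from the stack of all three diagrams by contracting one of the two
  inner layers first; contracting a layer splits off exactly the loops lying inside it.\<close>

lemma diagram_comp_assoc:
  assumes f: "f \<in> brauer_diagrams s t" and g: "g \<in> brauer_diagrams q s" and h: "h \<in> brauer_diagrams p q"
  shows "diagram_comp (diagram_comp f g) h = diagram_comp f (diagram_comp g h)"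
    and "loops f g + loops (diagram_comp f g) h = loops g h + loops f (diagram_comp g h)"
proof -
  \<comment> \<open>Layer 0 is the top of h and layer 3 the bottom of f; \<open>Z\<close> and
    \<open>Y\<close> are the two glued layers in between.\<close>
  define H where "H = lrel 0 (1::nat) h"
  define G where "G = lrel 1 (2::nat) g"
  define F where "F = lrel 2 (3::nat) f"
  define Z where "Z = {1::nat} \<times> {1..q}"
  define Y where "Y = {2::nat} \<times> {1..s}"
  note fg = diagram_comp_closed[OF f g] and gh = diagram_comp_closed[OF g h]
  have FH: "Field H = {0} \<times> {1..p} \<union> Z" and FG: "Field G = Z \<union> Y" and FF: "Field F = Y \<union> {3} \<times> {1..t}"
    unfolding H_def G_def F_def Z_def Y_def
    using matching_lrel[OF _ h, of 0 "1::nat"] matching_lrel[OF _ g, of 1 "2::nat"] matching_lrel[OF _ f, of 2 "3::nat"]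
    by (auto dest!: matching_Field)
  have s: "sym H" "sym G" "sym F" by (simp_all add: H_def G_def F_def sym_lrel)
  have fin: "finite Z" "finite Y" by (simp_all add: Z_def Y_def)
  have c1: "contract (G \<union> F) ({1, 3} \<times> UNIV) = lrel 1 3 (diagram_comp f g)"
    unfolding G_def F_def by (rule contract_comp[OF f g]) simp
  have c2: "contract (H \<union> G) ({0, 2} \<times> UNIV) = lrel 0 2 (diagram_comp g h)"
    unfolding H_def G_def by (rule contract_comp[OF g h]) simp
  have A1: "Field (G \<union> F) \<subseteq> {1, 3} \<times> UNIV \<union> Y" "{1, 3} \<times> UNIV \<inter> Y = {}" "Field H \<inter> Y = {}" "Z \<inter> Y = {}"
    unfolding FH Field_Un FG FF by (auto simp: Z_def Y_def)
  have A2: "Field (H \<union> G) \<subseteq> {0, 2} \<times> UNIV \<union> Z" "{0, 2} \<times> UNIV \<inter> Z = {}" "Field F \<inter> Z = {}" "Y \<inter> Z = {}"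
    unfolding FF Field_Un FG FH by (auto simp: Z_def Y_def)
  let ?l = "layers 0 (3::nat)"
  have nY: "?l x \<notin> Y" "?l x \<notin> Z" for x by (cases x; simp add: Y_def Z_def)+
  have r1: "(?l x, ?l y) \<in> (lrel 0 1 h \<union> lrel 1 3 (diagram_comp f g))\<^sup>* \<longleftrightarrow> (?l x, ?l y) \<in> (H \<union> G \<union> F)\<^sup>*" for x y
    using rtrancl_contract(1)[OF A1(1-3) nY(1) nY(1), of x y] unfolding c1 H_def[symmetric]
    by (simp add: Un_ac)
  have r2: "(?l x, ?l y) \<in> (lrel 0 2 (diagram_comp g h) \<union> lrel 2 3 f)\<^sup>* \<longleftrightarrow> (?l x, ?l y) \<in> (H \<union> G \<union> F)\<^sup>*" for x y
    using rtrancl_contract(1)[OF A2(1-3) nY(2) nY(2), of x y] unfolding c2 F_def[symmetric]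
    by (simp add: Un_ac)
  have "rel (diagram_comp (diagram_comp f g) h) = rel (diagram_comp f (diagram_comp g h))"
    using diagram_comp_props(1)[OF fg h, of 0 1 "3::nat"] diagram_comp_props(1)[OF f gh, of 0 2 "3::nat"] r1 r2 by simp
  moreover have "D \<subseteq> E" if DE: "rel D = rel E" "D \<in> brauer_diagrams p t" for D E
  proof
    fix e assume e: "e \<in> D"
    obtain x y where xy: "e = {x, y}" "x \<noteq> y" using brauerD(1)[OF DE(2) e] by blast
    then have "(x, y) \<in> rel D" using e by (simp add: rel_iff)
    then show "e \<in> E" unfolding DE(1) using xy by (simp add: rel_iff)
  qed
  ultimately show "diagram_comp (diagram_comp f g) h = diagram_comp f (diagram_comp g h)"
    using diagram_comp_closed[OF fg h] diagram_comp_closed[OF f gh] by (intro equalityI) auto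
  have "loops f g + loops (diagram_comp f g) h = card (comps (G \<union> F) Y) + card (comps (lrel 0 1 h \<union> lrel 1 3 (diagram_comp f g)) Z)"
    using loops_comps[OF f g, of 1 2 "3::nat"] loops_comps[OF fg h, of 0 1 "3::nat"]
    by (simp add: G_def F_def Y_def Z_def)
  also have "\<dots> = card (comps (G \<union> F \<union> H) (Z \<union> Y))"
    using card_comps_contract[OF A1(1-3) sym_Un[OF s(2,3)] s(1) A1(4) fin] unfolding c1 H_def[symmetric]
    by (simp add: Un_ac)
  also have "\<dots> = card (comps (H \<union> G \<union> F) (Y \<union> Z))" by (simp add: Un_ac)
  also have "\<dots> = card (comps (H \<union> G) Z) + card (comps (lrel 0 2 (diagram_comp g h) \<union> lrel 2 3 f) Y)"
    using card_comps_contract[OF A2(1-3) sym_Un[OF s(1,2)] s(3) A2(4) fin(2,1)] unfolding c2 F_def[symmetric]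
    by simp
  also have "\<dots> = loops g h + loops f (diagram_comp g h)"
    using loops_comps[OF g h, of 0 1 "2::nat"] loops_comps[OF f gh, of 0 2 "3::nat"]
    by (simp add: H_def G_def Y_def Z_def)
  finally show "loops f g + loops (diagram_comp f g) h = loops g h + loops f (diagram_comp g h)" .
qed

section \<open>Short paths in a stack; upward, downward and level diagrams\<close>

lemma stack_upper: "{x, y} \<in> g \<Longrightarrow> (upper_vertex x, upper_vertex y) \<in> stack_conn f g"
  unfolding stack_conn_def
  by (rule r_into_rtrancl) (auto simp: stack_edges_def intro!: bexI[of _ "upper_vertex ` {x, y}"] simp del: image_insert)

lemma stack_lower: "{x, y} \<in> f \<Longrightarrow> (lower_vertex x, lower_vertex y) \<in> stack_conn f g"
  unfolding stack_conn_def
  by (rule r_into_rtrancl) (auto simp: stack_edges_def intro!: bexI[of _ "lower_vertex ` {x, y}"] simp del: image_insert)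

lemma stack_trans: "(u, v) \<in> stack_conn f g \<Longrightarrow> (v, w) \<in> stack_conn f g \<Longrightarrow> (u, w) \<in> stack_conn f g"
  unfolding stack_conn_def by (rule rtrancl_trans)

lemma comp_memI: "(outer_vertex x, outer_vertex y) \<in> stack_conn f g \<Longrightarrow> x \<noteq> y \<Longrightarrow> {x, y} \<in> diagram_comp f g"
  unfolding diagram_comp_def by blast

lemma comp_TT: "{Top i, Top k} \<in> g \<Longrightarrow> i \<noteq> k \<Longrightarrow> {Top i, Top k} \<in> diagram_comp f g"
  using stack_upper[of "Top i" "Top k" g f] by (intro comp_memI) simp_all

lemma comp_BB: "{Bot j, Bot l} \<in> f \<Longrightarrow> j \<noteq> l \<Longrightarrow> {Bot j, Bot l} \<in> diagram_comp f g"
  using stack_lower[of "Bot j" "Bot l" f g] by (intro comp_memI) simp_all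

lemma comp_TB: "{Top i, Bot a} \<in> g \<Longrightarrow> {Top a, Bot j} \<in> f \<Longrightarrow> {Top i, Bot j} \<in> diagram_comp f g"
  using stack_trans[OF stack_upper[of "Top i" "Bot a" g f], of "Lower j"] stack_lower[of "Top a" "Bot j" f g]
  by (intro comp_memI) simp_all

lemma comp_TT_lower:
  assumes "{Top i, Bot a} \<in> g" "{Top a, Top b} \<in> f" "{Top k, Bot b} \<in> g" "i \<noteq> k"
  shows "{Top i, Top k} \<in> diagram_comp f g"
proof (rule comp_memI)
  have "(Upper i, Middle a) \<in> stack_conn f g" using stack_upper[OF assms(1), of f] by simp
  moreover have "(Middle a, Middle b) \<in> stack_conn f g" using stack_lower[OF assms(2), of g] by simp
  moreover have "(Middle b, Upper k) \<in> stack_conn f g"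
    using stack_upper[of "Bot b" "Top k" g f] assms(3) by (simp add: insert_commute)
  ultimately show "(outer_vertex (Top i), outer_vertex (Top k)) \<in> stack_conn f g"
    by (metis outer_vertex.simps(1) stack_trans)
qed (use assms(4) in simp)

lemma comp_BB_upper:
  assumes "{Top a, Bot j} \<in> f" "{Bot a, Bot b} \<in> g" "{Top b, Bot l} \<in> f" "j \<noteq> l"
  shows "{Bot j, Bot l} \<in> diagram_comp f g"
proof (rule comp_memI)
  have "(Lower j, Middle a) \<in> stack_conn f g"
    using stack_lower[of "Bot j" "Top a" f g] assms(1) by (simp add: insert_commute)
  moreover have "(Middle a, Middle b) \<in> stack_conn f g" using stack_upper[OF assms(2), of f] by simp
  moreover have "(Middle b, Lower l) \<in> stack_conn f g" using stack_lower[OF assms(3), of g] by simp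
  ultimately show "(outer_vertex (Bot j), outer_vertex (Bot l)) \<in> stack_conn f g"
    by (metis outer_vertex.simps(2) stack_trans)
qed (use assms(4) in simp)

lemma brauer_cases:
  assumes "E \<in> brauer_diagrams p q" "e \<in> E"
  obtains (TT) i k where "e = {Top i, Top k}" "i \<noteq> k"
  | (TB) i j where "e = {Top i, Bot j}"
  | (BB) j l where "e = {Bot j, Bot l}" "j \<noteq> l"
proof -
  obtain x y where xy: "e = {x, y}" "x \<noteq> y" using brauerD(1)[OF assms] by blast
  show thesis
  proof (cases x)
    case (Top i)
    then show thesis using xy TT TB by (cases y) auto
  next
    case (Bot j)
    then show thesis using xy TB[of _ j] BB by (cases y) (auto simp: insert_commute)
  qed
qed

text \<open>By \<open>brauer_eqI\<close> it suffices to find each pair of E in the composite, and a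
  pair is an arc at the top, a through strand or an arc at the bottom.\<close>

lemma diagram_comp_eqI:
  assumes f: "f \<in> brauer_diagrams q s" and g: "g \<in> brauer_diagrams p q" and E: "E \<in> brauer_diagrams p s"
    and "\<And>i k. {Top i, Top k} \<in> E \<Longrightarrow> i \<noteq> k \<Longrightarrow> {Top i, Top k} \<in> diagram_comp f g"
    and "\<And>i j. {Top i, Bot j} \<in> E \<Longrightarrow> {Top i, Bot j} \<in> diagram_comp f g"
    and "\<And>j l. {Bot j, Bot l} \<in> E \<Longrightarrow> j \<noteq> l \<Longrightarrow> {Bot j, Bot l} \<in> diagram_comp f g"
  shows "diagram_comp f g = E"
proof (rule brauer_eqI[OF E diagram_comp_closed[OF f g], symmetric], rule subsetI)
  fix e assume e: "e \<in> E"
  from E e show "e \<in> diagram_comp f g"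
    by (cases rule: brauer_cases) (use assms(4-6) e in auto)
qed

lemma up_brauer: "f \<in> up_diagrams p q \<Longrightarrow> f \<in> brauer_diagrams p q"
  and down_brauer: "f \<in> down_diagrams p q \<Longrightarrow> f \<in> brauer_diagrams p q"
  and level_brauer: "f \<in> level_diagrams p q \<Longrightarrow> f \<in> brauer_diagrams p q"
  and level_up: "f \<in> level_diagrams p q \<Longrightarrow> f \<in> up_diagrams p q"
  and level_down: "f \<in> level_diagrams p q \<Longrightarrow> f \<in> down_diagrams p q"
  and levelI: "f \<in> up_diagrams p q \<Longrightarrow> f \<in> down_diagrams p q \<Longrightarrow> f \<in> level_diagrams p q"
  and mono_up: "f \<in> mono_up_diagrams p q \<Longrightarrow> f \<in> up_diagrams p q"
  by (simp_all add: up_diagrams_def down_diagrams_def level_diagrams_def is_level_def mono_up_diagrams_def)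

lemma finite_diagrams [simp]:
  "finite (up_diagrams p q)" "finite (down_diagrams p q)" "finite (level_diagrams p q)" "finite (mono_up_diagrams p q)"
proof -
  show "finite (up_diagrams p q)" "finite (down_diagrams p q)" "finite (level_diagrams p q)"
    by (rule finite_subset[OF _ finite_brauer[of p q]]; use up_brauer down_brauer level_brauer in blast)+
  then show "finite (mono_up_diagrams p q)" using finite_subset[of "mono_up_diagrams p q" "up_diagrams p q"] mono_up by blast
qed

lemma upE:
  assumes f: "f \<in> up_diagrams p q" and i: "i \<in> {1..p}"
  obtains j where "j \<in> {1..q}" "{Top i, Bot j} \<in> f"
proof -
  note fb = brauerD[OF up_brauer[OF f]]
  obtain y where y: "{Top i, y} \<in> f" using fb(6)[of "Top i"] i by auto
  show thesis
  proof (cases y)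
    case (Top k)
    then show thesis using f fb(4)[OF y] y by (auto simp: up_diagrams_def is_upward_def)
  next
    case (Bot j)
    then show thesis using that y fb(3)[OF y] by auto
  qed
qed

lemma downE:
  assumes f: "f \<in> down_diagrams p q" and j: "j \<in> {1..q}"
  obtains i where "i \<in> {1..p}" "{Top i, Bot j} \<in> f"
proof -
  note fb = brauerD[OF down_brauer[OF f]]
  obtain y where y: "{Bot j, y} \<in> f" using fb(6)[of "Bot j"] j by auto
  show thesis
  proof (cases y)
    case (Bot k)
    then show thesis using f fb(4)[OF y] y by (auto simp: down_diagrams_def is_downward_def)
  next
    case (Top i)
    then show thesis using that y fb(3)[OF y] by (auto simp: insert_commute)
  qed
qed

lemma upI:
  assumes "f \<in> brauer_diagrams p q" "\<And>i. i \<in> {1..p} \<Longrightarrow> \<exists>j. {Top i, Bot j} \<in> f"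
  shows "f \<in> up_diagrams p q"
proof -
  have False if "{Top i, Top k} \<in> f" for i k
  proof -
    have "i \<in> {1..p}" using brauerD(2)[OF assms(1) that] by simp
    then obtain j where "{Top i, Bot j} \<in> f" using assms(2) by blast
    then show False using brauerD(5)[OF assms(1) that] by blast
  qed
  then show ?thesis using assms(1) by (auto simp: up_diagrams_def is_upward_def)
qed

lemma downI:
  assumes "f \<in> brauer_diagrams p q" "\<And>j. j \<in> {1..q} \<Longrightarrow> \<exists>i. {Top i, Bot j} \<in> f"
  shows "f \<in> down_diagrams p q"
proof -
  have False if "{Bot j, Bot l} \<in> f" for j l
  proof -
    have "j \<in> {1..q}" using brauerD(2)[OF assms(1) that] by simp
    then obtain i where "{Bot j, Top i} \<in> f" using assms(2) by (auto simp: insert_commute)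
    then show False using brauerD(5)[OF assms(1) that] by blast
  qed
  then show ?thesis using assms(1) by (auto simp: down_diagrams_def is_downward_def)
qed

lemma up_comp:
  assumes f: "f \<in> up_diagrams q s" and g: "g \<in> up_diagrams p q"
  shows "diagram_comp f g \<in> up_diagrams p s"
proof (rule upI[OF diagram_comp_closed[OF up_brauer[OF f] up_brauer[OF g]]])
  fix i assume "i \<in> {1..p}"
  then obtain a where a: "a \<in> {1..q}" "{Top i, Bot a} \<in> g" using upE[OF g] by blast
  then obtain j where "{Top a, Bot j} \<in> f" using upE[OF f] by blast
  then show "\<exists>j. {Top i, Bot j} \<in> diagram_comp f g" using comp_TB a by blast
qed

lemma down_comp:
  assumes f: "f \<in> down_diagrams q s" and g: "g \<in> down_diagrams p q"
  shows "diagram_comp f g \<in> down_diagrams p s"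
proof (rule downI[OF diagram_comp_closed[OF down_brauer[OF f] down_brauer[OF g]]])
  fix j assume "j \<in> {1..s}"
  then obtain a where a: "a \<in> {1..q}" "{Top a, Bot j} \<in> f" using downE[OF f] by blast
  then obtain i where "{Top i, Bot a} \<in> g" using downE[OF g] by blast
  then show "\<exists>i. {Top i, Bot j} \<in> diagram_comp f g" using comp_TB a by blast
qed

lemma level_comp: "f \<in> level_diagrams q s \<Longrightarrow> g \<in> level_diagrams p q \<Longrightarrow> diagram_comp f g \<in> level_diagrams p s"
  by (rule levelI[OF up_comp[OF level_up level_up] down_comp[OF level_down level_down]])

section \<open>Identity diagrams and flips\<close>

lemma id_brauer: "id_diagram p \<in> brauer_diagrams p p"
proof -
  have "partition_on (points p p) (id_diagram p)"
    by (rule partition_onI) (auto simp: id_diagram_def points_def disjnt_def)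
  then show ?thesis by (auto simp: brauer_diagrams_def id_diagram_def)
qed

lemma id_mem: "i \<in> {1..p} \<Longrightarrow> {Top i, Bot i} \<in> id_diagram p"
  by (simp add: id_diagram_def)

lemma id_iff:
  "{Top i, Bot j} \<in> id_diagram p \<longleftrightarrow> i = j \<and> i \<in> {1..p}"
  "{Top i, Top k} \<notin> id_diagram p" "{Bot i, Bot k} \<notin> id_diagram p"
proof -
  show "{Top i, Bot j} \<in> id_diagram p \<longleftrightarrow> i = j \<and> i \<in> {1..p}"
  proof
    assume "{Top i, Bot j} \<in> id_diagram p"
    then obtain k where "k \<in> {1..p}" "{Top i, Bot j} = {Top k, Bot k}" unfolding id_diagram_def by blast
    then show "i = j \<and> i \<in> {1..p}" by (simp add: doubleton_eq_iff)
  qed (simp add: id_mem)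
qed (simp_all add: id_diagram_def image_iff doubleton_eq_iff)

lemma id_level: "id_diagram p \<in> level_diagrams p p"
  using upI[OF id_brauer] downI[OF id_brauer] id_mem by (intro levelI) blast+

lemma brauer_TB: "D \<in> brauer_diagrams p q \<Longrightarrow> {Top i, Bot j} \<in> D \<Longrightarrow> i \<in> {1..p} \<and> j \<in> {1..q}"
  and brauer_TT: "D \<in> brauer_diagrams p q \<Longrightarrow> {Top i, Top k} \<in> D \<Longrightarrow> i \<in> {1..p} \<and> k \<in> {1..p}"
  and brauer_BB: "D \<in> brauer_diagrams p q \<Longrightarrow> {Bot j, Bot l} \<in> D \<Longrightarrow> j \<in> {1..q} \<and> l \<in> {1..q}"
  using brauerD(2,3) points_iff by metis+

lemma id_comp_left: "g \<in> brauer_diagrams p q \<Longrightarrow> diagram_comp (id_diagram q) g = g"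
proof (rule diagram_comp_eqI[OF id_brauer])
  assume g: "g \<in> brauer_diagrams p q"
  show "{Top i, Bot j} \<in> diagram_comp (id_diagram q) g" if "{Top i, Bot j} \<in> g" for i j
    using comp_TB[OF that id_mem] brauer_TB[OF g that] by blast
  show "{Bot j, Bot l} \<in> diagram_comp (id_diagram q) g" if "{Bot j, Bot l} \<in> g" "j \<noteq> l" for j l
    using comp_BB_upper[OF id_mem that(1) id_mem that(2)] brauer_BB[OF g that(1)] by blast
qed (auto intro: comp_TT)

lemma id_comp_right: "f \<in> brauer_diagrams p q \<Longrightarrow> diagram_comp f (id_diagram p) = f"
proof (rule diagram_comp_eqI[OF _ id_brauer])
  assume f: "f \<in> brauer_diagrams p q"
  show "{Top i, Bot j} \<in> diagram_comp f (id_diagram p)" if "{Top i, Bot j} \<in> f" for i j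
    using comp_TB[OF id_mem that] brauer_TB[OF f that] by blast
  show "{Top i, Top k} \<in> diagram_comp f (id_diagram p)" if "{Top i, Top k} \<in> f" "i \<noteq> k" for i k
    using comp_TT_lower[OF id_mem that(1) id_mem that(2)] brauer_TT[OF f that(1)] by blast
qed (auto intro: comp_BB)

lemma flip_point_flip [simp]: "flip_point (flip_point x) = x"
  by (cases x) auto

lemma inj_flip_point: "inj flip_point"
  by (rule injI) (metis flip_point_flip)

lemma flip_flip [simp]: "flip_diagram (flip_diagram D) = D"
  by (simp add: flip_diagram_def image_image)

lemma flip_mem [simp]: "{flip_point x, flip_point y} \<in> flip_diagram D \<longleftrightarrow> {x, y} \<in> D"
proof
  have *: "{flip_point x, flip_point y} \<in> flip_diagram D" if "{x, y} \<in> D" for x y D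
    unfolding flip_diagram_def using that by (intro image_eqI[of _ _ "{x, y}"]) simp_all
  show "{x, y} \<in> D \<Longrightarrow> {flip_point x, flip_point y} \<in> flip_diagram D" by (rule *)
  show "{flip_point x, flip_point y} \<in> flip_diagram D \<Longrightarrow> {x, y} \<in> D"
    using *[of "flip_point x" "flip_point y" "flip_diagram D"] by simp
qed

lemma flip_mem' [simp]:
  "{Top i, Bot j} \<in> flip_diagram D \<longleftrightarrow> {Top j, Bot i} \<in> D"
  "{Bot i, Top j} \<in> flip_diagram D \<longleftrightarrow> {Top i, Bot j} \<in> D"
  "{Top i, Top k} \<in> flip_diagram D \<longleftrightarrow> {Bot i, Bot k} \<in> D"
  "{Bot i, Bot k} \<in> flip_diagram D \<longleftrightarrow> {Top i, Top k} \<in> D"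
  using flip_mem[of "Bot i" "Top j" D] flip_mem[of "Top i" "Bot j" D] flip_mem[of "Bot i" "Bot k" D]
    flip_mem[of "Top i" "Top k" D]
  by (simp_all add: insert_commute)

lemma flip_brauer: "D \<in> brauer_diagrams p q \<Longrightarrow> flip_diagram D \<in> brauer_diagrams q p"
proof -
  assume D: "D \<in> brauer_diagrams p q"
  have "flip_point ` points p q = points q p"
    unfolding points_def image_Un image_image flip_point.simps by auto
  moreover have "partition_on (flip_point ` points p q) (flip_diagram D)"
  proof -
    have P: "partition_on (points p q) D" using D by (simp add: brauer_diagrams_def)
    then have "{} \<notin> D" by (simp add: partition_on_def)
    then have "flip_diagram D = (`) flip_point ` D - {{}}" by (auto simp: flip_diagram_def)
    then show ?thesis
      using partition_on_inj_image[OF P inj_on_subset[OF inj_flip_point subset_UNIV]] by simp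
  qed
  moreover have "card e = 2" if e: "e \<in> flip_diagram D" for e
  proof -
    obtain e' where e': "e' \<in> D" "e = flip_point ` e'" using e unfolding flip_diagram_def by blast
    then have "card e' = 2" using D by (simp add: brauer_diagrams_def)
    then show ?thesis using card_image[OF inj_on_subset[OF inj_flip_point subset_UNIV], of e'] e'(2) by simp
  qed
  ultimately show ?thesis by (simp add: brauer_diagrams_def)
qed

lemma flip_up:
  assumes D: "D \<in> up_diagrams p q"
  shows "flip_diagram D \<in> down_diagrams q p"
proof (rule downI[OF flip_brauer[OF up_brauer[OF D]]])
  fix j assume "j \<in> {1..p}"
  then obtain l where "{Top j, Bot l} \<in> D" by (rule upE[OF D])
  then have "{Top l, Bot j} \<in> flip_diagram D" by simp
  then show "\<exists>i. {Top i, Bot j} \<in> flip_diagram D" ..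
qed

lemma flip_down:
  assumes D: "D \<in> down_diagrams p q"
  shows "flip_diagram D \<in> up_diagrams q p"
proof (rule upI[OF flip_brauer[OF down_brauer[OF D]]])
  fix i assume "i \<in> {1..q}"
  then obtain l where "{Top l, Bot i} \<in> D" by (rule downE[OF D])
  then have "{Top i, Bot l} \<in> flip_diagram D" by simp
  then show "\<exists>j. {Top i, Bot j} \<in> flip_diagram D" ..
qed

lemma flip_level: "D \<in> level_diagrams p q \<Longrightarrow> flip_diagram D \<in> level_diagrams q p"
  by (rule levelI[OF flip_down[OF level_down] flip_up[OF level_up]])

fun flip_vertex :: "vertex \<Rightarrow> vertex" where
  "flip_vertex (Upper i) = Lower i"
| "flip_vertex (Middle i) = Middle i"
| "flip_vertex (Lower i) = Upper i"

lemma flip_vertex_simps: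
  "flip_vertex (upper_vertex x) = lower_vertex (flip_point x)"
  "flip_vertex (lower_vertex x) = upper_vertex (flip_point x)"
  "flip_vertex (outer_vertex x) = outer_vertex (flip_point x)"
  by (cases x; simp)+

lemma stack_conn_flip: "(u, v) \<in> stack_conn f g \<Longrightarrow>
    (flip_vertex u, flip_vertex v) \<in> stack_conn (flip_diagram g) (flip_diagram f)"
  unfolding stack_conn_def
proof (induction rule: rtrancl_induct)
  case (step v w)
  then obtain e where e: "e \<in> stack_edges f g" "v \<in> e" "w \<in> e" by auto
  have "flip_vertex ` e \<in> stack_edges (flip_diagram g) (flip_diagram f)"
    using e(1) unfolding stack_edges_def
  proof (elim UnE imageE)
    fix x assume x: "e = upper_vertex ` x" "x \<in> g"
    have "flip_vertex ` e = lower_vertex ` (flip_point ` x)"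
      unfolding x(1) image_image flip_vertex_simps ..
    then show "flip_vertex ` e \<in> (`) upper_vertex ` flip_diagram f \<union> (`) lower_vertex ` flip_diagram g"
      using x(2) unfolding flip_diagram_def by blast
  next
    fix x assume x: "e = lower_vertex ` x" "x \<in> f"
    have "flip_vertex ` e = upper_vertex ` (flip_point ` x)"
      unfolding x(1) image_image flip_vertex_simps ..
    then show "flip_vertex ` e \<in> (`) upper_vertex ` flip_diagram f \<union> (`) lower_vertex ` flip_diagram g"
      using x(2) unfolding flip_diagram_def by blast
  qed
  then have "(flip_vertex v, flip_vertex w) \<in> {(u, v). \<exists>e\<in>stack_edges (flip_diagram g) (flip_diagram f). u \<in> e \<and> v \<in> e}"
    using e(2,3) by blast
  with step.IH show ?case by (rule rtrancl_into_rtrancl)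
qed simp

text \<open>Reflecting the stack in its middle layer carries paths to paths, and one inclusion is
  enough by \<open>brauer_eqI\<close>.\<close>

lemma flip_comp:
  assumes f: "f \<in> brauer_diagrams q s" and g: "g \<in> brauer_diagrams p q"
  shows "flip_diagram (diagram_comp f g) = diagram_comp (flip_diagram g) (flip_diagram f)"
proof (rule brauer_eqI[OF flip_brauer[OF diagram_comp_closed[OF f g]] diagram_comp_closed[OF flip_brauer[OF g] flip_brauer[OF f]]], rule subsetI)
  fix e assume "e \<in> flip_diagram (diagram_comp f g)"
  then obtain x y where "e = {flip_point x, flip_point y}" "x \<noteq> y" "(outer_vertex x, outer_vertex y) \<in> stack_conn f g"
    unfolding flip_diagram_def diagram_comp_def by auto
  then show "e \<in> diagram_comp (flip_diagram g) (flip_diagram f)"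
    using stack_conn_flip[of "outer_vertex x" "outer_vertex y" f g] inj_flip_point
    by (auto simp: flip_vertex_simps inj_eq intro!: comp_memI)
qed

text \<open>Each through strand of f meets its own mirror image. The arcs of f close up with theirs
  into loops, which \<open>diagram_comp\<close> discards, so this is a cancellation of diagrams and
  not of morphisms.\<close>

lemma flip_comp_up: "f \<in> up_diagrams p q \<Longrightarrow> diagram_comp (flip_diagram f) f = id_diagram p"
proof (rule diagram_comp_eqI)
  assume f: "f \<in> up_diagrams p q"
  show "flip_diagram f \<in> brauer_diagrams q p" "f \<in> brauer_diagrams p q" "id_diagram p \<in> brauer_diagrams p p"
    using f up_brauer flip_brauer id_brauer by blast+
  show "{Top i, Bot j} \<in> diagram_comp (flip_diagram f) f" if "{Top i, Bot j} \<in> id_diagram p" for i j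
  proof -
    have ij: "i = j" "i \<in> {1..p}" using that id_iff(1) by simp_all
    then obtain k where "{Top i, Bot k} \<in> f" using upE[OF f] by blast
    then show ?thesis using comp_TB[of i k f i "flip_diagram f"] ij by simp
  qed
qed (simp_all add: id_iff)

lemma comp_flip_down: "g \<in> down_diagrams p q \<Longrightarrow> diagram_comp g (flip_diagram g) = id_diagram q"
  using flip_comp_up[OF flip_down, of g p q] by simp

text \<open>If f is upward, every middle point has a strand to the bottom; if g is downward, every
  middle point has one to the top. Either way no component stays in the middle.\<close>

lemma loops_eq_0:
  assumes f: "f \<in> brauer_diagrams q s" and g: "g \<in> brauer_diagrams p q"
    and ud: "f \<in> up_diagrams q s \<or> g \<in> down_diagrams p q"
  shows "loops f g = 0"
proof -
  have "False" if v: "v \<in> \<Union>(stack_edges f g)" and C: "stack_conn f g `` {v} \<subseteq> range Middle" for v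
  proof -
    have "(v, v) \<in> stack_conn f g" by (simp add: stack_conn_def)
    then obtain a where a: "v = Middle a" using C by blast
    have V: "\<Union>((\<lambda>e. h ` e) ` D) = h ` points p' q'" if "D \<in> brauer_diagrams p' q'" for h :: "point \<Rightarrow> vertex" and D p' q'
      using that unfolding brauer_diagrams_def partition_on_def by blast
    have "v \<in> upper_vertex ` points p q \<union> lower_vertex ` points q s"
      using v unfolding stack_edges_def Union_Un_distrib V[OF f] V[OF g] .
    then have aq: "a \<in> {1..q}" unfolding a by (auto simp: points_def)
    show False
      using ud
    proof
      assume "f \<in> up_diagrams q s"
      then obtain j where "{Top a, Bot j} \<in> f" using upE[OF _ aq] by blast
      then have "(v, Lower j) \<in> stack_conn f g" using stack_lower[of "Top a" "Bot j" f g] a by simp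
      then show False using C by blast
    next
      assume "g \<in> down_diagrams p q"
      then obtain i where "{Top i, Bot a} \<in> g" using downE[OF _ aq] by blast
      then have "(v, Upper i) \<in> stack_conn f g"
        using stack_upper[of "Bot a" "Top i" g f] a by (simp add: insert_commute)
      then show False using C by blast
    qed
  qed
  then have "{C. \<exists>v\<in>\<Union>(stack_edges f g). C = stack_conn f g `` {v} \<and> C \<subseteq> range Middle} = {}" by blast
  then show ?thesis unfolding loops_def by (simp only: card.empty)
qed

lemma brauer_even: "D \<in> brauer_diagrams p q \<Longrightarrow> even (p + q)"
proof -
  assume D: "D \<in> brauer_diagrams p q"
  then have P: "partition_on (points p q) D" and c: "\<And>e. e \<in> D \<Longrightarrow> card e = 2" by (auto simp: brauer_diagrams_def)
  have "2 * card D = card (\<Union>D)"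
    using P c finite_elements[OF finite_points P]
    by (intro card_partition) (auto simp: partition_on_def disjoint_def)
  also have "\<Union>D = points p q" using P by (simp add: partition_on_def)
  also have "card (points p q) = p + q"
    unfolding points_def by (subst card_Un_disjoint) (auto simp: card_image inj_on_def)
  finally show ?thesis by (metis dvd_triv_left)
qed

text \<open>The through strands inject the top points into the bottom points, and the parity comes
  from \<open>brauer_even\<close>.\<close>

lemma up_prec:
  assumes f: "f \<in> up_diagrams p q"
  shows "prec p q"
proof -
  have "\<exists>\<phi>. \<forall>i\<in>{1..p}. \<phi> i \<in> {1..q} \<and> {Top i, Bot (\<phi> i)} \<in> f"
    using upE[OF f] by (intro bchoice) blast
  then obtain \<phi> where \<phi>: "\<And>i. i \<in> {1..p} \<Longrightarrow> \<phi> i \<in> {1..q} \<and> {Top i, Bot (\<phi> i)} \<in> f" by blast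
  have "inj_on \<phi> {1..p}"
  proof (rule inj_onI)
    fix i k assume "i \<in> {1..p}" "k \<in> {1..p}" "\<phi> i = \<phi> k"
    then have "{Bot (\<phi> i), Top i} \<in> f" "{Bot (\<phi> i), Top k} \<in> f" using \<phi>[of i] \<phi>[of k] by (simp_all add: insert_commute)
    then show "i = k" using brauerD(5)[OF up_brauer[OF f]] by blast
  qed
  then have "card {1..p} \<le> card {1..q}" using \<phi> by (intro card_inj_on_le[of \<phi>]) auto
  then show ?thesis using brauer_even[OF up_brauer[OF f]] by (auto simp: prec_def)
qed

lemma down_prec: "f \<in> down_diagrams p q \<Longrightarrow> prec q p"
  using up_prec[OF flip_down] .

lemma level_eq: "f \<in> level_diagrams p q \<Longrightarrow> p = q"
  using up_prec[OF level_up] down_prec[OF level_down] by (fastforce simp: prec_def)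

section \<open>Factorization through monotone diagrams\<close>

lemma strict_mono_bij_unique:
  fixes \<phi> \<psi> :: "nat \<Rightarrow> nat"
  assumes \<phi>: "strict_mono_on {1..s} \<phi>" and \<psi>: "strict_mono_on {1..s} \<psi>" and eq: "\<phi> ` {1..s} = \<psi> ` {1..s}"
  shows "a \<in> {1..s} \<Longrightarrow> \<phi> a = \<psi> a"
proof (induction a rule: less_induct)
  case (less a)
  \<comment> \<open>At the first disagreement the smaller of the two values would have to be
    attained by the other function before or after a, and both are impossible. The functions are
    generalized so that the argument also applies with the roles exchanged.\<close>
  have *: False if m: "strict_mono_on {1..s} \<phi>" "strict_mono_on {1..s} \<psi>" "\<phi> ` {1..s} = \<psi> ` {1..s}"
    and IH: "\<And>b. b < a \<Longrightarrow> b \<in> {1..s} \<Longrightarrow> \<phi> b = \<psi> b" and lt: "\<phi> a < \<psi> a" for \<phi> \<psi> :: "nat \<Rightarrow> nat"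
  proof -
    obtain c where c: "c \<in> {1..s}" "\<phi> a = \<psi> c" using m(3) less.prems by blast
    consider "c < a" | "c = a" | "a < c" by linarith
    then show False
    proof cases
      case 1
      then show False using IH[OF 1 c(1)] c(2) strict_mono_onD[OF m(1) c(1) less.prems 1] by simp
    next
      case 3
      then show False using lt c(2) strict_mono_onD[OF m(2) less.prems c(1) 3] by simp
    qed (use lt c in simp)
  qed
  show ?case
    using *[OF \<phi> \<psi> eq less.IH] *[OF \<psi> \<phi> eq[symmetric]] less.IH by (metis nat_neq_iff)
qed

text \<open>Bottom ends of the through strands. Together with the bottom arcs this set determines a
  monotone upward diagram.\<close>

definition exits :: "diagram \<Rightarrow> nat set" where
  "exits D = {j. \<exists>i. {Top i, Bot j} \<in> D}"

lemma mono_up_strict: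
  assumes f: "f \<in> mono_up_diagrams s q"
  obtains \<phi> where "strict_mono_on {1..s} \<phi>" "\<phi> ` {1..s} = exits f" "\<And>a j. {Top a, Bot j} \<in> f \<longleftrightarrow> a \<in> {1..s} \<and> j = \<phi> a"
proof -
  note fu = mono_up[OF f]
  note fb = brauerD[OF up_brauer[OF fu]]
  have "\<exists>\<phi>. \<forall>i\<in>{1..s}. {Top i, Bot (\<phi> i)} \<in> f"
    using upE[OF fu] by (intro bchoice) blast
  then obtain \<phi> where \<phi>: "\<And>i. i \<in> {1..s} \<Longrightarrow> {Top i, Bot (\<phi> i)} \<in> f" by blast
  have iff: "{Top a, Bot j} \<in> f \<longleftrightarrow> a \<in> {1..s} \<and> j = \<phi> a" for a j
  proof
    assume a: "{Top a, Bot j} \<in> f"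
    then have "a \<in> {1..s}" using fb(2)[OF a] by simp
    then show "a \<in> {1..s} \<and> j = \<phi> a" using fb(5)[OF a \<phi>] by simp
  qed (use \<phi> in blast)
  have "strict_mono_on {1..s} \<phi>"
  proof (rule strict_mono_onI)
    fix a b assume ab: "a \<in> {1..s}" "b \<in> {1..s}" "a < b"
    have "(int a - int b) * (int (\<phi> a) - int (\<phi> b)) > 0"
      using f \<phi>[OF ab(1)] \<phi>[OF ab(2)] ab(3)
      unfolding mono_up_diagrams_def is_monotone_def by (simp add: doubleton_eq_iff)
    then show "\<phi> a < \<phi> b" using ab(3) by (simp add: zero_less_mult_iff)
  qed
  moreover have "\<phi> ` {1..s} = exits f" unfolding exits_def iff by auto
  ultimately show thesis using that iff by blast
qed

text \<open>u is downward, so every through strand of f continues through u to the top; conversely a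
  bottom point on an arc of f stays on that arc in the composite.\<close>

lemma comp_up_down_TB:
  assumes f: "f \<in> up_diagrams s q" and u: "u \<in> down_diagrams p s"
  shows "exits (diagram_comp f u) = exits f"
proof (intro equalityI subsetI)
  note D = brauerD[OF diagram_comp_closed[OF up_brauer[OF f] down_brauer[OF u]]]
  fix j assume "j \<in> exits (diagram_comp f u)"
  then obtain i where i: "{Top i, Bot j} \<in> diagram_comp f u" by (auto simp: exits_def)
  then have "Bot j \<in> points s q" using D(3)[OF i] by simp
  then obtain y where y: "{Bot j, y} \<in> f" using brauerD(6)[OF up_brauer[OF f]] by blast
  show "j \<in> exits f"
  proof (cases y)
    case (Top a)
    then show ?thesis using y by (auto simp: exits_def insert_commute)
  next
    case (Bot l)
    then have "{Bot j, Bot l} \<in> diagram_comp f u" using comp_BB y brauerD(4)[OF up_brauer[OF f] y] by simp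
    moreover have "{Bot j, Top i} \<in> diagram_comp f u" using i by (simp add: insert_commute)
    ultimately show ?thesis using D(5) by blast
  qed
next
  fix j assume "j \<in> exits f"
  then obtain a where a: "{Top a, Bot j} \<in> f" by (auto simp: exits_def)
  then have "a \<in> {1..s}" using brauerD(2)[OF up_brauer[OF f] a] by simp
  then obtain i where "{Top i, Bot a} \<in> u" using downE[OF u] by blast
  then show "j \<in> exits (diagram_comp f u)" using comp_TB[OF _ a] by (auto simp: exits_def)
qed

text \<open>The composite shows the bottom arcs and the exits of f, and monotonicity leaves one way
  of ordering the exits. Once f is known, u is recovered by composing with
  \<open>flip_diagram f\<close>.\<close>

lemma factor_unique:
  assumes f: "f \<in> mono_up_diagrams s q" and u: "u \<in> down_diagrams p s"
    and f': "f' \<in> mono_up_diagrams s' q" and u': "u' \<in> down_diagrams p s'"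
    and eq: "diagram_comp f u = diagram_comp f' u'"
  shows "s = s'" "f = f'" "u = u'"
proof -
  note fu = mono_up[OF f] and fu' = mono_up[OF f']
  note fb = up_brauer[OF fu] and fb' = up_brauer[OF fu']
  have ex: "exits f = exits f'" using comp_up_down_TB[OF fu u] comp_up_down_TB[OF fu' u'] eq by simp
  obtain \<phi> where \<phi>: "strict_mono_on {1..s} \<phi>" "\<phi> ` {1..s} = exits f" "\<And>a j. {Top a, Bot j} \<in> f \<longleftrightarrow> a \<in> {1..s} \<and> j = \<phi> a"
    using mono_up_strict[OF f] by blast
  obtain \<psi> where \<psi>: "strict_mono_on {1..s'} \<psi>" "\<psi> ` {1..s'} = exits f'" "\<And>a j. {Top a, Bot j} \<in> f' \<longleftrightarrow> a \<in> {1..s'} \<and> j = \<psi> a"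
    using mono_up_strict[OF f'] by blast
  have "card (\<phi> ` {1..s}) = card {1..s}" "card (\<psi> ` {1..s'}) = card {1..s'}"
    by (rule card_image, rule strict_mono_on_imp_inj_on, fact)+
  then show s: "s = s'" using \<phi>(2) \<psi>(2) ex by simp
  have \<phi>\<psi>: "\<phi> a = \<psi> a" if "a \<in> {1..s}" for a
    using strict_mono_bij_unique[of s \<phi> \<psi> a] \<phi> \<psi> ex s that by simp
  have "f \<subseteq> f'"
  proof
    fix e assume e: "e \<in> f"
    from fb e show "e \<in> f'"
    proof (cases rule: brauer_cases)
      case (TT i k)
      then show ?thesis using fu e by (auto simp: up_diagrams_def is_upward_def)
    next
      case (TB i j)
      then show ?thesis using e \<phi>(3) \<psi>(3) \<phi>\<psi> s by simp
    next
      case (BB j l)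
      then have D: "{Bot j, Bot l} \<in> diagram_comp f' u'" using comp_BB e eq by metis
      have jl: "{Bot j, Bot l} \<in> f" using e BB by simp
      then have "Bot j \<in> points s' q" using brauerD(2)[OF fb jl] s by simp
      then obtain y where y: "{Bot j, y} \<in> f'" using brauerD(6)[OF fb'] by blast
      show ?thesis
      proof (cases y)
        case (Top a)
        then have "j \<in> exits f" using y ex by (auto simp: exits_def insert_commute)
        then obtain b where "{Bot j, Top b} \<in> f" by (auto simp: exits_def insert_commute)
        then show ?thesis using brauerD(5)[OF fb jl] by blast
      next
        case (Bot l')
        then have "{Bot j, Bot l'} \<in> diagram_comp f' u'"
          using comp_BB y brauerD(4)[OF fb' y] by simp
        from brauerD(5)[OF diagram_comp_closed[OF fb' down_brauer[OF u']] D this] have "l' = l" by simp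
        then show ?thesis using y Bot BB by simp
      qed
    qed
  qed
  then show ff: "f = f'" using brauer_eqI[OF fb _ \<open>f \<subseteq> f'\<close>] fb' s by simp
  have inv: "v = diagram_comp (flip_diagram g) (diagram_comp g v)"
    if "g \<in> up_diagrams t q" "v \<in> down_diagrams p t" for g v t
    using diagram_comp_assoc(1)[OF flip_brauer[OF up_brauer[OF that(1)]] up_brauer[OF that(1)] down_brauer[OF that(2)]]
      flip_comp_up[OF that(1)] id_comp_left[OF down_brauer[OF that(2)]] by simp
  show "u = u'" using inv[OF fu u] inv[OF fu' u'] eq ff by simp
qed

text \<open>s is the number of through strands of D. The diagram f keeps the bottom arcs of D and
  sends its top point a to the a-th exit in increasing order; u is what remains after cancelling f
  by its flip.\<close>

lemma factor_exists:
  assumes D: "D \<in> brauer_diagrams p q"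
  shows "\<exists>s f u. f \<in> mono_up_diagrams s q \<and> u \<in> down_diagrams p s \<and> D = diagram_comp f u"
proof -
  note Db = brauerD[OF D]
  define J where "J = exits D"
  have Jq: "J \<subseteq> {1..q}" using Db(3) by (fastforce simp: J_def exits_def)
  then have finJ: "finite J" by (rule finite_subset) simp
  define s where "s = card J"
  obtain h where h: "bij_betw h {..<s} J" "strict_mono_on {..<s} h"
    using ex_bij_betw_strict_mono_card[OF finJ] unfolding s_def by blast
  \<comment> \<open>The enumeration h counts from 0, the points of a diagram from 1.\<close>
  define \<phi> where "\<phi> a = h (a - 1)" for a
  have \<phi>J: "\<phi> ` {1..s} = J"
    using h(1) unfolding image_Suc_lessThan[symmetric] image_image \<phi>_def by (simp add: bij_betw_def)
  have \<phi>m: "strict_mono_on {1..s} \<phi>"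
  proof (rule strict_mono_onI)
    fix a b assume "a \<in> {1..s}" "b \<in> {1..s}" "a < b"
    then show "\<phi> a < \<phi> b" unfolding \<phi>_def by (intro strict_mono_onD[OF h(2)]) auto
  qed
  note \<phi>i = inj_onD[OF strict_mono_on_imp_inj_on[OF \<phi>m]]
  define R where "R = {(x, y). (\<exists>a\<in>{1..s}. {x, y} = {Top a, Bot (\<phi> a)}) \<or> (\<exists>j l. {x, y} = {Bot j, Bot l} \<and> {Bot j, Bot l} \<in> D)}"
  have BBJ: "j \<notin> J" if "{Bot j, Bot l} \<in> D" for j l
  proof
    assume "j \<in> J"
    then obtain i where "{Bot j, Top i} \<in> D" by (auto simp: J_def exits_def insert_commute)
    then show False using Db(5)[OF that] by blast
  qed
  have R1: "(Top a, y) \<in> R \<longleftrightarrow> a \<in> {1..s} \<and> y = Bot (\<phi> a)" for a y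
    unfolding R_def by (auto simp: doubleton_eq_iff)
  have R2: "(Bot j, y) \<in> R \<longleftrightarrow> (\<exists>a\<in>{1..s}. y = Top a \<and> j = \<phi> a) \<or> (\<exists>l. y = Bot l \<and> {Bot j, Bot l} \<in> D)" for j y
    unfolding R_def by (auto simp: doubleton_eq_iff insert_commute)
  have mR: "matching R (points s q)"
    unfolding matching_def
  proof (intro conjI)
    show "sym R" by (auto simp: sym_def R_def insert_commute)
    show "irrefl R"
      unfolding irrefl_def
    proof
      fix x show "(x, x) \<notin> R"
      proof (cases x)
        case (Bot j)
        have "{Bot j} \<notin> D" using Db(4)[of "Bot j" "Bot j"] by auto
        then show ?thesis using Bot by (simp add: R2)
      qed (simp add: R1)
    qed
    show "single_valued R"
    proof (rule single_valuedI)
      fix x y z assume xy: "(x, y) \<in> R" and xz: "(x, z) \<in> R"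
      show "y = z"
      proof (cases x)
        case (Top a)
        then show ?thesis using xy xz by (simp add: R1)
      next
        case (Bot j)
        have t: "j \<in> J \<and> (\<exists>a\<in>{1..s}. w = Top a \<and> j = \<phi> a) \<or> j \<notin> J \<and> (\<exists>l. w = Bot l \<and> {Bot j, Bot l} \<in> D)"
          if "(x, w) \<in> R" for w
          using that BBJ[of j] \<phi>J unfolding Bot R2 by blast
        show ?thesis
        proof (cases "j \<in> J")
          case True
          then obtain a b where "a \<in> {1..s}" "y = Top a" "j = \<phi> a" "b \<in> {1..s}" "z = Top b" "j = \<phi> b"
            using t[OF xy] t[OF xz] by blast
          then show ?thesis using \<phi>i[of a b] by simp
        next
          case False
          then have "{Bot j, y} \<in> D" "{Bot j, z} \<in> D" using t[OF xy] t[OF xz] by blast+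
          then show ?thesis by (rule Db(5))
        qed
      qed
    qed
    show "Domain R = points s q"
    proof (intro equalityI subsetI)
      fix x assume "x \<in> Domain R"
      then obtain y where y: "(x, y) \<in> R" by blast
      show "x \<in> points s q"
      proof (cases x)
        case (Top a)
        then show ?thesis using y by (simp add: R1)
      next
        case (Bot j)
        then consider "j \<in> J" | l where "{Bot j, Bot l} \<in> D" using y \<phi>J unfolding Bot R2 by blast
        then show ?thesis
        proof cases
          case 1
          then show ?thesis using Jq Bot by auto
        next
          case 2
          then show ?thesis using Db(2)[OF 2] Bot by simp
        qed
      qed
    next
      fix x assume x: "x \<in> points s q"
      show "x \<in> Domain R"
      proof (cases x)
        case (Top a)
        then show ?thesis using x by (intro DomainI[of x "Bot (\<phi> a)"]) (simp add: R1)
      next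
        case (Bot j)
        then have "Bot j \<in> points p q" using x by simp
        then obtain y where y: "{Bot j, y} \<in> D" using Db(6) by blast
        show ?thesis
        proof (cases y)
          case (Top i)
          then have "j \<in> J" using y by (auto simp: J_def exits_def insert_commute)
          then obtain a where "a \<in> {1..s}" "j = \<phi> a" using \<phi>J by blast
          then show ?thesis using Bot by (intro DomainI[of x "Top a"]) (simp add: R2)
        next
          case Bl: (Bot l)
          then show ?thesis using Bot y by (intro DomainI[of x "Bot l"]) (simp add: R2)
        qed
      qed
    qed
  qed
  define f where "f = {{x, y} | x y. (x, y) \<in> R}"
  have fb: "f \<in> brauer_diagrams s q" unfolding f_def by (rule brauerI[OF mR])
  have fmem: "{x, y} \<in> f \<longleftrightarrow> (x, y) \<in> R" for x y
  proof
    assume xy: "{x, y} \<in> f"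
    then obtain a b where ab: "{x, y} = {a, b}" "(a, b) \<in> R" unfolding f_def by blast
    then show "(x, y) \<in> R" using matchingD(1)[OF mR ab(2)] by (auto simp: doubleton_eq_iff)
  next
    assume "(x, y) \<in> R"
    then show "{x, y} \<in> f" unfolding f_def by blast
  qed
  have fTB: "{Top a, Bot j} \<in> f \<longleftrightarrow> a \<in> {1..s} \<and> j = \<phi> a" for a j by (simp add: fmem R1)
  have fBB: "{Bot j, Bot l} \<in> f \<longleftrightarrow> {Bot j, Bot l} \<in> D" for j l by (simp add: fmem R2)
  have fu: "f \<in> up_diagrams s q" by (rule upI[OF fb]) (use fTB in blast)
  have fm: "f \<in> mono_up_diagrams s q"
    unfolding mono_up_diagrams_def is_monotone_def
  proof (intro CollectI conjI fu allI impI, elim conjE)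
    fix i j k l assume "{Top i, Bot j} \<in> f" "{Top k, Bot l} \<in> f" "{Top i, Bot j} \<noteq> {Top k, Bot l}"
    then have ik: "i \<in> {1..s}" "k \<in> {1..s}" "j = \<phi> i" "l = \<phi> k" "i \<noteq> k" by (auto simp: fTB)
    then show "0 < (int i - int k) * (int j - int l)"
      using strict_mono_onD[OF \<phi>m, of i k] strict_mono_onD[OF \<phi>m, of k i]
      by (cases "i < k") (auto simp: zero_less_mult_iff)
  qed
  define u where "u = diagram_comp (flip_diagram f) D"
  have ub: "u \<in> brauer_diagrams p s" unfolding u_def by (rule diagram_comp_closed[OF flip_brauer[OF fb] D])
  have uTB: "{Top i, Bot a} \<in> u" if "{Top i, Bot (\<phi> a)} \<in> D" "a \<in> {1..s}" for i a
  proof -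
    have "{Top a, Bot (\<phi> a)} \<in> f" using fTB that(2) by blast
    then show ?thesis unfolding u_def by (intro comp_TB[OF that(1)]) simp
  qed
  have ud: "u \<in> down_diagrams p s"
  proof (rule downI[OF ub])
    fix a assume a: "a \<in> {1..s}"
    then have "\<phi> a \<in> J" using \<phi>J by blast
    then obtain i where "{Top i, Bot (\<phi> a)} \<in> D" by (auto simp: J_def exits_def)
    then show "\<exists>i. {Top i, Bot a} \<in> u" using uTB a by blast
  qed
  have "diagram_comp f u = D"
  proof (rule diagram_comp_eqI[OF fb ub D])
    fix i k assume "{Top i, Top k} \<in> D" "i \<noteq> k"
    then show "{Top i, Top k} \<in> diagram_comp f u" unfolding u_def by (intro comp_TT)
  next
    fix i j assume ij: "{Top i, Bot j} \<in> D"
    then have "j \<in> J" by (auto simp: J_def exits_def)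
    then obtain a where a: "a \<in> {1..s}" "j = \<phi> a" using \<phi>J by blast
    have "{Top i, Bot a} \<in> u" using uTB[OF _ a(1), of i] ij a(2) by simp
    moreover have "{Top a, Bot j} \<in> f" using fTB a by blast
    ultimately show "{Top i, Bot j} \<in> diagram_comp f u" by (rule comp_TB)
  next
    fix j l assume "{Bot j, Bot l} \<in> D" "j \<noteq> l"
    then show "{Bot j, Bot l} \<in> diagram_comp f u" by (intro comp_BB) (simp_all add: fBB)
  qed
  then show ?thesis using fm ud by metis
qed

text \<open>A top arc of u would survive in the composite, so u is upward as well as
  downward.\<close>

lemma up_factor_level:
  assumes f: "f \<in> up_diagrams s q" and u: "u \<in> down_diagrams p s" and fu: "diagram_comp f u \<in> up_diagrams p q"
  shows "p = s" "u \<in> level_diagrams p p"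
proof -
  have "u \<in> up_diagrams p s"
    using fu down_brauer[OF u] comp_TT[of _ _ u f] unfolding up_diagrams_def is_upward_def by blast
  then have "u \<in> level_diagrams p s" using u by (rule levelI)
  moreover from level_eq[OF this] show "p = s" .
  ultimately show "u \<in> level_diagrams p p" by simp
qed

text \<open>\<open>factor_exists\<close> and \<open>factor_unique\<close> restricted to upward
  diagrams, where \<open>up_factor_level\<close> forces the downward factor to be a
  permutation.\<close>

lemma up_bij:
  "bij_betw (\<lambda>(f, \<sigma>). diagram_comp f \<sigma>) (mono_up_diagrams p q \<times> level_diagrams p p) (up_diagrams p q)"
  unfolding bij_betw_def
proof
  show "inj_on (\<lambda>(f, \<sigma>). diagram_comp f \<sigma>) (mono_up_diagrams p q \<times> level_diagrams p p)"
  proof (rule inj_onI)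
    fix x y assume x: "x \<in> mono_up_diagrams p q \<times> level_diagrams p p"
      and y: "y \<in> mono_up_diagrams p q \<times> level_diagrams p p"
      and eq: "(case x of (f, \<sigma>) \<Rightarrow> diagram_comp f \<sigma>) = (case y of (f, \<sigma>) \<Rightarrow> diagram_comp f \<sigma>)"
    obtain f \<sigma> g \<tau> where *: "x = (f, \<sigma>)" "y = (g, \<tau>)" "f \<in> mono_up_diagrams p q" "\<sigma> \<in> level_diagrams p p"
      "g \<in> mono_up_diagrams p q" "\<tau> \<in> level_diagrams p p" using x y by auto
    then show "x = y" using factor_unique(2,3)[OF *(3) level_down[OF *(4)] *(5) level_down[OF *(6)]] eq by simp
  qed
  show "(\<lambda>(f, \<sigma>). diagram_comp f \<sigma>) ` (mono_up_diagrams p q \<times> level_diagrams p p) = up_diagrams p q"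
  proof (intro equalityI subsetI)
    fix v assume "v \<in> (\<lambda>(f, \<sigma>). diagram_comp f \<sigma>) ` (mono_up_diagrams p q \<times> level_diagrams p p)"
    then obtain f \<sigma> where "f \<in> mono_up_diagrams p q" "\<sigma> \<in> level_diagrams p p" "v = diagram_comp f \<sigma>" by auto
    then show "v \<in> up_diagrams p q" using up_comp[OF mono_up level_up] by simp
  next
    fix v assume v: "v \<in> up_diagrams p q"
    obtain s f u where *: "f \<in> mono_up_diagrams s q" "u \<in> down_diagrams p s" "v = diagram_comp f u"
      using factor_exists[OF up_brauer[OF v]] by blast
    then have "p = s" "u \<in> level_diagrams p p" using up_factor_level[OF mono_up[OF *(1)] *(2)] v by auto
    then show "v \<in> (\<lambda>(f, \<sigma>). diagram_comp f \<sigma>) ` (mono_up_diagrams p q \<times> level_diagrams p p)"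
      using * by (intro image_eqI[of _ _ "(f, u)"]) simp_all
  qed
qed

section \<open>The Brauer category\<close>

lemma lookup_scale_brauer: "Poly_Mapping.lookup (scale_brauer c F) d = c * Poly_Mapping.lookup F d"
  by (simp add: scale_brauer_def Poly_Mapping.map.rep_eq when_def)

lemma scale_single: "scale_brauer c (Poly_Mapping.single d x) = Poly_Mapping.single d (c * x)"
  by (rule poly_mapping_eqI) (simp add: lookup_scale_brauer lookup_single when_def)

lemma module_brauer: "Modules.module (scale_brauer :: 'k::comm_ring_1 \<Rightarrow> 'k brauer \<Rightarrow> 'k brauer)"
  by unfold_locales (rule poly_mapping_eqI, simp add: lookup_scale_brauer lookup_add algebra_simps)+

lemma scale_add_right: "scale_brauer c (F + G) = scale_brauer c F + scale_brauer c G"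
  and scale_add_left: "scale_brauer (c + d) F = scale_brauer c F + scale_brauer d F"
  and scale_scale: "scale_brauer c (scale_brauer d F) = scale_brauer (c * d) F"
  and scale_zero_left: "scale_brauer 0 F = 0"
  and scale_zero_right: "scale_brauer c 0 = 0"
  by (rule poly_mapping_eqI, simp add: lookup_scale_brauer lookup_add algebra_simps)+

lemma scale_sum: "scale_brauer c (sum F A) = (\<Sum>a\<in>A. scale_brauer c (F a))"
  by (induction A rule: infinite_finite_induct) (simp_all add: scale_add_right scale_zero_right)

text \<open>Sums over different supports are compared by enlarging them to a common finite set,
  which makes bilinearity a termwise statement.\<close>

lemma bilinear_ext_superset:
  assumes "finite A" "finite B" "Poly_Mapping.keys F \<subseteq> A" "Poly_Mapping.keys G \<subseteq> B"
  shows "bilinear_ext \<phi> F G = (\<Sum>f\<in>A. \<Sum>g\<in>B.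
    scale_brauer (Poly_Mapping.lookup F f * Poly_Mapping.lookup G g) (\<phi> f g))"
proof -
  have "bilinear_ext \<phi> F G = (\<Sum>f\<in>Poly_Mapping.keys F. \<Sum>g\<in>B.
    scale_brauer (Poly_Mapping.lookup F f * Poly_Mapping.lookup G g) (\<phi> f g))"
    unfolding bilinear_ext_def using assms
    by (intro sum.cong refl sum.mono_neutral_left) (simp_all add: in_keys_iff scale_zero_left)
  also have "\<dots> = (\<Sum>f\<in>A. \<Sum>g\<in>B. scale_brauer (Poly_Mapping.lookup F f * Poly_Mapping.lookup G g) (\<phi> f g))"
    using assms by (intro sum.mono_neutral_left) (simp_all add: in_keys_iff scale_zero_left)
  finally show ?thesis .
qed

lemma bilinear_ext_add_left: "bilinear_ext \<phi> (F + F') G = bilinear_ext \<phi> F G + bilinear_ext \<phi> F' G"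
proof -
  let ?A = "Poly_Mapping.keys F \<union> Poly_Mapping.keys F'" and ?B = "Poly_Mapping.keys G"
  have s: "finite ?A" "finite ?B" by simp_all
  show ?thesis
    using Poly_Mapping.keys_add[of F F']
    by (simp add: bilinear_ext_superset[OF s] lookup_add distrib_right scale_add_left sum.distrib)
qed

lemma bilinear_ext_add_right: "bilinear_ext \<phi> F (G + G') = bilinear_ext \<phi> F G + bilinear_ext \<phi> F G'"
proof -
  let ?A = "Poly_Mapping.keys F" and ?B = "Poly_Mapping.keys G \<union> Poly_Mapping.keys G'"
  have s: "finite ?A" "finite ?B" by simp_all
  show ?thesis
    using Poly_Mapping.keys_add[of G G']
    by (simp add: bilinear_ext_superset[OF s] lookup_add distrib_left scale_add_left sum.distrib)
qed

lemma bilinear_ext_single: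
  "bilinear_ext \<phi> (Poly_Mapping.single f c) (Poly_Mapping.single g e) = scale_brauer (c * e) (\<phi> f g)"
  by (subst bilinear_ext_superset[of "{f}" "{g}"]) auto

lemma bilinear_ext_zero: "bilinear_ext \<phi> 0 G = 0" "bilinear_ext \<phi> F 0 = 0"
  by (simp_all add: bilinear_ext_def)

section \<open>Spans of diagrams and the linear extension of composition\<close>

lemma span_zero [simp]: "0 \<in> diagram_span X"
  by (simp add: diagram_span_def)

lemma span_add: "F \<in> diagram_span X \<Longrightarrow> G \<in> diagram_span X \<Longrightarrow> F + G \<in> diagram_span X"
  using Poly_Mapping.keys_add[of F G] by (auto simp: diagram_span_def)

lemma span_uminus: "F \<in> diagram_span X \<Longrightarrow> - F \<in> diagram_span X"
  by (simp add: diagram_span_def)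

lemma span_scale: "F \<in> diagram_span X \<Longrightarrow> scale_brauer c F \<in> diagram_span X"
  unfolding diagram_span_def by (metis (mono_tags, lifting) in_keys_iff lookup_scale_brauer mem_Collect_eq mult_zero_right subset_iff)

lemma span_single: "f \<in> X \<Longrightarrow> Poly_Mapping.single f c \<in> diagram_span X"
  by (simp add: diagram_span_def)

lemma span_sum: "(\<And>a. a \<in> A \<Longrightarrow> F a \<in> diagram_span X) \<Longrightarrow> sum F A \<in> diagram_span X"
  by (induction A rule: infinite_finite_induct) (auto intro: span_add)

lemma span_mono: "X \<subseteq> Y \<Longrightarrow> diagram_span X \<subseteq> diagram_span Y"
  by (auto simp: diagram_span_def)

lemma span_expand: "F = (\<Sum>f\<in>Poly_Mapping.keys F. Poly_Mapping.single f (Poly_Mapping.lookup F f))"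
  by (rule poly_mapping_eqI) (simp add: lookup_sum lookup_single when_def in_keys_iff)

lemma span_induct [consumes 1, case_names zero add single]:
  assumes F: "F \<in> diagram_span X" and 0: "P 0"
    and add: "\<And>F G. F \<in> diagram_span X \<Longrightarrow> G \<in> diagram_span X \<Longrightarrow> P F \<Longrightarrow> P G \<Longrightarrow> P (F + G)"
    and single: "\<And>f c. f \<in> X \<Longrightarrow> P (Poly_Mapping.single f c)"
  shows "P F"
proof -
  have "P (\<Sum>f\<in>K. Poly_Mapping.single f (Poly_Mapping.lookup F f))" if "finite K" "K \<subseteq> X" for K
    using that
  proof (induction K rule: finite_induct)
    case (insert f K)
    then show ?case
      by (auto intro!: add single span_single span_sum)
  qed (simp add: 0)
  then show ?thesis using F by (subst span_expand) (simp add: diagram_span_def)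
qed

text \<open>Applied once for each argument of a multilinear identity, each use replacing a multiple
  of a diagram by a general morphism. The maps are assumed additive, hence the arbitrary coefficient
  c in the last premise.\<close>

lemma span_eqI:
  assumes "F \<in> diagram_span X"
    and "\<And>F G. \<Phi> (F + G) = \<Phi> F + \<Phi> G" "\<And>F G. \<Psi> (F + G) = \<Psi> F + \<Psi> G"
    and "\<And>f c. f \<in> X \<Longrightarrow> \<Phi> (Poly_Mapping.single f c) = \<Psi> (Poly_Mapping.single f c)"
  shows "(\<Phi> F :: 'b::ab_group_add) = \<Psi> F"
  using assms(1)
proof (induction rule: span_induct)
  case zero
  have "\<Phi> 0 = 0" "\<Psi> 0 = 0" using assms(2)[of 0 0] assms(3)[of 0 0] by simp_all
  then show ?case by simp
qed (use assms in simp_all)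

lemma brauer_comp_single:
  "brauer_comp \<delta> (Poly_Mapping.single f c) (Poly_Mapping.single g e)
    = Poly_Mapping.single (diagram_comp f g) (c * e * \<delta> ^ loops f g)"
  by (simp add: brauer_comp_def bilinear_ext_single scale_single)

lemma brauer_comp_add:
  "brauer_comp \<delta> (F + F') G = brauer_comp \<delta> F G + brauer_comp \<delta> F' G"
  "brauer_comp \<delta> F (G + G') = brauer_comp \<delta> F G + brauer_comp \<delta> F G'"
  by (simp_all add: brauer_comp_def bilinear_ext_add_left bilinear_ext_add_right)

lemma brauer_comp_zero [simp]: "brauer_comp \<delta> 0 G = 0" "brauer_comp \<delta> F 0 = 0"
  by (simp_all add: brauer_comp_def bilinear_ext_zero)

lemma brauer_comp_sum:
  "brauer_comp \<delta> (sum F A) G = (\<Sum>a\<in>A. brauer_comp \<delta> (F a) G)"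
  "brauer_comp \<delta> G (sum F A) = (\<Sum>a\<in>A. brauer_comp \<delta> G (F a))"
  by (induction A rule: infinite_finite_induct) (simp_all add: brauer_comp_add)

lemma in_span_UNIV: "F \<in> diagram_span UNIV"
  by (simp add: diagram_span_def)

lemma brauer_comp_scale:
  "brauer_comp \<delta> (scale_brauer c F) G = scale_brauer c (brauer_comp \<delta> F G)"
  "brauer_comp \<delta> F (scale_brauer c G) = scale_brauer c (brauer_comp \<delta> F G)"
proof -
  have *: "brauer_comp \<delta> (scale_brauer c (Poly_Mapping.single f e)) G = scale_brauer c (brauer_comp \<delta> (Poly_Mapping.single f e) G)" for f e
    by (rule span_eqI[OF in_span_UNIV[of G]]) (simp_all add: scale_add_right brauer_comp_add brauer_comp_single scale_single ac_simps)
  show "brauer_comp \<delta> (scale_brauer c F) G = scale_brauer c (brauer_comp \<delta> F G)"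
    by (rule span_eqI[OF in_span_UNIV[of F]]) (simp_all add: scale_add_right brauer_comp_add *)
  have *: "brauer_comp \<delta> (Poly_Mapping.single f e) (scale_brauer c G) = scale_brauer c (brauer_comp \<delta> (Poly_Mapping.single f e) G)" for f e
    by (rule span_eqI[OF in_span_UNIV[of G]]) (simp_all add: scale_add_right brauer_comp_add brauer_comp_single scale_single ac_simps)
  show "brauer_comp \<delta> F (scale_brauer c G) = scale_brauer c (brauer_comp \<delta> F G)"
    by (rule span_eqI[OF in_span_UNIV[of F]]) (simp_all add: scale_add_right brauer_comp_add *)
qed

lemma brauer_comp_span:
  assumes cl: "\<And>f g. f \<in> X \<Longrightarrow> g \<in> Y \<Longrightarrow> diagram_comp f g \<in> Z"
    and F: "F \<in> diagram_span X" and G: "G \<in> diagram_span Y"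
  shows "brauer_comp \<delta> F G \<in> diagram_span Z"
  using F
proof (induction rule: span_induct)
  case (single f c)
  show ?case
    using G
  proof (induction rule: span_induct)
    case (single g e)
    then show ?case using cl \<open>f \<in> X\<close> by (simp add: brauer_comp_single span_single)
  qed (simp_all add: brauer_comp_add span_add)
qed (simp_all add: brauer_comp_add span_add)

text \<open>On diagrams this combines both parts of \<open>diagram_comp_assoc\<close>: equality of
  the composites and of the total number of loops, the exponent of \<delta>.\<close>

lemma brauer_comp_assoc:
  assumes F: "F \<in> BMor s t" and G: "G \<in> BMor q s" and H: "H \<in> BMor p q"
  shows "brauer_comp \<delta> (brauer_comp \<delta> F G) H = brauer_comp \<delta> F (brauer_comp \<delta> G H)"
proof -
  have 1: "brauer_comp \<delta> (brauer_comp \<delta> (Poly_Mapping.single f a) (Poly_Mapping.single g b)) (Poly_Mapping.single h c)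
    = brauer_comp \<delta> (Poly_Mapping.single f a) (brauer_comp \<delta> (Poly_Mapping.single g b) (Poly_Mapping.single h c))"
    if "f \<in> brauer_diagrams s t" "g \<in> brauer_diagrams q s" "h \<in> brauer_diagrams p q" for f g h a b c
  proof -
    note as = diagram_comp_assoc[OF that]
    have "\<delta> ^ loops f g * \<delta> ^ loops (diagram_comp f g) h = \<delta> ^ loops g h * \<delta> ^ loops f (diagram_comp g h)"
      unfolding power_add[symmetric] as(2) ..
    then have "a * b * c * (\<delta> ^ loops f g * \<delta> ^ loops (diagram_comp f g) h)
        = a * b * c * (\<delta> ^ loops g h * \<delta> ^ loops f (diagram_comp g h))" by simp
    then show ?thesis unfolding brauer_comp_single as(1) by (simp only: ac_simps)
  qed
  have 2: "brauer_comp \<delta> (brauer_comp \<delta> (Poly_Mapping.single f a) (Poly_Mapping.single g b)) H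
    = brauer_comp \<delta> (Poly_Mapping.single f a) (brauer_comp \<delta> (Poly_Mapping.single g b) H)"
    if "f \<in> brauer_diagrams s t" "g \<in> brauer_diagrams q s" for f g a b
    using H unfolding BMor_def by (rule span_eqI) (simp_all add: brauer_comp_add 1 that)
  have 3: "brauer_comp \<delta> (brauer_comp \<delta> (Poly_Mapping.single f a) G) H
    = brauer_comp \<delta> (Poly_Mapping.single f a) (brauer_comp \<delta> G H)"
    if "f \<in> brauer_diagrams s t" for f a
    using G unfolding BMor_def by (rule span_eqI) (simp_all add: brauer_comp_add 2 that)
  show ?thesis
    using F unfolding BMor_def by (rule span_eqI) (simp_all add: brauer_comp_add 3)
qed

lemma brauer_id_closed: "brauer_id p \<in> BSym p p"
  unfolding BSym_def brauer_id_def by (rule span_single[OF id_level])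

lemma brauer_id_left: "F \<in> BMor p q \<Longrightarrow> brauer_comp \<delta> (brauer_id q) F = F"
  unfolding BMor_def
  by (erule span_eqI) (simp_all add: brauer_comp_add brauer_id_def brauer_comp_single id_comp_left
      loops_eq_0[OF id_brauer _ disjI1[OF level_up[OF id_level]]])

lemma brauer_id_right: "F \<in> BMor p q \<Longrightarrow> brauer_comp \<delta> F (brauer_id p) = F"
  unfolding BMor_def
  by (erule span_eqI) (simp_all add: brauer_comp_add brauer_id_def brauer_comp_single id_comp_right
      loops_eq_0[OF _ id_brauer disjI2[OF level_down[OF id_level]]])

lemma BSym_sub: "BSym p q \<subseteq> BUp p q" "BSym p q \<subseteq> BDown p q" "BSym p q \<subseteq> BMor p q"
  and BUp_sub: "BUp p q \<subseteq> BMor p q" and BDown_sub: "BDown p q \<subseteq> BMor p q"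
  unfolding BSym_def BUp_def BDown_def BMor_def
  by (rule span_mono, use level_up level_down level_brauer up_brauer down_brauer in blast)+

lemma brauer_id_in: "brauer_id p \<in> BUp p p" "brauer_id p \<in> BDown p p" "brauer_id p \<in> BMor p p"
  using brauer_id_closed[of p] BSym_sub[of p p] by blast+

lemma brauer_comp_closed:
  "F \<in> BMor q s \<Longrightarrow> G \<in> BMor p q \<Longrightarrow> brauer_comp \<delta> F G \<in> BMor p s"
  "F \<in> BUp q s \<Longrightarrow> G \<in> BUp p q \<Longrightarrow> brauer_comp \<delta> F G \<in> BUp p s"
  "F \<in> BDown q s \<Longrightarrow> G \<in> BDown p q \<Longrightarrow> brauer_comp \<delta> F G \<in> BDown p s"
  "F \<in> BSym q s \<Longrightarrow> G \<in> BSym p q \<Longrightarrow> brauer_comp \<delta> F G \<in> BSym p s"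
  unfolding BSym_def BUp_def BDown_def BMor_def
  by (rule brauer_comp_span; use diagram_comp_closed up_comp down_comp level_comp in blast)+

lemma subspace_span: "Modules.module.subspace scale_brauer (diagram_span X)"
  unfolding Modules.module.subspace_def[OF module_brauer] by (auto intro: span_add span_scale)

lemma subspace_B:
  "Modules.module.subspace scale_brauer (BSym p q)" "Modules.module.subspace scale_brauer (BUp p q)"
  "Modules.module.subspace scale_brauer (BDown p q)" "Modules.module.subspace scale_brauer (BMor p q)"
  unfolding BSym_def BUp_def BDown_def BMor_def by (rule subspace_span)+

lemma linear_category_brauer: "linear_category scale_brauer Ob BMor (brauer_comp \<delta>) brauer_id"
  unfolding linear_category_def linear_category_axioms_def
proof (intro conjI allI impI)
  show "Modules.module (scale_brauer :: 'a \<Rightarrow> _)" by (rule module_brauer)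
  show "Modules.module.subspace scale_brauer (BMor p q)" for p q unfolding BMor_def by (rule subspace_span)
qed (use brauer_comp_closed(1) brauer_id_in(3) in
  \<open>auto simp: brauer_comp_add brauer_comp_scale brauer_id_left brauer_id_right intro!: brauer_comp_assoc\<close>)

lemma wide_subcategory_brauer:
  "linear_category.wide_subcategory scale_brauer Ob BMor (brauer_comp \<delta>) brauer_id BSym"
  "linear_category.wide_subcategory scale_brauer Ob BMor (brauer_comp \<delta>) brauer_id BUp"
  "linear_category.wide_subcategory scale_brauer Ob BMor (brauer_comp \<delta>) brauer_id BDown"
  "linear_category.wide_subcategory scale_brauer Ob BMor (brauer_comp \<delta>) brauer_id BMor"
  unfolding linear_category.wide_subcategory_def[OF linear_category_brauer]
  by (simp_all add: subspace_B BSym_sub BUp_sub BDown_sub brauer_id_closed brauer_id_in brauer_comp_closed)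

lemma hom_bimodule_simps [simp]:
  "carrier (grp (hom_bimodule cmp N) p q) = N p q"
  "monoid.mult (grp (hom_bimodule cmp N) p q) = (+)"
  "one (grp (hom_bimodule cmp N) p q) = 0"
  "lact (hom_bimodule cmp N) p q = cmp"
  "ract (hom_bimodule cmp N) p q = cmp"
  by (simp_all add: hom_bimodule_def)

section \<open>Bimodules of morphisms in a linear category\<close>

context linear_category
begin

lemma comm_group_hom_bimodule:
  assumes "wide_subcategory N" "p \<in> Ob" "q \<in> Ob"
  shows "comm_group (grp (hom_bimodule cmp N) p q)"
proof -
  have s: "subspace (N p q)" using assms by (simp add: wide_subcategory_def)
  show ?thesis
  proof (rule comm_groupI)
    show "\<exists>y\<in>carrier (grp (hom_bimodule cmp N) p q). y \<otimes>\<^bsub>grp (hom_bimodule cmp N) p q\<^esub> x = \<one>\<^bsub>grp (hom_bimodule cmp N) p q\<^esub>"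
      if "x \<in> carrier (grp (hom_bimodule cmp N) p q)" for x
      using that subspace_neg[OF s, of x] by (intro bexI[of _ "- x"]) simp_all
  qed (use subspace_add[OF s] subspace_0[OF s] in \<open>simp_all add: ac_simps\<close>)
qed

lemma bimod_hom_bimodule:
  assumes S: "wide_subcategory S" and N: "wide_subcategory N" and SN: "\<And>p. p \<in> Ob \<Longrightarrow> S p p \<subseteq> N p p"
  shows "bimod Ob (\<lambda>s. S s s) (hom_bimodule cmp N)"
proof -
  have M: "N p q \<subseteq> Mor p q" if "p \<in> Ob" "q \<in> Ob" for p q using N that by (simp add: wide_subcategory_def)
  have c: "cmp f g \<in> N p s" if "p \<in> Ob" "q \<in> Ob" "s \<in> Ob" "f \<in> N q s" "g \<in> N p q" for p q s f g
    using N that by (simp add: wide_subcategory_def)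
  show ?thesis
    unfolding bimod_def hom_bimodule_simps
  proof (intro ballI conjI)
    fix p q assume pq: "p \<in> Ob" "q \<in> Ob"
    show "comm_group (grp (hom_bimodule cmp N) p q)" by (rule comm_group_hom_bimodule[OF N pq])
    note M' = subsetD[OF M[OF pq]] subsetD[OF M[OF pq(1) pq(1)]] subsetD[OF M[OF pq(2) pq(2)]]
    show "cmp a \<in> hom (grp (hom_bimodule cmp N) p q) (grp (hom_bimodule cmp N) p q)" if "a \<in> S q q" for a
      using SN[OF pq(2)] that c[OF pq(1,2,2)] cmp_add_right[OF pq(1,2,2)] M' by (intro homI) auto
    show "(\<lambda>x. cmp x a) \<in> hom (grp (hom_bimodule cmp N) p q) (grp (hom_bimodule cmp N) p q)" if "a \<in> S p p" for a
      using SN[OF pq(1)] that c[OF pq(1,1,2)] cmp_add_left[OF pq(1,1,2)] M' by (intro homI) auto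
    show "cmp a (cmp x b) = cmp (cmp a x) b" if "a \<in> S q q" "b \<in> S p p" "x \<in> N p q" for a b x
      using SN[OF pq(1)] SN[OF pq(2)] that M' by (intro cmp_assoc[OF pq(1,1,2,2), symmetric]) auto
  qed
qed

lemma balanced_cmp:
  assumes S: "wide_subcategory S" and P: "wide_subcategory P" and M: "wide_subcategory M"
    and SP: "\<And>p. p \<in> Ob \<Longrightarrow> S p p \<subseteq> P p p" and pq: "p \<in> Ob" "q \<in> Ob"
  shows "balanced Ob (\<lambda>s. S s s) (hom_bimodule cmp P) (hom_bimodule cmp M) p q
    (grp (hom_bimodule cmp Mor) p q) (\<lambda>(s, f, g). cmp f g)"
proof (rule balancedI, unfold hom_bimodule_simps)
  have PM: "P p q \<subseteq> Mor p q" "M p q \<subseteq> Mor p q" "S p q \<subseteq> Mor p q" if "p \<in> Ob" "q \<in> Ob" for p q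
    using P M S that by (simp_all add: wide_subcategory_def)
  fix s f g assume s: "s \<in> Ob" and f: "f \<in> P s q" and g: "g \<in> M p s"
  note fm = subsetD[OF PM(1)[OF s pq(2)]] and gm = subsetD[OF PM(2)[OF pq(1) s]]
  show "cmp f g \<in> Mor p q" using cmp_closed[OF pq(1) s pq(2) fm[OF f] gm[OF g]] .
  show "cmp f (g + g') = cmp f g + cmp f g'" if "g' \<in> M p s" for g'
    using cmp_add_right[OF pq(1) s pq(2) fm[OF f] gm[OF g] gm[OF that]] .
  show "cmp (f + f') g = cmp f g + cmp f' g" if "f' \<in> P s q" for f'
    using cmp_add_left[OF pq(1) s pq(2) fm[OF f] fm[OF that] gm[OF g]] .
  show "cmp (cmp f a) g = cmp f (cmp a g)" if "a \<in> S s s" for a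
    using cmp_assoc[OF pq(1) s s pq(2) fm[OF f] subsetD[OF PM(3)[OF s s] that] gm[OF g]] .
qed

lemma unital_hom_bimodule:
  assumes S: "wide_subcategory S" and N: "wide_subcategory N" and SN: "\<And>p. p \<in> Ob \<Longrightarrow> S p p \<subseteq> N p p"
  shows "unital Ob (\<lambda>s. S s s) (hom_bimodule cmp S) (hom_bimodule cmp N)"
proof -
  have NM: "N p q \<subseteq> Mor p q" "S p q \<subseteq> Mor p q" if "p \<in> Ob" "q \<in> Ob" for p q
    using N S that by (simp_all add: wide_subcategory_def)
  have c: "cmp f g \<in> N p s" if "p \<in> Ob" "q \<in> Ob" "s \<in> Ob" "f \<in> N q s" "g \<in> N p q" for p q s f g
    using N that by (simp add: wide_subcategory_def)
  have z: "0 \<in> N p q" if "p \<in> Ob" "q \<in> Ob" for p q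
    using N that subspace_0 by (simp add: wide_subcategory_def)
  show ?thesis
    unfolding unital_def
  proof (intro ballI conjI)
    fix p q assume pq: "p \<in> Ob" "q \<in> Ob"
    note nm = subsetD[OF NM(1)[OF pq]]
    note sp = subsetD[OF NM(2)[OF pq(1) pq(1)]] subsetD[OF SN[OF pq(1)]]
    note sq = subsetD[OF NM(2)[OF pq(2) pq(2)]] subsetD[OF SN[OF pq(2)]]
    show "balanced Ob (\<lambda>s. S s s) (hom_bimodule cmp S) (hom_bimodule cmp N) p q (grp (hom_bimodule cmp N) p q)
     (\<lambda>(s, a, n). if s = q then lact (hom_bimodule cmp N) p q a n else \<one>\<^bsub>grp (hom_bimodule cmp N) p q\<^esub>)"
      by (rule balancedI, unfold hom_bimodule_simps)
        (auto simp: z[OF pq] nm sq intro!: c[OF pq(1,2,2)] cmp_add_left[OF pq(1,2,2)] cmp_add_right[OF pq(1,2,2)]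
          cmp_assoc[OF pq(1,2,2,2)])
    show "balanced Ob (\<lambda>s. S s s) (hom_bimodule cmp N) (hom_bimodule cmp S) p q (grp (hom_bimodule cmp N) p q)
     (\<lambda>(s, m, a). if s = p then ract (hom_bimodule cmp N) p q m a else \<one>\<^bsub>grp (hom_bimodule cmp N) p q\<^esub>)"
      by (rule balancedI, unfold hom_bimodule_simps)
        (auto simp: z[OF pq] nm sp intro!: c[OF pq(1,1,2)] cmp_add_left[OF pq(1,1,2)] cmp_add_right[OF pq(1,1,2)]
          cmp_assoc[OF pq(1,1,1,2)])
  qed
qed

end

lemma keys_sum_subset:
  "(\<And>i. i \<in> I \<Longrightarrow> Poly_Mapping.keys (c i) \<subseteq> X) \<Longrightarrow> Poly_Mapping.keys (sum c I) \<subseteq> X"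
  for c :: "'i \<Rightarrow> 'x \<Rightarrow>\<^sub>0 int"
proof (induction I rule: infinite_finite_induct)
  case (insert i I)
  then show ?case using Poly_Mapping.keys_add[of "c i" "sum c I"] by auto
qed simp_all

section \<open>Finite sums of tensor classes\<close>

context tensor_pair
begin

text \<open>Evaluates a homomorphism termwise on the class of a finite formal sum, the form in which
  the values of the copairings at identities are given.\<close>

lemma hom_class_sum_class:
  assumes T': "tensor_pair Ob A M' N' p' q'"
    and h: "h \<in> hom T (tensor_grp Ob A M' N' p' q')" and fin: "finite I"
    and c: "\<And>i. i \<in> I \<Longrightarrow> Poly_Mapping.keys (c i) \<subseteq> tensor_gens Ob M N p q"
    and d: "\<And>i. i \<in> I \<Longrightarrow> Poly_Mapping.keys (d i) \<subseteq> tensor_gens Ob M' N' p' q'"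
    and eq: "\<And>i. i \<in> I \<Longrightarrow> h (cls (c i)) = tensor_class Ob A M' N' p' q' (d i)"
  shows "h (cls (sum c I)) = tensor_class Ob A M' N' p' q' (sum d I)"
  using fin c d eq
proof (induction I rule: finite_induct)
  case empty
  then show ?case
    using hom_one[OF h group_tensor tensor_pair.group_tensor[OF T']] class_zero tensor_pair.class_zero[OF T'] by simp
next
  case (insert i I)
  have ks: "Poly_Mapping.keys (sum c I) \<subseteq> tensor_gens Ob M N p q"
    and kd: "Poly_Mapping.keys (sum d I) \<subseteq> tensor_gens Ob M' N' p' q'"
    by (rule keys_sum_subset, use insert.prems in simp)+
  have ci: "Poly_Mapping.keys (c i) \<subseteq> tensor_gens Ob M N p q" and di: "Poly_Mapping.keys (d i) \<subseteq> tensor_gens Ob M' N' p' q'"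
    using insert.prems by simp_all
  have "h (cls (sum c (insert i I))) = h (cls (c i) \<otimes>\<^bsub>T\<^esub> cls (sum c I))"
    using insert.hyps class_add[OF ci ks] by simp
  also have "\<dots> = h (cls (c i)) \<otimes>\<^bsub>tensor_grp Ob A M' N' p' q'\<^esub> h (cls (sum c I))"
    by (rule hom_mult[OF h class_closed[OF ci] class_closed[OF ks]])
  also have "\<dots> = tensor_class Ob A M' N' p' q' (sum d (insert i I))"
    using insert tensor_pair.class_add[OF T' di kd] by simp
  finally show ?case .
qed

lemma class_sum_cong:
  assumes "finite I" "\<And>i. i \<in> I \<Longrightarrow> Poly_Mapping.keys (c i) \<subseteq> tensor_gens Ob M N p q"
    "\<And>i. i \<in> I \<Longrightarrow> Poly_Mapping.keys (d i) \<subseteq> tensor_gens Ob M N p q"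
    "\<And>i. i \<in> I \<Longrightarrow> cls (c i) = cls (d i)"
  shows "cls (sum c I) = cls (sum d I)"
  using hom_class_sum_class[OF tensor_pairI[OF M N p q] hom_id assms(1-3)] assms(4) by simp

lemma hom_class_sum:
  assumes h: "h \<in> hom T (grp (hom_bimodule cmp V) a b)" and G: "comm_group (grp (hom_bimodule cmp V) a b)"
    and fin: "finite I" and x: "\<And>i. i \<in> I \<Longrightarrow> x i \<in> tensor_gens Ob M N p q"
  shows "h (cls (\<Sum>i\<in>I. frag_of (x i))) = (\<Sum>i\<in>I. h (cls (frag_of (x i))))"
  using fin x
proof (induction I rule: finite_induct)
  case empty
  then show ?case using hom_one[OF h group_tensor comm_group_group[OF G]] class_zero by simp
next
  case (insert i I)
  have ks: "Poly_Mapping.keys (\<Sum>i\<in>I. frag_of (x i)) \<subseteq> tensor_gens Ob M N p q"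
    by (rule keys_sum_subset) (use insert.prems in simp)
  have ci: "Poly_Mapping.keys (frag_of (x i)) \<subseteq> tensor_gens Ob M N p q"
    using insert.prems by simp
  have "h (cls (\<Sum>i\<in>insert i I. frag_of (x i))) = h (cls (frag_of (x i)) \<otimes>\<^bsub>T\<^esub> cls (\<Sum>i\<in>I. frag_of (x i)))"
    using insert.hyps class_add[OF ci ks] by simp
  also have "\<dots> = h (cls (frag_of (x i))) + h (cls (\<Sum>i\<in>I. frag_of (x i)))"
    using hom_mult[OF h class_closed[OF ci] class_closed[OF ks]] by simp
  finally show ?case using insert by simp
qed

end

section \<open>Stratification\<close>

lemma trunc_iff: "q \<in> trunc_objects r \<longleftrightarrow> q \<le> r \<and> even (r - q)"
  by (simp add: trunc_objects_def prec_def)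

lemma prec_trunc: "prec s p \<Longrightarrow> p \<in> trunc_objects r \<Longrightarrow> s \<in> trunc_objects r"
  unfolding trunc_iff prec_def by presburger

lemma span_no_diagrams: "X = {} \<Longrightarrow> diagram_span X = {0}"
  by (simp add: diagram_span_def)

lemma BUp_zero: "\<not> prec p q \<Longrightarrow> BUp p q = {0}"
  unfolding BUp_def using up_prec[of _ p q] by (intro span_no_diagrams) blast

lemma BDown_zero: "\<not> prec q p \<Longrightarrow> BDown p q = {0}"
  unfolding BDown_def using down_prec[of _ p q] by (intro span_no_diagrams) blast

lemma BSym_zero: "p \<noteq> q \<Longrightarrow> BSym p q = {0}"
  unfolding BSym_def using level_eq[of _ p q] by (intro span_no_diagrams) blast

text \<open>With equal ranks the through strands inject {1..p} into itself, hence use up all bottom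
  points and leave none for an arc.\<close>

lemma up_diag: "up_diagrams p p = level_diagrams p p"
proof -
  have "f \<in> down_diagrams p p" if f: "f \<in> up_diagrams p p" for f
  proof (rule downI[OF up_brauer[OF f]])
    have "\<exists>\<phi>. \<forall>i\<in>{1..p}. \<phi> i \<in> {1..p} \<and> {Top i, Bot (\<phi> i)} \<in> f"
      using upE[OF f] by (intro bchoice) blast
    then obtain \<phi> where \<phi>: "\<And>i. i \<in> {1..p} \<Longrightarrow> \<phi> i \<in> {1..p} \<and> {Top i, Bot (\<phi> i)} \<in> f" by blast
    have "inj_on \<phi> {1..p}"
    proof (rule inj_onI)
      fix i k assume "i \<in> {1..p}" "k \<in> {1..p}" "\<phi> i = \<phi> k"
      then have "{Bot (\<phi> i), Top i} \<in> f" "{Bot (\<phi> i), Top k} \<in> f" using \<phi>[of i] \<phi>[of k] by (simp_all add: insert_commute)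
      then show "i = k" using brauerD(5)[OF up_brauer[OF f]] by blast
    qed
    then have "\<phi> ` {1..p} = {1..p}" using \<phi> by (intro endo_inj_surj) auto
    then show "\<exists>i. {Top i, Bot j} \<in> f" if "j \<in> {1..p}" for j using that \<phi> by (metis imageE)
  qed
  then show ?thesis using levelI level_up by blast
qed

lemma down_diag: "down_diagrams p p = level_diagrams p p"
proof -
  have "f \<in> level_diagrams p p" if "f \<in> down_diagrams p p" for f
    using flip_level[of "flip_diagram f" p p] flip_down[OF that] up_diag[of p] by simp
  then show ?thesis using level_down by blast
qed

lemma B_diag: "BUp p p = BSym p p" "BDown p p = BSym p p"
  by (simp_all add: BUp_def BDown_def BSym_def up_diag down_diag)

lemma up_factor:
  assumes "v \<in> up_diagrams p q"
  obtains f \<sigma> where "f \<in> mono_up_diagrams p q" "\<sigma> \<in> level_diagrams p p" "v = diagram_comp f \<sigma>"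
proof -
  have "v \<in> (\<lambda>(f, \<sigma>). diagram_comp f \<sigma>) ` (mono_up_diagrams p q \<times> level_diagrams p p)"
    using bij_betw_imp_surj_on[OF up_bij] assms by simp
  then show thesis using that by auto
qed

abbreviation BMorBim :: "'k::comm_ring_1 \<Rightarrow> (nat, 'k brauer, 'k brauer) bimodule" where
  "BMorBim \<delta> \<equiv> hom_bimodule (brauer_comp \<delta>) BMor"

lemma bimod_brauer:
  "bimod Ob (\<lambda>s. BSym s s) (BSymBim \<delta>)" "bimod Ob (\<lambda>s. BSym s s) (BUpBim \<delta>)"
  "bimod Ob (\<lambda>s. BSym s s) (BDownBim \<delta>)" "bimod Ob (\<lambda>s. BSym s s) (BMorBim \<delta>)"
  by (rule linear_category.bimod_hom_bimodule[OF linear_category_brauer wide_subcategory_brauer(1)],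
      rule wide_subcategory_brauer, rule BSym_sub subset_refl)+

lemma comm_group_brauer:
  assumes "p \<in> Ob" "q \<in> Ob"
  shows "comm_group (grp (BSymBim \<delta>) p q)" "comm_group (grp (BUpBim \<delta>) p q)"
    "comm_group (grp (BDownBim \<delta>) p q)" "comm_group (grp (BMorBim \<delta>) p q)"
proof -
  show "comm_group (grp (BSymBim \<delta>) p q)" by (rule bimodD(1)[OF bimod_brauer(1) assms])
  show "comm_group (grp (BUpBim \<delta>) p q)" by (rule bimodD(1)[OF bimod_brauer(2) assms])
  show "comm_group (grp (BDownBim \<delta>) p q)" by (rule bimodD(1)[OF bimod_brauer(3) assms])
  show "comm_group (grp (BMorBim \<delta>) p q)" by (rule bimodD(1)[OF bimod_brauer(4) assms])
qed

lemma unital_brauer: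
  "unital Ob (\<lambda>s. BSym s s) (BSymBim \<delta>) (BUpBim \<delta>)"
  "unital Ob (\<lambda>s. BSym s s) (BSymBim \<delta>) (BDownBim \<delta>)"
  by (rule linear_category.unital_hom_bimodule[OF linear_category_brauer wide_subcategory_brauer(1)],
      rule wide_subcategory_brauer, rule BSym_sub)+

text \<open>The inverse \<theta> of composition sends a diagram to f \<otimes> u, its factorization
  through a monotone upward diagram. Composing back produces no power of \<delta> since f is upward;
  that \<theta> undoes composition on the whole tensor product is \<open>\<theta>pure\<close>, where
  balancing over permutations enters.\<close>

lemma brauer_comp_iso:
  fixes \<delta> :: "'k::comm_ring_1" and r :: nat
  defines "Ob \<equiv> trunc_objects r"
  shows "bimodule_iso Ob (\<lambda>s. BSym s s) (tensor Ob (\<lambda>s. BSym s s) (BUpBim \<delta>) (BDownBim \<delta>)) (BMorBim \<delta>)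
      (\<lambda>p q. tensor_lift (grp (BMorBim \<delta>) p q) (\<lambda>(s, f, g). brauer_comp \<delta> f g))"
proof -
  let ?A = "\<lambda>s. BSym s s :: 'k brauer set" and ?P = "BUpBim \<delta>" and ?M = "BDownBim \<delta>" and ?B = "BMorBim \<delta>"
  let ?c = "brauer_comp \<delta>"
  let ?L = "\<lambda>p q. tensor_lift (grp ?B p q) (\<lambda>(s, f, g). ?c f g)"
  note bP = bimod_brauer(2)[of Ob \<delta>] and bM = bimod_brauer(3)[of Ob \<delta>] and bB = bimod_brauer(4)[of Ob \<delta>]
  have key: "?L p q \<in> hom (tensor_grp Ob ?A ?P ?M p q) (grp ?B p q) \<and>
      (\<forall>x\<in>carrier (tensor_grp Ob ?A ?P ?M p q).
        (\<forall>a\<in>BSym q q. ?L p q (lact (tensor Ob ?A ?P ?M) p q a x) = ?c a (?L p q x)) \<and>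
        (\<forall>a\<in>BSym p p. ?L p q (ract (tensor Ob ?A ?P ?M) p q x a) = ?c (?L p q x) a)) \<and>
      bij_betw (?L p q) (carrier (tensor_grp Ob ?A ?P ?M p q)) (BMor p q)"
    if pq: "p \<in> Ob" "q \<in> Ob" for p q
  proof -
    interpret tp: tensor_pair Ob ?A ?P ?M p q by (rule tensor_pairI[OF bP bM pq])
    have bal: "balanced Ob ?A ?P ?M p q (grp ?B p q) (\<lambda>(s, f, g). ?c f g)"
      by (rule linear_category.balanced_cmp[OF linear_category_brauer wide_subcategory_brauer(1,2,3) BSym_sub(1) pq])
    note cg = comm_group_brauer(4)[OF pq, of \<delta>]
    note hL = tp.lift_hom[OF cg bal]
    have Lp: "?L p q (tp.pure s f g) = ?c f g" if "s \<in> Ob" "f \<in> BUp s q" "g \<in> BDown p s" for s f g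
      using tp.lift_pure[OF cg bal, of s f g] that by simp
    have mor: "F \<in> BMor s t" if "F \<in> BUp s t \<or> F \<in> BDown s t \<or> F \<in> BSym s t" for F s t
      using that BUp_sub BDown_sub BSym_sub(3) by blast
    have l: "?L p q (lact (tensor Ob ?A ?P ?M) p q a x) = ?c a (?L p q x)"
      if x: "x \<in> carrier tp.T" and a: "a \<in> BSym q q" for x a
    proof (rule tp.hom_class_eq[OF comm_group_group[OF cg] hom_comp[OF lact_tensor(1)[OF bP bM pq a] hL] _ _ x])
      show "(\<lambda>x. ?c a (?L p q x)) \<in> hom tp.T (grp ?B p q)"
        using hom_comp[OF hL bimodD(2)[OF bB pq a]] by simp
      fix s f g assume *: "s \<in> Ob" "f \<in> carrier (grp ?P s q)" "g \<in> carrier (grp ?M p s)"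
      then have "?c a f \<in> BUp s q" using a brauer_comp_closed(2) BSym_sub(1) by (simp add: subset_iff) blast
      then show "?L p q (lact (tensor Ob ?A ?P ?M) p q a (tp.pure s f g)) = ?c a (?L p q (tp.pure s f g))"
        using * a by (simp add: lact_tensor(2)[OF bP bM pq] Lp mor brauer_comp_assoc[of a q q f s g p])
    qed
    have rr: "?L p q (ract (tensor Ob ?A ?P ?M) p q x a) = ?c (?L p q x) a"
      if x: "x \<in> carrier tp.T" and a: "a \<in> BSym p p" for x a
    proof (rule tp.hom_class_eq[OF comm_group_group[OF cg] hom_comp[OF ract_tensor(1)[OF bP bM pq a] hL] _ _ x])
      show "(\<lambda>x. ?c (?L p q x) a) \<in> hom tp.T (grp ?B p q)"
        using hom_comp[OF hL bimodD(3)[OF bB pq a]] by simp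
      fix s f g assume *: "s \<in> Ob" "f \<in> carrier (grp ?P s q)" "g \<in> carrier (grp ?M p s)"
      then have "?c g a \<in> BDown p s" using a brauer_comp_closed(3) BSym_sub(2) by (simp add: subset_iff) blast
      then show "?L p q (ract (tensor Ob ?A ?P ?M) p q (tp.pure s f g) a) = ?c (?L p q (tp.pure s f g)) a"
        using * a by (simp add: ract_tensor(2)[OF bP bM pq] Lp mor brauer_comp_assoc[of f s q g p a p])
    qed
    have "\<forall>D\<in>brauer_diagrams p q. \<exists>t. fst (snd t) \<in> mono_up_diagrams (fst t) q \<and> snd (snd t) \<in> down_diagrams p (fst t)
        \<and> D = diagram_comp (fst (snd t)) (snd (snd t))"
      using factor_exists by fastforce
    then have "\<exists>t. \<forall>D\<in>brauer_diagrams p q. fst (snd (t D)) \<in> mono_up_diagrams (fst (t D)) q \<and>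
        snd (snd (t D)) \<in> down_diagrams p (fst (t D)) \<and> D = diagram_comp (fst (snd (t D))) (snd (snd (t D)))"
      by (rule bchoice)
    then obtain t where t: "\<And>D. D \<in> brauer_diagrams p q \<Longrightarrow> fst (snd (t D)) \<in> mono_up_diagrams (fst (t D)) q \<and>
        snd (snd (t D)) \<in> down_diagrams p (fst (t D)) \<and> D = diagram_comp (fst (snd (t D))) (snd (snd (t D)))"
      by blast
    define s where "s D = fst (t D)" for D
    define f where "f D = fst (snd (t D))" for D
    define u where "u D = snd (snd (t D))" for D
    have fu: "f D \<in> mono_up_diagrams (s D) q" "u D \<in> down_diagrams p (s D)" "diagram_comp (f D) (u D) = D" "s D \<in> Ob"
      if "D \<in> brauer_diagrams p q" for D
      using t[OF that] prec_trunc[OF down_prec, of "u D" p "s D" r] pq by (simp_all add: s_def f_def u_def Ob_def)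
    \<comment> \<open>The coefficient is placed in the left factor, so that additivity of \<theta>
      reduces to \<open>pure_hom_left\<close>.\<close>
    define x where "x F D = (s D, Poly_Mapping.single (f D) (Poly_Mapping.lookup F D), diag_mor (u D) :: 'k brauer)" for F :: "'k brauer" and D
    define \<theta> where "\<theta> F = tp.cls (\<Sum>D\<in>brauer_diagrams p q. frag_of (x F D))" for F
    have up: "Poly_Mapping.single (f D) c \<in> BUp (s D) q" "Poly_Mapping.single (u D) c \<in> BDown p (s D)"
      if "D \<in> brauer_diagrams p q" for D and c :: 'k
      unfolding BUp_def BDown_def using fu[OF that] mono_up by (simp_all add: span_single)
    have xg: "x F D \<in> tensor_gens Ob ?P ?M p q" if "D \<in> brauer_diagrams p q" for F D
      using fu[OF that] up[OF that] by (simp add: x_def tp.gen_iff)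
    have clx: "tp.cls (frag_of (x F D)) = tp.pure (s D) (Poly_Mapping.single (f D) (Poly_Mapping.lookup F D)) (diag_mor (u D))" for F D
      by (simp add: x_def pure_tensor_def)
    have \<theta>c: "\<theta> F \<in> carrier tp.T" for F
      unfolding \<theta>_def by (rule tp.class_closed, rule keys_sum_subset) (use xg in simp)
    have \<theta>h: "\<theta> \<in> hom (grp ?B p q) tp.T"
    proof (rule homI)
      fix F G assume "F \<in> carrier (grp ?B p q)" "G \<in> carrier (grp ?B p q)"
      have k: "Poly_Mapping.keys (\<Sum>D\<in>brauer_diagrams p q. frag_of (x F D)) \<subseteq> tensor_gens Ob ?P ?M p q" for F
        by (rule keys_sum_subset) (use xg in simp)
      have "\<theta> F \<otimes>\<^bsub>tp.T\<^esub> \<theta> G = tp.cls (\<Sum>D\<in>brauer_diagrams p q. frag_of (x F D) + frag_of (x G D))"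
        unfolding \<theta>_def sum.distrib by (rule tp.class_add[OF k k, symmetric])
      also have "\<dots> = \<theta> (F + G)"
        unfolding \<theta>_def
      proof (rule tp.class_sum_cong[OF finite_brauer])
        fix D assume D: "D \<in> brauer_diagrams p q"
        show "Poly_Mapping.keys (frag_of (x F D) + frag_of (x G D)) \<subseteq> tensor_gens Ob ?P ?M p q"
          using Poly_Mapping.keys_add[of "frag_of (x F D)" "frag_of (x G D)"] xg[OF D] by auto
        show "Poly_Mapping.keys (frag_of (x (F + G) D)) \<subseteq> tensor_gens Ob ?P ?M p q" using xg[OF D] by simp
        have "tp.cls (frag_of (x F D) + frag_of (x G D)) = tp.cls (frag_of (x F D)) \<otimes>\<^bsub>tp.T\<^esub> tp.cls (frag_of (x G D))"
          using xg[OF D] by (intro tp.class_add) simp_all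
        also have "\<dots> = tp.cls (frag_of (x (F + G) D))"
          using hom_mult[OF tp.pure_hom_left[OF fu(4)[OF D]], of "diag_mor (u D)"
              "Poly_Mapping.single (f D) (Poly_Mapping.lookup F D)" "Poly_Mapping.single (f D) (Poly_Mapping.lookup G D)"] up[OF D]
          by (simp add: clx lookup_add single_add)
        finally show "tp.cls (frag_of (x F D) + frag_of (x G D)) = tp.cls (frag_of (x (F + G) D))" .
      qed
      finally show "\<theta> (F \<otimes>\<^bsub>grp ?B p q\<^esub> G) = \<theta> F \<otimes>\<^bsub>tp.T\<^esub> \<theta> G" by simp
    qed (simp add: \<theta>c)
    have \<theta>0: "\<theta> 0 = \<one>\<^bsub>tp.T\<^esub>"
      using hom_one[OF \<theta>h comm_group_group[OF cg] tp.group_tensor] by simp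
    have pure0: "tp.pure t 0 G = \<one>\<^bsub>tp.T\<^esub>" "tp.pure t F 0 = \<one>\<^bsub>tp.T\<^esub>"
      if "t \<in> Ob" "F \<in> BUp t q" "G \<in> BDown p t" for t F G
      using hom_one[OF tp.pure_hom_left[OF that(1)] comm_group_group[OF comm_group_brauer(2)[OF that(1) pq(2)]] tp.group_tensor, of G]
        hom_one[OF tp.pure_hom_right[OF that(1)] comm_group_group[OF comm_group_brauer(3)[OF pq(1) that(1)]] tp.group_tensor, of F] that
      by simp_all
    have \<theta>1: "\<theta> (Poly_Mapping.single D c) = tp.pure (s D) (Poly_Mapping.single (f D) c) (diag_mor (u D))"
      if D: "D \<in> brauer_diagrams p q" for D c
    proof -
      have "\<theta> (Poly_Mapping.single D c) = tp.cls (\<Sum>E\<in>brauer_diagrams p q. if E = D then frag_of (x (Poly_Mapping.single D c) D) else 0)"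
        unfolding \<theta>_def
      proof (rule tp.class_sum_cong[OF finite_brauer])
        fix E assume E: "E \<in> brauer_diagrams p q"
        show "tp.cls (frag_of (x (Poly_Mapping.single D c) E)) = tp.cls (if E = D then frag_of (x (Poly_Mapping.single D c) D) else 0)"
          using pure0(1)[OF fu(4)[OF E] up[OF E], of 1] by (simp add: clx tp.class_zero lookup_single)
      qed (use xg D in simp_all)
      also have "\<dots> = tp.pure (s D) (Poly_Mapping.single (f D) c) (diag_mor (u D))"
        using D by (simp add: clx)
      finally show ?thesis .
    qed
    have \<theta>pure: "\<theta> (?c F G) = tp.pure t F G" if t: "t \<in> Ob" and F: "F \<in> BUp t q" and G: "G \<in> BDown p t" for t F G
    proof -
      have cM: "?c F G \<in> BMor p q" if "F \<in> BUp t q" "G \<in> BDown p t" for F G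
        using brauer_comp_closed(1)[of F t q G p] that mor by blast
      have 1: "\<theta> (?c (Poly_Mapping.single f0 a) (Poly_Mapping.single u0 b)) = tp.pure t (Poly_Mapping.single f0 a) (Poly_Mapping.single u0 b)"
        if f0: "f0 \<in> up_diagrams t q" and u0: "u0 \<in> down_diagrams p t" for f0 u0 a b
      proof -
        obtain g \<sigma> where g: "g \<in> mono_up_diagrams t q" "\<sigma> \<in> level_diagrams t t" "f0 = diagram_comp g \<sigma>"
          using up_factor[OF f0] by blast
        note gb = up_brauer[OF mono_up[OF g(1)]] and \<sigma>b = level_brauer[OF g(2)] and u0b = down_brauer[OF u0]
        let ?D = "diagram_comp f0 u0"
        have Db: "?D \<in> brauer_diagrams p q" using diagram_comp_closed[OF up_brauer[OF f0] u0b] .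
        have D: "?D = diagram_comp g (diagram_comp \<sigma> u0)"
          unfolding g(3) by (rule diagram_comp_assoc(1)[OF gb \<sigma>b u0b])
        have \<sigma>u: "diagram_comp \<sigma> u0 \<in> down_diagrams p t" using down_comp[OF level_down[OF g(2)] u0] .
        \<comment> \<open>f0 = g \<sigma> gives f0 u0 = g (\<sigma> u0), so by uniqueness g and
          \<sigma> u0 are the factors chosen for this diagram; \<sigma> is then carried across the
          tensor sign.\<close>
        note fq = factor_unique[OF fu(1)[OF Db] fu(2)[OF Db] g(1) \<sigma>u, unfolded fu(3)[OF Db], OF D]
        have sym: "(diag_mor \<sigma> :: 'k brauer) \<in> BSym t t" "Poly_Mapping.single (id_diagram t) b \<in> BSym t t"
          unfolding BSym_def using g(2) id_level by (auto intro: span_single)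
        have Bu: "Poly_Mapping.single g c \<in> BUp t q" "Poly_Mapping.single f0 c \<in> BUp t q"
          "Poly_Mapping.single u0 c \<in> BDown p t" for c :: 'k
          unfolding BUp_def BDown_def using mono_up[OF g(1)] f0 u0 by (auto intro: span_single)
        have l0: "loops f0 u0 = 0" by (rule loops_eq_0[OF up_brauer[OF f0] u0b disjI1[OF f0]])
        have l1: "loops \<sigma> u0 = 0" by (rule loops_eq_0[OF \<sigma>b u0b disjI1[OF level_up[OF g(2)]]])
        have l2: "loops g \<sigma> = 0" by (rule loops_eq_0[OF gb \<sigma>b disjI1[OF mono_up[OF g(1)]]])
        have l3: "loops f0 (id_diagram t) = 0" by (rule loops_eq_0[OF up_brauer[OF f0] id_brauer disjI1[OF f0]])
        have l4: "loops (id_diagram t) u0 = 0"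
          by (rule loops_eq_0[OF id_brauer u0b disjI1[OF level_up[OF id_level]]])
        have "\<theta> (?c (Poly_Mapping.single f0 a) (Poly_Mapping.single u0 b))
            = tp.pure t (Poly_Mapping.single g (a * b)) (diag_mor (diagram_comp \<sigma> u0))"
          using \<theta>1[OF Db] fq by (simp add: brauer_comp_single l0)
        also have "\<dots> = tp.pure t (Poly_Mapping.single g (a * b)) (?c (diag_mor \<sigma>) (diag_mor u0))"
          by (simp add: brauer_comp_single l1)
        also have "\<dots> = tp.pure t (?c (Poly_Mapping.single g (a * b)) (diag_mor \<sigma>)) (diag_mor u0)"
          using tp.pure_ract_lact[OF t, of "Poly_Mapping.single g (a * b)" "diag_mor \<sigma>" "diag_mor u0"] sym Bu by simp
        \<comment> \<open>A scalar crosses the tensor sign as a multiple of the identity diagram,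
          which lies in the group algebra.\<close>
        also have "\<dots> = tp.pure t (?c (Poly_Mapping.single f0 a) (Poly_Mapping.single (id_diagram t) b)) (diag_mor u0)"
          by (simp add: brauer_comp_single l2 l3 id_comp_right[OF up_brauer[OF f0]] g(3)[symmetric])
        also have "\<dots> = tp.pure t (Poly_Mapping.single f0 a) (?c (Poly_Mapping.single (id_diagram t) b) (diag_mor u0))"
          using tp.pure_ract_lact[OF t, of "Poly_Mapping.single f0 a" "Poly_Mapping.single (id_diagram t) b" "diag_mor u0"] sym Bu by simp
        also have "\<dots> = tp.pure t (Poly_Mapping.single f0 a) (Poly_Mapping.single u0 b)"
          by (simp add: brauer_comp_single l4 id_comp_left[OF u0b])
        finally show ?thesis .
      qed
      have 2: "\<theta> (?c (Poly_Mapping.single f0 a) G) = tp.pure t (Poly_Mapping.single f0 a) G"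
        if f0: "f0 \<in> up_diagrams t q" for f0 a
      proof -
        have sf: "Poly_Mapping.single f0 a \<in> BUp t q" unfolding BUp_def using f0 by (rule span_single)
        show ?thesis
          using G[unfolded BDown_def]
        proof (induction rule: span_induct)
          case zero
          show ?case using \<theta>0 pure0(2)[OF t sf span_zero[of "down_diagrams p t", folded BDown_def]] by simp
        next
          case (add F G)
          have m: "F \<in> BDown p t" "G \<in> BDown p t" using add(1,2) by (simp_all add: BDown_def)
          show ?case
            using hom_mult[OF \<theta>h, of "?c (Poly_Mapping.single f0 a) F" "?c (Poly_Mapping.single f0 a) G"] cM[OF sf m(1)] cM[OF sf m(2)]
              hom_mult[OF tp.pure_hom_right[OF t, of "Poly_Mapping.single f0 a"], of F G] sf add(3,4) m
            by (simp add: brauer_comp_add)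
        next
          case (single u0 b)
          then show ?case by (rule 1[OF f0])
        qed
      qed
      show ?thesis
        using F[unfolded BUp_def]
      proof (induction rule: span_induct)
        case zero
        show ?case using \<theta>0 pure0(1)[OF t span_zero[of "up_diagrams t q", folded BUp_def] G] by simp
      next
        case (add F F')
        have m: "F \<in> BUp t q" "F' \<in> BUp t q" using add(1,2) by (simp_all add: BUp_def)
        show ?case
          using hom_mult[OF \<theta>h, of "?c F G" "?c F' G"] cM[OF m(1) G] cM[OF m(2) G]
            hom_mult[OF tp.pure_hom_left[OF t, of G], of F F'] G add(3,4) m
          by (simp add: brauer_comp_add)
      next
        case (single f0 a)
        then show ?case by (rule 2)
      qed
    qed
    have "bij_betw (?L p q) (carrier tp.T) (BMor p q)"
    proof (rule bij_betw_byWitness[where f' = \<theta>])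
      show "\<forall>x\<in>carrier tp.T. \<theta> (?L p q x) = x"
      proof
        fix x assume x: "x \<in> carrier tp.T"
        have "\<theta> (?L p q x) = id x"
          by (rule tp.hom_class_eq[OF tp.group_tensor hom_comp[OF hL \<theta>h] hom_id _ x])
            (simp add: Lp \<theta>pure)
        then show "\<theta> (?L p q x) = x" by simp
      qed
      show "\<forall>F\<in>BMor p q. ?L p q (\<theta> F) = F"
      proof
        fix F :: "'k brauer" assume F: "F \<in> BMor p q"
        have "?L p q (\<theta> F) = (\<Sum>D\<in>brauer_diagrams p q. ?L p q (tp.cls (frag_of (x F D))))"
          unfolding \<theta>_def by (rule tp.hom_class_sum[OF hL cg finite_brauer xg])
        also have "\<dots> = (\<Sum>D\<in>brauer_diagrams p q. Poly_Mapping.single D (Poly_Mapping.lookup F D))"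
        proof (rule sum.cong[OF refl])
          fix D assume D: "D \<in> brauer_diagrams p q"
          have "loops (f D) (u D) = 0"
            using fu[OF D] by (intro loops_eq_0[OF up_brauer down_brauer]) (auto intro: mono_up)
          then show "?L p q (tp.cls (frag_of (x F D))) = Poly_Mapping.single D (Poly_Mapping.lookup F D)"
            using fu[OF D] up[OF D] by (simp add: clx Lp brauer_comp_single)
        qed
        also have "\<dots> = (\<Sum>D\<in>Poly_Mapping.keys F. Poly_Mapping.single D (Poly_Mapping.lookup F D))"
          using F by (intro sum.mono_neutral_right) (auto simp: BMor_def diagram_span_def in_keys_iff)
        also have "\<dots> = F" by (rule span_expand[symmetric])
        finally show "?L p q (\<theta> F) = F" .
      qed
      show "?L p q ` carrier tp.T \<subseteq> BMor p q" using hom_in_carrier[OF hL] by auto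
      show "\<theta> ` BMor p q \<subseteq> carrier tp.T" using \<theta>c by blast
    qed
    then show ?thesis using hL l rr by blast
  qed
  show ?thesis
    unfolding bimodule_iso_def bimodule_map_def grp_tensor hom_bimodule_simps using key by blast
qed

lemma stratified_brauer:
  "stratified_category scale_brauer (trunc_objects r) BMor (brauer_comp \<delta>) brauer_id prec BSym BUp BDown"
  unfolding stratified_category_def stratified_category_axioms_def
proof (intro conjI allI impI)
  show "partial_order_on (trunc_objects r) {(p, q). p \<in> trunc_objects r \<and> q \<in> trunc_objects r \<and> prec p q}"
    unfolding partial_order_on_def preorder_on_def
  proof (intro conjI)
    show "trans {(p, q). p \<in> trunc_objects r \<and> q \<in> trunc_objects r \<and> prec p q}"
      unfolding trans_def prec_def by auto
  qed (auto simp: refl_on_def antisym_def prec_def)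
qed (simp_all add: linear_category_brauer wide_subcategory_brauer BSym_zero BUp_zero BDown_zero B_diag brauer_comp_iso)

section \<open>Pairings from invariant forms\<close>

lemma level_cancel:
  assumes \<sigma>: "\<sigma> \<in> level_diagrams p p"
  shows "g \<in> brauer_diagrams q p \<Longrightarrow> diagram_comp (flip_diagram \<sigma>) (diagram_comp \<sigma> g) = g"
    and "g \<in> brauer_diagrams q p \<Longrightarrow> diagram_comp \<sigma> (diagram_comp (flip_diagram \<sigma>) g) = g"
    and "f \<in> brauer_diagrams p q \<Longrightarrow> diagram_comp (diagram_comp f \<sigma>) (flip_diagram \<sigma>) = f"
    and "f \<in> brauer_diagrams p q \<Longrightarrow> diagram_comp (diagram_comp f (flip_diagram \<sigma>)) \<sigma> = f"
proof -
  note b = level_brauer[OF \<sigma>] and fb = flip_brauer[OF level_brauer[OF \<sigma>]]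
  note i1 = flip_comp_up[OF level_up[OF \<sigma>]] and i2 = comp_flip_down[OF level_down[OF \<sigma>]]
  show "g \<in> brauer_diagrams q p \<Longrightarrow> diagram_comp (flip_diagram \<sigma>) (diagram_comp \<sigma> g) = g"
    using diagram_comp_assoc(1)[OF fb b, of g q] by (simp add: i1 id_comp_left)
  show "g \<in> brauer_diagrams q p \<Longrightarrow> diagram_comp \<sigma> (diagram_comp (flip_diagram \<sigma>) g) = g"
    using diagram_comp_assoc(1)[OF b fb, of g q] by (simp add: i2 id_comp_left)
  show "f \<in> brauer_diagrams p q \<Longrightarrow> diagram_comp (diagram_comp f \<sigma>) (flip_diagram \<sigma>) = f"
    using diagram_comp_assoc(1)[OF _ b fb, of f q] by (simp add: i2 id_comp_right)
  show "f \<in> brauer_diagrams p q \<Longrightarrow> diagram_comp (diagram_comp f (flip_diagram \<sigma>)) \<sigma> = f"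
    using diagram_comp_assoc(1)[OF _ fb b, of f q] by (simp add: i1 id_comp_right)
qed

lemma loops_level:
  "\<sigma> \<in> level_diagrams p p \<Longrightarrow> g \<in> brauer_diagrams q p \<Longrightarrow> loops \<sigma> g = 0"
  "\<sigma> \<in> level_diagrams p p \<Longrightarrow> f \<in> brauer_diagrams p q \<Longrightarrow> loops f \<sigma> = 0"
  using loops_eq_0[OF level_brauer _ disjI1[OF level_up]] loops_eq_0[OF _ level_brauer disjI2[OF level_down]] by blast+

text \<open>An invariant scalar form determines a pairing with values in the group algebra: the coefficient
  of \<open>\<sigma>\<close> in the value is the form on the arguments twisted by the inverse of \<open>\<sigma>\<close>. Both pairings of
  the theorem are of this kind.\<close>

locale brauer_form =
  fixes \<delta> :: "'k::comm_ring_1" and r :: nat and \<beta> :: "diagram \<Rightarrow> diagram \<Rightarrow> 'k"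
    and \<psi> :: "nat \<Rightarrow> nat \<Rightarrow> diagram \<Rightarrow> diagram \<Rightarrow> 'k brauer"
  assumes \<beta>_left: "\<sigma> \<in> level_diagrams p p \<Longrightarrow> g \<in> down_diagrams q p \<Longrightarrow> f \<in> up_diagrams p q \<Longrightarrow>
      \<beta> (diagram_comp \<sigma> g) f = \<beta> g (diagram_comp f \<sigma>)"
    and \<beta>_mid: "\<tau> \<in> level_diagrams q q \<Longrightarrow> g \<in> down_diagrams q p \<Longrightarrow> f \<in> up_diagrams p q \<Longrightarrow>
      \<beta> (diagram_comp g \<tau>) f = \<beta> g (diagram_comp \<tau> f)"
    and \<psi>_eq: "g \<in> down_diagrams q s \<Longrightarrow> f \<in> up_diagrams p q \<Longrightarrow> \<psi> p s g f =
      (if s = p then \<Sum>\<sigma>\<in>level_diagrams p p. Poly_Mapping.single \<sigma> (\<beta> g (diagram_comp f (flip_diagram \<sigma>))) else 0)"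
begin

abbreviation "Ob \<equiv> trunc_objects r"
abbreviation A :: "nat \<Rightarrow> 'k brauer set" where "A \<equiv> \<lambda>s. BSym s s"
abbreviation "cc \<equiv> brauer_comp \<delta>"

definition B :: "nat \<Rightarrow> nat \<Rightarrow> 'k brauer \<Rightarrow> 'k brauer \<Rightarrow> 'k brauer" where
  "B p s = bilinear_ext (\<psi> p s)"

text \<open>Written like \<open>cell_pairing\<close> and \<open>level_pairing\<close>, which become
  instances by unfolding; \<psi> takes the two ranks as arguments because
  \<open>cell_pairing_diag\<close> depends on them.\<close>

definition pairing :: "nat \<Rightarrow> nat \<Rightarrow> 'k brauer_tensor \<Rightarrow> 'k brauer" where
  "pairing p s = tensor_lift (grp (BSymBim \<delta>) p s) (\<lambda>(q, g, f). bilinear_ext (\<psi> p s) g f)"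

text \<open>The bilinear extension of \<open>\<beta>\<close>; reusing \<open>bilinear_ext\<close>, its value is stored as the coefficient
  of the empty diagram.\<close>

definition bt :: "'k brauer \<Rightarrow> 'k brauer \<Rightarrow> 'k" where
  "bt G F = Poly_Mapping.lookup (bilinear_ext (\<lambda>g f. Poly_Mapping.single {} (\<beta> g f)) G F) {}"

lemma bt_add: "bt (G + G') F = bt G F + bt G' F" "bt G (F + F') = bt G F + bt G F'"
  by (simp_all add: bt_def bilinear_ext_add_left bilinear_ext_add_right lookup_add)

lemma bt_zero: "bt 0 F = 0" "bt G 0 = 0"
  by (simp_all add: bt_def bilinear_ext_zero)

lemma bt_sum: "bt (sum G I) F = (\<Sum>i\<in>I. bt (G i) F)" "bt F (sum G I) = (\<Sum>i\<in>I. bt F (G i))"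
  by (induction I rule: infinite_finite_induct) (simp_all add: bt_add bt_zero)

lemma bt_single: "bt (Poly_Mapping.single g c) (Poly_Mapping.single f e) = c * e * \<beta> g f"
  by (simp add: bt_def bilinear_ext_single scale_single)

lemma bt_diff: "bt (G - G') F = bt G F - bt G' F"
  using bt_add(1)[of "G - G'" G' F] by simp

lemma bt_single_scale: "bt G (Poly_Mapping.single f c) = c * bt G (diag_mor f)"
  by (rule span_eqI[OF in_span_UNIV[of G]]) (simp_all add: bt_add bt_single algebra_simps)

lemma B_add: "B p s (G + G') F = B p s G F + B p s G' F" "B p s G (F + F') = B p s G F + B p s G F'"
  by (simp_all add: B_def bilinear_ext_add_left bilinear_ext_add_right)

lemma B_single: "B p s (Poly_Mapping.single g c) (Poly_Mapping.single f e) = scale_brauer (c * e) (\<psi> p s g f)"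
  by (simp add: B_def bilinear_ext_single)

text \<open>\<beta> reads off the coefficient of the identity permutation, and this coefficient does
  not change when a factor of a product in the group algebra is moved cyclically.\<close>

lemma bt_left:
  assumes a: "a \<in> BSym p p" and G: "G \<in> BDown q p" and F: "F \<in> BUp p q"
  shows "bt (cc a G) F = bt G (cc F a)"
proof -
  have 1: "bt (cc (Poly_Mapping.single \<sigma> c) (Poly_Mapping.single g d)) (Poly_Mapping.single f e)
      = bt (Poly_Mapping.single g d) (cc (Poly_Mapping.single f e) (Poly_Mapping.single \<sigma> c))"
    if "\<sigma> \<in> level_diagrams p p" "g \<in> down_diagrams q p" "f \<in> up_diagrams p q" for \<sigma> g f c d e
    using that by (simp add: brauer_comp_single bt_single loops_level[OF _ down_brauer] loops_level[OF _ up_brauer]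
        \<beta>_left algebra_simps)
  have 2: "bt (cc (Poly_Mapping.single \<sigma> c) (Poly_Mapping.single g d)) F
      = bt (Poly_Mapping.single g d) (cc F (Poly_Mapping.single \<sigma> c))"
    if "\<sigma> \<in> level_diagrams p p" "g \<in> down_diagrams q p" for \<sigma> g c d
    by (rule span_eqI[OF F[unfolded BUp_def]]) (simp_all add: bt_add brauer_comp_add 1 that)
  have 3: "bt (cc (Poly_Mapping.single \<sigma> c) G) F = bt G (cc F (Poly_Mapping.single \<sigma> c))"
    if "\<sigma> \<in> level_diagrams p p" for \<sigma> c
    by (rule span_eqI[OF G[unfolded BDown_def]]) (simp_all add: bt_add brauer_comp_add 2 that)
  show ?thesis
    by (rule span_eqI[OF a[unfolded BSym_def]]) (simp_all add: bt_add brauer_comp_add 3)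
qed

lemma bt_mid:
  assumes a: "a \<in> BSym q q" and G: "G \<in> BDown q p" and F: "F \<in> BUp p q"
  shows "bt (cc G a) F = bt G (cc a F)"
proof -
  have 1: "bt (cc (Poly_Mapping.single g d) (Poly_Mapping.single \<sigma> c)) (Poly_Mapping.single f e)
      = bt (Poly_Mapping.single g d) (cc (Poly_Mapping.single \<sigma> c) (Poly_Mapping.single f e))"
    if "\<sigma> \<in> level_diagrams q q" "g \<in> down_diagrams q p" "f \<in> up_diagrams p q" for \<sigma> g f c d e
    using that by (simp add: brauer_comp_single bt_single loops_level[OF _ down_brauer] loops_level[OF _ up_brauer]
        \<beta>_mid algebra_simps)
  have 2: "bt (cc (Poly_Mapping.single g d) (Poly_Mapping.single \<sigma> c)) F
      = bt (Poly_Mapping.single g d) (cc (Poly_Mapping.single \<sigma> c) F)"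
    if "\<sigma> \<in> level_diagrams q q" "g \<in> down_diagrams q p" for \<sigma> g c d
    by (rule span_eqI[OF F[unfolded BUp_def]]) (simp_all add: bt_add brauer_comp_add 1 that)
  have 3: "bt (cc G (Poly_Mapping.single \<sigma> c)) F = bt G (cc (Poly_Mapping.single \<sigma> c) F)"
    if "\<sigma> \<in> level_diagrams q q" for \<sigma> c
    by (rule span_eqI[OF G[unfolded BDown_def]]) (simp_all add: bt_add brauer_comp_add 2 that)
  show ?thesis
    by (rule span_eqI[OF a[unfolded BSym_def]]) (simp_all add: bt_add brauer_comp_add 3)
qed

lemma B_eq:
  assumes G: "G \<in> BDown q p" and F: "F \<in> BUp p q"
  shows "B p p G F = (\<Sum>\<sigma>\<in>level_diagrams p p. Poly_Mapping.single \<sigma> (bt G (cc F (diag_mor (flip_diagram \<sigma>)))))"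
proof -
  have 1: "B p p (Poly_Mapping.single g c) (Poly_Mapping.single f e) = (\<Sum>\<sigma>\<in>level_diagrams p p.
      Poly_Mapping.single \<sigma> (bt (Poly_Mapping.single g c) (cc (Poly_Mapping.single f e) (diag_mor (flip_diagram \<sigma>)))))"
    if "g \<in> down_diagrams q p" "f \<in> up_diagrams p q" for g f c e
    using that by (auto simp: B_single \<psi>_eq scale_sum scale_single brauer_comp_single bt_single
        loops_level(2)[OF flip_level up_brauer] intro!: sum.cong)
  have 2: "B p p (Poly_Mapping.single g c) F = (\<Sum>\<sigma>\<in>level_diagrams p p.
      Poly_Mapping.single \<sigma> (bt (Poly_Mapping.single g c) (cc F (diag_mor (flip_diagram \<sigma>)))))"
    if "g \<in> down_diagrams q p" for g c
    by (rule span_eqI[OF F[unfolded BUp_def]]) (simp_all add: B_add brauer_comp_add bt_add single_add sum.distrib 1 that)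
  show ?thesis
    by (rule span_eqI[OF G[unfolded BDown_def]]) (simp_all add: B_add brauer_comp_add bt_add single_add sum.distrib 2)
qed

lemma B_off:
  assumes "s \<noteq> p" and G: "G \<in> BDown q s" and F: "F \<in> BUp p q"
  shows "B p s G F = 0"
proof -
  have 1: "B p s (Poly_Mapping.single g c) F = 0" if "g \<in> down_diagrams q s" for g c
    by (rule span_eqI[OF F[unfolded BUp_def], where \<Psi> = "\<lambda>_. 0"])
      (use assms(1) that in \<open>simp_all add: B_add B_single \<psi>_eq scale_zero_right\<close>)
  show ?thesis
    by (rule span_eqI[OF G[unfolded BDown_def], where \<Psi> = "\<lambda>_. 0"]) (simp_all add: B_add 1)
qed

lemma B_closed:
  assumes "G \<in> BDown q s" "F \<in> BUp p q"
  shows "B p s G F \<in> BSym p s"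
proof (cases "s = p")
  case True
  then show ?thesis using B_eq[of G q p F] assms by (auto simp: BSym_def intro!: span_sum span_single)
next
  case False
  then show ?thesis using B_off[OF False assms] by (simp add: BSym_def)
qed

text \<open>Substitute \<sigma> = \<tau> \<rho> in the sum over permutations: the twist by the
  inverse of \<sigma> splits, and \<open>\<beta>_left\<close> absorbs \<tau>.\<close>

lemma \<psi>_left:
  assumes t: "\<tau> \<in> level_diagrams p p" and g: "g \<in> down_diagrams q p" and f: "f \<in> up_diagrams p q"
  shows "\<psi> p p (diagram_comp \<tau> g) f = cc (diag_mor \<tau>) (\<psi> p p g f)"
proof -
  have tg: "diagram_comp \<tau> g \<in> down_diagrams q p" using down_comp[OF level_down[OF t] g] .
  have "\<psi> p p (diagram_comp \<tau> g) f = (\<Sum>\<sigma>\<in>level_diagrams p p. Poly_Mapping.single \<sigma> (\<beta> (diagram_comp \<tau> g) (diagram_comp f (flip_diagram \<sigma>))))"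
    using \<psi>_eq[OF tg f] by simp
  also have "\<dots> = (\<Sum>\<rho>\<in>level_diagrams p p. Poly_Mapping.single (diagram_comp \<tau> \<rho>) (\<beta> g (diagram_comp f (flip_diagram \<rho>))))"
  proof (rule sum.reindex_bij_witness[where i = "\<lambda>\<rho>. diagram_comp \<tau> \<rho>" and j = "\<lambda>\<sigma>. diagram_comp (flip_diagram \<tau>) \<sigma>"])
    fix \<sigma> assume s: "\<sigma> \<in> level_diagrams p p"
    show "diagram_comp \<tau> (diagram_comp (flip_diagram \<tau>) \<sigma>) = \<sigma>" by (rule level_cancel(2)[OF t level_brauer[OF s]])
    show "diagram_comp (flip_diagram \<tau>) \<sigma> \<in> level_diagrams p p" by (rule level_comp[OF flip_level[OF t] s])
    have fs: "diagram_comp f (flip_diagram \<sigma>) \<in> up_diagrams p q" by (rule up_comp[OF f level_up[OF flip_level[OF s]]])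
    have "diagram_comp f (flip_diagram (diagram_comp (flip_diagram \<tau>) \<sigma>)) = diagram_comp (diagram_comp f (flip_diagram \<sigma>)) \<tau>"
      using flip_comp[OF flip_brauer[OF level_brauer[OF t]] level_brauer[OF s]]
        diagram_comp_assoc(1)[OF up_brauer[OF f] flip_brauer[OF level_brauer[OF s]] level_brauer[OF t]] by simp
    then show "Poly_Mapping.single (diagram_comp \<tau> (diagram_comp (flip_diagram \<tau>) \<sigma>)) (\<beta> g (diagram_comp f (flip_diagram (diagram_comp (flip_diagram \<tau>) \<sigma>))))
       = Poly_Mapping.single \<sigma> (\<beta> (diagram_comp \<tau> g) (diagram_comp f (flip_diagram \<sigma>)))"
      using \<beta>_left[OF t g fs] level_cancel(2)[OF t level_brauer[OF s]] by simp
  next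
    fix \<rho> assume s: "\<rho> \<in> level_diagrams p p"
    show "diagram_comp (flip_diagram \<tau>) (diagram_comp \<tau> \<rho>) = \<rho>" by (rule level_cancel(1)[OF t level_brauer[OF s]])
    show "diagram_comp \<tau> \<rho> \<in> level_diagrams p p" by (rule level_comp[OF t s])
  qed
  also have "\<dots> = cc (diag_mor \<tau>) (\<psi> p p g f)"
    using \<psi>_eq[OF g f] by (simp add: brauer_comp_sum brauer_comp_single loops_level(1)[OF t level_brauer])
  finally show ?thesis .
qed

text \<open>Here the substitution is \<sigma> = \<rho> \<tau>: when f \<tau> is twisted by the
  inverse of \<sigma>, the factor \<tau> cancels.\<close>

lemma \<psi>_right:
  assumes t: "\<tau> \<in> level_diagrams p p" and g: "g \<in> down_diagrams q p" and f: "f \<in> up_diagrams p q"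
  shows "\<psi> p p g (diagram_comp f \<tau>) = cc (\<psi> p p g f) (diag_mor \<tau>)"
proof -
  have ft: "diagram_comp f \<tau> \<in> up_diagrams p q" using up_comp[OF f level_up[OF t]] .
  have "\<psi> p p g (diagram_comp f \<tau>) = (\<Sum>\<sigma>\<in>level_diagrams p p. Poly_Mapping.single \<sigma> (\<beta> g (diagram_comp (diagram_comp f \<tau>) (flip_diagram \<sigma>))))"
    using \<psi>_eq[OF g ft] by simp
  also have "\<dots> = (\<Sum>\<rho>\<in>level_diagrams p p. Poly_Mapping.single (diagram_comp \<rho> \<tau>) (\<beta> g (diagram_comp f (flip_diagram \<rho>))))"
  proof (rule sum.reindex_bij_witness[where i = "\<lambda>\<rho>. diagram_comp \<rho> \<tau>" and j = "\<lambda>\<sigma>. diagram_comp \<sigma> (flip_diagram \<tau>)"])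
    fix \<sigma> assume s: "\<sigma> \<in> level_diagrams p p"
    show "diagram_comp (diagram_comp \<sigma> (flip_diagram \<tau>)) \<tau> = \<sigma>" by (rule level_cancel(4)[OF t level_brauer[OF s]])
    show "diagram_comp \<sigma> (flip_diagram \<tau>) \<in> level_diagrams p p" by (rule level_comp[OF s flip_level[OF t]])
    have "diagram_comp f (flip_diagram (diagram_comp \<sigma> (flip_diagram \<tau>))) = diagram_comp (diagram_comp f \<tau>) (flip_diagram \<sigma>)"
      using flip_comp[OF level_brauer[OF s] flip_brauer[OF level_brauer[OF t]]]
        diagram_comp_assoc(1)[OF up_brauer[OF f] level_brauer[OF t] flip_brauer[OF level_brauer[OF s]]] by simp
    then show "Poly_Mapping.single (diagram_comp (diagram_comp \<sigma> (flip_diagram \<tau>)) \<tau>) (\<beta> g (diagram_comp f (flip_diagram (diagram_comp \<sigma> (flip_diagram \<tau>)))))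
       = Poly_Mapping.single \<sigma> (\<beta> g (diagram_comp (diagram_comp f \<tau>) (flip_diagram \<sigma>)))"
      using level_cancel(4)[OF t level_brauer[OF s]] by simp
  next
    fix \<rho> assume s: "\<rho> \<in> level_diagrams p p"
    show "diagram_comp (diagram_comp \<rho> \<tau>) (flip_diagram \<tau>) = \<rho>" by (rule level_cancel(3)[OF t level_brauer[OF s]])
    show "diagram_comp \<rho> \<tau> \<in> level_diagrams p p" by (rule level_comp[OF s t])
  qed
  also have "\<dots> = cc (\<psi> p p g f) (diag_mor \<tau>)"
    using \<psi>_eq[OF g f] by (simp add: brauer_comp_sum brauer_comp_single loops_level(2)[OF t level_brauer])
  finally show ?thesis .
qed

lemma \<psi>_mid:
  assumes t: "\<tau> \<in> level_diagrams q q" and g: "g \<in> down_diagrams q s" and f: "f \<in> up_diagrams p q"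
  shows "\<psi> p s (diagram_comp g \<tau>) f = \<psi> p s g (diagram_comp \<tau> f)"
proof -
  have gt: "diagram_comp g \<tau> \<in> down_diagrams q s" using down_comp[OF g level_down[OF t]] .
  have tf: "diagram_comp \<tau> f \<in> up_diagrams p q" using up_comp[OF level_up[OF t] f] .
  show ?thesis
  proof (cases "s = p")
    case True
    have "\<beta> (diagram_comp g \<tau>) (diagram_comp f (flip_diagram \<sigma>)) = \<beta> g (diagram_comp (diagram_comp \<tau> f) (flip_diagram \<sigma>))"
      if s: "\<sigma> \<in> level_diagrams p p" for \<sigma>
      using \<beta>_mid[OF t _ up_comp[OF f level_up[OF flip_level[OF s]]], of g] g True
        diagram_comp_assoc(1)[OF level_brauer[OF t] up_brauer[OF f] flip_brauer[OF level_brauer[OF s]]] by simp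
    then show ?thesis using \<psi>_eq[OF gt f] \<psi>_eq[OF g tf] True by simp
  next
    case False
    then show ?thesis using \<psi>_eq[OF gt f] \<psi>_eq[OF g tf] by simp
  qed
qed

lemma B_left:
  assumes a: "a \<in> BSym p p" and G: "G \<in> BDown q p" and F: "F \<in> BUp p q"
  shows "B p p (cc a G) F = cc a (B p p G F)"
proof -
  have s: "cc (Poly_Mapping.single \<tau> c) X = scale_brauer c (cc (diag_mor \<tau>) X)" for \<tau> c X
    using brauer_comp_scale(1)[of \<delta> c "diag_mor \<tau>" X] by (simp add: scale_single)
  have 1: "B p p (cc (Poly_Mapping.single \<tau> c) (Poly_Mapping.single g d)) (Poly_Mapping.single f e)
      = cc (Poly_Mapping.single \<tau> c) (B p p (Poly_Mapping.single g d) (Poly_Mapping.single f e))"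
    if "\<tau> \<in> level_diagrams p p" "g \<in> down_diagrams q p" "f \<in> up_diagrams p q" for \<tau> g f c d e
    using that
    by (simp add: brauer_comp_scale brauer_comp_single loops_level[OF _ down_brauer] B_single \<psi>_left scale_scale
        s[of \<tau> c "\<psi> p p g f"] ac_simps)
  have 2: "B p p (cc (Poly_Mapping.single \<tau> c) (Poly_Mapping.single g d)) F = cc (Poly_Mapping.single \<tau> c) (B p p (Poly_Mapping.single g d) F)"
    if "\<tau> \<in> level_diagrams p p" "g \<in> down_diagrams q p" for \<tau> g c d
    by (rule span_eqI[OF F[unfolded BUp_def]]) (simp_all add: B_add brauer_comp_add 1 that)
  have 3: "B p p (cc (Poly_Mapping.single \<tau> c) G) F = cc (Poly_Mapping.single \<tau> c) (B p p G F)"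
    if "\<tau> \<in> level_diagrams p p" for \<tau> c
    by (rule span_eqI[OF G[unfolded BDown_def]]) (simp_all add: B_add brauer_comp_add 2 that)
  show ?thesis
    by (rule span_eqI[OF a[unfolded BSym_def]]) (simp_all add: B_add brauer_comp_add 3)
qed

lemma B_right:
  assumes a: "a \<in> BSym p p" and G: "G \<in> BDown q p" and F: "F \<in> BUp p q"
  shows "B p p G (cc F a) = cc (B p p G F) a"
proof -
  have s: "cc X (Poly_Mapping.single \<tau> c) = scale_brauer c (cc X (diag_mor \<tau>))" for \<tau> c X
    using brauer_comp_scale(2)[of \<delta> X c "diag_mor \<tau>"] by (simp add: scale_single)
  have 1: "B p p (Poly_Mapping.single g d) (cc (Poly_Mapping.single f e) (Poly_Mapping.single \<tau> c))
      = cc (B p p (Poly_Mapping.single g d) (Poly_Mapping.single f e)) (Poly_Mapping.single \<tau> c)"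
    if "\<tau> \<in> level_diagrams p p" "g \<in> down_diagrams q p" "f \<in> up_diagrams p q" for \<tau> g f c d e
    using that
    by (simp add: brauer_comp_scale brauer_comp_single loops_level[OF _ up_brauer] B_single \<psi>_right scale_scale
        s[of "\<psi> p p g f" \<tau> c] ac_simps)
  have 2: "B p p (Poly_Mapping.single g d) (cc F (Poly_Mapping.single \<tau> c)) = cc (B p p (Poly_Mapping.single g d) F) (Poly_Mapping.single \<tau> c)"
    if "\<tau> \<in> level_diagrams p p" "g \<in> down_diagrams q p" for \<tau> g c d
    by (rule span_eqI[OF F[unfolded BUp_def]]) (simp_all add: B_add brauer_comp_add 1 that)
  have 3: "B p p G (cc F (Poly_Mapping.single \<tau> c)) = cc (B p p G F) (Poly_Mapping.single \<tau> c)"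
    if "\<tau> \<in> level_diagrams p p" for \<tau> c
    by (rule span_eqI[OF G[unfolded BDown_def]]) (simp_all add: B_add brauer_comp_add 2 that)
  show ?thesis
    by (rule span_eqI[OF a[unfolded BSym_def]]) (simp_all add: B_add brauer_comp_add 3)
qed

lemma B_mid:
  assumes a: "a \<in> BSym q q" and G: "G \<in> BDown q s" and F: "F \<in> BUp p q"
  shows "B p s (cc G a) F = B p s G (cc a F)"
proof -
  have 1: "B p s (cc (Poly_Mapping.single g d) (Poly_Mapping.single \<tau> c)) (Poly_Mapping.single f e)
      = B p s (Poly_Mapping.single g d) (cc (Poly_Mapping.single \<tau> c) (Poly_Mapping.single f e))"
    if "\<tau> \<in> level_diagrams q q" "g \<in> down_diagrams q s" "f \<in> up_diagrams p q" for \<tau> g f c d e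
    using that
    by (simp add: brauer_comp_single loops_level[OF _ up_brauer] loops_level[OF _ down_brauer] B_single \<psi>_mid ac_simps)
  have 2: "B p s (cc (Poly_Mapping.single g d) (Poly_Mapping.single \<tau> c)) F = B p s (Poly_Mapping.single g d) (cc (Poly_Mapping.single \<tau> c) F)"
    if "\<tau> \<in> level_diagrams q q" "g \<in> down_diagrams q s" for \<tau> g c d
    by (rule span_eqI[OF F[unfolded BUp_def]]) (simp_all add: B_add brauer_comp_add 1 that)
  have 3: "B p s (cc G (Poly_Mapping.single \<tau> c)) F = B p s G (cc (Poly_Mapping.single \<tau> c) F)"
    if "\<tau> \<in> level_diagrams q q" for \<tau> c
    by (rule span_eqI[OF G[unfolded BDown_def]]) (simp_all add: B_add brauer_comp_add 2 that)
  show ?thesis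
    by (rule span_eqI[OF a[unfolded BSym_def]]) (simp_all add: B_add brauer_comp_add 3)
qed

lemma balanced_B:
  assumes ps: "p \<in> Ob" "s \<in> Ob"
  shows "balanced Ob A (BDownBim \<delta>) (BUpBim \<delta>) p s (grp (BSymBim \<delta>) p s) (\<lambda>(q, g, f). bilinear_ext (\<psi> p s) g f)"
  unfolding B_def[symmetric]
  by (rule balancedI, unfold hom_bimodule_simps) (auto simp: B_add B_mid intro: B_closed)

lemma pairing_pure:
  assumes "p \<in> Ob" "s \<in> Ob" "q \<in> Ob" "g \<in> BDown q s" "f \<in> BUp p q"
  shows "pairing p s (pure_tensor Ob A (BDownBim \<delta>) (BUpBim \<delta>) p s q g f) = B p s g f"
  unfolding pairing_def B_def
  using tensor_pair.lift_pure[OF tensor_pairI[OF bimod_brauer(3,2) assms(1,2)] comm_group_brauer(1)[OF assms(1,2)] balanced_B[OF assms(1,2)] assms(3)]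
    assms(4,5) by simp

text \<open>Off the diagonal the pairing vanishes; on it the two actions are \<open>B_left\<close>
  and \<open>B_right\<close>, and pure tensors suffice for the comparison.\<close>

lemma pairing_map: "bimodule_map Ob A (tensor Ob A (BDownBim \<delta>) (BUpBim \<delta>)) (BSymBim \<delta>) pairing"
  unfolding bimodule_map_def grp_tensor
proof (intro ballI conjI)
  fix p s assume ps: "p \<in> Ob" "s \<in> Ob"
  note bM = bimod_brauer(3)[of Ob \<delta>] and bP = bimod_brauer(2)[of Ob \<delta>] and bS = bimod_brauer(1)[of Ob \<delta>]
  interpret tp: tensor_pair Ob A "BDownBim \<delta>" "BUpBim \<delta>" p s by (rule tensor_pairI[OF bM bP ps])
  note cg = comm_group_brauer(1)[OF ps, of \<delta>]
  show h: "pairing p s \<in> hom tp.T (grp (BSymBim \<delta>) p s)"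
    unfolding pairing_def by (rule tp.lift_hom[OF cg balanced_B[OF ps]])
  have zero: "B p s g f = 0" if "s \<noteq> p" "g \<in> BDown q s" "f \<in> BUp p q" for q g f using B_off that by blast
  fix x assume x: "x \<in> carrier tp.T"
  show "pairing p s (lact (tensor Ob A (BDownBim \<delta>) (BUpBim \<delta>)) p s a x) = lact (BSymBim \<delta>) p s a (pairing p s x)"
    if a: "a \<in> BSym s s" for a
  proof (rule tp.hom_class_eq[OF comm_group_group[OF cg] hom_comp[OF lact_tensor(1)[OF bM bP ps a] h]
        hom_comp[OF h bimodD(2)[OF bS ps a]] _ x])
    fix q g f assume *: "q \<in> Ob" "g \<in> carrier (grp (BDownBim \<delta>) q s)" "f \<in> carrier (grp (BUpBim \<delta>) p q)"
    have ag: "cc a g \<in> BDown q s" using brauer_comp_closed(3)[of a s s g q] a BSym_sub(2)[of s s] * by auto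
    show "pairing p s (lact (tensor Ob A (BDownBim \<delta>) (BUpBim \<delta>)) p s a (tp.pure q g f)) =
        lact (BSymBim \<delta>) p s a (pairing p s (tp.pure q g f))"
    proof -
      have "pairing p s (lact (tensor Ob A (BDownBim \<delta>) (BUpBim \<delta>)) p s a (tp.pure q g f)) = B p s (cc a g) f"
        using * ag by (simp add: lact_tensor(2)[OF bM bP ps a] pairing_pure[OF ps])
      also have "\<dots> = cc a (B p s g f)"
        using * ag a zero B_left[of a p g q f] by (cases "s = p") simp_all
      finally show ?thesis using * by (simp add: pairing_pure[OF ps])
    qed
  qed
  show "pairing p s (ract (tensor Ob A (BDownBim \<delta>) (BUpBim \<delta>)) p s x a) = ract (BSymBim \<delta>) p s (pairing p s x) a"
    if a: "a \<in> BSym p p" for a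
  proof (rule tp.hom_class_eq[OF comm_group_group[OF cg] hom_comp[OF ract_tensor(1)[OF bM bP ps a] h]
        hom_comp[OF h bimodD(3)[OF bS ps a]] _ x])
    fix q g f assume *: "q \<in> Ob" "g \<in> carrier (grp (BDownBim \<delta>) q s)" "f \<in> carrier (grp (BUpBim \<delta>) p q)"
    have fa: "cc f a \<in> BUp p q" using brauer_comp_closed(2)[of f p q a p] a BSym_sub(1)[of p p] * by auto
    show "pairing p s (ract (tensor Ob A (BDownBim \<delta>) (BUpBim \<delta>)) p s (tp.pure q g f) a) =
        ract (BSymBim \<delta>) p s (pairing p s (tp.pure q g f)) a"
    proof -
      have "pairing p s (ract (tensor Ob A (BDownBim \<delta>) (BUpBim \<delta>)) p s (tp.pure q g f) a) = B p s g (cc f a)"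
        using * fa by (simp add: ract_tensor(2)[OF bM bP ps a] pairing_pure[OF ps])
      also have "\<dots> = cc (B p s g f) a"
        using * fa a zero B_right[of a p g q f] by (cases "s = p") simp_all
      finally show ?thesis using * by (simp add: pairing_pure[OF ps])
    qed
  qed
qed

end

section \<open>Copairings from dual bases\<close>

text \<open>\<open>dual p q u\<close> is the element of the dual basis belonging to u. The last
  assumption makes equations between downward morphisms testable against upward diagrams.\<close>

locale dual_form = brauer_form +
  fixes dual :: "nat \<Rightarrow> nat \<Rightarrow> diagram \<Rightarrow> 'a brauer"
  assumes dual_closed: "p \<in> Ob \<Longrightarrow> q \<in> Ob \<Longrightarrow> u \<in> up_diagrams p q \<Longrightarrow> dual p q u \<in> BDown q p"
    and dual_bt: "p \<in> Ob \<Longrightarrow> q \<in> Ob \<Longrightarrow> u \<in> up_diagrams p q \<Longrightarrow> h \<in> up_diagrams p q \<Longrightarrow>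
      bt (dual p q u) (diag_mor h) = (if u = h then 1 else 0)"
    and nondeg: "p \<in> Ob \<Longrightarrow> q \<in> Ob \<Longrightarrow> G \<in> BDown q p \<Longrightarrow>
      (\<And>h. h \<in> up_diagrams p q \<Longrightarrow> bt G (diag_mor h) = 0) \<Longrightarrow> G = 0"
begin

abbreviation "PP \<equiv> BUpBim \<delta>"
abbreviation "MM \<equiv> BDownBim \<delta>"
abbreviation "SS \<equiv> BSymBim \<delta>"
abbreviation "TT \<equiv> tensor Ob A PP MM"
abbreviation "Tg \<equiv> tensor_grp Ob A PP MM"
abbreviation "pt \<equiv> pure_tensor Ob A PP MM"

definition idx :: "nat \<Rightarrow> (nat \<times> diagram) set" where
  "idx q = Sigma {s. prec s q} (\<lambda>s. mono_up_diagrams s q)"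

text \<open>Monotone diagrams represent the upward ones modulo permutations of the source. Over the
  group algebra, replacing f by f \<sigma> and its dual accordingly gives the same tensor, so each
  class contributes one summand.\<close>

definition cop_id :: "nat \<Rightarrow> 'a brauer_tensor" where
  "cop_id q = tensor_class Ob A PP MM q q
    (\<Sum>x\<in>idx q. frag_of (fst x, diag_mor (snd x), dual (fst x) q (snd x)))"

definition cop :: "nat \<Rightarrow> nat \<Rightarrow> 'a brauer \<Rightarrow> 'a brauer_tensor" where
  "cop p q x = (if p = q then lact TT p p x (cop_id p) else \<one>\<^bsub>Tg p q\<^esub>)"

lemma bimod_PM: "bimod Ob A PP" "bimod Ob A MM" "bimod Ob A SS"
  by (rule bimod_brauer)+

lemma tpI: "p \<in> Ob \<Longrightarrow> q \<in> Ob \<Longrightarrow> tensor_pair Ob A PP MM p q"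
  by (rule tensor_pairI[OF bimod_PM(1,2)])

lemma sub:
  fixes a F :: "'a brauer"
  shows "a \<in> BSym p q \<Longrightarrow> a \<in> BUp p q" "a \<in> BSym p q \<Longrightarrow> a \<in> BDown p q"
  "a \<in> BSym p q \<Longrightarrow> a \<in> BMor p q" "F \<in> BUp p q \<Longrightarrow> F \<in> BMor p q" "F \<in> BDown p q \<Longrightarrow> F \<in> BMor p q"
  using BSym_sub[of p q] BUp_sub[of p q] BDown_sub[of p q] by blast+

lemma sym_act:
  "a \<in> BSym q q \<Longrightarrow> F \<in> BUp p q \<Longrightarrow> cc a F \<in> BUp p q"
  "a \<in> BSym p p \<Longrightarrow> F \<in> BUp p q \<Longrightarrow> cc F a \<in> BUp p q"
  "a \<in> BSym q q \<Longrightarrow> G \<in> BDown p q \<Longrightarrow> cc a G \<in> BDown p q"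
  "a \<in> BSym p p \<Longrightarrow> G \<in> BDown p q \<Longrightarrow> cc G a \<in> BDown p q"
  by (erule brauer_comp_closed(2)[OF sub(1)], assumption, erule brauer_comp_closed(2)[OF _ sub(1)], assumption,
      erule brauer_comp_closed(3)[OF sub(2)], assumption, erule brauer_comp_closed(3)[OF _ sub(2)], assumption)

lemma finite_idx [simp]: "finite (idx q)"
proof -
  have "finite {s. prec s q}" by (rule finite_subset[of _ "{..q}"]) (auto simp: prec_def)
  then show ?thesis unfolding idx_def by (rule finite_SigmaI) simp
qed

lemma idxD:
  assumes "x \<in> idx q" "q \<in> Ob"
  shows "fst x \<in> Ob" "snd x \<in> mono_up_diagrams (fst x) q" "snd x \<in> up_diagrams (fst x) q"
    "diag_mor (snd x) \<in> BUp (fst x) q" "dual (fst x) q (snd x) \<in> BDown q (fst x)"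
proof -
  show 1: "fst x \<in> Ob" "snd x \<in> mono_up_diagrams (fst x) q" using assms prec_trunc by (auto simp: idx_def)
  then show 2: "snd x \<in> up_diagrams (fst x) q" using mono_up by blast
  then show "diag_mor (snd x) \<in> BUp (fst x) q" unfolding BUp_def by (rule span_single)
  show "dual (fst x) q (snd x) \<in> BDown q (fst x)" using dual_closed[OF 1(1) assms(2) 2] .
qed

lemma idx_gen:
  "x \<in> idx q \<Longrightarrow> q \<in> Ob \<Longrightarrow> a \<in> BSym q q \<Longrightarrow>
    (fst x, cc a (diag_mor (snd x)), dual (fst x) q (snd x)) \<in> tensor_gens Ob PP MM q q"
  "x \<in> idx q \<Longrightarrow> q \<in> Ob \<Longrightarrow> b \<in> BSym q q \<Longrightarrow>
    (fst x, diag_mor (snd x), cc (dual (fst x) q (snd x)) b) \<in> tensor_gens Ob PP MM q q"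
  "x \<in> idx q \<Longrightarrow> q \<in> Ob \<Longrightarrow>
    (fst x, diag_mor (snd x), dual (fst x) q (snd x)) \<in> tensor_gens Ob PP MM q q"
  using idxD[of x q] sym_act by (simp_all add: tensor_gens_def)

text \<open>In the zigzag sums only the summands of one rank survive. If \<open>prec p q\<close>
  fails, both sides are 0, by \<open>up_prec\<close>.\<close>

lemma sum_idx:
  fixes k :: "diagram \<Rightarrow> 'b::comm_monoid_add"
  shows "(\<Sum>x\<in>idx q. if fst x = p then k (snd x) else 0) = (\<Sum>f\<in>mono_up_diagrams p q. k f)"
proof -
  have "{x \<in> idx q. fst x = p} = Pair p ` mono_up_diagrams p q"
    using up_prec[OF mono_up] by (auto simp: idx_def image_iff)
  then have "(\<Sum>x\<in>idx q. if fst x = p then k (snd x) else 0) = (\<Sum>x\<in>Pair p ` mono_up_diagrams p q. k (snd x))"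
    by (simp add: sum.inter_filter[symmetric])
  also have "\<dots> = (\<Sum>f\<in>mono_up_diagrams p q. k f)"
    by (subst sum.reindex) (auto simp: inj_on_def)
  finally show ?thesis .
qed

section \<open>The candidate copairing as a bimodule map\<close>

lemma cop_id_closed: "q \<in> Ob \<Longrightarrow> cop_id q \<in> carrier (Tg q q)"
  unfolding cop_id_def
  by (rule tensor_pair.class_closed[OF tpI], assumption, assumption, rule keys_sum_subset)
    (use idx_gen(3) in simp)

lemma lact_TT:
  assumes "p \<in> Ob" "q \<in> Ob" "a \<in> BSym q q"
  shows "lact TT p q a \<in> hom (Tg p q) (Tg p q)"
    and "s \<in> Ob \<Longrightarrow> f \<in> BUp s q \<Longrightarrow> g \<in> BDown p s \<Longrightarrow> lact TT p q a (pt p q s f g) = pt p q s (cc a f) g"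
  using lact_tensor[OF bimod_PM(1,2) assms] by simp_all

lemma ract_TT:
  assumes "p \<in> Ob" "q \<in> Ob" "a \<in> BSym p p"
  shows "(\<lambda>x. ract TT p q x a) \<in> hom (Tg p q) (Tg p q)"
    and "s \<in> Ob \<Longrightarrow> f \<in> BUp s q \<Longrightarrow> g \<in> BDown p s \<Longrightarrow> ract TT p q (pt p q s f g) a = pt p q s f (cc g a)"
  using ract_tensor[OF bimod_PM(1,2) assms] by simp_all

text \<open>\<open>bimod\<close> records additivity in the module variable; additivity in the acting
  element is checked on pure tensors. It makes \<open>cop\<close> additive and lets centrality be
  tested on multiples of single permutations.\<close>

lemma lact_TT_add:
  assumes pq: "p \<in> Ob" "q \<in> Ob" and a: "a \<in> BSym q q" "a' \<in> BSym q q" and x: "x \<in> carrier (Tg p q)"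
  shows "lact TT p q (a + a') x = lact TT p q a x \<otimes>\<^bsub>Tg p q\<^esub> lact TT p q a' x"
proof -
  interpret tp: tensor_pair Ob A PP MM p q by (rule tpI[OF pq])
  have aa: "a + a' \<in> BSym q q" using a by (simp add: BSym_def span_add)
  show ?thesis
  proof (rule tp.hom_class_eq[OF tp.group_tensor lact_TT(1)[OF pq aa]
        hom_mult_fun[OF tp.comm_group_tensor lact_TT(1)[OF pq a(1)] lact_TT(1)[OF pq a(2)]] _ x])
    fix s f g assume *: "s \<in> Ob" "f \<in> carrier (grp PP s q)" "g \<in> carrier (grp MM p s)"
    then show "lact TT p q (a + a') (tp.pure s f g) = lact TT p q a (tp.pure s f g) \<otimes>\<^bsub>tp.T\<^esub> lact TT p q a' (tp.pure s f g)"
      using hom_mult[OF tp.pure_hom_left[OF *(1,3)], of "cc a f" "cc a' f"] sym_act(1) a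
      by (simp add: lact_TT(2)[OF pq aa] lact_TT(2)[OF pq a(1)] lact_TT(2)[OF pq a(2)] brauer_comp_add)
  qed
qed

lemma ract_TT_add:
  assumes pq: "p \<in> Ob" "q \<in> Ob" and a: "a \<in> BSym p p" "a' \<in> BSym p p" and x: "x \<in> carrier (Tg p q)"
  shows "ract TT p q x (a + a') = ract TT p q x a \<otimes>\<^bsub>Tg p q\<^esub> ract TT p q x a'"
proof -
  interpret tp: tensor_pair Ob A PP MM p q by (rule tpI[OF pq])
  have aa: "a + a' \<in> BSym p p" using a by (simp add: BSym_def span_add)
  show ?thesis
  proof (rule tp.hom_class_eq[OF tp.group_tensor ract_TT(1)[OF pq aa]
        hom_mult_fun[OF tp.comm_group_tensor ract_TT(1)[OF pq a(1)] ract_TT(1)[OF pq a(2)]] _ x])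
    fix s f g assume *: "s \<in> Ob" "f \<in> carrier (grp PP s q)" "g \<in> carrier (grp MM p s)"
    then show "ract TT p q (tp.pure s f g) (a + a') = ract TT p q (tp.pure s f g) a \<otimes>\<^bsub>tp.T\<^esub> ract TT p q (tp.pure s f g) a'"
      using hom_mult[OF tp.pure_hom_right[OF *(1,2)], of "cc g a" "cc g a'"] sym_act(4) a
      by (simp add: ract_TT(2)[OF pq aa] ract_TT(2)[OF pq a(1)] ract_TT(2)[OF pq a(2)] brauer_comp_add)
  qed
qed

lemma lact_TT_mult:
  assumes pq: "p \<in> Ob" "q \<in> Ob" and a: "a \<in> BSym q q" "a' \<in> BSym q q" and x: "x \<in> carrier (Tg p q)"
  shows "lact TT p q (cc a a') x = lact TT p q a (lact TT p q a' x)"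
proof -
  interpret tp: tensor_pair Ob A PP MM p q by (rule tpI[OF pq])
  have aa: "cc a a' \<in> BSym q q" using brauer_comp_closed(4)[OF a] .
  show ?thesis
  proof (rule tp.hom_class_eq[OF tp.group_tensor lact_TT(1)[OF pq aa]
        hom_comp[OF lact_TT(1)[OF pq a(2)] lact_TT(1)[OF pq a(1)]] _ x])
    fix s f g assume *: "s \<in> Ob" "f \<in> carrier (grp PP s q)" "g \<in> carrier (grp MM p s)"
    then show "lact TT p q (cc a a') (tp.pure s f g) = lact TT p q a (lact TT p q a' (tp.pure s f g))"
      using sym_act(1)[of a' q f s] a brauer_comp_assoc[of a q q a' q f s \<delta>] sub
      by (simp add: lact_TT(2)[OF pq aa] lact_TT(2)[OF pq a(1)] lact_TT(2)[OF pq a(2)])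
  qed
qed

lemma lact_cop_id:
  assumes q: "q \<in> Ob" and a: "a \<in> BSym q q"
  shows "lact TT q q a (cop_id q) = tensor_class Ob A PP MM q q
    (\<Sum>x\<in>idx q. frag_of (fst x, cc a (diag_mor (snd x)), dual (fst x) q (snd x)))"
  unfolding cop_id_def
proof (rule tensor_pair.hom_class_sum_class[OF tpI[OF q q] tpI[OF q q] lact_TT(1)[OF q q a] finite_idx])
  fix x assume x: "x \<in> idx q"
  show "lact TT q q a (tensor_class Ob A PP MM q q (frag_of (fst x, diag_mor (snd x), dual (fst x) q (snd x)))) =
      tensor_class Ob A PP MM q q (frag_of (fst x, cc a (diag_mor (snd x)), dual (fst x) q (snd x)))"
    using lact_TT(2)[OF q q a idxD(1)[OF x q] idxD(4,5)[OF x q]] by (simp add: pure_tensor_def)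
qed (use idx_gen(1)[OF _ q a] idx_gen(3)[OF _ q] in simp_all)

lemma ract_cop_id:
  assumes q: "q \<in> Ob" and a: "a \<in> BSym q q"
  shows "ract TT q q (cop_id q) a = tensor_class Ob A PP MM q q
    (\<Sum>x\<in>idx q. frag_of (fst x, diag_mor (snd x), cc (dual (fst x) q (snd x)) a))"
  unfolding cop_id_def
proof (rule tensor_pair.hom_class_sum_class[OF tpI[OF q q] tpI[OF q q] ract_TT(1)[OF q q a] finite_idx])
  fix x assume x: "x \<in> idx q"
  show "ract TT q q (tensor_class Ob A PP MM q q (frag_of (fst x, diag_mor (snd x), dual (fst x) q (snd x)))) a =
      tensor_class Ob A PP MM q q (frag_of (fst x, diag_mor (snd x), cc (dual (fst x) q (snd x)) a))"
    using ract_TT(2)[OF q q a idxD(1)[OF x q] idxD(4,5)[OF x q]] by (simp add: pure_tensor_def)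
qed (use idx_gen(2)[OF _ q a] idx_gen(3)[OF _ q] in simp_all)

text \<open>Paired with an upward diagram h, the left side gives c when f = h \<tau> and the right
  side when f' = \<sigma> h, and 0 otherwise. By \<sigma> f = f' \<tau> these conditions coincide,
  so \<open>nondeg\<close> applies.\<close>

lemma dual_move:
  assumes o: "s \<in> Ob" "q \<in> Ob" and f: "f \<in> up_diagrams s q" and f': "f' \<in> up_diagrams s q"
    and s: "\<sigma> \<in> level_diagrams q q" and t: "\<tau> \<in> level_diagrams s s"
    and eq: "diagram_comp \<sigma> f = diagram_comp f' \<tau>"
  shows "cc (Poly_Mapping.single \<tau> c) (dual s q f) = cc (dual s q f') (Poly_Mapping.single \<sigma> c)"
proof -
  have st: "Poly_Mapping.single \<tau> c \<in> BSym s s" "Poly_Mapping.single \<sigma> c \<in> BSym q q"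
    using s t by (simp_all add: BSym_def span_single)
  note d = dual_closed[OF o f] and d' = dual_closed[OF o f']
  have "cc (Poly_Mapping.single \<tau> c) (dual s q f) - cc (dual s q f') (Poly_Mapping.single \<sigma> c) = 0"
  proof (rule nondeg[OF o])
    show "cc (Poly_Mapping.single \<tau> c) (dual s q f) - cc (dual s q f') (Poly_Mapping.single \<sigma> c) \<in> BDown q s"
      using sym_act(3)[OF st(1) d] sym_act(4)[OF st(2) d']
      unfolding BDown_def diff_conv_add_uminus by (intro span_add span_uminus)
    fix h assume h: "h \<in> up_diagrams s q"
    then have hs: "(diag_mor h :: 'a brauer) \<in> BUp s q" by (simp add: BUp_def span_single)
    have ht: "diagram_comp h \<tau> \<in> up_diagrams s q" and sh: "diagram_comp \<sigma> h \<in> up_diagrams s q"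
      using up_comp h level_up s t by blast+
    have iff: "f = diagram_comp h \<tau> \<longleftrightarrow> f' = diagram_comp \<sigma> h"
    proof
      assume "f = diagram_comp h \<tau>"
      then have "diagram_comp f' \<tau> = diagram_comp (diagram_comp \<sigma> h) \<tau>"
        using eq diagram_comp_assoc(1)[OF level_brauer[OF s] up_brauer[OF h] level_brauer[OF t]] by simp
      then show "f' = diagram_comp \<sigma> h"
        using level_cancel(3)[OF t up_brauer[OF f']] level_cancel(3)[OF t up_brauer[OF sh]] by metis
    next
      assume "f' = diagram_comp \<sigma> h"
      then have "diagram_comp \<sigma> f = diagram_comp \<sigma> (diagram_comp h \<tau>)"
        using eq diagram_comp_assoc(1)[OF level_brauer[OF s] up_brauer[OF h] level_brauer[OF t]] by simp
      then show "f = diagram_comp h \<tau>"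
        using level_cancel(1)[OF s up_brauer[OF f]] level_cancel(1)[OF s up_brauer[OF ht]] by metis
    qed
    have "bt (cc (Poly_Mapping.single \<tau> c) (dual s q f)) (diag_mor h) = bt (dual s q f) (Poly_Mapping.single (diagram_comp h \<tau>) c)"
      using bt_left[OF st(1) d hs] loops_level(2)[OF t up_brauer[OF h]] by (simp add: brauer_comp_single)
    moreover have "bt (cc (dual s q f') (Poly_Mapping.single \<sigma> c)) (diag_mor h) = bt (dual s q f') (Poly_Mapping.single (diagram_comp \<sigma> h) c)"
      using bt_mid[OF st(2) d' hs] loops_level(1)[OF s up_brauer[OF h]] by (simp add: brauer_comp_single)
    ultimately show "bt (cc (Poly_Mapping.single \<tau> c) (dual s q f) - cc (dual s q f') (Poly_Mapping.single \<sigma> c)) (diag_mor h) = 0"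
      using dual_bt[OF o f ht] dual_bt[OF o f' sh] iff
      by (simp add: bt_diff bt_single_scale[of "dual s q f" "diagram_comp h \<tau>" c] bt_single_scale[of "dual s q f'" "diagram_comp \<sigma> h" c])
  qed
  then show ?thesis by simp
qed

text \<open>\<sigma> permutes the monotone diagrams up to permutations of their sources: \<sigma> f
  = f' \<tau>. Write D(f) for the dual of f. Then \<sigma> f \<otimes> D(f) = f' \<tau> \<otimes>
  D(f) = f' \<otimes> \<tau> D(f) = f' \<otimes> D(f') \<sigma>, the last step by
  \<open>dual_move\<close>, and the sum over f becomes the sum over f'.\<close>

lemma cop_id_central_single:
  assumes q: "q \<in> Ob" and s: "\<sigma> \<in> level_diagrams q q"
  shows "lact TT q q (Poly_Mapping.single \<sigma> c) (cop_id q) = ract TT q q (cop_id q) (Poly_Mapping.single \<sigma> c)"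
proof -
  interpret tp: tensor_pair Ob A PP MM q q by (rule tpI[OF q q])
  let ?a = "Poly_Mapping.single \<sigma> c"
  have a: "?a \<in> BSym q q" using s by (simp add: BSym_def span_single)
  have "\<forall>x\<in>idx q. \<exists>y. fst y \<in> mono_up_diagrams (fst x) q \<and> snd y \<in> level_diagrams (fst x) (fst x) \<and>
      diagram_comp \<sigma> (snd x) = diagram_comp (fst y) (snd y)"
  proof
    fix x assume x: "x \<in> idx q"
    obtain f \<tau> where "f \<in> mono_up_diagrams (fst x) q" "\<tau> \<in> level_diagrams (fst x) (fst x)" "diagram_comp \<sigma> (snd x) = diagram_comp f \<tau>"
      using up_factor[OF up_comp[OF level_up[OF s] idxD(3)[OF x q]]] by metis
    then show "\<exists>y. fst y \<in> mono_up_diagrams (fst x) q \<and> snd y \<in> level_diagrams (fst x) (fst x) \<and>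
      diagram_comp \<sigma> (snd x) = diagram_comp (fst y) (snd y)" by (intro exI[of _ "(f, \<tau>)"]) simp
  qed
  then have "\<exists>y. \<forall>x\<in>idx q. fst (y x) \<in> mono_up_diagrams (fst x) q \<and> snd (y x) \<in> level_diagrams (fst x) (fst x) \<and>
      diagram_comp \<sigma> (snd x) = diagram_comp (fst (y x)) (snd (y x))" by (rule bchoice)
  then obtain y where y: "\<And>x. x \<in> idx q \<Longrightarrow> fst (y x) \<in> mono_up_diagrams (fst x) q"
    "\<And>x. x \<in> idx q \<Longrightarrow> snd (y x) \<in> level_diagrams (fst x) (fst x)"
    "\<And>x. x \<in> idx q \<Longrightarrow> diagram_comp \<sigma> (snd x) = diagram_comp (fst (y x)) (snd (y x))" by blast
  define \<pi> where "\<pi> x = (fst x, fst (y x))" for x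
  have \<pi>idx: "\<pi> x \<in> idx q" if "x \<in> idx q" for x using y(1)[OF that] that by (auto simp: \<pi>_def idx_def)
  have \<pi>inj: "inj_on \<pi> (idx q)"
  proof (rule inj_onI)
    fix x z assume x: "x \<in> idx q" and z: "z \<in> idx q" and eq: "\<pi> x = \<pi> z"
    then have f: "fst x = fst z" "fst (y x) = fst (y z)" by (simp_all add: \<pi>_def)
    \<comment> \<open>Equal images mean that \<sigma> sends the diagrams of x and z to diagrams with
      the same monotone part, so they differ by the permutation \<open>?t\<close> of the source; as
      both are monotone, uniqueness of the factorization makes them equal.\<close>
    let ?t = "diagram_comp (flip_diagram (snd (y z))) (snd (y x))"
    have lx: "snd (y x) \<in> level_diagrams (fst x) (fst x)" and lz: "snd (y z) \<in> level_diagrams (fst x) (fst x)"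
      using y(2)[OF x] y(2)[OF z] f by simp_all
    have fz: "flip_diagram (snd (y z)) \<in> level_diagrams (fst x) (fst x)" by (rule flip_level[OF lz])
    note gb = up_brauer[OF mono_up[OF y(1)[OF x]]]
    have zu: "snd z \<in> up_diagrams (fst x) q" using idxD(3)[OF z q] f by simp
    have t: "?t \<in> level_diagrams (fst x) (fst x)" using level_comp[OF fz lx] .
    have "diagram_comp \<sigma> (snd x) = diagram_comp (fst (y x)) (diagram_comp (snd (y z)) ?t)"
      using y(3)[OF x] level_cancel(2)[OF lz level_brauer[OF lx]] by simp
    also have "\<dots> = diagram_comp (diagram_comp (fst (y x)) (snd (y z))) ?t"
      using diagram_comp_assoc(1)[OF gb level_brauer[OF lz] level_brauer[OF t]] by simp
    also have "\<dots> = diagram_comp (diagram_comp \<sigma> (snd z)) ?t" using y(3)[OF z] f by simp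
    also have "\<dots> = diagram_comp \<sigma> (diagram_comp (snd z) ?t)"
      by (rule diagram_comp_assoc(1)[OF level_brauer[OF s] up_brauer[OF zu] level_brauer[OF t]])
    finally have "diagram_comp (flip_diagram \<sigma>) (diagram_comp \<sigma> (snd x)) = diagram_comp (flip_diagram \<sigma>) (diagram_comp \<sigma> (diagram_comp (snd z) ?t))"
      by simp
    then have sx: "snd x = diagram_comp (snd z) ?t"
      unfolding level_cancel(1)[OF s up_brauer[OF idxD(3)[OF x q]]]
        level_cancel(1)[OF s up_brauer[OF up_comp[OF zu level_up[OF t]]]] .
    have "diagram_comp (snd x) (id_diagram (fst x)) = diagram_comp (snd z) ?t"
      using sx id_comp_right[OF up_brauer[OF idxD(3)[OF x q]]] by simp
    then have "snd x = snd z"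
      using factor_unique(2)[OF idxD(2)[OF x q] level_down[OF id_level] _ level_down[OF t]] idxD(2)[OF z q] f by metis
    then show "x = z" using f(1) by (simp add: prod_eq_iff)
  qed
  have bij: "bij_betw \<pi> (idx q) (idx q)"
    unfolding bij_betw_def using \<pi>inj endo_inj_surj[OF finite_idx _ \<pi>inj] \<pi>idx by blast
  have "lact TT q q ?a (cop_id q) = tp.cls (\<Sum>x\<in>idx q. frag_of (fst (\<pi> x), diag_mor (snd (\<pi> x)), cc (dual (fst (\<pi> x)) q (snd (\<pi> x))) ?a))"
    unfolding lact_cop_id[OF q a]
  proof (rule tp.class_sum_cong[OF finite_idx])
    fix x assume x: "x \<in> idx q"
    note ix = idxD[OF x q]
    let ?s = "fst x" and ?f = "snd x" and ?g = "fst (y x)" and ?t = "Poly_Mapping.single (snd (y x)) c"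
    have gm: "?g \<in> up_diagrams ?s q" using mono_up[OF y(1)[OF x]] .
    have t: "?t \<in> BSym ?s ?s" using y(2)[OF x] by (simp add: BSym_def span_single)
    have g: "(diag_mor ?g :: 'a brauer) \<in> BUp ?s q" using gm by (simp add: BUp_def span_single)
    have "cc ?a (diag_mor ?f) = cc (diag_mor ?g) ?t"
      using y(3)[OF x] loops_level(1)[OF s up_brauer[OF ix(3)]] loops_level(2)[OF y(2)[OF x] up_brauer[OF gm]]
      by (simp add: brauer_comp_single)
    then have "tp.pure ?s (cc ?a (diag_mor ?f)) (dual ?s q ?f) = tp.pure ?s (diag_mor ?g) (cc ?t (dual ?s q ?f))"
      using tp.pure_ract_lact[OF ix(1), of "diag_mor ?g" ?t "dual ?s q ?f"] g t ix(5) by simp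
    also have "cc ?t (dual ?s q ?f) = cc (dual ?s q ?g) ?a"
      by (rule dual_move[OF ix(1) q ix(3) gm s y(2)[OF x] y(3)[OF x]])
    finally show "tp.cls (frag_of (?s, cc ?a (diag_mor ?f), dual ?s q ?f)) =
        tp.cls (frag_of (fst (\<pi> x), diag_mor (snd (\<pi> x)), cc (dual (fst (\<pi> x)) q (snd (\<pi> x))) ?a))"
      by (simp add: pure_tensor_def \<pi>_def)
  qed (use idx_gen(1)[OF _ q a] idx_gen(2)[OF \<pi>idx q a] in simp_all)
  also have "\<dots> = tp.cls (\<Sum>x\<in>idx q. frag_of (fst x, diag_mor (snd x), cc (dual (fst x) q (snd x)) ?a))"
    using sum.reindex_bij_betw[OF bij, of "\<lambda>x. frag_of (fst x, diag_mor (snd x) :: 'a brauer, cc (dual (fst x) q (snd x)) ?a)"] by simp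
  also have "\<dots> = ract TT q q (cop_id q) ?a" unfolding ract_cop_id[OF q a] ..
  finally show ?thesis .
qed

lemma cop_id_central:
  assumes q: "q \<in> Ob" and a: "a \<in> BSym q q"
  shows "lact TT q q a (cop_id q) = ract TT q q (cop_id q) a"
  using a[unfolded BSym_def]
proof (induction rule: span_induct)
  case zero
  then show ?case using cop_id_central_single[OF q id_level, of 0] by simp
next
  case (add F G)
  then show ?case
    using lact_TT_add[OF q q _ _ cop_id_closed[OF q], of F G] ract_TT_add[OF q q _ _ cop_id_closed[OF q], of F G]
    by (simp add: BSym_def)
next
  case (single \<sigma> c)
  then show ?case by (rule cop_id_central_single[OF q])
qed

text \<open>Left linearity is built into \<open>cop\<close>; right linearity is the centrality of
  \<open>cop_id\<close>. Off the diagonal both sides are neutral.\<close>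

lemma cop_map: "bimodule_map Ob A SS TT cop"
  unfolding bimodule_map_def grp_tensor hom_bimodule_simps
proof (intro ballI conjI)
  fix p q assume pq: "p \<in> Ob" "q \<in> Ob"
  interpret tp: tensor_pair Ob A PP MM p q by (rule tpI[OF pq])
  interpret T: comm_group "Tg p q" by (rule tp.comm_group_tensor)
  have off: "cop p q x = \<one>\<^bsub>Tg p q\<^esub>" if "p \<noteq> q" for x using that by (simp add: cop_def)
  have on: "cop p q x = lact TT p q x (cop_id p)" if "p = q" for x using that by (simp add: cop_def)
  show "cop p q \<in> hom (grp SS p q) (Tg p q)"
  proof (cases "p = q")
    case True
    show ?thesis
    proof (rule homI)
      fix x assume "x \<in> carrier (grp SS p q)"
      then show "cop p q x \<in> carrier (Tg p q)"
        unfolding on[OF True] using hom_in_carrier[OF lact_TT(1)[OF pq]] cop_id_closed[OF pq(1)] True by simp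
    next
      fix x y assume "x \<in> carrier (grp SS p q)" "y \<in> carrier (grp SS p q)"
      then show "cop p q (x \<otimes>\<^bsub>grp SS p q\<^esub> y) = cop p q x \<otimes>\<^bsub>Tg p q\<^esub> cop p q y"
        unfolding on[OF True] using lact_TT_add[OF pq] cop_id_closed[OF pq(1)] True by simp
    qed
  next
    case False
    then show ?thesis by (intro homI) (simp_all add: off)
  qed
  fix x :: "'a brauer" assume x: "x \<in> BSym p q"
  show "cop p q (cc a x) = lact TT p q a (cop p q x)" if a: "a \<in> BSym q q" for a
  proof (cases "p = q")
    case True
    then show ?thesis using lact_TT_mult[OF pq a _ _, of x "cop_id p"] x cop_id_closed[OF pq(1)] by (simp add: cop_def)
  next
    case False
    then show ?thesis using hom_one[OF lact_TT(1)[OF pq a] T.is_group T.is_group] by (simp add: off)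
  qed
  show "cop p q (cc x a) = ract TT p q (cop p q x) a" if a: "a \<in> BSym p p" for a
  proof (cases "p = q")
    case True
    have "lact TT p p (cc x a) (cop_id p) = lact TT p p x (ract TT p p (cop_id p) a)"
      using lact_TT_mult[OF pq(1,1) _ a cop_id_closed[OF pq(1)], of x] x True cop_id_central[OF pq(1) a] by simp
    also have "\<dots> = ract TT p p (lact TT p p x (cop_id p)) a"
      using bimodD(4)[OF bimod_tensor[OF bimod_PM(1,2)] pq(1,1)] x a True cop_id_closed[OF pq(1)] by (simp add: grp_tensor)
    finally show ?thesis using True by (simp add: cop_def)
  next
    case False
    then show ?thesis using hom_one[OF ract_TT(1)[OF pq a] T.is_group T.is_group] by (simp add: off)
  qed
qed

text \<open>The expansion of n in the monotone diagrams f, with the pairings of n with their duals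
  as coefficients. For a single diagram v the coefficient of \<sigma> vanishes unless f \<sigma> =
  v, and by \<open>up_bij\<close> exactly one pair (f, \<sigma>) qualifies.\<close>

lemma resolution_up:
  assumes o: "p \<in> Ob" "q \<in> Ob" and n: "n \<in> BUp p q"
  shows "(\<Sum>f\<in>mono_up_diagrams p q. cc (diag_mor f) (B p p (dual p q f) n)) = n"
proof -
  have "(\<Sum>f\<in>mono_up_diagrams p q. cc (diag_mor f) (B p p (dual p q f) (Poly_Mapping.single v c))) = Poly_Mapping.single v c"
    if v: "v \<in> up_diagrams p q" for v c
  proof -
    have vs: "Poly_Mapping.single v c \<in> BUp p q" using v by (simp add: BUp_def span_single)
    have 1: "cc (diag_mor f) (B p p (dual p q f) (Poly_Mapping.single v c))
        = (\<Sum>\<sigma>\<in>level_diagrams p p. if diagram_comp f \<sigma> = v then Poly_Mapping.single v c else 0)"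
      if fm: "f \<in> mono_up_diagrams p q" for f
    proof -
      note f = mono_up[OF fm]
      have "bt (dual p q f) (cc (Poly_Mapping.single v c) (diag_mor (flip_diagram \<sigma>))) = (if diagram_comp f \<sigma> = v then c else 0)"
        if s: "\<sigma> \<in> level_diagrams p p" for \<sigma>
      proof -
        have vs: "diagram_comp v (flip_diagram \<sigma>) \<in> up_diagrams p q" using up_comp[OF v level_up[OF flip_level[OF s]]] .
        have "f = diagram_comp v (flip_diagram \<sigma>) \<longleftrightarrow> diagram_comp f \<sigma> = v"
          using level_cancel(4)[OF s up_brauer[OF v]] level_cancel(3)[OF s up_brauer[OF f]] by metis
        then show ?thesis
          using dual_bt[OF o f vs] loops_level(2)[OF flip_level[OF s] up_brauer[OF v]]
          by (simp add: brauer_comp_single bt_single_scale[of "dual p q f" "diagram_comp v (flip_diagram \<sigma>)" c])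
      qed
      then have "B p p (dual p q f) (Poly_Mapping.single v c) = (\<Sum>\<sigma>\<in>level_diagrams p p. Poly_Mapping.single \<sigma> (if diagram_comp f \<sigma> = v then c else 0))"
        unfolding B_eq[OF dual_closed[OF o f] vs] by simp
      then show ?thesis
        by (auto simp: brauer_comp_sum brauer_comp_single loops_level(2)[OF _ up_brauer[OF f]] intro!: sum.cong)
    qed
    have "(\<Sum>f\<in>mono_up_diagrams p q. cc (diag_mor f) (B p p (dual p q f) (Poly_Mapping.single v c)))
        = (\<Sum>f\<in>mono_up_diagrams p q. \<Sum>\<sigma>\<in>level_diagrams p p. if diagram_comp f \<sigma> = v then Poly_Mapping.single v c else 0)"
      using 1 by simp
    also have "\<dots> = (\<Sum>x\<in>mono_up_diagrams p q \<times> level_diagrams p p. if (case x of (f, \<sigma>) \<Rightarrow> diagram_comp f \<sigma>) = v then Poly_Mapping.single v c else 0)"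
      by (simp add: sum.cartesian_product case_prod_unfold)
    also have "\<dots> = (\<Sum>w\<in>up_diagrams p q. if w = v then Poly_Mapping.single v c else 0)"
      by (rule sum.reindex_bij_betw[OF up_bij])
    also have "\<dots> = Poly_Mapping.single v c" using v by simp
    finally show ?thesis .
  qed
  then show ?thesis
    by (intro span_eqI[OF n[unfolded BUp_def], where \<Psi> = "\<lambda>x. x"]) (simp_all add: B_add brauer_comp_add sum.distrib)
qed

text \<open>The dual expansion. Both sides are paired with an upward diagram h; by
  \<open>bt_left\<close> the group algebra coefficients move over to h, and again a single pair (f,
  \<sigma>) with f \<sigma> = h contributes.\<close>

lemma resolution_down:
  assumes o: "q \<in> Ob" "p \<in> Ob" and m: "m \<in> BDown p q"
  shows "(\<Sum>f\<in>mono_up_diagrams q p. cc (B q q m (diag_mor f)) (dual q p f)) = m"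
proof -
  let ?X = "\<Sum>f\<in>mono_up_diagrams q p. cc (B q q m (diag_mor f)) (dual q p f)"
  have fs: "(diag_mor f :: 'a brauer) \<in> BUp q p" if "f \<in> up_diagrams q p" for f using that by (simp add: BUp_def span_single)
  have Bc: "B q q m (diag_mor f) \<in> BSym q q" if "f \<in> up_diagrams q p" for f using B_closed[OF m fs[OF that]] .
  have "?X - m = 0"
  proof (rule nondeg[OF o])
    have "?X \<in> BDown p q"
      unfolding BDown_def by (rule span_sum, fold BDown_def) (use sym_act(3)[OF Bc dual_closed[OF o]] mono_up in blast)
    then show "?X - m \<in> BDown p q"
      using m unfolding BDown_def diff_conv_add_uminus by (intro span_add span_uminus)
    fix h assume h: "h \<in> up_diagrams q p"
    have 1: "bt (cc (B q q m (diag_mor f)) (dual q p f)) (diag_mor h)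
        = (\<Sum>\<sigma>\<in>level_diagrams q q. if diagram_comp f \<sigma> = h then bt m (diag_mor h) else 0)"
      if fm: "f \<in> mono_up_diagrams q p" for f
    proof -
      note f = mono_up[OF fm]
      have "bt (cc (B q q m (diag_mor f)) (dual q p f)) (diag_mor h) = bt (dual q p f) (cc (diag_mor h) (B q q m (diag_mor f)))"
        by (rule bt_left[OF Bc[OF f] dual_closed[OF o f] fs[OF h]])
      also have "\<dots> = (\<Sum>\<sigma>\<in>level_diagrams q q. bt (dual q p f) (Poly_Mapping.single (diagram_comp h \<sigma>) (bt m (diag_mor (diagram_comp f (flip_diagram \<sigma>))))))"
        unfolding B_eq[OF m fs[OF f]] brauer_comp_sum bt_sum
        by (intro sum.cong refl)
          (simp add: brauer_comp_single loops_level(2)[OF _ up_brauer[OF h]] loops_level(2)[OF flip_level up_brauer[OF f]])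
      also have "\<dots> = (\<Sum>\<sigma>\<in>level_diagrams q q. if diagram_comp f (flip_diagram \<sigma>) = h then bt m (diag_mor h) else 0)"
      proof (rule sum.cong[OF refl])
        fix \<sigma> assume s: "\<sigma> \<in> level_diagrams q q"
        have hs: "diagram_comp h \<sigma> \<in> up_diagrams q p" using up_comp[OF h level_up[OF s]] .
        have "f = diagram_comp h \<sigma> \<longleftrightarrow> diagram_comp f (flip_diagram \<sigma>) = h"
          using level_cancel(3)[OF s up_brauer[OF h]] level_cancel(4)[OF s up_brauer[OF f]] by metis
        then show "bt (dual q p f) (Poly_Mapping.single (diagram_comp h \<sigma>) (bt m (diag_mor (diagram_comp f (flip_diagram \<sigma>)))))
            = (if diagram_comp f (flip_diagram \<sigma>) = h then bt m (diag_mor h) else 0)"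
          using dual_bt[OF o f hs] by (simp add: bt_single_scale[of "dual q p f" "diagram_comp h \<sigma>" "bt m (diag_mor (diagram_comp f (flip_diagram \<sigma>)))"])
      qed
      also have "\<dots> = (\<Sum>\<sigma>\<in>level_diagrams q q. if diagram_comp f \<sigma> = h then bt m (diag_mor h) else 0)"
        by (rule sum.reindex_bij_witness[where i = flip_diagram and j = flip_diagram]) (simp_all add: flip_level)
      finally show ?thesis .
    qed
    have "bt ?X (diag_mor h) = (\<Sum>f\<in>mono_up_diagrams q p. \<Sum>\<sigma>\<in>level_diagrams q q. if diagram_comp f \<sigma> = h then bt m (diag_mor h) else 0)"
      using 1 by (simp add: bt_sum)
    also have "\<dots> = (\<Sum>x\<in>mono_up_diagrams q p \<times> level_diagrams q q. if (case x of (f, \<sigma>) \<Rightarrow> diagram_comp f \<sigma>) = h then bt m (diag_mor h) else 0)"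
      by (simp add: sum.cartesian_product case_prod_unfold)
    also have "\<dots> = (\<Sum>w\<in>up_diagrams q p. if w = h then bt m (diag_mor h) else 0)"
      by (rule sum.reindex_bij_betw[OF up_bij])
    also have "\<dots> = bt m (diag_mor h)" using h by simp
    finally show "bt (?X - m) (diag_mor h) = 0" by (simp add: bt_diff)
  qed
  then show ?thesis by simp
qed

text \<open>\<open>zig_props\<close> and \<open>zag_props\<close> turn the two identities into
  \<open>resolution_up\<close> for n, multiplied by a, and \<open>resolution_down\<close> for m a;
  in the second, \<open>B_mid\<close> moves a from the diagrams to m.\<close>

theorem cop_copairing: "is_copairing Ob A SS PP MM pairing cop"
proof -
  note iff = is_copairing_iff[OF bimod_PM(3,1,2) unital_brauer pairing_map]
  note zig = zig_props[OF bimod_PM(3,1,2) unital_brauer pairing_map]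
  note zag = zag_props[OF bimod_PM(3,1,2) unital_brauer pairing_map]
  show ?thesis
    unfolding iff
  proof (intro conjI cop_map ballI)
    fix p q s a n assume o: "p \<in> Ob" "q \<in> Ob" "s \<in> Ob"
      and a: "a \<in> carrier (grp SS s q)" and n: "n \<in> carrier (grp PP p s)"
    have n': "n \<in> BUp p s" and a': "a \<in> BSym s q" using n a by simp_all
    interpret tp: tensor_pair Ob A PP MM s q by (rule tpI[OF o(3,2)])
    note cg = comm_group_brauer(2)[OF o(1,2), of \<delta>]
    show "zig Ob A SS PP MM pairing p q s n (cop s q a) = (if s = q then lact PP p q a n else \<one>\<^bsub>grp PP p q\<^esub>)"
    proof (cases "s = q")
      case False
      then show ?thesis
        using hom_one[OF zig(1)[OF o n] tp.group_tensor comm_group_group[OF cg]] by (simp add: cop_def)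
    next
      case True
      have aq: "a \<in> BSym q q" and nq: "n \<in> BUp p q" using a' n' True by simp_all
      have nz: "n \<in> carrier (grp PP p q)" using nq by simp
      interpret tq: tensor_pair Ob A PP MM q q by (rule tpI[OF o(2,2)])
      have "zig Ob A SS PP MM pairing p q q n (lact TT q q a (cop_id q))
          = (\<Sum>x\<in>idx q. zig Ob A SS PP MM pairing p q q n (tq.cls (frag_of (fst x, cc a (diag_mor (snd x)), dual (fst x) q (snd x)))))"
        unfolding lact_cop_id[OF o(2) aq]
        by (rule tq.hom_class_sum[OF zig(1)[OF o(1,2,2) nz] cg finite_idx idx_gen(1)[OF _ o(2) aq]])
      also have "\<dots> = (\<Sum>x\<in>idx q. if fst x = p then cc (cc a (diag_mor (snd x))) (B p p (dual p q (snd x)) n) else 0)"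
      proof (rule sum.cong[OF refl])
        fix x assume x: "x \<in> idx q"
        note ix = idxD[OF x o(2)]
        have "zig Ob A SS PP MM pairing p q q n (tq.pure (fst x) (cc a (diag_mor (snd x))) (dual (fst x) q (snd x)))
          = (if fst x = p then cc (cc a (diag_mor (snd x))) (pairing p p (pure_tensor Ob A MM PP p p q (dual (fst x) q (snd x)) n)) else 0)"
          using zig(2)[OF o(1,2,2) nz ix(1), of "cc a (diag_mor (snd x))" "dual (fst x) q (snd x)"] sym_act(1)[OF aq ix(4)] ix(5) by simp
        then show "zig Ob A SS PP MM pairing p q q n (tq.cls (frag_of (fst x, cc a (diag_mor (snd x)), dual (fst x) q (snd x))))
          = (if fst x = p then cc (cc a (diag_mor (snd x))) (B p p (dual p q (snd x)) n) else 0)"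
          using pairing_pure[OF o(1,1,2), of "dual p q (snd x)" n] ix(5) nq by (cases "fst x = p") (simp_all add: pure_tensor_def)
      qed
      also have "\<dots> = (\<Sum>f\<in>mono_up_diagrams p q. cc (cc a (diag_mor f)) (B p p (dual p q f) n))"
        by (rule sum_idx)
      also have "\<dots> = (\<Sum>f\<in>mono_up_diagrams p q. cc a (cc (diag_mor f) (B p p (dual p q f) n)))"
      proof (rule sum.cong[OF refl])
        fix f assume "f \<in> mono_up_diagrams p q"
        then have f: "f \<in> up_diagrams p q" by (rule mono_up)
        show "cc (cc a (diag_mor f)) (B p p (dual p q f) n) = cc a (cc (diag_mor f) (B p p (dual p q f) n))"
          by (rule brauer_comp_assoc[OF sub(3)[OF aq] _ sub(3)[OF B_closed[OF dual_closed[OF o(1,2) f] nq]]])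
            (use up_brauer[OF f] in \<open>simp add: BMor_def span_single\<close>)
      qed
      also have "\<dots> = cc a n"
        unfolding brauer_comp_sum(2)[symmetric] resolution_up[OF o(1,2) nq] ..
      finally show ?thesis using True by (simp add: cop_def)
    qed
  next
    fix p q s m a assume o: "p \<in> Ob" "q \<in> Ob" "s \<in> Ob"
      and m: "m \<in> carrier (grp MM s q)" and a: "a \<in> carrier (grp SS p s)"
    have m': "m \<in> BDown s q" and a': "a \<in> BSym p s" using m a by simp_all
    interpret tp: tensor_pair Ob A PP MM p s by (rule tpI[OF o(1,3)])
    note cg = comm_group_brauer(3)[OF o(1,2), of \<delta>]
    show "zag Ob A SS PP MM pairing p q s m (cop p s a) = (if s = p then ract MM p q m a else \<one>\<^bsub>grp MM p q\<^esub>)"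
    proof (cases "s = p")
      case False
      then show ?thesis
        using hom_one[OF zag(1)[OF o m] tp.group_tensor comm_group_group[OF cg]] by (simp add: cop_def)
    next
      case True
      have ap: "a \<in> BSym p p" and mp: "m \<in> BDown p q" using a' m' True by simp_all
      have mz: "m \<in> carrier (grp MM p q)" using mp by simp
      interpret tq: tensor_pair Ob A PP MM p p by (rule tpI[OF o(1,1)])
      have "zag Ob A SS PP MM pairing p q p m (lact TT p p a (cop_id p))
          = (\<Sum>x\<in>idx p. zag Ob A SS PP MM pairing p q p m (tq.cls (frag_of (fst x, cc a (diag_mor (snd x)), dual (fst x) p (snd x)))))"
        unfolding lact_cop_id[OF o(1) ap]
        by (rule tq.hom_class_sum[OF zag(1)[OF o(1,2,1) mz] cg finite_idx idx_gen(1)[OF _ o(1) ap]])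
      also have "\<dots> = (\<Sum>x\<in>idx p. if fst x = q then cc (B q q m (cc a (diag_mor (snd x)))) (dual q p (snd x)) else 0)"
      proof (rule sum.cong[OF refl])
        fix x assume x: "x \<in> idx p"
        note ix = idxD[OF x o(1)]
        have "zag Ob A SS PP MM pairing p q p m (tq.pure (fst x) (cc a (diag_mor (snd x))) (dual (fst x) p (snd x)))
          = (if fst x = q then cc (pairing q q (pure_tensor Ob A MM PP q q p m (cc a (diag_mor (snd x))))) (dual (fst x) p (snd x)) else 0)"
          using zag(2)[OF o(1,2,1) mz ix(1), of "cc a (diag_mor (snd x))" "dual (fst x) p (snd x)"] sym_act(1)[OF ap ix(4)] ix(5) by simp
        then show "zag Ob A SS PP MM pairing p q p m (tq.cls (frag_of (fst x, cc a (diag_mor (snd x)), dual (fst x) p (snd x))))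
          = (if fst x = q then cc (B q q m (cc a (diag_mor (snd x)))) (dual q p (snd x)) else 0)"
          using pairing_pure[OF o(2,2,1) mp, of "cc a (diag_mor (snd x))"] sym_act(1)[OF ap ix(4)] by (cases "fst x = q") (simp_all add: pure_tensor_def)
      qed
      also have "\<dots> = (\<Sum>f\<in>mono_up_diagrams q p. cc (B q q m (cc a (diag_mor f))) (dual q p f))"
        by (rule sum_idx)
      also have "\<dots> = (\<Sum>f\<in>mono_up_diagrams q p. cc (B q q (cc m a) (diag_mor f)) (dual q p f))"
      proof (rule sum.cong[OF refl])
        fix f assume "f \<in> mono_up_diagrams q p"
        then have "(diag_mor f :: 'a brauer) \<in> BUp q p" using mono_up by (simp add: BUp_def span_single)
        then show "cc (B q q m (cc a (diag_mor f))) (dual q p f) = cc (B q q (cc m a) (diag_mor f)) (dual q p f)"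
          using B_mid[OF ap mp] by simp
      qed
      also have "\<dots> = cc m a" by (rule resolution_down[OF o(2,1) sym_act(4)[OF ap mp]])
      finally show ?thesis using True by (simp add: cop_def)
    qed
  qed
qed

end

section \<open>Copairings and inverses of the Gram matrix of an invariant form\<close>

context brauer_form
begin

text \<open>Downward diagrams are the flips of the upward ones, so pairing with G is multiplying its
  row of coordinates by the Gram matrix.\<close>

lemma bt_expand:
  assumes G: "G \<in> BDown q p"
  shows "bt G (diag_mor h) = (\<Sum>v\<in>up_diagrams p q. Poly_Mapping.lookup G (flip_diagram v) * \<beta> (flip_diagram v) h)"
proof (rule span_eqI[OF G[unfolded BDown_def]])
  fix g c assume g: "g \<in> down_diagrams q p"
  have "(\<Sum>v\<in>up_diagrams p q. Poly_Mapping.lookup (Poly_Mapping.single g c) (flip_diagram v) * \<beta> (flip_diagram v) h)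
      = (\<Sum>v\<in>up_diagrams p q. if v = flip_diagram g then c * \<beta> g h else 0)"
  proof (rule sum.cong[OF refl])
    fix v
    have "g = flip_diagram v \<longleftrightarrow> v = flip_diagram g" by (metis flip_flip)
    then show "Poly_Mapping.lookup (Poly_Mapping.single g c) (flip_diagram v) * \<beta> (flip_diagram v) h
        = (if v = flip_diagram g then c * \<beta> g h else 0)"
      by (simp add: lookup_single)
  qed
  also have "\<dots> = c * \<beta> g h" using flip_down[OF g] by simp
  finally show "bt (Poly_Mapping.single g c) (diag_mor h) = (\<Sum>v\<in>up_diagrams p q.
      Poly_Mapping.lookup (Poly_Mapping.single g c) (flip_diagram v) * \<beta> (flip_diagram v) h)"
    by (simp add: bt_single)
qed (simp_all add: bt_add lookup_add distrib_right sum.distrib)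

text \<open>Row u of the left inverse holds the coordinates of the dual of u. If G pairs to zero
  with every upward diagram, its row of coordinates times the Gram matrix vanishes, and the right
  inverse yields G = 0.\<close>

lemma dual_formI:
  assumes C: "\<And>p q u w. p \<in> Ob \<Longrightarrow> q \<in> Ob \<Longrightarrow> u \<in> up_diagrams p q \<Longrightarrow> w \<in> up_diagrams p q \<Longrightarrow>
      (\<Sum>v\<in>up_diagrams p q. C p q u v * \<beta> (flip_diagram v) w) = (if u = w then 1 else 0)"
    and C': "\<And>p q u w. p \<in> Ob \<Longrightarrow> q \<in> Ob \<Longrightarrow> u \<in> up_diagrams p q \<Longrightarrow> w \<in> up_diagrams p q \<Longrightarrow>
      (\<Sum>v\<in>up_diagrams p q. \<beta> (flip_diagram u) v * C p q v w) = (if u = w then 1 else 0)"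
  shows "dual_form r \<beta> \<psi> (\<lambda>p q u. \<Sum>v\<in>up_diagrams p q. Poly_Mapping.single (flip_diagram v) (C p q u v))"
proof
  fix p q u assume o: "p \<in> Ob" "q \<in> Ob" and u: "u \<in> up_diagrams p q"
  show "(\<Sum>v\<in>up_diagrams p q. Poly_Mapping.single (flip_diagram v) (C p q u v)) \<in> BDown q p"
    unfolding BDown_def by (rule span_sum) (simp add: span_single flip_up)
  fix h assume h: "h \<in> up_diagrams p q"
  show "bt (\<Sum>v\<in>up_diagrams p q. Poly_Mapping.single (flip_diagram v) (C p q u v)) (diag_mor h) = (if u = h then 1 else 0)"
    using C[OF o u h] by (simp add: bt_sum bt_single)
next
  fix p q and G :: "'k brauer"
  assume o: "p \<in> Ob" "q \<in> Ob" and G: "G \<in> BDown q p" and z: "\<And>h. h \<in> up_diagrams p q \<Longrightarrow> bt G (diag_mor h) = 0"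
  have "Poly_Mapping.lookup G (flip_diagram w) = 0" if w: "w \<in> up_diagrams p q" for w
  proof -
    have "Poly_Mapping.lookup G (flip_diagram w) = (\<Sum>v\<in>up_diagrams p q. Poly_Mapping.lookup G (flip_diagram v) * (if v = w then 1 else 0))"
      using w by (simp add: if_distrib cong: if_cong)
    also have "\<dots> = (\<Sum>v\<in>up_diagrams p q. Poly_Mapping.lookup G (flip_diagram v) * (\<Sum>h\<in>up_diagrams p q. \<beta> (flip_diagram v) h * C p q h w))"
      using C'[OF o _ w] by simp
    also have "\<dots> = (\<Sum>v\<in>up_diagrams p q. \<Sum>h\<in>up_diagrams p q. Poly_Mapping.lookup G (flip_diagram v) * \<beta> (flip_diagram v) h * C p q h w)"
      by (simp add: sum_distrib_left mult.assoc)
    also have "\<dots> = (\<Sum>h\<in>up_diagrams p q. bt G (diag_mor h) * C p q h w)"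
      by (subst sum.swap) (simp add: bt_expand[OF G] sum_distrib_right)
    also have "\<dots> = 0" using z by simp
    finally show ?thesis .
  qed
  then have "Poly_Mapping.lookup G g = 0" if "g \<in> down_diagrams q p" for g
    using flip_down[OF that] by (metis flip_flip)
  moreover have "Poly_Mapping.lookup G g = 0" if "g \<notin> down_diagrams q p" for g
    using G that by (auto simp: BDown_def diagram_span_def in_keys_iff)
  ultimately show "G = 0" by (intro poly_mapping_eqI) (metis lookup_zero)
qed

text \<open>Reading off coefficients in the zigzag identity for \<open>P\<close> exhibits a left inverse of the Gram matrix.\<close>

lemma copairing_left_inverse:
  assumes d: "is_copairing Ob A (BSymBim \<delta>) (BUpBim \<delta>) (BDownBim \<delta>) pairing d"
    and o: "p \<in> Ob" "q \<in> Ob"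
  shows "\<exists>C. \<forall>u\<in>up_diagrams p q. \<forall>h\<in>up_diagrams p q.
    (\<Sum>v\<in>up_diagrams p q. C u v * \<beta> (flip_diagram v) h) = (if u = h then 1 else 0)"
proof -
  let ?S = "BSymBim \<delta>" and ?P = "BUpBim \<delta>" and ?M = "BDownBim \<delta>"
  note iff = is_copairing_iff[OF bimod_brauer(1,2,3) unital_brauer pairing_map]
  note zig = zig_props[OF bimod_brauer(1,2,3) unital_brauer pairing_map]
  interpret tp: tensor_pair Ob A ?P ?M q q by (rule tensor_pairI[OF bimod_brauer(2,3) o(2,2)])
  note cg = comm_group_brauer(2)[OF o, of \<delta>]
  let ?z = "\<lambda>h. zig Ob A ?S ?P ?M pairing p q q (diag_mor h)"
  have hs: "(diag_mor h :: 'k brauer) \<in> BUp p q" if "h \<in> up_diagrams p q" for h using that by (simp add: BUp_def span_single)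
  have hs': "(diag_mor h :: 'k brauer) \<in> carrier (grp ?P p q)" if "h \<in> up_diagrams p q" for h using hs[OF that] by simp
  have id: "(brauer_id q :: 'k brauer) \<in> BSym q q" by (rule brauer_id_closed)
  have "d q q (brauer_id q) \<in> carrier tp.T"
    using d id hom_in_carrier[OF bimodule_mapD(1)[OF _ o(2,2)]] unfolding iff by (fastforce simp: grp_tensor)
  from tp.tensor_sum_pures[OF this] obtain xs where
    xs: "\<forall>(s, m, n)\<in>set xs. s \<in> Ob \<and> m \<in> carrier (grp ?P s q) \<and> n \<in> carrier (grp ?M q s)"
    and D: "d q q (brauer_id q) = foldr (\<lambda>(s, m, n) y. tp.pure s m n \<otimes>\<^bsub>tp.T\<^esub> y) xs \<one>\<^bsub>tp.T\<^esub>" by blast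
  \<comment> \<open>For one summand f \<otimes> g the value is f b(g \<otimes> h), and h enters its
    coefficient at u only through \<beta>: as a function of h it is a row, computed from f and g
    alone, times the Gram matrix.\<close>
  have pure: "\<exists>C. \<forall>u. \<forall>h\<in>up_diagrams p q. Poly_Mapping.lookup (?z h (tp.pure t f g)) u
      = (\<Sum>v\<in>up_diagrams p q. C u v * \<beta> (flip_diagram v) h)"
    if t: "t \<in> Ob" and f: "f \<in> BUp t q" and g: "g \<in> BDown q t" for t f g
  proof (cases "t = p")
    case False
    then show ?thesis using zig(2)[OF o o(2) hs' t] f g by (intro exI[of _ "\<lambda>_ _. 0"]) simp
  next
    case True
    have fp: "f \<in> BUp p q" and gp: "g \<in> BDown q p" using f g True by simp_all
    define C where "C u v = (\<Sum>\<sigma>\<in>level_diagrams p p. Poly_Mapping.lookup (cc f (diag_mor \<sigma>)) u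
      * Poly_Mapping.lookup (cc (diag_mor (flip_diagram \<sigma>)) g) (flip_diagram v))" for u v
    have "Poly_Mapping.lookup (?z h (tp.pure t f g)) u = (\<Sum>v\<in>up_diagrams p q. C u v * \<beta> (flip_diagram v) h)"
      if h: "h \<in> up_diagrams p q" for u h
    proof -
      have fs: "(diag_mor (flip_diagram \<sigma>) :: 'k brauer) \<in> BSym p p" if "\<sigma> \<in> level_diagrams p p" for \<sigma>
        using flip_level[OF that] by (simp add: BSym_def span_single)
      have sc: "cc f (Poly_Mapping.single \<sigma> c) = scale_brauer c (cc f (diag_mor \<sigma>))" for \<sigma> c
        using brauer_comp_scale(2)[of \<delta> f c "diag_mor \<sigma>"] by (simp add: scale_single)
      have "?z h (tp.pure t f g) = cc f (B p p g (diag_mor h))"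
        using zig(2)[OF o o(2) hs'[OF h] o(1), of f g] pairing_pure[OF o(1,1,2) gp hs[OF h]] fp gp True by simp
      also have "\<dots> = (\<Sum>\<sigma>\<in>level_diagrams p p. scale_brauer (bt g (cc (diag_mor h) (diag_mor (flip_diagram \<sigma>)))) (cc f (diag_mor \<sigma>)))"
        unfolding B_eq[OF gp hs[OF h]] brauer_comp_sum by (rule sum.cong[OF refl]) (rule sc)
      finally have "Poly_Mapping.lookup (?z h (tp.pure t f g)) u = (\<Sum>\<sigma>\<in>level_diagrams p p.
          bt g (cc (diag_mor h) (diag_mor (flip_diagram \<sigma>))) * Poly_Mapping.lookup (cc f (diag_mor \<sigma>)) u)"
        by (simp add: lookup_sum lookup_scale_brauer)
      also have "\<dots> = (\<Sum>\<sigma>\<in>level_diagrams p p. \<Sum>v\<in>up_diagrams p q. Poly_Mapping.lookup (cc f (diag_mor \<sigma>)) u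
          * Poly_Mapping.lookup (cc (diag_mor (flip_diagram \<sigma>)) g) (flip_diagram v) * \<beta> (flip_diagram v) h)"
      proof (rule sum.cong[OF refl])
        fix \<sigma> assume s: "\<sigma> \<in> level_diagrams p p"
        have sg: "cc (diag_mor (flip_diagram \<sigma>)) g \<in> BDown q p"
          using brauer_comp_closed(3)[of "diag_mor (flip_diagram \<sigma>)" p p g q] fs[OF s] BSym_sub(2)[of p p] gp by blast
        \<comment> \<open>The twist by \<sigma> is moved from h to g, which leaves h as a column
          index of the Gram matrix.\<close>
        have "bt g (cc (diag_mor h) (diag_mor (flip_diagram \<sigma>))) = bt (cc (diag_mor (flip_diagram \<sigma>)) g) (diag_mor h)"
          by (rule bt_left[OF fs[OF s] gp hs[OF h], symmetric])
        also have "\<dots> = (\<Sum>v\<in>up_diagrams p q. Poly_Mapping.lookup (cc (diag_mor (flip_diagram \<sigma>)) g) (flip_diagram v) * \<beta> (flip_diagram v) h)"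
          by (rule bt_expand[OF sg])
        finally show "bt g (cc (diag_mor h) (diag_mor (flip_diagram \<sigma>))) * Poly_Mapping.lookup (cc f (diag_mor \<sigma>)) u
          = (\<Sum>v\<in>up_diagrams p q. Poly_Mapping.lookup (cc f (diag_mor \<sigma>)) u
            * Poly_Mapping.lookup (cc (diag_mor (flip_diagram \<sigma>)) g) (flip_diagram v) * \<beta> (flip_diagram v) h)"
          by (simp add: sum_distrib_left sum_distrib_right ac_simps)
      qed
      also have "\<dots> = (\<Sum>v\<in>up_diagrams p q. C u v * \<beta> (flip_diagram v) h)"
        unfolding C_def by (subst sum.swap) (simp add: sum_distrib_right)
      finally show ?thesis .
    qed
    then show ?thesis by blast
  qed
  \<comment> \<open>Functions of h of this form are closed under addition, so the value of d at the
    identity, a finite sum of pure tensors, gives one too.\<close>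
  have "\<exists>C. \<forall>u. \<forall>h\<in>up_diagrams p q. Poly_Mapping.lookup (?z h y) u = (\<Sum>v\<in>up_diagrams p q. C u v * \<beta> (flip_diagram v) h)"
    if "y = foldr (\<lambda>(s, m, n) y. tp.pure s m n \<otimes>\<^bsub>tp.T\<^esub> y) xs \<one>\<^bsub>tp.T\<^esub>"
      "\<forall>(s, m, n)\<in>set xs. s \<in> Ob \<and> m \<in> carrier (grp ?P s q) \<and> n \<in> carrier (grp ?M q s)" for xs y
    using that
  proof (induction xs arbitrary: y)
    case Nil
    have "?z h y = 0" if "h \<in> up_diagrams p q" for h
      using hom_one[OF zig(1)[OF o o(2) hs'[OF that]] tp.group_tensor comm_group_group[OF cg]] Nil by simp
    then show ?case by (intro exI[of _ "\<lambda>_ _. 0"]) simp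
  next
    case (Cons x xs)
    obtain t f g where x: "x = (t, f, g)" by (cases x)
    define y' where "y' = foldr (\<lambda>(s, m, n) y. tp.pure s m n \<otimes>\<^bsub>tp.T\<^esub> y) xs \<one>\<^bsub>tp.T\<^esub>"
    have ok: "\<forall>(s, m, n)\<in>set xs. s \<in> Ob \<and> m \<in> carrier (grp ?P s q) \<and> n \<in> carrier (grp ?M q s)" using Cons.prems(2) by simp
    have tfg: "t \<in> Ob" "f \<in> BUp t q" "g \<in> BDown q t" using Cons.prems(2) x by simp_all
    have y: "y = tp.pure t f g \<otimes>\<^bsub>tp.T\<^esub> y'" using Cons.prems(1) by (simp add: x y'_def)
    interpret T: comm_group tp.T by (rule tp.comm_group_tensor)
    have yc: "y' \<in> carrier tp.T"
      using ok unfolding y'_def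
      by (induction xs) (auto intro!: tp.pure_closed T.m_closed)
    have pc: "tp.pure t f g \<in> carrier tp.T" using tfg by (intro tp.pure_closed) simp_all
    obtain C1 where C1: "\<And>u h. h \<in> up_diagrams p q \<Longrightarrow> Poly_Mapping.lookup (?z h y') u = (\<Sum>v\<in>up_diagrams p q. C1 u v * \<beta> (flip_diagram v) h)"
      using Cons.IH[OF y'_def ok] by blast
    obtain C2 where C2: "\<And>u h. h \<in> up_diagrams p q \<Longrightarrow> Poly_Mapping.lookup (?z h (tp.pure t f g)) u = (\<Sum>v\<in>up_diagrams p q. C2 u v * \<beta> (flip_diagram v) h)"
      using pure[OF tfg] by blast
    have "Poly_Mapping.lookup (?z h y) u = (\<Sum>v\<in>up_diagrams p q. (C2 u v + C1 u v) * \<beta> (flip_diagram v) h)"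
      if h: "h \<in> up_diagrams p q" for u h
    proof -
      have "?z h y = ?z h (tp.pure t f g) + ?z h y'"
        using hom_mult[OF zig(1)[OF o o(2) hs'[OF h]] pc yc] by (simp add: y)
      then show ?thesis using C1[OF h] C2[OF h] by (simp add: lookup_add distrib_right sum.distrib)
    qed
    then show ?case by (intro exI[of _ "\<lambda>u v. C2 u v + C1 u v"]) blast
  qed
  from this[OF D xs] obtain C where C: "\<And>u h. h \<in> up_diagrams p q \<Longrightarrow>
      Poly_Mapping.lookup (?z h (d q q (brauer_id q))) u = (\<Sum>v\<in>up_diagrams p q. C u v * \<beta> (flip_diagram v) h)" by blast
  \<comment> \<open>The zigzag identity at the identity and h returns h, whose coefficients are
    entries of the identity matrix.\<close>
  have "?z h (d q q (brauer_id q)) = diag_mor h" if h: "h \<in> up_diagrams p q" for h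
  proof -
    have "?z h (d q q (brauer_id q)) = cc (brauer_id q) (diag_mor h)"
      using d o id hs'[OF h] unfolding iff by simp
    then show ?thesis using brauer_id_left[of "diag_mor h" p q \<delta>] hs[OF h] BUp_sub[of p q] by auto
  qed
  then have "(\<Sum>v\<in>up_diagrams p q. C u v * \<beta> (flip_diagram v) h) = (if u = h then 1 else 0)"
    if "h \<in> up_diagrams p q" for u h
  proof -
    have "(\<Sum>v\<in>up_diagrams p q. C u v * \<beta> (flip_diagram v) h) = Poly_Mapping.lookup (diag_mor h) u"
      using C[OF that, of u] \<open>\<And>h. h \<in> up_diagrams p q \<Longrightarrow> ?z h (d q q (brauer_id q)) = diag_mor h\<close>[OF that] by simp
    then show ?thesis by (simp add: lookup_single when_def eq_commute[of h u])
  qed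
  then show ?thesis by blast
qed

end

section \<open>The cellular and the level pairing\<close>

lemma level_inverse_iff:
  assumes s: "\<sigma> \<in> level_diagrams p p"
  shows "x \<in> brauer_diagrams p p \<Longrightarrow> diagram_comp \<sigma> x = id_diagram p \<longleftrightarrow> x = flip_diagram \<sigma>"
    and "x \<in> brauer_diagrams p p \<Longrightarrow> diagram_comp x \<sigma> = id_diagram p \<longleftrightarrow> x = flip_diagram \<sigma>"
  using level_cancel(1,3)[OF s, of x p] id_comp_left[OF flip_brauer[OF level_brauer[OF s]]]
    id_comp_right[OF flip_brauer[OF level_brauer[OF s]]]
    comp_flip_down[OF level_down[OF s]] flip_comp_up[OF level_up[OF s]] by metis+

text \<open>Permutations neither create nor destroy loops: in the loop identity of
  \<open>diagram_comp_assoc\<close> the terms with a permutation as one factor are 0 by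
  \<open>loops_level\<close>.\<close>

lemma loops_comp_level:
  assumes g: "g \<in> brauer_diagrams q s" and f: "f \<in> brauer_diagrams p q"
  shows "\<sigma> \<in> level_diagrams p p \<Longrightarrow> loops g (diagram_comp f \<sigma>) = loops g f"
    and "\<sigma> \<in> level_diagrams s s \<Longrightarrow> loops (diagram_comp \<sigma> g) f = loops g f"
    and "h \<in> brauer_diagrams q q' \<Longrightarrow> \<tau> \<in> level_diagrams q q \<Longrightarrow> loops (diagram_comp h \<tau>) f = loops h (diagram_comp \<tau> f)"
proof -
  show "loops g (diagram_comp f \<sigma>) = loops g f" if s: "\<sigma> \<in> level_diagrams p p"
    using diagram_comp_assoc(2)[OF g f level_brauer[OF s]] loops_level(2)[OF s f]
      loops_level(2)[OF s diagram_comp_closed[OF g f]] by simp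
  show "loops (diagram_comp \<sigma> g) f = loops g f" if s: "\<sigma> \<in> level_diagrams s s"
    using diagram_comp_assoc(2)[OF level_brauer[OF s] g f] loops_level(1)[OF s g]
      loops_level(1)[OF s diagram_comp_closed[OF g f]] by simp
  show "loops (diagram_comp h \<tau>) f = loops h (diagram_comp \<tau> f)"
    if h: "h \<in> brauer_diagrams q q'" and t: "\<tau> \<in> level_diagrams q q"
    using diagram_comp_assoc(2)[OF h level_brauer[OF t] f] loops_level(2)[OF t h] loops_level(1)[OF t f] by simp
qed

text \<open>Lets the membership test in \<open>range id_diagram\<close> be replaced by equality with
  the identity of the known rank.\<close>

lemma id_diagram_inj:
  assumes "id_diagram p' \<in> brauer_diagrams p p"
  shows "p' = p"
proof -
  have "i \<in> {1..p'} \<longleftrightarrow> i \<in> {1..p}" for i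
  proof
    assume "i \<in> {1..p'}"
    then show "i \<in> {1..p}" using brauer_TB[OF assms id_mem] by blast
  next
    assume "i \<in> {1..p}"
    then obtain y where "{Top i, y} \<in> id_diagram p'" using brauerD(6)[OF assms, of "Top i"] by auto
    then show "i \<in> {1..p'}" using id_iff by (cases y) auto
  qed
  then have "{1..p'} = {1..p}" by blast
  from arg_cong[OF this, of card] show ?thesis by simp
qed

definition cell_form :: "diagram \<Rightarrow> diagram \<Rightarrow> 'k::comm_ring_1" where
  "cell_form g f = (if g = flip_diagram f then 1 else 0)"

text \<open>Diagrams do not record their ranks; \<open>range id_diagram\<close> stands for the identity of the rank at hand.\<close>

definition level_form :: "'k::comm_ring_1 \<Rightarrow> diagram \<Rightarrow> diagram \<Rightarrow> 'k" where
  "level_form \<delta> g f = (if diagram_comp g f \<in> range id_diagram then \<delta> ^ loops g f else 0)"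

lemma level_form_eq:
  assumes "g \<in> brauer_diagrams q p" "f \<in> brauer_diagrams p q"
  shows "level_form \<delta> g f = (if diagram_comp g f = id_diagram p then \<delta> ^ loops g f else 0)"
proof -
  have "diagram_comp g f \<in> range id_diagram \<longleftrightarrow> diagram_comp g f = id_diagram p"
    using id_diagram_inj diagram_comp_closed[OF assms] by (metis rangeE rangeI)
  then show ?thesis by (simp add: level_form_def)
qed

lemma flip_comp_level:
  assumes f: "f \<in> brauer_diagrams p q" and s: "\<sigma> \<in> level_diagrams p p"
  shows "flip_diagram (diagram_comp f \<sigma>) = diagram_comp (flip_diagram \<sigma>) (flip_diagram f)"
    and "flip_diagram (diagram_comp f (flip_diagram \<sigma>)) = diagram_comp \<sigma> (flip_diagram f)"
  using flip_comp[OF f level_brauer[OF s]] flip_comp[OF f flip_brauer[OF level_brauer[OF s]]] by simp_all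

text \<open>The form at g and the twist of f by the inverse of \<sigma> is 1 exactly when g is
  \<sigma> after \<open>flip_diagram f\<close>. Composing with f on the right cancels the flip, so
  there is at most one such \<sigma>, the one selected in \<open>cell_pairing_diag\<close>.\<close>

lemma cell_brauer_form: "brauer_form (cell_form :: _ \<Rightarrow> _ \<Rightarrow> 'k::comm_ring_1) cell_pairing_diag"
proof
  fix \<sigma> p g q f assume s: "\<sigma> \<in> level_diagrams p p" and g: "g \<in> down_diagrams q p" and f: "f \<in> up_diagrams p q"
  show "(cell_form (diagram_comp \<sigma> g) f :: 'k) = cell_form g (diagram_comp f \<sigma>)"
    unfolding cell_form_def flip_comp_level(1)[OF up_brauer[OF f] s]
    using level_cancel(1)[OF s down_brauer[OF g]] level_cancel(2)[OF s flip_brauer[OF up_brauer[OF f]]] by metis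
next
  fix \<tau> q g p f assume t: "\<tau> \<in> level_diagrams q q" and g: "g \<in> down_diagrams q p" and f: "f \<in> up_diagrams p q"
  show "(cell_form (diagram_comp g \<tau>) f :: 'k) = cell_form g (diagram_comp \<tau> f)"
    unfolding cell_form_def flip_comp[OF level_brauer[OF t] up_brauer[OF f]]
    using level_cancel(3)[OF t down_brauer[OF g]] level_cancel(4)[OF t flip_brauer[OF up_brauer[OF f]]] by metis
next
  fix g q s f p assume g: "g \<in> down_diagrams q s" and f: "f \<in> up_diagrams p q"
  show "(cell_pairing_diag p s g f :: 'k brauer) = (if s = p then
     \<Sum>\<sigma>\<in>level_diagrams p p. Poly_Mapping.single \<sigma> (cell_form g (diagram_comp f (flip_diagram \<sigma>))) else 0)"
  proof (cases "s = p")
    case True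
    have sum: "(\<Sum>\<sigma>\<in>level_diagrams p p. Poly_Mapping.single \<sigma> (cell_form g (diagram_comp f (flip_diagram \<sigma>)) :: 'k))
        = (\<Sum>\<sigma>\<in>level_diagrams p p. if g = diagram_comp \<sigma> (flip_diagram f) then diag_mor \<sigma> else 0)"
      by (rule sum.cong[OF refl]) (simp add: cell_form_def flip_comp_level(2)[OF up_brauer[OF f]])
    have uniq: "\<sigma> = \<tau>" if "\<sigma> \<in> level_diagrams p p" "\<tau> \<in> level_diagrams p p"
      "diagram_comp \<sigma> (flip_diagram f) = diagram_comp \<tau> (flip_diagram f)" for \<sigma> \<tau>
    proof -
      have "diagram_comp (diagram_comp \<rho> (flip_diagram f)) f = \<rho>" if "\<rho> \<in> level_diagrams p p" for \<rho>
        using diagram_comp_assoc(1)[OF level_brauer[OF that] flip_brauer[OF up_brauer[OF f]] up_brauer[OF f]]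
          flip_comp_up[OF f] id_comp_right[OF level_brauer[OF that]] by simp
      then show ?thesis using that by metis
    qed
    show ?thesis
    proof (cases "\<exists>\<sigma>\<in>level_diagrams p p. g = diagram_comp \<sigma> (flip_diagram f)")
      case ex: True
      then obtain \<sigma> where s: "\<sigma> \<in> level_diagrams p p" "g = diagram_comp \<sigma> (flip_diagram f)" by blast
      have "(THE \<sigma>. \<sigma> \<in> level_diagrams p p \<and> g = diagram_comp \<sigma> (flip_diagram f)) = \<sigma>"
        using s uniq by (intro the_equality) blast+
      moreover have "(\<Sum>\<tau>\<in>level_diagrams p p. if g = diagram_comp \<tau> (flip_diagram f) then diag_mor \<tau> else 0)
          = (\<Sum>\<tau>\<in>level_diagrams p p. if \<tau> = \<sigma> then diag_mor \<sigma> else (0 :: 'k brauer))"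
        using s uniq by (intro sum.cong refl) (metis (no_types, lifting))
      ultimately show ?thesis using True ex s(1) unfolding sum by (simp add: cell_pairing_diag_def)
    next
      case False
      then have "(\<Sum>\<sigma>\<in>level_diagrams p p. if g = diagram_comp \<sigma> (flip_diagram f) then diag_mor \<sigma> else (0 :: 'k brauer)) = 0"
        by (intro sum.neutral) auto
      then show ?thesis using True False unfolding sum by (simp add: cell_pairing_diag_def)
    qed
  qed (simp add: cell_pairing_diag_def)
qed

text \<open>The composite g f equals \<sigma> exactly when its twist by the inverse of \<sigma> is
  an identity, and twisting changes no loops; so at most the summand at \<sigma> = g f survives.
  Invariance holds because left and right inverses of a permutation agree.\<close>

lemma level_brauer_form: "brauer_form (level_form \<delta>) (\<lambda>_ _. level_pairing_diag \<delta>)"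
proof
  fix \<sigma> p g q f assume s: "\<sigma> \<in> level_diagrams p p" and g: "g \<in> down_diagrams q p" and f: "f \<in> up_diagrams p q"
  note gb = down_brauer[OF g] and fb = up_brauer[OF f] and sb = level_brauer[OF s]
  show "level_form \<delta> (diagram_comp \<sigma> g) f = level_form \<delta> g (diagram_comp f \<sigma>)"
    unfolding level_form_eq[OF diagram_comp_closed[OF sb gb] fb] level_form_eq[OF gb diagram_comp_closed[OF fb sb]]
      loops_comp_level(1)[OF gb fb s] loops_comp_level(2)[OF gb fb s]
      diagram_comp_assoc(1)[OF sb gb fb] diagram_comp_assoc(1)[OF gb fb sb, symmetric]
      level_inverse_iff[OF s diagram_comp_closed[OF gb fb]] ..
next
  fix \<tau> q g p f assume t: "\<tau> \<in> level_diagrams q q" and g: "g \<in> down_diagrams q p" and f: "f \<in> up_diagrams p q"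
  note gb = down_brauer[OF g] and fb = up_brauer[OF f] and tb = level_brauer[OF t]
  show "level_form \<delta> (diagram_comp g \<tau>) f = level_form \<delta> g (diagram_comp \<tau> f)"
    unfolding level_form_def loops_comp_level(3)[OF gb fb gb t] diagram_comp_assoc(1)[OF gb tb fb] ..
next
  fix g q s f p assume g: "g \<in> down_diagrams q s" and f: "f \<in> up_diagrams p q"
  note gb = down_brauer[OF g] and fb = up_brauer[OF f]
  note gf = diagram_comp_closed[OF gb fb]
  have lev: "is_level (diagram_comp g f) \<longleftrightarrow> diagram_comp g f \<in> level_diagrams p s"
    using gf by (simp add: level_diagrams_def)
  show "level_pairing_diag \<delta> g f = (if s = p then
     \<Sum>\<sigma>\<in>level_diagrams p p. Poly_Mapping.single \<sigma> (level_form \<delta> g (diagram_comp f (flip_diagram \<sigma>))) else 0)"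
  proof (cases "s = p")
    case True
    have "level_form \<delta> g (diagram_comp f (flip_diagram \<sigma>)) = (if diagram_comp g f = \<sigma> then \<delta> ^ loops g f else 0)"
      if s: "\<sigma> \<in> level_diagrams p p" for \<sigma>
    proof -
      note fs = flip_level[OF s]
      have gp: "g \<in> brauer_diagrams q p" and gfp: "diagram_comp g f \<in> brauer_diagrams p p" using gb gf True by simp_all
      show ?thesis
        unfolding level_form_eq[OF gp diagram_comp_closed[OF fb level_brauer[OF fs]]]
          loops_comp_level(1)[OF gb fb fs] diagram_comp_assoc(1)[OF gb fb level_brauer[OF fs], symmetric]
          level_inverse_iff(2)[OF fs gfp] flip_flip ..
    qed
    then have "(\<Sum>\<sigma>\<in>level_diagrams p p. Poly_Mapping.single \<sigma> (level_form \<delta> g (diagram_comp f (flip_diagram \<sigma>))))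
        = (\<Sum>\<sigma>\<in>level_diagrams p p. if diagram_comp g f = \<sigma> then Poly_Mapping.single \<sigma> (\<delta> ^ loops g f) else 0)"
      by (intro sum.cong refl) simp
    also have "\<dots> = level_pairing_diag \<delta> g f"
      using lev True by (simp add: level_pairing_diag_def brauer_comp_single)
    finally show ?thesis using True by simp
  next
    case False
    then show ?thesis using lev level_eq[of "diagram_comp g f" p s] by (auto simp: level_pairing_diag_def)
  qed
qed

section \<open>Gram determinants\<close>

text \<open>Cramer's rule: \<open>e\<close> is the inverse of the determinant, and the adjugate
  serves on both sides.\<close>

lemma det_unit_inverse:
  fixes M :: "'k::comm_ring_1 mat"
  assumes M: "M \<in> carrier_mat n n" and u: "det M dvd 1"
  shows "\<exists>C\<in>carrier_mat n n. C * M = 1\<^sub>m n \<and> M * C = 1\<^sub>m n"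
proof -
  obtain e where e: "1 = det M * e" using u by (rule dvdE)
  note adj = adj_mat[OF M]
  have "(e \<cdot>\<^sub>m adj_mat M) * M = e \<cdot>\<^sub>m (det M \<cdot>\<^sub>m 1\<^sub>m n)" "M * (e \<cdot>\<^sub>m adj_mat M) = e \<cdot>\<^sub>m (det M \<cdot>\<^sub>m 1\<^sub>m n)"
    using M adj by (simp_all add: mult_smult_assoc_mat[of _ n n] mult_smult_distrib[of _ n n])
  moreover have "e \<cdot>\<^sub>m (det M \<cdot>\<^sub>m 1\<^sub>m n) = 1\<^sub>m n"
    using e by (intro eq_matI) (auto simp: mult.commute)
  ultimately show ?thesis using adj(1) by (intro bexI[of _ "e \<cdot>\<^sub>m adj_mat M"]) simp_all
qed

lemma sum_set_nth:
  assumes "distinct xs"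
  shows "(\<Sum>v\<in>set xs. f v) = (\<Sum>i<length xs. f (xs ! i))"
  using sum.reindex_bij_betw[OF bij_betw_nth[OF assms refl refl], of f] by simp

definition gram :: "'b list \<Rightarrow> ('b \<Rightarrow> 'b \<Rightarrow> 'k) \<Rightarrow> 'k mat" where
  "gram xs \<Gamma> = mat (length xs) (length xs) (\<lambda>(i, j). \<Gamma> (xs ! i) (xs ! j))"

lemma gram_mult:
  fixes \<Gamma> :: "'b \<Rightarrow> 'b \<Rightarrow> 'k::comm_ring_1"
  assumes "distinct xs" "i < length xs" "j < length xs"
  shows "(gram xs C * gram xs \<Gamma>) $$ (i, j) = (\<Sum>v\<in>set xs. C (xs ! i) v * \<Gamma> v (xs ! j))"
  using assms by (simp add: gram_def scalar_prod_def sum_set_nth[OF assms(1)] atLeast0LessThan)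

lemma det_gram_unit:
  fixes \<Gamma> :: "'b \<Rightarrow> 'b \<Rightarrow> 'k::comm_ring_1"
  assumes d: "distinct xs"
    and C: "\<And>u w. u \<in> set xs \<Longrightarrow> w \<in> set xs \<Longrightarrow> (\<Sum>v\<in>set xs. C u v * \<Gamma> v w) = (if u = w then 1 else 0)"
  shows "det (gram xs \<Gamma>) dvd 1"
proof -
  have c: "gram xs C \<in> carrier_mat (length xs) (length xs)" "gram xs \<Gamma> \<in> carrier_mat (length xs) (length xs)"
    by (simp_all add: gram_def)
  have "gram xs C * gram xs \<Gamma> = 1\<^sub>m (length xs)"
  proof (rule eq_matI)
    fix i j assume "i < dim_row (1\<^sub>m (length xs))" "j < dim_col (1\<^sub>m (length xs))"
    then have ij: "i < length xs" "j < length xs" by simp_all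
    show "(gram xs C * gram xs \<Gamma>) $$ (i, j) = 1\<^sub>m (length xs) $$ (i, j)"
      unfolding gram_mult[OF d ij] using C[of "xs ! i" "xs ! j"] ij nth_eq_iff_index_eq[OF d ij] by simp
  qed (use c in simp_all)
  then have "det (gram xs C) * det (gram xs \<Gamma>) = 1" using det_mult[OF c] by simp
  then show ?thesis by (metis dvd_triv_right)
qed

lemma det_gram_inverse:
  fixes \<Gamma> :: "'b \<Rightarrow> 'b \<Rightarrow> 'k::comm_ring_1"
  assumes d: "distinct xs" and u: "det (gram xs \<Gamma>) dvd 1"
  shows "\<exists>C. \<forall>u\<in>set xs. \<forall>w\<in>set xs. (\<Sum>v\<in>set xs. C u v * \<Gamma> v w) = (if u = w then 1 else 0) \<and>
    (\<Sum>v\<in>set xs. \<Gamma> u v * C v w) = (if u = w then 1 else 0)"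
proof -
  let ?n = "length xs"
  have c: "gram xs \<Gamma> \<in> carrier_mat ?n ?n" by (simp add: gram_def)
  obtain D where D: "D \<in> carrier_mat ?n ?n" "D * gram xs \<Gamma> = 1\<^sub>m ?n" "gram xs \<Gamma> * D = 1\<^sub>m ?n"
    using det_unit_inverse[OF c u] by blast
  define pos where "pos = inv_into {..<?n} ((!) xs)"
  have pos: "pos (xs ! i) = i" if "i < ?n" for i
    unfolding pos_def using inv_into_f_f[of "(!) xs" "{..<?n}" i] d that by (simp add: inj_on_nth)
  define C where "C u v = D $$ (pos u, pos v)" for u v
  have DC: "D = gram xs C"
    using D(1) by (intro eq_matI) (auto simp: gram_def C_def pos)
  have *: "(\<Sum>v\<in>set xs. C u v * \<Gamma> v w) = (if u = w then 1 else 0) \<and> (\<Sum>v\<in>set xs. \<Gamma> u v * C v w) = (if u = w then 1 else 0)"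
    if uw: "u \<in> set xs" "w \<in> set xs" for u w
  proof -
    obtain i j where ij: "i < ?n" "j < ?n" "u = xs ! i" "w = xs ! j" using uw by (metis in_set_conv_nth)
    have one: "1\<^sub>m ?n $$ (i, j) = (if u = w then 1 else (0 :: 'k))"
      using ij nth_eq_iff_index_eq[OF d ij(1,2)] by simp
    show ?thesis
      using gram_mult[OF d ij(1,2), of C \<Gamma>] gram_mult[OF d ij(1,2), of \<Gamma> C] D(2,3) one ij(3,4) by (simp add: DC)
  qed
  then show ?thesis by blast
qed

lemma enumeration_props:
  assumes "finite X"
  shows "distinct (enumeration X)" "set (enumeration X) = X"
proof -
  have "\<exists>xs. distinct xs \<and> set xs = X" using finite_distinct_list[OF assms] by blast
  then have "distinct (enumeration X) \<and> set (enumeration X) = X"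
    unfolding enumeration_def by (rule someI_ex)
  then show "distinct (enumeration X)" "set (enumeration X) = X" by simp_all
qed

text \<open>The specialization of x to \<delta> in \<open>nonsingular\<close>, named in order to use
  it as a ring homomorphism, which commutes with \<open>det\<close>.\<close>

definition int_poly_eval :: "'k::comm_ring_1 \<Rightarrow> int poly \<Rightarrow> 'k" where
  "int_poly_eval \<delta> P = poly (map_poly of_int P) \<delta>"

lemma int_poly_eval_hom: "comm_ring_hom (int_poly_eval \<delta> :: int poly \<Rightarrow> 'k::comm_ring_1)"
proof -
  have "map_poly of_int (P + Q) = (map_poly of_int P + map_poly of_int Q :: 'k poly)" for P Q
    by (rule poly_eqI) (simp add: coeff_map_poly)
  moreover have "map_poly of_int (P * Q) = (map_poly of_int P * map_poly of_int Q :: 'k poly)" for P Q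
    by (rule poly_eqI) (simp add: coeff_map_poly coeff_mult)
  ultimately show ?thesis
    by unfold_locales (simp_all add: int_poly_eval_def)
qed

lemma int_poly_eval_X: "int_poly_eval \<delta> [:0, 1:] = \<delta>"
  by (simp add: int_poly_eval_def map_poly_pCons)

text \<open>The Gram matrix of \<open>cell_form\<close> on upward diagrams and their flips is the
  identity matrix.\<close>

lemma cell_dual_form:
  "dual_form r (cell_form :: diagram \<Rightarrow> diagram \<Rightarrow> 'k::comm_ring_1) cell_pairing_diag (\<lambda>p q u. diag_mor (flip_diagram u))"
proof -
  \<comment> \<open>0 is a placeholder for the loop parameter: the form and \<open>bt\<close> are
    defined without it, so what is proved here holds for every \<delta>.\<close>
  interpret brauer_form "0 :: 'k" r "cell_form :: diagram \<Rightarrow> diagram \<Rightarrow> 'k" cell_pairing_diag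
    by (rule cell_brauer_form)
  show ?thesis
  proof (intro dual_form.intro dual_form_axioms.intro cell_brauer_form)
    fix p q u assume u: "u \<in> up_diagrams p q"
    show "(diag_mor (flip_diagram u) :: 'k brauer) \<in> BDown q p"
      using flip_up[OF u] by (simp add: BDown_def span_single)
    fix h assume h: "h \<in> up_diagrams p q"
    have "flip_diagram u = flip_diagram h \<longleftrightarrow> u = h" by (metis flip_flip)
    then show "bt (diag_mor (flip_diagram u)) (diag_mor h) = (if u = h then 1 else 0)"
      by (simp add: bt_single cell_form_def)
  next
    fix p q and G :: "'k brauer"
    assume G: "G \<in> BDown q p" and z: "\<And>h. h \<in> up_diagrams p q \<Longrightarrow> bt G (diag_mor h) = 0"
    have *: "Poly_Mapping.lookup G (flip_diagram h) = 0" if h: "h \<in> up_diagrams p q" for h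
    proof -
      have "bt G (diag_mor h) = (\<Sum>v\<in>up_diagrams p q. if v = h then Poly_Mapping.lookup G (flip_diagram h) else 0)"
        unfolding bt_expand[OF G]
      proof (rule sum.cong[OF refl])
        fix v
        have "flip_diagram v = flip_diagram h \<longleftrightarrow> v = h" by (metis flip_flip)
        then show "Poly_Mapping.lookup G (flip_diagram v) * cell_form (flip_diagram v) h = (if v = h then Poly_Mapping.lookup G (flip_diagram h) else 0)"
          by (simp add: cell_form_def)
      qed
      then show ?thesis using z[OF h] h by simp
    qed
    have "Poly_Mapping.lookup G g = 0" for g
    proof (cases "g \<in> down_diagrams q p")
      case True
      then show ?thesis using *[OF flip_down[OF True]] by simp
    next
      case False
      then show ?thesis using G by (auto simp: BDown_def diagram_span_def in_keys_iff)
    qed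
    then show "G = 0" by (intro poly_mapping_eqI) simp
  qed
qed

lemma level_flip_eq:
  assumes "\<sigma> \<in> level_diagrams p p" "v \<in> level_diagrams p p"
  shows "id_diagram p = diagram_comp \<sigma> (flip_diagram v) \<longleftrightarrow> \<sigma> = v"
  using level_inverse_iff(1)[OF assms(1) flip_brauer[OF level_brauer[OF assms(2)]]] by (metis flip_flip)

text \<open>Both structure maps are those attached to \<open>cell_form\<close>, so
  \<open>cop_copairing\<close> applies. For the conditions on identities, \<open>B_off\<close>
  handles different ranks; at equal ranks all upward and downward morphisms are combinations of
  permutations, and pairing one with the identity returns it.\<close>

lemma quasi_cellular_brauer:
  fixes \<delta> :: "'k::comm_ring_1"
  shows "brauer_quasi_cellular \<delta> r"
proof -
  interpret dual_form \<delta> r cell_form cell_pairing_diag "\<lambda>p q u. diag_mor (flip_diagram u)"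
    by (rule cell_dual_form)
  have P: "cell_pairing \<delta> = pairing"
    by (intro ext) (simp add: cell_pairing_def pairing_def)
  have "finite {s. prec s p}" for p by (rule finite_subset[of _ "{..p}"]) (auto simp: prec_def)
  then have "cell_copairing_id \<delta> r p = cop_id p" for p
    unfolding cell_copairing_id_def cop_id_def idx_def
    by (subst sum.Sigma) (simp_all add: case_prod_unfold)
  then have D: "cell_copairing \<delta> r = cop"
    by (intro ext) (simp add: cell_copairing_def cop_def grp_tensor)
  have dm: "(diag_mor v :: 'k brauer) \<in> BUp p p" "(diag_mor v :: 'k brauer) \<in> BDown p p" if "v \<in> level_diagrams p p" for v p
    using that level_up level_down by (simp_all add: BUp_def BDown_def span_single)
  have left: "B p p (brauer_id p) f = f" if f: "f \<in> BUp p p" for p f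
  proof (rule span_eqI[OF f[unfolded BUp_def up_diag], where \<Psi> = "\<lambda>x. x"])
    fix v c assume v: "v \<in> level_diagrams p p"
    have "(\<Sum>\<sigma>\<in>level_diagrams p p. Poly_Mapping.single \<sigma> (cell_form (id_diagram p) (diagram_comp v (flip_diagram \<sigma>)) :: 'k))
        = (\<Sum>\<sigma>\<in>level_diagrams p p. if \<sigma> = v then diag_mor v else 0)"
      by (rule sum.cong[OF refl])
        (simp add: cell_form_def flip_comp_level(2)[OF level_brauer[OF v]] level_flip_eq[OF _ v])
    then show "B p p (brauer_id p) (Poly_Mapping.single v c) = Poly_Mapping.single v c"
      using v \<psi>_eq[OF level_down[OF id_level] level_up[OF v]]
      by (simp add: brauer_id_def B_single scale_single)
  qed (simp_all add: B_add)
  have right: "B p p g (brauer_id p) = g" if g: "g \<in> BDown p p" for p g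
  proof (rule span_eqI[OF g[unfolded BDown_def down_diag], where \<Psi> = "\<lambda>x. x"])
    fix v c assume v: "v \<in> level_diagrams p p"
    have "(\<Sum>\<sigma>\<in>level_diagrams p p. Poly_Mapping.single \<sigma> (cell_form v (diagram_comp (id_diagram p) (flip_diagram \<sigma>)) :: 'k))
        = (\<Sum>\<sigma>\<in>level_diagrams p p. if \<sigma> = v then diag_mor v else 0)"
      by (rule sum.cong[OF refl])
        (simp add: cell_form_def id_comp_left[OF flip_brauer[OF level_brauer]] eq_commute[of v])
    then show "B p p (Poly_Mapping.single v c) (brauer_id p) = Poly_Mapping.single v c"
      using v \<psi>_eq[OF level_down[OF v] level_up[OF id_level]]
      by (simp add: brauer_id_def B_single scale_single)
  qed (simp_all add: B_add)
  show ?thesis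
    unfolding brauer_quasi_cellular_def quasi_cellular_category_def quasi_cellular_category_axioms_def P D
  proof (intro conjI allI impI stratified_brauer pairing_map cop_copairing)
    fix p q and f :: "'k brauer"
    assume o: "p \<in> trunc_objects r" "q \<in> trunc_objects r"
    show "pairing q p (pure_tensor Ob A MM PP q p p (brauer_id p) f) = (if q = p then f else 0)" if f: "f \<in> BUp q p"
      using pairing_pure[OF o(2,1,1) brauer_id_in(2) f] left[of f p] B_off[OF _ brauer_id_in(2) f] f by auto
    show "pairing p q (pure_tensor Ob A MM PP p q p f (brauer_id p)) = (if p = q then f else 0)" if f: "f \<in> BDown p q"
      using pairing_pure[OF o(1,2,1) f brauer_id_in(1)] right[of f p] B_off[OF _ f brauer_id_in(1)] f by auto
  qed
qed

text \<open>The entry is the coefficient of \<sigma> in the pairing of the flip of f with g,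
  multiplied by \<tau>. Moving the inverse of \<sigma> across the form leaves the condition that the
  flip of f, g and \<tau> compose to \<sigma>, with the loops of the first two as exponent. If the
  first two do not compose to a permutation, both sides are 0.\<close>

lemma gram_entry_eval:
  assumes f: "f \<in> mono_up_diagrams p q" and g: "g \<in> mono_up_diagrams p q"
    and s: "\<sigma> \<in> level_diagrams p p" and t: "\<tau> \<in> level_diagrams p p"
  shows "int_poly_eval \<delta> (left_regular (gram_entry f g) \<sigma> \<tau>)
    = level_form \<delta> (flip_diagram (diagram_comp f \<sigma>)) (diagram_comp g \<tau>)"
proof -
  interpret h: comm_ring_hom "int_poly_eval \<delta>" by (rule int_poly_eval_hom)
  \<comment> \<open>The truncation rank 0 is a placeholder; \<open>\<beta>_left\<close> does not
    refer to it.\<close>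
  interpret brauer_form \<delta> 0 "level_form \<delta>" "\<lambda>_ _. level_pairing_diag \<delta>" by (rule level_brauer_form)
  note fu = mono_up[OF f] and gu = mono_up[OF g]
  note fb = up_brauer[OF fu] and gb = up_brauer[OF gu] and sb = level_brauer[OF s] and tb = level_brauer[OF t]
  let ?x = "[:0, 1:] :: int poly" and ?F = "flip_diagram f"
  note Fd = flip_up[OF fu] and Fb = flip_brauer[OF fb] and fs = flip_level[OF s]
  note Fg = diagram_comp_closed[OF Fb gb] and gt = up_comp[OF gu level_up[OF t]]
  have lev: "is_level (diagram_comp ?F g) \<longleftrightarrow> diagram_comp ?F g \<in> level_diagrams p p"
    using Fg by (simp add: level_diagrams_def)
  have "level_form \<delta> (flip_diagram (diagram_comp f \<sigma>)) (diagram_comp g \<tau>)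
      = level_form \<delta> ?F (diagram_comp (diagram_comp g \<tau>) (flip_diagram \<sigma>))"
    unfolding flip_comp_level(1)[OF fb s] by (rule \<beta>_left[OF fs Fd gt])
  also have "\<dots> = (if diagram_comp (diagram_comp ?F g) \<tau> = \<sigma> then \<delta> ^ loops ?F g else 0)"
    unfolding level_form_eq[OF Fb diagram_comp_closed[OF up_brauer[OF gt] level_brauer[OF fs]]]
      loops_comp_level(1)[OF Fb up_brauer[OF gt] fs] loops_comp_level(1)[OF Fb gb t]
      diagram_comp_assoc(1)[OF Fb up_brauer[OF gt] level_brauer[OF fs], symmetric]
      diagram_comp_assoc(1)[OF Fb gb tb, symmetric]
      level_inverse_iff(2)[OF fs diagram_comp_closed[OF Fg tb]] flip_flip ..
  also have "\<dots> = int_poly_eval \<delta> (if diagram_comp (diagram_comp ?F g) \<tau> = \<sigma> then ?x ^ loops ?F g else 0)"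
    by (simp add: h.hom_power int_poly_eval_X)
  also have "(if diagram_comp (diagram_comp ?F g) \<tau> = \<sigma> then ?x ^ loops ?F g else 0) = left_regular (gram_entry f g) \<sigma> \<tau>"
  proof (cases "diagram_comp ?F g \<in> level_diagrams p p")
    case True
    then show ?thesis
      using lev loops_level(2)[OF t Fg]
      by (simp add: left_regular_def gram_entry_def level_pairing_diag_def brauer_comp_single lookup_single when_def)
  next
    case False
    have "diagram_comp (diagram_comp ?F g) \<tau> \<noteq> \<sigma>"
    proof
      assume "diagram_comp (diagram_comp ?F g) \<tau> = \<sigma>"
      then have "diagram_comp ?F g = diagram_comp \<sigma> (flip_diagram \<tau>)" using level_cancel(3)[OF t Fg] by simp
      then show False using False level_comp[OF s flip_level[OF t]] by simp
    qed
    then show ?thesis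
      using lev False by (simp add: left_regular_def gram_entry_def level_pairing_diag_def)
  qed
  finally show ?thesis ..
qed

section \<open>Specialized Gram determinants and the equivalence\<close>

abbreviation "gram_index p q \<equiv> enumeration (mono_up_diagrams p q \<times> level_diagrams p p)"
abbreviation "index_up \<equiv> \<lambda>(f, \<sigma>). diagram_comp f \<sigma>"

lemma gram_index_props:
  "distinct (gram_index p q)" "set (gram_index p q) = mono_up_diagrams p q \<times> level_diagrams p p"
  by (rule enumeration_props; simp)+

text \<open>A ring homomorphism commutes with the determinant, and \<open>gram_entry_eval\<close>
  identifies the entries: the specialized matrix is the Gram matrix of \<open>level_form\<close>,
  with f \<sigma> at the index (f, \<sigma>).\<close>

lemma gram_det_eval:
  "int_poly_eval \<delta> (gram_det p q)
    = det (gram (gram_index p q) (\<lambda>x y. level_form \<delta> (flip_diagram (index_up x)) (index_up y)))"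
proof -
  interpret h: comm_ring_hom "int_poly_eval \<delta>" by (rule int_poly_eval_hom)
  let ?I = "gram_index p q"
  have "map_mat (int_poly_eval \<delta>) (gram_matrix p q)
      = gram ?I (\<lambda>x y. level_form \<delta> (flip_diagram (index_up x)) (index_up y))"
  proof (rule eq_matI)
    fix i j assume "i < dim_row (gram ?I (\<lambda>x y. level_form \<delta> (flip_diagram (index_up x)) (index_up y)))"
      "j < dim_col (gram ?I (\<lambda>x y. level_form \<delta> (flip_diagram (index_up x)) (index_up y)))"
    then have ij: "i < length ?I" "j < length ?I" by (simp_all add: gram_def)
    then have mem: "?I ! i \<in> mono_up_diagrams p q \<times> level_diagrams p p" "?I ! j \<in> mono_up_diagrams p q \<times> level_diagrams p p"
      using gram_index_props(2) nth_mem by blast+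
    obtain f \<sigma> g \<tau> where e: "?I ! i = (f, \<sigma>)" "?I ! j = (g, \<tau>)" by fastforce
    show "map_mat (int_poly_eval \<delta>) (gram_matrix p q) $$ (i, j)
        = gram ?I (\<lambda>x y. level_form \<delta> (flip_diagram (index_up x)) (index_up y)) $$ (i, j)"
      using ij mem gram_entry_eval[of f p q g \<sigma> \<tau> \<delta>] by (simp add: gram_matrix_def Let_def gram_def e)
  qed (simp_all add: gram_matrix_def Let_def gram_def)
  then show ?thesis unfolding gram_det_def h.hom_det[symmetric] by simp
qed

text \<open>The left inverse is transported along \<open>up_bij\<close> from upward diagrams to the
  index pairs of \<open>gram_matrix\<close>.\<close>

lemma gram_det_unit:
  assumes C: "\<And>u w. u \<in> up_diagrams p q \<Longrightarrow> w \<in> up_diagrams p q \<Longrightarrow>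
    (\<Sum>v\<in>up_diagrams p q. C u v * level_form \<delta> (flip_diagram v) w) = (if u = w then 1 else 0)"
  shows "int_poly_eval \<delta> (gram_det p q) dvd 1"
  unfolding gram_det_eval
proof (rule det_gram_unit[OF gram_index_props(1), where C = "\<lambda>x y. C (index_up x) (index_up y)"], unfold gram_index_props(2))
  let ?X = "mono_up_diagrams p q \<times> level_diagrams p p"
  fix x w assume x: "x \<in> ?X" and w: "w \<in> ?X"
  have "(\<Sum>v\<in>?X. C (index_up x) (index_up v) * level_form \<delta> (flip_diagram (index_up v)) (index_up w))
      = (\<Sum>v\<in>up_diagrams p q. C (index_up x) v * level_form \<delta> (flip_diagram v) (index_up w))"
    by (rule sum.reindex_bij_betw[OF up_bij])
  also have "\<dots> = (if index_up x = index_up w then 1 else 0)"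
    by (rule C; rule bij_betwE[OF up_bij, rule_format]; fact)
  also have "index_up x = index_up w \<longleftrightarrow> x = w"
    by (rule inj_on_eq_iff[OF bij_betw_imp_inj_on[OF up_bij] x w])
  finally show "(\<Sum>v\<in>?X. C (index_up x) (index_up v) * level_form \<delta> (flip_diagram (index_up v)) (index_up w)) = (if x = w then 1 else 0)" .
qed

text \<open>The inverse matrix is carried back to upward diagrams by the inverse of
  \<open>up_bij\<close>, so that it fits \<open>dual_formI\<close>.\<close>

lemma gram_det_inverse:
  assumes "int_poly_eval \<delta> (gram_det p q) dvd 1"
  shows "\<exists>C. \<forall>u\<in>up_diagrams p q. \<forall>w\<in>up_diagrams p q.
    (\<Sum>v\<in>up_diagrams p q. C u v * level_form \<delta> (flip_diagram v) w) = (if u = w then 1 else 0) \<and>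
    (\<Sum>v\<in>up_diagrams p q. level_form \<delta> (flip_diagram u) v * C v w) = (if u = w then 1 else 0)"
proof -
  let ?X = "mono_up_diagrams p q \<times> level_diagrams p p"
  obtain C where C: "\<And>x w. x \<in> ?X \<Longrightarrow> w \<in> ?X \<Longrightarrow>
      (\<Sum>v\<in>?X. C x v * level_form \<delta> (flip_diagram (index_up v)) (index_up w)) = (if x = w then 1 else 0) \<and>
      (\<Sum>v\<in>?X. level_form \<delta> (flip_diagram (index_up x)) (index_up v) * C v w) = (if x = w then 1 else 0)"
    using det_gram_inverse[OF gram_index_props(1) assms[unfolded gram_det_eval]] unfolding gram_index_props(2) by blast
  let ?i = "inv_into ?X index_up"
  note inj = bij_betw_imp_inj_on[OF up_bij[of p q]]
  have iX: "?i u \<in> ?X" "index_up (?i u) = u" if "u \<in> up_diagrams p q" for u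
    using that inv_into_into[of u index_up ?X] f_inv_into_f[of u index_up ?X] bij_betw_imp_surj_on[OF up_bij[of p q]] by simp_all
  have ii: "?i (index_up x) = x" if "x \<in> ?X" for x using inv_into_f_f[OF inj that] .
  have "(\<Sum>v\<in>up_diagrams p q. C (?i u) (?i v) * level_form \<delta> (flip_diagram v) w) = (if u = w then 1 else 0) \<and>
    (\<Sum>v\<in>up_diagrams p q. level_form \<delta> (flip_diagram u) v * C (?i v) (?i w)) = (if u = w then 1 else 0)"
    if u: "u \<in> up_diagrams p q" and w: "w \<in> up_diagrams p q" for u w
  proof -
    have "?i u = ?i w \<longleftrightarrow> u = w" using iX(2)[OF u] iX(2)[OF w] by metis
    moreover have "(\<Sum>v\<in>up_diagrams p q. C (?i u) (?i v) * level_form \<delta> (flip_diagram v) w)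
        = (\<Sum>x\<in>?X. C (?i u) (?i (index_up x)) * level_form \<delta> (flip_diagram (index_up x)) w)"
      by (rule sum.reindex_bij_betw[OF up_bij, symmetric])
    moreover have "\<dots> = (\<Sum>x\<in>?X. C (?i u) x * level_form \<delta> (flip_diagram (index_up x)) (index_up (?i w)))"
      using ii iX(2)[OF w] by (intro sum.cong refl) presburger
    moreover have "(\<Sum>v\<in>up_diagrams p q. level_form \<delta> (flip_diagram u) v * C (?i v) (?i w))
        = (\<Sum>x\<in>?X. level_form \<delta> (flip_diagram u) (index_up x) * C (?i (index_up x)) (?i w))"
      by (rule sum.reindex_bij_betw[OF up_bij, symmetric])
    moreover have "\<dots> = (\<Sum>x\<in>?X. level_form \<delta> (flip_diagram (index_up (?i u))) (index_up x) * C x (?i w))"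
      using ii iX(2)[OF u] by (intro sum.cong refl) presburger
    ultimately show ?thesis using C[OF iX(1)[OF u] iX(1)[OF w]] by presburger
  qed
  then show ?thesis by (intro exI[of _ "\<lambda>u v. C (?i u) (?i v)"]) blast
qed

theorem theorem8p1:
  fixes \<delta> :: "'k::comm_ring_1" and r :: nat
  shows "brauer_quasi_cellular \<delta> r \<and> brauer_perfect \<delta> r \<longleftrightarrow> nonsingular \<delta> r"
proof -
  interpret brauer_form \<delta> r "level_form \<delta>" "\<lambda>_ _. level_pairing_diag \<delta>" by (rule level_brauer_form)
  have P: "level_pairing \<delta> = pairing"
    by (intro ext) (simp add: level_pairing_def pairing_def)
  have "brauer_perfect \<delta> r \<longleftrightarrow> nonsingular \<delta> r"
  proof
    assume "brauer_perfect \<delta> r"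
    then obtain d where d: "is_copairing Ob A (BSymBim \<delta>) (BUpBim \<delta>) (BDownBim \<delta>) pairing d"
      by (auto simp: brauer_perfect_def perfect_pairing_def P)
    show "nonsingular \<delta> r"
      unfolding nonsingular_def int_poly_eval_def[symmetric]
    proof (intro allI impI, elim conjE)
      fix p q assume "prec p q" "prec q r"
      then have o: "p \<in> Ob" "q \<in> Ob" using prec_trunc[of p q r] by (simp_all add: trunc_objects_def)
      obtain C where "\<forall>u\<in>up_diagrams p q. \<forall>h\<in>up_diagrams p q.
          (\<Sum>v\<in>up_diagrams p q. C u v * level_form \<delta> (flip_diagram v) h) = (if u = h then 1 else 0)"
        using copairing_left_inverse[OF d o] by blast
      then show "int_poly_eval \<delta> (gram_det p q) dvd 1" by (intro gram_det_unit[where C = C]) blast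
    qed
  next
    assume ns: "nonsingular \<delta> r"
    define inverse where "inverse C p q \<longleftrightarrow> (\<forall>u\<in>up_diagrams p q. \<forall>w\<in>up_diagrams p q.
      (\<Sum>v\<in>up_diagrams p q. C u v * level_form \<delta> (flip_diagram v) w) = (if u = w then 1 else 0) \<and>
      (\<Sum>v\<in>up_diagrams p q. level_form \<delta> (flip_diagram u) v * C v w) = (if u = w then 1 else 0))"
      for C :: "diagram \<Rightarrow> diagram \<Rightarrow> 'k" and p q
    have ex: "\<exists>C. inverse C p q" if "q \<in> Ob" for p q
    proof (cases "prec p q")
      case True
      then show ?thesis
        unfolding inverse_def
        using ns that by (intro gram_det_inverse) (simp add: nonsingular_def int_poly_eval_def trunc_objects_def)
    next
      \<comment> \<open>No upward diagrams exist here, so the required identities are vacuous;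
        \<open>nonsingular\<close> covers the remaining ranks.\<close>
      case False
      then show ?thesis unfolding inverse_def using up_prec by blast
    qed
    define C where "C p q = (SOME C. inverse C p q)" for p q
    have C: "inverse (C p q) p q" if "q \<in> Ob" for p q
      unfolding C_def by (rule someI_ex[OF ex[OF that]])
    have l: "(\<Sum>v\<in>up_diagrams p q. C p q u v * level_form \<delta> (flip_diagram v) w) = (if u = w then 1 else 0)"
      and r: "(\<Sum>v\<in>up_diagrams p q. level_form \<delta> (flip_diagram u) v * C p q v w) = (if u = w then 1 else 0)"
      if "q \<in> Ob" "u \<in> up_diagrams p q" "w \<in> up_diagrams p q" for p q u w
      using C[OF that(1), unfolded inverse_def, rule_format, OF that(2,3)] by blast+
    interpret dual_form \<delta> r "level_form \<delta>" "\<lambda>_ _. level_pairing_diag \<delta>"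
      "\<lambda>p q u. \<Sum>v\<in>up_diagrams p q. Poly_Mapping.single (flip_diagram v) (C p q u v)"
      by (rule dual_formI; rule l r)
    show "brauer_perfect \<delta> r"
      unfolding brauer_perfect_def perfect_pairing_def P using pairing_map cop_copairing by blast
  qed
  then show ?thesis using quasi_cellular_brauer by blast
qed

end
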